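(* Let $(\Omega,\mathcal F,\mathbb P)$ be a probability space carrying a Brownian motion $W$. Let $x_0\ge 0$ and $0\le\delta<1$. Let $S$ be the (necessarily non-negative) solution of $$dS_t = 2\sqrt{|S_t|}\,dW_t+\delta\,dt,\qquad S_0=x_0^2,$$ so that $X=\sqrt S$ is a $BES^\delta(x_0)$ process. Then $X$ solves the strong martingale problem with respect to $\mathcal D_{L^\delta}$ and $W$. In particular, for every $f\in\mathcal D_{L^\delta}$, $$f(X_t)-f(X_0)-\int_0^t L^\delta f(X_s)\,ds=\int_0^t f'(X_s)\,dW_s .$$
   Context: Processes are indexed by $t\in[0,T]$ with $T>0$ fixed. $\mathbb R_+=[0,\infty)$, $\mathbb R_-=(-\infty,0]$; $C^k(I)$ is the space of real functions on the interval $I$ with continuous derivatives up to order $k$. Domain and operator ($0\le\delta<1$): $\mathcal D_{L^\delta}$ is the set of continuous $f:\mathbb R\to\mathbb R$ whose restrictions to $\mathbb R_+$ and to $\mathbb R_-$ are of class $C^2$ and such that (a) there is a continuous $g:\mathbb R\to\mathbb R$ extending $x\mapsto f'(x)|x|^{\delta-1}$, $x\neq0$; (b) there is a continuous $G:\mathbb R\to\mathbb R$ extending $x\mapsto g'(x)|x|^{1-\delta}$, $x\ne0$. One sets $L^\delta f:=G/2$; thus $L^\delta f(x)=\frac{f''(x)}2+\frac{(\delta-1)f'(x)}{2x}$ for $x\neq0$. (Such $f$ are $C^1$ with $f'(0)=0$.) Squared Bessel process: the SDE $dS_t=2\sqrt{|S_t|}dW_t+\delta dt$, $S_0=s_0\ge0$,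 has strong existence and pathwise uniqueness; its non-negative solution is called $BESQ^\delta(s_0)$. A non-negative process $X$ is a $BES^\delta(x_0)$ (Bessel process) if $X^2$ is a $BESQ^\delta(x_0^2)$. Strong martingale problem (with respect to $\mathcal D_{L^\delta}$ and $W$, $\sigma=1$, no path-dependent drift): a continuous real process $X$ with $X_0=x_0$, adapted to the canonical filtration of $W$ (made to satisfy the usual conditions), is a solution if $f(X_t)-f(x_0)-\int_0^tL^\delta f(X_s)ds=\int_0^tf'(X_s)dW_s$ for all $f\in\mathcal D_{L^\delta}$ and all $t\in[0,T]$. *)

theory Defs
  imports "HOL-Probability.Probability"
begin

text \<open>
  Processes are functions \<open>X :: real \<Rightarrow> 'a \<Rightarrow> real\<close> (time first) of which only the values
  at times in \<open>{0..T}\<close> are ever used.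
\<close>

section \<open>The domain and the operator\<close>

definition C_k_on :: "nat \<Rightarrow> real set \<Rightarrow> (real \<Rightarrow> real) \<Rightarrow> bool" where
  "C_k_on k I f \<longleftrightarrow> (\<exists>D :: nat \<Rightarrow> real \<Rightarrow> real. D 0 = f \<and>
     (\<forall>i<k. \<forall>x\<in>I. (D i has_real_derivative D (Suc i) x) (at x within I)) \<and>
     (\<forall>i\<le>k. continuous_on I (D i)))"

definition L_extensions ::
  "real \<Rightarrow> (real \<Rightarrow> real) \<Rightarrow> (real \<Rightarrow> real) \<Rightarrow> (real \<Rightarrow> real) \<Rightarrow> bool" where
  "L_extensions \<delta> f g G \<longleftrightarrow>
     continuous_on UNIV g \<and> (\<forall>x. x \<noteq> 0 \<longrightarrow> g x = deriv f x * \<bar>x\<bar> powr (\<delta> - 1)) \<and>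
     continuous_on UNIV G \<and> (\<forall>x. x \<noteq> 0 \<longrightarrow> G x = deriv g x * \<bar>x\<bar> powr (1 - \<delta>))"

definition D_L :: "real \<Rightarrow> (real \<Rightarrow> real) set" where
  "D_L \<delta> = {f. continuous_on UNIV f \<and> C_k_on 2 {0..} f \<and> C_k_on 2 {..0} f \<and>
     (\<exists>g G. L_extensions \<delta> f g G)}"

text \<open>The description below is proper on \<^term>\<open>D_L \<delta>\<close>: continuous extensions are unique.\<close>

definition L_op :: "real \<Rightarrow> (real \<Rightarrow> real) \<Rightarrow> real \<Rightarrow> real" where
  "L_op \<delta> f x = (THE G. \<exists>g. L_extensions \<delta> f g G) x / 2"

lemma continuous_eq_off_0:
  fixes g h :: "real \<Rightarrow> real"
  assumes "continuous_on UNIV g" "continuous_on UNIV h" "\<And>x. x \<noteq> 0 \<Longrightarrow> g x = h x"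
  shows "g = h"
proof
  fix x
  have "isCont g 0" "isCont h 0"
    using assms(1,2) by (auto simp: continuous_on_eq_continuous_at)
  then have "(g \<longlongrightarrow> g 0) (at 0)" "(h \<longlongrightarrow> h 0) (at 0)"
    by (auto simp: isCont_def)
  moreover have "(g \<longlongrightarrow> h 0) (at 0) \<longleftrightarrow> (h \<longlongrightarrow> h 0) (at 0)"
    by (rule filterlim_cong) (auto simp: eventually_at_filter assms(3))
  ultimately have "g 0 = h 0"
    using tendsto_unique[of "at (0::real)" g] by auto
  then show "g x = h x"
    using assms(3) by (cases "x = 0") auto
qed

lemma L_op_eq:
  assumes "L_extensions \<delta> f g G"
  shows "L_op \<delta> f x = G x / 2"
proof -
  have "(THE G. \<exists>g. L_extensions \<delta> f g G) = G"
  proof (rule the_equality)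
    show "\<exists>g. L_extensions \<delta> f g G"
      using assms by blast
  next
    fix H assume "\<exists>h. L_extensions \<delta> f h H"
    then obtain h where h: "L_extensions \<delta> f h H" by blast
    have "h = g"
      using h assms by (intro continuous_eq_off_0) (auto simp: L_extensions_def)
    then show "H = G"
      using h assms by (intro continuous_eq_off_0) (auto simp: L_extensions_def)
  qed
  then show ?thesis
    by (simp add: L_op_def)
qed

section \<open>Brownian motion and its filtration\<close>

definition brownian_motion :: "'a measure \<Rightarrow> real \<Rightarrow> (real \<Rightarrow> 'a \<Rightarrow> real) \<Rightarrow> bool" where
  "brownian_motion M T W \<longleftrightarrow>
     (\<forall>t\<in>{0..T}. W t \<in> borel_measurable M) \<and>
     (AE \<omega> in M. W 0 \<omega> = 0) \<and>
     (AE \<omega> in M. continuous_on {0..T} (\<lambda>t. W t \<omega>)) \<and>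
     (\<forall>s t. 0 \<le> s \<longrightarrow> s < t \<longrightarrow> t \<le> T \<longrightarrow>
        distributed M lborel (\<lambda>\<omega>. W t \<omega> - W s \<omega>) (normal_density 0 (sqrt (t - s)))) \<and>
     (\<forall>(n::nat) p. 0 \<le> p 0 \<longrightarrow> (\<forall>i<n. p i \<le> p (Suc i)) \<longrightarrow> p n \<le> T \<longrightarrow>
        prob_space.indep_vars M (\<lambda>_. borel) (\<lambda>i \<omega>. W (p (Suc i)) \<omega> - W (p i) \<omega>) {..<n})"

text \<open>
  The canonical filtration of \<open>W\<close>, made complete and right-continuous. As \<open>M\<close> need not be
  complete, its null sets are taken in the completion, so \<open>F\<^sub>t\<close> consists of events of
  \<^term>\<open>completion M\<close>. Because of the \<open>min\<close>, right limits at \<open>T\<close> do not leave \<open>{0..T}\<close>.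
  Only the \<open>\<sigma>\<close>-algebras of the resulting measure spaces matter.
\<close>

definition canonical_filtration ::
  "'a measure \<Rightarrow> real \<Rightarrow> (real \<Rightarrow> 'a \<Rightarrow> real) \<Rightarrow> real \<Rightarrow> 'a measure" where
  "canonical_filtration M T W t = sigma (space M)
     (\<Inter>\<epsilon>\<in>{0<..}. sigma_sets (space M)
        ({W u -` A \<inter> space M | u A. u \<in> {0..min (t + \<epsilon>) T} \<and> A \<in> sets borel} \<union>
         null_sets (completion M)))"

definition adapted :: "(real \<Rightarrow> 'a measure) \<Rightarrow> real \<Rightarrow> (real \<Rightarrow> 'a \<Rightarrow> real) \<Rightarrow> bool" where
  "adapted F T X \<longleftrightarrow> (\<forall>t\<in>{0..T}. X t \<in> borel_measurable (F t))"

definition continuous_paths :: "'a measure \<Rightarrow> real \<Rightarrow> (real \<Rightarrow> 'a \<Rightarrow> real) \<Rightarrow> bool" where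
  "continuous_paths M T X \<longleftrightarrow> (\<forall>\<omega>\<in>space M. continuous_on {0..T} (\<lambda>t. X t \<omega>))"

definition progressive :: "(real \<Rightarrow> 'a measure) \<Rightarrow> real \<Rightarrow> (real \<Rightarrow> 'a \<Rightarrow> real) \<Rightarrow> bool" where
  "progressive F T H \<longleftrightarrow> (\<forall>t\<in>{0..T}.
     (\<lambda>(s, \<omega>). H s \<omega>) \<in> borel_measurable (restrict_space borel {0..t} \<Otimes>\<^sub>M F t))"

section \<open>The Ito integral\<close>

text \<open>
  \<open>(k, p, \<xi>)\<close> stands for the simple process \<open>\<Sum>i<k. \<xi>\<^sub>i 1\<^bsub>(p\<^sub>i, p\<^sub>i\<^sub>+\<^sub>1]\<^esub>\<close>.
\<close>

type_synonym 'a simple_process = "nat \<times> (nat \<Rightarrow> real) \<times> (nat \<Rightarrow> 'a \<Rightarrow> real)"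

definition is_simple_process :: "(real \<Rightarrow> 'a measure) \<Rightarrow> real \<Rightarrow> 'a simple_process \<Rightarrow> bool" where
  "is_simple_process F T = (\<lambda>(k, p, \<xi>).
     0 \<le> p 0 \<and> (\<forall>i<k. p i \<le> p (Suc i)) \<and> p k \<le> T \<and>
     (\<forall>i<k. \<xi> i \<in> borel_measurable (F (p i)) \<and> (\<exists>B. \<forall>\<omega>\<in>space (F (p i)). \<bar>\<xi> i \<omega>\<bar> \<le> B)))"

definition simple_value :: "'a simple_process \<Rightarrow> real \<Rightarrow> 'a \<Rightarrow> real" where
  "simple_value = (\<lambda>(k, p, \<xi>) t \<omega>. \<Sum>i<k. \<xi> i \<omega> * indicator {p i<..p (Suc i)} t)"

definition simple_integral_W ::
  "(real \<Rightarrow> 'a \<Rightarrow> real) \<Rightarrow> 'a simple_process \<Rightarrow> real \<Rightarrow> 'a \<Rightarrow> real" where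
  "simple_integral_W W = (\<lambda>(k, p, \<xi>) t \<omega>.
     \<Sum>i<k. \<xi> i \<omega> * (W (min (p (Suc i)) t) \<omega> - W (min (p i) t) \<omega>))"

definition vanishes_in_prob :: "'a measure \<Rightarrow> (nat \<Rightarrow> 'a \<Rightarrow> ennreal) \<Rightarrow> bool" where
  "vanishes_in_prob N Z \<longleftrightarrow>
     (\<forall>\<epsilon>::real. \<epsilon> > 0 \<longrightarrow> (\<lambda>n. measure N {\<omega> \<in> space N. Z n \<omega> > ennreal \<epsilon>}) \<longlonglongrightarrow> 0)"

text \<open>
  \<open>has_ito_integral M T W H Y\<close> says that the process \<open>Y\<close> is (a version of)
  \<open>\<integral>\<^sub>0\<^sup>\<cdot> H\<^sub>s dW\<^sub>s\<close> on \<open>{0..T}\<close>, for progressive \<open>H\<close> with \<open>\<integral>\<^sub>0\<^sup>T H\<^sub>s\<^sup>2 ds < \<infinity>\<close> almost surely: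
  \<open>Y\<close> is the uniform limit in probability of the integrals of simple processes that approximate
  \<open>H\<close> in \<open>L\<^sup>2(0,T)\<close> in probability. Such a \<open>Y\<close> is unique up to indistinguishability, so the
  predicate expresses the identity \<open>Y\<^sub>t = \<integral>\<^sub>0\<^sup>t H\<^sub>s dW\<^sub>s\<close> for all \<open>t\<close>, almost surely.
  The events measured in \<^term>\<open>vanishes_in_prob\<close> are measurable for the completion, because
  \<open>H\<close> is progressive and \<open>W\<close>, \<open>Y\<close> are (almost surely) continuous.
\<close>

definition has_ito_integral ::
  "'a measure \<Rightarrow> real \<Rightarrow> (real \<Rightarrow> 'a \<Rightarrow> real) \<Rightarrow> (real \<Rightarrow> 'a \<Rightarrow> real) \<Rightarrow>
   (real \<Rightarrow> 'a \<Rightarrow> real) \<Rightarrow> bool" where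
  "has_ito_integral M T W H Y \<longleftrightarrow>
     progressive (canonical_filtration M T W) T H \<and>
     (AE \<omega> in completion M. (\<integral>\<^sup>+ s\<in>{0..T}. ennreal ((H s \<omega>)\<^sup>2) \<partial>lborel) < \<infinity>) \<and>
     adapted (canonical_filtration M T W) T Y \<and> continuous_paths M T Y \<and>
     (\<exists>\<Phi> :: nat \<Rightarrow> 'a simple_process.
        (\<forall>n. is_simple_process (canonical_filtration M T W) T (\<Phi> n)) \<and>
        vanishes_in_prob (completion M)
          (\<lambda>n \<omega>. \<integral>\<^sup>+ s\<in>{0..T}. ennreal ((simple_value (\<Phi> n) s \<omega> - H s \<omega>)\<^sup>2) \<partial>lborel) \<and>
        vanishes_in_prob (completion M)
          (\<lambda>n \<omega>. SUP t\<in>{0..T}. ennreal \<bar>simple_integral_W W (\<Phi> n) t \<omega> - Y t \<omega>\<bar>))"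

section \<open>Bessel processes and the strong martingale problem\<close>

text \<open>
  \<open>dS\<^sub>t = 2 \<surd>|S\<^sub>t| dW\<^sub>t + \<delta> dt\<close>, \<open>S\<^sub>0 = s\<^sub>0\<close>. The initial condition is the case \<open>t = 0\<close> of the
  integrated equation.
\<close>

definition squared_bessel_solution ::
  "'a measure \<Rightarrow> real \<Rightarrow> (real \<Rightarrow> 'a \<Rightarrow> real) \<Rightarrow> real \<Rightarrow> real \<Rightarrow> (real \<Rightarrow> 'a \<Rightarrow> real) \<Rightarrow> bool" where
  "squared_bessel_solution M T W \<delta> s0 S \<longleftrightarrow>
     adapted (canonical_filtration M T W) T S \<and> continuous_paths M T S \<and>
     has_ito_integral M T W (\<lambda>t \<omega>. 2 * sqrt \<bar>S t \<omega>\<bar>) (\<lambda>t \<omega>. S t \<omega> - s0 - \<delta> * t)"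

definition nonneg_process :: "'a measure \<Rightarrow> real \<Rightarrow> (real \<Rightarrow> 'a \<Rightarrow> real) \<Rightarrow> bool" where
  "nonneg_process M T X \<longleftrightarrow> (AE \<omega> in completion M. \<forall>t\<in>{0..T}. 0 \<le> X t \<omega>)"

definition BESQ ::
  "'a measure \<Rightarrow> real \<Rightarrow> (real \<Rightarrow> 'a \<Rightarrow> real) \<Rightarrow> real \<Rightarrow> real \<Rightarrow> (real \<Rightarrow> 'a \<Rightarrow> real) \<Rightarrow> bool" where
  "BESQ M T W \<delta> s0 S \<longleftrightarrow> squared_bessel_solution M T W \<delta> s0 S \<and> nonneg_process M T S"

definition BES ::
  "'a measure \<Rightarrow> real \<Rightarrow> (real \<Rightarrow> 'a \<Rightarrow> real) \<Rightarrow> real \<Rightarrow> real \<Rightarrow> (real \<Rightarrow> 'a \<Rightarrow> real) \<Rightarrow> bool" where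
  "BES M T W \<delta> x0 X \<longleftrightarrow> nonneg_process M T X \<and> BESQ M T W \<delta> (x0\<^sup>2) (\<lambda>t \<omega>. (X t \<omega>)\<^sup>2)"

definition strong_martingale_problem ::
  "'a measure \<Rightarrow> real \<Rightarrow> (real \<Rightarrow> 'a \<Rightarrow> real) \<Rightarrow> (real \<Rightarrow> real) set \<Rightarrow>
   ((real \<Rightarrow> real) \<Rightarrow> real \<Rightarrow> real) \<Rightarrow> real \<Rightarrow> (real \<Rightarrow> 'a \<Rightarrow> real) \<Rightarrow> bool" where
  "strong_martingale_problem M T W D L x0 X \<longleftrightarrow>
     adapted (canonical_filtration M T W) T X \<and> continuous_paths M T X \<and>
     (AE \<omega> in completion M. X 0 \<omega> = x0) \<and>
     (\<forall>f\<in>D. has_ito_integral M T W (\<lambda>t \<omega>. deriv f (X t \<omega>))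
        (\<lambda>t \<omega>. f (X t \<omega>) - f x0 - (LINT s:{0..t}|lborel. L f (X s \<omega>))))"

end

theory Submission
  imports Defs
begin

text \<open>
  Write \<open>f(X) = F(S)\<close> with \<open>F(s) = f(\<surd>s)\<close>. As \<open>f\<close> is \<open>C\<^sup>2\<close> up to \<open>0\<close> with \<open>f'(0) = 0\<close>, the function
  \<open>F\<close> is \<open>C\<^sup>1\<close> on \<open>[0, \<infinity>)\<close> and \<open>s F''(s) \<rightarrow> 0\<close> for \<open>s \<rightarrow> 0\<close>. Replacing \<open>F\<close> below \<open>e\<close> by its second
  order Taylor polynomial at \<open>e\<close> gives \<open>C\<^sup>2\<close> functions \<open>G\<close> for which \<open>G\<close>, \<open>G'\<close> and \<open>s G''(s)\<close>
  converge uniformly on \<open>[0, \<infinity>)\<close> as \<open>e \<rightarrow> 0\<close>. Hence Ito's formula for \<open>G(S)\<close> passes to the limit, and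
  \<open>\<delta> F' + 2 s F'' = L\<^sup>\<delta> f\<close> and \<open>2 \<surd>s F' = f'\<close> at \<open>\<surd>s\<close>.

  An Ito integral is a limit in probability, uniformly in time, of integrals of simple processes, so
  it suffices to approximate almost surely along a subsequence. Ito's formula for \<open>S\<close> then follows
  from the one for \<open>z + \<integral>\<phi> dW + \<delta> t\<close> with simple \<open>\<phi>\<close>, which by Foellmer's argument holds on every path of
  \<open>W\<close> whose quadratic variation along dyadic grids is \<open>t\<close>.

  Non-negativity of \<open>S\<close> follows from \<open>E[D\<^sub>t G(S\<^sub>t)] \<rightarrow> 0\<close> with the discount \<open>D\<^sub>t = exp (- \<integral>\<^sub>0\<^sup>t 4 |S\<^sub>s| ds)\<close> for
  \<open>C\<^sup>2\<close> approximations \<open>G\<close> of the negative part such that \<open>s G''(s)\<close> is bounded and tends to \<open>0\<close>.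
\<close>

section \<open>Quadratic variation along dyadic grids\<close>

text \<open>The obstacle is that \<open>F''\<close> may blow up at 0, a point that \<open>S\<close>
  can reach. The factor 4 s in the quadratic variation of \<open>S\<close> compensates for this:
  with x = sqrt s one has s F''(s) = (f''(x) - f'(x) / x) / 4, and both terms in the bracket tend to
  f''(0) because f'(0) = 0. The latter comes from f' = g |x| powr (1 - \<delta>) with g continuous
  and \<delta> < 1.

  A second obstacle is that the coefficient of the equation is square integrable only path by path,
  so its integral carries no moments and expectations cannot be taken directly. Discounting by the
  clock, the time integral of the squared integrand, replaces localisation by stopping times: for
  any integrand \<phi> with discount D, the integral of D \<phi>^2 equals 1 - D and is bounded by 1.
  The discount is carried with a parameter \<kappa>, so that \<kappa> = 0 gives the plain Ito
  formula.

  The probabilistic input is thus small: the quadratic variation of \<open>W\<close> along dyadic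
  grids, and the mean and second moment of bounded simple integrals. The remaining limits are taken
  on single paths, and the null sets are absorbed by the completion.\<close>

definition grid :: "real \<Rightarrow> real \<Rightarrow> nat \<Rightarrow> nat \<Rightarrow> real" where
  "grid a b n j = a + (b - a) * real j / 2 ^ n"

lemma grid_0 [simp]: "grid a b n 0 = a"
  by (simp add: grid_def)

lemma grid_last [simp]: "grid a b n (2 ^ n) = b"
  by (simp add: grid_def)

lemma grid_mono: "a \<le> b \<Longrightarrow> j \<le> j' \<Longrightarrow> grid a b n j \<le> grid a b n j'"
  by (auto simp: grid_def intro!: divide_right_mono mult_left_mono)

lemma grid_mem: "a \<le> b \<Longrightarrow> j \<le> 2 ^ n \<Longrightarrow> grid a b n j \<in> {a..b}"
  using grid_mono[of a b 0 j n] grid_mono[of a b j "2 ^ n" n] by simp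

lemma grid_step: "grid a b n (Suc j) - grid a b n j = (b - a) / 2 ^ n"
  by (simp add: grid_def field_simps)

lemma mesh_tendsto_0: "(\<lambda>n. c / 2 ^ n :: real) \<longlonglongrightarrow> 0"
  by (rule LIMSEQ_divide_realpow_zero) simp

text \<open>Cutting both endpoints at \<open>t\<close> keeps all \<open>2 ^ n\<close> cells for
  every \<open>t\<close>; a cell beyond \<open>t\<close> contributes 0. Sums for different
  \<open>t\<close> can thus be compared term by term.\<close>

definition quad_var :: "(real \<Rightarrow> real) \<Rightarrow> real \<Rightarrow> real \<Rightarrow> nat \<Rightarrow> real \<Rightarrow> real" where
  "quad_var w a b n t =
     (\<Sum>j<2 ^ n. (w (min (grid a b n (Suc j)) t) - w (min (grid a b n j) t))\<^sup>2)"

lemma grid_osc: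
  fixes w :: "real \<Rightarrow> real"
  assumes w: "continuous_on {a..b} w" and "a \<le> b" and "e > (0::real)"
  shows "\<forall>\<^sub>F n in sequentially. \<forall>s\<in>{a..b}. \<forall>t\<in>{a..b}.
    \<bar>s - t\<bar> \<le> (b - a) / 2 ^ n \<longrightarrow> \<bar>w s - w t\<bar> < e"
proof -
  have "uniformly_continuous_on {a..b} w"
    using w by (intro compact_uniformly_continuous) auto
  then obtain d where d: "d > 0" "\<And>s t. s \<in> {a..b} \<Longrightarrow> t \<in> {a..b} \<Longrightarrow> dist t s < d \<Longrightarrow> dist (w t) (w s) < e"
    using \<open>e > 0\<close> unfolding uniformly_continuous_on_def by metis
  have "\<forall>\<^sub>F n in sequentially. (b - a) / 2 ^ n < d"
    using order_tendstoD(2)[OF mesh_tendsto_0 d(1)] .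
  then show ?thesis
    by eventually_elim (use d(2) in \<open>force simp: dist_real_def abs_minus_commute\<close>)
qed

lemma min_grid_step:
  assumes "a \<le> b"
  shows "0 \<le> min (grid a b n (Suc j)) t - min (grid a b n j) t"
    "min (grid a b n (Suc j)) t - min (grid a b n j) t \<le> (b - a) / 2 ^ n"
  using grid_mono[OF assms, of j "Suc j" n] grid_step[of a b n j] by (auto simp: min_def)

lemma min_grid_mem:
  assumes "a \<le> b" "t \<in> {a..b}" "j \<le> 2 ^ n"
  shows "min (grid a b n j) t \<in> {a..b}"
  using grid_mem[OF assms(1,3)] assms(2) by (auto simp: min_def)

lemma sum_grid_telescope:
  fixes f :: "real \<Rightarrow> real"
  assumes "a \<le> b" "t \<in> {a..b}"
  shows "(\<Sum>j<2 ^ n. f (min (grid a b n (Suc j)) t) - f (min (grid a b n j) t)) = f t - f a"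
  by (subst sum_lessThan_telescope) (use assms in simp)

text \<open>Exact monotonicity in time fails: as \<open>s\<close> moves on to \<open>t\<close>, the
  increment over the cell with \<open>s\<close> in its interior may shrink. No other cell loses
  anything, and this one loses at most the squared oscillation \<open>o'\<^sup>2\<close>.\<close>

lemma quad_var_almost_mono:
  assumes "a \<le> b" "s \<in> {a..b}" "t \<in> {a..b}" "s \<le> t" "o' \<ge> 0"
    and osc: "\<And>u v. u \<in> {a..b} \<Longrightarrow> v \<in> {a..b} \<Longrightarrow> \<bar>u - v\<bar> \<le> (b - a) / 2 ^ n \<Longrightarrow> \<bar>w u - w v\<bar> \<le> o'"
  shows "quad_var w a b n s \<le> quad_var w a b n t + o'\<^sup>2"
proof -
  let ?g = "grid a b n"
  define P where "P j \<longleftrightarrow> ?g j < s \<and> s < ?g (Suc j)" for j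
  have uniq: "j = j'" if "P j" "P j'" for j j'
  proof (rule ccontr)
    assume "j \<noteq> j'"
    then consider "Suc j \<le> j'" | "Suc j' \<le> j" by linarith
    then show False
      using that grid_mono[OF \<open>a \<le> b\<close>, of "Suc j" j' n] grid_mono[OF \<open>a \<le> b\<close>, of "Suc j'" j n]
      by cases (auto simp: P_def)
  qed
  have "quad_var w a b n s \<le> (\<Sum>j<2 ^ n. (w (min (?g (Suc j)) t) - w (min (?g j) t))\<^sup>2
      + (if P j then o'\<^sup>2 else 0))"
    unfolding quad_var_def
  proof (rule sum_mono)
    fix j :: nat assume j: "j \<in> {..<2 ^ n}"
    show "(w (min (?g (Suc j)) s) - w (min (?g j) s))\<^sup>2
      \<le> (w (min (?g (Suc j)) t) - w (min (?g j) t))\<^sup>2 + (if P j then o'\<^sup>2 else 0)"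
    proof (cases "P j")
      case True
      have "\<bar>w (min (?g (Suc j)) s) - w (min (?g j) s)\<bar> \<le> o'"
        using j min_grid_step[OF \<open>a \<le> b\<close>, of n j s] assms
        by (intro osc min_grid_mem) auto
      then have "(w (min (?g (Suc j)) s) - w (min (?g j) s))\<^sup>2 \<le> o'\<^sup>2"
        by (metis abs_ge_zero power2_abs power_mono)
      then show ?thesis using True by (simp add: add_increasing)
    next
      case False
      then consider "s \<le> ?g j" | "?g (Suc j) \<le> s" unfolding P_def by linarith
      then show ?thesis
      proof cases
        case 1
        then have "min (?g (Suc j)) s = min (?g j) s"
          using grid_mono[OF \<open>a \<le> b\<close>, of j "Suc j" n] by simp
        then show ?thesis by simp
      next
        case 2
        then show ?thesis using False grid_mono[OF \<open>a \<le> b\<close>, of j "Suc j" n] \<open>s \<le> t\<close> by (simp add: min_def)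
      qed
    qed
  qed
  also have "\<dots> = quad_var w a b n t + (\<Sum>j<2 ^ n. if P j then o'\<^sup>2 else 0)"
    by (simp add: sum.distrib quad_var_def)
  also have "(\<Sum>j<2 ^ n. if P j then o'\<^sup>2 else 0) \<le> o'\<^sup>2"
  proof (cases "\<exists>j<2 ^ n. P j")
    case True
    then obtain j0 where j0: "j0 < 2 ^ n" "P j0" by blast
    then have "(\<Sum>j<2 ^ n. if P j then o'\<^sup>2 else 0) = (\<Sum>j<2 ^ n. if j = j0 then o'\<^sup>2 else 0)"
      using uniq by (intro sum.cong) auto
    then show ?thesis using j0 by simp
  next
    case False
    then have "(\<Sum>j<2 ^ n. if P j then o'\<^sup>2 else 0) = 0" by (intro sum.neutral) auto
    then show ?thesis by simp
  qed
  finally show ?thesis by simp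
qed

text \<open>A countable set, so that almost sure convergence can hold on all of it at once, and one
  that contains equidistant nets of any mesh. For \<open>l = 0\<close> the division yields the point
  \<open>a\<close>.\<close>

definition rational_points :: "real \<Rightarrow> real \<Rightarrow> real set" where
  "rational_points a b = {a + (b - a) * real r / real l | r l. r \<le> l}"

text \<open>Polya's argument: almost monotone functions that converge to a continuous monotone limit
  on arbitrarily fine nets converge uniformly, since each value is squeezed between those at the
  neighbouring net points.\<close>

lemma uniform_quad_var:
  assumes ab: "a \<le> b" and w: "continuous_on {a..b} w"
    and qv: "\<And>t. t \<in> rational_points a b \<Longrightarrow> (\<lambda>n. quad_var w a b n t) \<longlonglongrightarrow> t - a"
  shows "uniform_limit {a..b} (\<lambda>n t. quad_var w a b n t) (\<lambda>t. t - a) sequentially"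
proof (rule uniform_limitI)
  fix e :: real assume "e > 0"
  \<comment> \<open>The bound by 1 gives \<open>o'\<^sup>2 \<le> o'\<close>, hence
    \<open>o'\<^sup>2 \<le> e / 4\<close>. The mesh of the net, the defect of monotonicity and the
    error at the net points each use one quarter of \<open>e\<close>.\<close>
  define o' where "o' = min 1 (e / 4)"
  have o': "o' > 0" "o'\<^sup>2 \<le> e / 4"
  proof -
    show "o' > 0" using \<open>e > 0\<close> by (simp add: o'_def)
    then have "o'\<^sup>2 \<le> o' * 1" unfolding power2_eq_square by (intro mult_left_mono) (auto simp: o'_def)
    then show "o'\<^sup>2 \<le> e / 4" by (simp add: o'_def)
  qed
  obtain L where L: "L > 0" "(b - a) / real L < e / 4"
  proof -
    obtain L where "real L > (b - a) / (e / 4) + 1" using reals_Archimedean2 by blast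
    moreover have "(b - a) / (e / 4) \<ge> 0" using ab \<open>e > 0\<close> by auto
    ultimately have L: "real L > 0" "real L > (b - a) / (e / 4)" by auto
    have "(b - a) / real L < e / 4"
      using L(2) \<open>e > 0\<close> by (simp add: pos_divide_less_eq[OF L(1)] pos_divide_less_eq mult.commute)
    then show thesis using L(1) that by auto
  qed
  define c where "c r = a + (b - a) * real r / real L" for r
  have c_mem: "c r \<in> {a..b}" if "r \<le> L" for r
  proof -
    have "(b - a) * real r \<le> (b - a) * real L" using ab that by (intro mult_left_mono) auto
    then have "(b - a) * real r / real L \<le> b - a" using L(1) by (simp add: pos_divide_le_eq)
    then show ?thesis using ab by (auto simp: c_def)
  qed
  have ev1: "\<forall>\<^sub>F n in sequentially. \<forall>r\<in>{..L}. \<bar>quad_var w a b n (c r) - (c r - a)\<bar> < e / 4"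
  proof (rule eventually_ball_finite)
    show "\<forall>r\<in>{..L}. \<forall>\<^sub>F n in sequentially. \<bar>quad_var w a b n (c r) - (c r - a)\<bar> < e / 4"
    proof
      fix r assume "r \<in> {..L}"
      then have "c r \<in> rational_points a b" by (auto simp: rational_points_def c_def)
      from tendstoD[OF qv[OF this], of "e / 4"] \<open>e > 0\<close>
      show "\<forall>\<^sub>F n in sequentially. \<bar>quad_var w a b n (c r) - (c r - a)\<bar> < e / 4"
        by (simp add: dist_real_def)
    qed
  qed simp
  have ev2: "\<forall>\<^sub>F n in sequentially. \<forall>s\<in>{a..b}. \<forall>t\<in>{a..b}.
    \<bar>s - t\<bar> \<le> (b - a) / 2 ^ n \<longrightarrow> \<bar>w s - w t\<bar> < o'"
    by (rule grid_osc[OF w ab o'(1)])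
  from ev1 ev2 show "\<forall>\<^sub>F n in sequentially. \<forall>t\<in>{a..b}. dist (quad_var w a b n t) (t - a) < e"
  proof eventually_elim
    case (elim n)
    show ?case
    proof
      fix t assume t: "t \<in> {a..b}"
      obtain r where r: "Suc r \<le> L" "c r \<le> t" "t \<le> c (Suc r)"
      \<comment> \<open>At \<open>t = b\<close> the floor of the general case would give the index
        \<open>L\<close>, which has no cell to its right.\<close>
      proof (cases "t = b \<or> a = b")
        case True
        have "t = b" using True t by auto
        have "c (L - 1) \<le> b" using c_mem[of "L - 1"] by auto
        moreover have "c L = b" using L(1) by (simp add: c_def)
        ultimately show thesis using that[of "L - 1"] L(1) \<open>t = b\<close> by auto
      next
        case False
        then have "t < b" "a < b" using t ab by auto
        define x where "x = (t - a) / (b - a) * real L"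
        have x0: "0 \<le> x" using t ab by (auto simp: x_def)
        have "(t - a) / (b - a) < 1" using \<open>t < b\<close> \<open>a < b\<close> by simp
        then have "x < 1 * real L" unfolding x_def using L(1) by (intro mult_strict_right_mono) auto
        define r where "r = nat \<lfloor>x\<rfloor>"
        have rx: "real r \<le> x" "x \<le> real (Suc r)" using x0 by (auto simp: r_def of_nat_nat) linarith
        have "Suc r \<le> L" using \<open>x < 1 * real L\<close> rx by linarith
        have tx: "t = a + (b - a) * x / real L" using \<open>a < b\<close> L(1) by (simp add: x_def)
        have "c r \<le> t" unfolding c_def tx using rx ab by (intro add_left_mono divide_right_mono mult_left_mono) auto
        moreover have "t \<le> c (Suc r)" unfolding c_def tx using rx ab
          by (intro add_left_mono divide_right_mono mult_left_mono) auto
        ultimately show thesis using that \<open>Suc r \<le> L\<close> by blast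
      qed
      have "c (Suc r) - c r = (b - a) / real L"
        by (simp add: c_def diff_divide_distrib[symmetric] algebra_simps)
      then have step: "c (Suc r) - c r < e / 4" using L(2) by simp
      have mem: "c r \<in> {a..b}" "c (Suc r) \<in> {a..b}" using r c_mem by auto
      have osc: "\<And>u v. u \<in> {a..b} \<Longrightarrow> v \<in> {a..b} \<Longrightarrow> \<bar>u - v\<bar> \<le> (b - a) / 2 ^ n \<Longrightarrow> \<bar>w u - w v\<bar> \<le> o'"
        using elim(2) by force
      have "quad_var w a b n (c r) \<le> quad_var w a b n t + o'\<^sup>2"
        using quad_var_almost_mono[OF ab mem(1) t r(2) _ osc] o' by simp
      moreover have "quad_var w a b n t \<le> quad_var w a b n (c (Suc r)) + o'\<^sup>2"
        using quad_var_almost_mono[OF ab t mem(2) r(3) _ osc] o' by simp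
      moreover have "\<bar>quad_var w a b n (c r) - (c r - a)\<bar> < e / 4"
        "\<bar>quad_var w a b n (c (Suc r)) - (c (Suc r) - a)\<bar> < e / 4"
        using elim(1) r(1) by auto
      ultimately show "dist (quad_var w a b n t) (t - a) < e"
        using o'(2) step r unfolding dist_real_def by linarith
    qed
  qed
qed

section \<open>Limits of weighted sums along the grid\<close>

lemma riemann_sum_uniform_limit:
  assumes ab: "a \<le> b" and h: "continuous_on {a..b} h"
  shows "uniform_limit {a..b}
    (\<lambda>n t. \<Sum>j<2 ^ n. h (grid a b n j) * (min (grid a b n (Suc j)) t - min (grid a b n j) t))
    (\<lambda>t. integral {a..t} h) sequentially"
proof (rule uniform_limitI)
  fix e :: real assume "e > 0"
  define e' where "e' = e / (b - a + 1)"
  have e': "e' > 0" "e' * (b - a) < e"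
    using ab \<open>e > 0\<close> by (auto simp: e'_def divide_simps intro!: mult_strict_left_mono)
  have "\<forall>\<^sub>F n in sequentially. \<forall>s\<in>{a..b}. \<forall>t\<in>{a..b}.
    \<bar>s - t\<bar> \<le> (b - a) / 2 ^ n \<longrightarrow> \<bar>h s - h t\<bar> < e'"
    by (rule grid_osc[OF h ab e'(1)])
  then show "\<forall>\<^sub>F n in sequentially. \<forall>t\<in>{a..b}. dist
    (\<Sum>j<2 ^ n. h (grid a b n j) * (min (grid a b n (Suc j)) t - min (grid a b n j) t))
    (integral {a..t} h) < e"
  proof eventually_elim
    case (elim n)
    show ?case
    proof
      fix t assume t: "t \<in> {a..b}"
      define v where "v j = min (grid a b n j) t" for j
      define I where "I s = integral {a..s} h" for s
      have step: "\<bar>h (grid a b n j) * (v (Suc j) - v j) - (I (v (Suc j)) - I (v j))\<bar>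
        \<le> e' * (v (Suc j) - v j)" if j: "j < 2 ^ n" for j
      proof (cases "grid a b n j < t")
        case False
        then show ?thesis using grid_mono[OF ab, of j "Suc j" n] by (simp add: v_def)
      next
        case True
        then have vg: "v j = grid a b n j" by (simp add: v_def)
        have mem: "v j \<in> {a..b}" "v (Suc j) \<in> {a..b}"
          using min_grid_mem[OF ab t] j by (auto simp: v_def)
        have le: "v j \<le> v (Suc j)" "v (Suc j) - v j \<le> (b - a) / 2 ^ n"
          using min_grid_step[OF ab, of n j t] by (auto simp: v_def)
        have hi: "h integrable_on {a..v (Suc j)}" "h integrable_on {v j..v (Suc j)}"
          using mem by (auto intro!: integrable_continuous_real continuous_on_subset[OF h])
        have "I (v j) + integral {v j..v (Suc j)} h = I (v (Suc j))"
          unfolding I_def using mem le hi by (intro Henstock_Kurzweil_Integration.integral_combine) auto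
        moreover have "((\<lambda>s. h (v j) - h s) has_integral
            (h (v j) * (v (Suc j) - v j) - integral {v j..v (Suc j)} h)) {v j..v (Suc j)}"
          using has_integral_const_real[of "h (v j)" "v j" "v (Suc j)"] le hi(2)
          by (intro has_integral_diff) (auto simp: mult.commute integrable_integral)
        then have "norm (h (v j) * (v (Suc j) - v j) - integral {v j..v (Suc j)} h)
          \<le> e' * measure lborel {v j..v (Suc j)}"
          by (rule has_integral_bound_real[where S = "{}", rotated 2])
            (use elim mem le e' in \<open>auto intro!: less_imp_le\<close>)
        ultimately show ?thesis using le by (simp add: vg)
      qed
      have "(\<Sum>j<2 ^ n. I (v (Suc j)) - I (v j)) = I t"
        using sum_grid_telescope[OF ab t, of I n] by (simp add: v_def I_def)
      then have "\<bar>(\<Sum>j<2 ^ n. h (grid a b n j) * (v (Suc j) - v j)) - I t\<bar>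
        = \<bar>\<Sum>j<2 ^ n. h (grid a b n j) * (v (Suc j) - v j) - (I (v (Suc j)) - I (v j))\<bar>"
        by (simp add: sum_subtractf)
      also have "\<dots> \<le> (\<Sum>j<2 ^ n. e' * (v (Suc j) - v j))"
        using step by (intro order_trans[OF sum_abs] sum_mono) auto
      also have "\<dots> = e' * (t - a)"
        using sum_grid_telescope[OF ab t, of "\<lambda>x. x" n] by (simp add: sum_distrib_left[symmetric] v_def)
      also have "\<dots> \<le> e' * (b - a)"
        using e' t by (intro mult_left_mono) auto
      also have "\<dots> < e" by (rule e')
      finally show "dist (\<Sum>j<2 ^ n. h (grid a b n j) *
          (min (grid a b n (Suc j)) t - min (grid a b n j) t)) (integral {a..t} h) < e"
        by (simp add: dist_real_def v_def I_def)
    qed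
  qed
qed

text \<open>Stopping at a grid point makes a partial sum a value of \<open>quad_var\<close>. Uniform
  convergence in time therefore controls all partial sums at once, as summation by parts
  requires.\<close>

lemma quad_var_partial:
  assumes "a \<le> b" "m \<le> 2 ^ n"
  shows "quad_var w a b n (min (grid a b n m) t) =
    (\<Sum>j<m. (w (min (grid a b n (Suc j)) t) - w (min (grid a b n j) t))\<^sup>2)"
  unfolding quad_var_def
proof (rule sum.mono_neutral_cong_right)
  show "\<forall>i\<in>{..<2 ^ n} - {..<m}. (w (min (grid a b n (Suc i)) (min (grid a b n m) t)) -
    w (min (grid a b n i) (min (grid a b n m) t)))\<^sup>2 = 0"
  proof
    fix i assume "i \<in> {..<2 ^ n} - {..<m}"
    then have "min (grid a b n (Suc i)) (min (grid a b n m) t) = min (grid a b n m) t"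
      "min (grid a b n i) (min (grid a b n m) t) = min (grid a b n m) t"
      using grid_mono[OF assms(1), of m i n] grid_mono[OF assms(1), of m "Suc i" n] by auto
    then show "(w (min (grid a b n (Suc i)) (min (grid a b n m) t)) -
      w (min (grid a b n i) (min (grid a b n m) t)))\<^sup>2 = 0" by simp
  qed
next
  fix i assume "i \<in> {..<m}"
  then have "min (grid a b n (Suc i)) (min (grid a b n m) t) = min (grid a b n (Suc i)) t"
    "min (grid a b n i) (min (grid a b n m) t) = min (grid a b n i) t"
    using grid_mono[OF assms(1), of "Suc i" m n] grid_mono[OF assms(1), of i m n] by auto
  then show "(w (min (grid a b n (Suc i)) (min (grid a b n m) t)) -
      w (min (grid a b n i) (min (grid a b n m) t)))\<^sup>2 =
      (w (min (grid a b n (Suc i)) t) - w (min (grid a b n i) t))\<^sup>2" by simp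
qed (use assms in auto)

lemma abel_summation:
  fixes h e :: "nat \<Rightarrow> real"
  shows "(\<Sum>j<N. h j * (e (Suc j) - e j)) = h N * e N - h 0 * e 0 - (\<Sum>j<N. (h (Suc j) - h j) * e (Suc j))"
  by (induction N) (auto simp: algebra_simps)

text \<open>Summation by parts: the partial sums \<open>E\<close> of squared increments minus cell
  lengths are uniformly small, and the differences of \<open>h\<close> add up to at most
  \<open>L' * (b - a)\<close>.\<close>

lemma weighted_quad_var_lipschitz:
  assumes ab: "a \<le> b"
    and qv: "uniform_limit {a..b} (\<lambda>n t. quad_var w a b n t) (\<lambda>t. t - a) sequentially"
    and L: "\<And>s t. s \<in> {a..b} \<Longrightarrow> t \<in> {a..b} \<Longrightarrow> \<bar>h s - h t\<bar> \<le> L * \<bar>s - t\<bar>"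
    and C: "\<And>t. t \<in> {a..b} \<Longrightarrow> \<bar>h t\<bar> \<le> C"
  shows "uniform_limit {a..b} (\<lambda>n t. \<Sum>j<2 ^ n. h (grid a b n j) *
      ((w (min (grid a b n (Suc j)) t) - w (min (grid a b n j) t))\<^sup>2
        - (min (grid a b n (Suc j)) t - min (grid a b n j) t))) (\<lambda>t. 0) sequentially"
proof (rule uniform_limitI)
  fix e :: real assume "e > 0"
  have "C \<ge> 0" using C[of a] ab by auto
  define L' where "L' = \<bar>L\<bar>"
  \<comment> \<open>\<open>C\<close> pays for the boundary term and \<open>L' * (b - a)\<close> for
    the differences of \<open>h\<close>; the 1 leaves room for a strict inequality.\<close>
  define c where "c = C + L' * (b - a) + 1"
  have "c > 0" using \<open>C \<ge> 0\<close> ab by (auto simp: c_def L'_def intro!: add_nonneg_pos)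
  have "\<forall>\<^sub>F n in sequentially. \<forall>t\<in>{a..b}. dist (quad_var w a b n t) (t - a) < e / c"
    using uniform_limitD[OF qv] \<open>e > 0\<close> \<open>c > 0\<close> by simp
  then show "\<forall>\<^sub>F n in sequentially. \<forall>t\<in>{a..b}. dist (\<Sum>j<2 ^ n. h (grid a b n j) *
      ((w (min (grid a b n (Suc j)) t) - w (min (grid a b n j) t))\<^sup>2
        - (min (grid a b n (Suc j)) t - min (grid a b n j) t))) 0 < e"
  proof eventually_elim
    case (elim n)
    show ?case
    proof
      fix t assume t: "t \<in> {a..b}"
      let ?g = "grid a b n"
      define E where "E m = quad_var w a b n (min (?g m) t) - (min (?g m) t - a)" for m
      have E: "\<bar>E m\<bar> \<le> e / c" if "m \<le> 2 ^ n" for m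
        using elim min_grid_mem[OF ab t that] by (auto simp: E_def dist_real_def intro: less_imp_le)
      have E0: "E 0 = 0" using quad_var_partial[OF ab, of 0 n w t] t by (simp add: E_def)
      have step: "(w (min (?g (Suc j)) t) - w (min (?g j) t))\<^sup>2 - (min (?g (Suc j)) t - min (?g j) t)
        = E (Suc j) - E j" if "j < 2 ^ n" for j
        using that quad_var_partial[OF ab, of "Suc j" n w t] quad_var_partial[OF ab, of j n w t]
        by (simp add: E_def)
      have "(\<Sum>j<2 ^ n. h (?g j) * ((w (min (?g (Suc j)) t) - w (min (?g j) t))\<^sup>2
        - (min (?g (Suc j)) t - min (?g j) t))) = (\<Sum>j<2 ^ n. h (?g j) * (E (Suc j) - E j))"
        using step by (intro sum.cong) auto
      also have "\<dots> = h b * E (2 ^ n) - (\<Sum>j<2 ^ n. (h (?g (Suc j)) - h (?g j)) * E (Suc j))"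
        using abel_summation[of "\<lambda>j. h (?g j)" E "2 ^ n"] by (simp add: E0)
      also have "\<bar>\<dots>\<bar> \<le> C * (e / c) + (\<Sum>j<2 ^ n. L' * (?g (Suc j) - ?g j) * (e / c))"
      proof -
        have "\<bar>h b * E (2 ^ n)\<bar> \<le> C * (e / c)"
          unfolding abs_mult using C[of b] E[of "2 ^ n"] ab \<open>C \<ge> 0\<close> by (intro mult_mono) auto
        moreover have "\<bar>\<Sum>j<2 ^ n. (h (?g (Suc j)) - h (?g j)) * E (Suc j)\<bar>
          \<le> (\<Sum>j<2 ^ n. L' * (?g (Suc j) - ?g j) * (e / c))"
        proof (intro order_trans[OF sum_abs] sum_mono)
          fix j :: nat assume j: "j \<in> {..<2 ^ n}"
          have "\<bar>h (?g (Suc j)) - h (?g j)\<bar> \<le> L * \<bar>?g (Suc j) - ?g j\<bar>"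
            using j grid_mem[OF ab] by (intro L) auto
          also have "\<dots> \<le> L' * (?g (Suc j) - ?g j)"
            using grid_mono[OF ab, of j "Suc j" n] by (auto simp: L'_def intro!: mult_mono)
          finally have *: "\<bar>h (?g (Suc j)) - h (?g j)\<bar> \<le> L' * (?g (Suc j) - ?g j)" .
          show "\<bar>(h (?g (Suc j)) - h (?g j)) * E (Suc j)\<bar> \<le> L' * (?g (Suc j) - ?g j) * (e / c)"
            unfolding abs_mult using * E[of "Suc j"] j by (intro mult_mono) auto
        qed
        ultimately show ?thesis by linarith
      qed
      also have "(\<Sum>j<2 ^ n. L' * (?g (Suc j) - ?g j) * (e / c)) = L' * (b - a) * (e / c)"
        by (simp only: sum_distrib_left[symmetric] sum_distrib_right[symmetric] sum_lessThan_telescope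
            grid_0 grid_last)
      also have "C * (e / c) + L' * (b - a) * (e / c) = (c - 1) * (e / c)"
        unfolding c_def by (simp only: ring_distribs)

      also have "\<dots> < c * (e / c)" using \<open>c > 0\<close> \<open>e > 0\<close> by (intro mult_strict_right_mono) auto
      also have "\<dots> = e" using \<open>c > 0\<close> by simp
      finally show "dist (\<Sum>j<2 ^ n. h (?g j) * ((w (min (?g (Suc j)) t) - w (min (?g j) t))\<^sup>2
        - (min (?g (Suc j)) t - min (?g j) t))) 0 < e" by simp
    qed
  qed
qed

lemma polynomial_lipschitz:
  fixes p :: "real \<Rightarrow> real"
  assumes "real_polynomial_function p" "a \<le> b"
  obtains L where "\<And>s t. s \<in> {a..b} \<Longrightarrow> t \<in> {a..b} \<Longrightarrow> \<bar>p s - p t\<bar> \<le> L * \<bar>s - t\<bar>"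
proof -
  obtain p' where p': "real_polynomial_function p'" "\<And>x. (p has_real_derivative p' x) (at x)"
    using has_real_derivative_polynomial_function[OF assms(1)] by blast
  have "continuous_on {a..b} p'"
    using p'(1) continuous_on_polymonial_function[of p' "{a..b}"] real_polynomial_function_eq by auto
  then have "bounded (p' ` {a..b})" by (intro compact_imp_bounded compact_continuous_image) auto
  then obtain L where L: "\<And>x. x \<in> {a..b} \<Longrightarrow> norm (p' x) \<le> L" unfolding bounded_iff by blast
  have "norm (p s - p t) \<le> L * norm (s - t)" if "s \<in> {a..b}" "t \<in> {a..b}" for s t
    using p'(2) L that
    by (intro field_differentiable_bound[of "{a..b}" p p' L]) (auto intro: has_field_derivative_at_within)
  then show thesis using that[of L] by simp
qed

text \<open>Polynomials are Lipschitz on the interval and dense by Stone-Weierstrass. Replacing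
  \<open>h\<close> by a polynomial costs at most their distance times the sum of squared increments
  and cell lengths, which stays bounded.\<close>

lemma weighted_quad_var:
  assumes ab: "a \<le> b" and h: "continuous_on {a..b} h"
    and qv: "uniform_limit {a..b} (\<lambda>n t. quad_var w a b n t) (\<lambda>t. t - a) sequentially"
  shows "uniform_limit {a..b} (\<lambda>n t. \<Sum>j<2 ^ n. h (grid a b n j) *
      (w (min (grid a b n (Suc j)) t) - w (min (grid a b n j) t))\<^sup>2)
      (\<lambda>t. integral {a..t} h) sequentially"
proof -
  define D where "D h n t = (\<Sum>j<2 ^ n. h (grid a b n j) *
      ((w (min (grid a b n (Suc j)) t) - w (min (grid a b n j) t))\<^sup>2
        - (min (grid a b n (Suc j)) t - min (grid a b n j) t)))" for h :: "real \<Rightarrow> real" and n t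
  have "uniform_limit {a..b} (D h) (\<lambda>t. 0) sequentially"
  proof (rule uniform_limitI)
    fix e :: real assume "e > 0"
    \<comment> \<open>Eventually \<open>quad_var\<close> is within 1 of \<open>t - a\<close>, so
      squared increments and cell lengths add up to at most \<open>2 * (b - a) + 1\<close>.\<close>
    define e' where "e' = e / 2 / (2 * (b - a) + 1)"
    have e': "e' > 0" "e' * (2 * (b - a) + 1) = e / 2"
    proof -
      define c where "c = 2 * (b - a) + 1"
      have "c > 0" using ab by (simp add: c_def)
      then have "e / 2 / c > 0" "e / 2 / c * c = e / 2" using \<open>e > 0\<close> by auto
      then show "e' > 0" "e' * (2 * (b - a) + 1) = e / 2"
        by (auto simp only: e'_def c_def)
    qed
    obtain p where p: "real_polynomial_function p" "\<And>x. x \<in> {a..b} \<Longrightarrow> \<bar>h x - p x\<bar> < e'"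
      using Stone_Weierstrass_real_polynomial_function[OF _ h e'(1)] by auto
    obtain L where L: "\<And>s t. s \<in> {a..b} \<Longrightarrow> t \<in> {a..b} \<Longrightarrow> \<bar>p s - p t\<bar> \<le> L * \<bar>s - t\<bar>"
      using polynomial_lipschitz[OF p(1) ab] by blast
    have "continuous_on {a..b} p"
      using p(1) continuous_on_polymonial_function[of p "{a..b}"] real_polynomial_function_eq by auto
    then have "bounded (p ` {a..b})" by (intro compact_imp_bounded compact_continuous_image) auto
    then obtain C where C: "\<And>x. x \<in> {a..b} \<Longrightarrow> \<bar>p x\<bar> \<le> C"
      unfolding bounded_iff by (metis image_eqI real_norm_def)
    have "uniform_limit {a..b} (D p) (\<lambda>t. 0) sequentially"
      unfolding D_def by (rule weighted_quad_var_lipschitz[OF ab qv L C])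
    then have "\<forall>\<^sub>F n in sequentially. \<forall>t\<in>{a..b}. dist (D p n t) 0 < e / 2"
      using \<open>e > 0\<close> by (intro uniform_limitD) auto
    moreover have "\<forall>\<^sub>F n in sequentially. \<forall>t\<in>{a..b}. dist (quad_var w a b n t) (t - a) < 1"
      by (intro uniform_limitD[OF qv]) auto
    ultimately show "\<forall>\<^sub>F n in sequentially. \<forall>t\<in>{a..b}. dist (D h n t) 0 < e"
    proof eventually_elim
      case (elim n)
      show ?case
      proof
        fix t assume t: "t \<in> {a..b}"
        let ?g = "grid a b n"
        define v where "v j = min (?g j) t" for j
        have "\<bar>D h n t - D p n t\<bar> \<le> (\<Sum>j<2 ^ n. e' * ((w (v (Suc j)) - w (v j))\<^sup>2 + (v (Suc j) - v j)))"
          unfolding D_def sum_subtractf[symmetric] left_diff_distrib[symmetric] v_def[symmetric]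
        proof (intro order_trans[OF sum_abs] sum_mono)
          fix j :: nat assume j: "j \<in> {..<2 ^ n}"
          have "0 \<le> v (Suc j) - v j" using min_grid_step[OF ab, of n j t] by (simp add: v_def)
          then have "\<bar>(w (v (Suc j)) - w (v j))\<^sup>2 - (v (Suc j) - v j)\<bar>
              \<le> (w (v (Suc j)) - w (v j))\<^sup>2 + (v (Suc j) - v j)"
            by (simp add: abs_le_iff)
          then show "\<bar>(h (?g j) - p (?g j)) * ((w (v (Suc j)) - w (v j))\<^sup>2 - (v (Suc j) - v j))\<bar>
              \<le> e' * ((w (v (Suc j)) - w (v j))\<^sup>2 + (v (Suc j) - v j))"
            unfolding abs_mult using p(2)[of "?g j"] grid_mem[OF ab, of j n] j
            by (intro mult_mono) auto
        qed
        also have "\<dots> = e' * (quad_var w a b n t + (t - a))"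
          using sum_grid_telescope[OF ab t, of "\<lambda>x. x" n]
          by (simp add: sum_distrib_left[symmetric] sum.distrib v_def quad_var_def)
        also have "\<dots> \<le> e / 2"
        proof -
          have "dist (quad_var w a b n t) (t - a) < 1" using elim t by auto
          then have "quad_var w a b n t + (t - a) \<le> 2 * (b - a) + 1"
            using t unfolding dist_real_def by auto
          then show ?thesis unfolding e'(2)[symmetric] using e'(1) by (intro mult_left_mono) auto
        qed
        finally have "\<bar>D h n t - D p n t\<bar> \<le> e / 2" .
        moreover have "\<bar>D p n t\<bar> < e / 2" using elim t by auto
        ultimately have "\<bar>D h n t\<bar> < e" by linarith
        then show "dist (D h n t) 0 < e" by simp
      qed
    qed
  qed
  from uniform_limit_add[OF this riemann_sum_uniform_limit[OF ab h]]
  show ?thesis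
    by (simp add: D_def sum.distrib[symmetric] ring_distribs)
qed

section \<open>The pathwise Ito formula\<close>

lemma taylor2:
  fixes f f' f'' :: "real \<Rightarrow> real"
  assumes "\<And>x. (f has_real_derivative f' x) (at x)" "\<And>x. (f' has_real_derivative f'' x) (at x)"
  obtains z where "min x y \<le> z" "z \<le> max x y"
    "f y = f x + f' x * (y - x) + f'' z / 2 * (y - x)\<^sup>2"
proof (cases "x = y")
  case True
  then show ?thesis using that[of x] by simp
next
  case False
  define d where "d m = (if m = 0 then f else if m = 1 then f' else f'')" for m :: nat
  have "\<exists>t. (if y < x then y < t \<and> t < x else x < t \<and> t < y) \<and>
    f y = (\<Sum>m<2. d m x / fact m * (y - x) ^ m) + d 2 t / fact 2 * (y - x)\<^sup>2"
    using assms False by (intro Taylor[where a = "min x y" and b = "max x y"]) (auto simp: d_def)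
  then obtain t where "if y < x then y < t \<and> t < x else x < t \<and> t < y"
    "f y = (\<Sum>m<2. d m x / fact m * (y - x) ^ m) + d 2 t / fact 2 * (y - x)\<^sup>2" by blast
  then show ?thesis using that[of t] False
    by (auto simp: d_def numeral_2_eq_2 split: if_splits)
qed

lemma abs_combination_le:
  fixes A B p q e :: real
  assumes "\<bar>A\<bar> \<le> e" "\<bar>B\<bar> \<le> e" "p \<ge> 0" "q \<ge> 0"
  shows "\<bar>A * p + B * q\<bar> \<le> e * (p + q)"
proof -
  have "\<bar>A * p\<bar> \<le> e * p" "\<bar>B * q\<bar> \<le> e * q"
    using assms by (auto simp: abs_mult intro!: mult_right_mono)
  then show ?thesis by (simp add: ring_distribs abs_le_iff)
qed

text \<open>Foellmer's argument: on each cell the time moves first, with the space variable frozen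
  at its final value; then the function is expanded in space to second order at the initial time.
  Uniform continuity of \<open>Kt\<close> and \<open>Kxx\<close> on a compact set makes the
  remainder small relative to cell length plus squared increment, and these sums stay
  bounded.\<close>

lemma foellmer_ito:
  fixes K Kt Kx Kxx :: "real \<Rightarrow> real \<Rightarrow> real"
  assumes ab: "a \<le> b" and w: "continuous_on {a..b} w"
    and qv: "\<And>t. t \<in> rational_points a b \<Longrightarrow> (\<lambda>n. quad_var w a b n t) \<longlonglongrightarrow> t - a"
    and Kt: "\<And>t x. t \<in> {a..b} \<Longrightarrow> ((\<lambda>s. K s x) has_real_derivative Kt t x) (at t within {a..b})"
    and Kx: "\<And>t x. t \<in> {a..b} \<Longrightarrow> (K t has_real_derivative Kx t x) (at x)"
    and Kxx: "\<And>t x. t \<in> {a..b} \<Longrightarrow> (Kx t has_real_derivative Kxx t x) (at x)"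
    and cKt: "continuous_on ({a..b} \<times> UNIV) (\<lambda>p. Kt (fst p) (snd p))"
    and cKxx: "continuous_on ({a..b} \<times> UNIV) (\<lambda>p. Kxx (fst p) (snd p))"
  shows "uniform_limit {a..b}
    (\<lambda>n t. \<Sum>j<2 ^ n. Kx (grid a b n j) (w (grid a b n j)) *
       (w (min (grid a b n (Suc j)) t) - w (min (grid a b n j) t)))
    (\<lambda>t. K t (w t) - K a (w a) - integral {a..t} (\<lambda>s. Kt s (w s) + Kxx s (w s) / 2)) sequentially"
proof -
  have uqv: "uniform_limit {a..b} (\<lambda>n t. quad_var w a b n t) (\<lambda>t. t - a) sequentially"
    by (rule uniform_quad_var[OF ab w qv])
  define h1 where "h1 s = Kt s (w s)" for s
  define h2 where "h2 s = Kxx s (w s) / 2" for s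
  have cw: "continuous_on {a..b} (\<lambda>s. (s, w s))" using w by (intro continuous_intros)
  have h1: "continuous_on {a..b} h1"
    unfolding h1_def using continuous_on_compose2[OF cKt cw] by auto
  have h2: "continuous_on {a..b} h2"
    unfolding h2_def using continuous_on_compose2[OF cKxx cw] by (auto intro!: continuous_intros)
  define R1 where "R1 n t = (\<Sum>j<2 ^ n. h1 (grid a b n j) * (min (grid a b n (Suc j)) t - min (grid a b n j) t))" for n t
  define R2 where "R2 n t = (\<Sum>j<2 ^ n. h2 (grid a b n j) *
      (w (min (grid a b n (Suc j)) t) - w (min (grid a b n j) t))\<^sup>2)" for n t
  define S where "S n t = (\<Sum>j<2 ^ n. Kx (grid a b n j) (w (grid a b n j)) *
       (w (min (grid a b n (Suc j)) t) - w (min (grid a b n j) t)))" for n t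
  have lim: "uniform_limit {a..b} (\<lambda>n t. K t (w t) - K a (w a) - S n t - R1 n t - R2 n t) (\<lambda>t. 0) sequentially"
  proof (rule uniform_limitI)
    fix e :: real assume "e > 0"
    \<comment> \<open>Cell lengths and squared increments together are eventually below
      \<open>2 * (b - a) + 2\<close>.\<close>
    define e' where "e' = e / (2 * (b - a) + 2)"
    have c0: "2 * (b - a) + 2 > 0" using ab by simp
    have e': "e' > 0" "e' * (2 * (b - a) + 2) = e"
      using c0 \<open>e > 0\<close> by (auto simp: e'_def)
    have "bounded (w ` {a..b})" using w by (intro compact_imp_bounded compact_continuous_image) auto
    then obtain R where R: "\<And>s. s \<in> {a..b} \<Longrightarrow> \<bar>w s\<bar> \<le> R"
      unfolding bounded_iff by (metis image_eqI real_norm_def)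
    let ?C = "{a..b} \<times> {-R..R}"
    have cpt: "compact ?C" by (intro compact_Times) auto
    have "uniformly_continuous_on ?C (\<lambda>p. Kt (fst p) (snd p))"
      by (intro compact_uniformly_continuous cpt continuous_on_subset[OF cKt]) auto
    then obtain d1 where d1: "d1 > 0" "\<And>p q. p \<in> ?C \<Longrightarrow> q \<in> ?C \<Longrightarrow> dist q p < d1 \<Longrightarrow>
        dist (Kt (fst q) (snd q)) (Kt (fst p) (snd p)) < e'"
      using e'(1) unfolding uniformly_continuous_on_def by metis
    have "uniformly_continuous_on ?C (\<lambda>p. Kxx (fst p) (snd p))"
      by (intro compact_uniformly_continuous cpt continuous_on_subset[OF cKxx]) auto
    then obtain d2 where d2: "d2 > 0" "\<And>p q. p \<in> ?C \<Longrightarrow> q \<in> ?C \<Longrightarrow> dist q p < d2 \<Longrightarrow>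
        dist (Kxx (fst q) (snd q)) (Kxx (fst p) (snd p)) < e'"
      using e'(1) unfolding uniformly_continuous_on_def by metis
    define d where "d = min d1 d2 / 2"
    have d: "d > 0" using d1(1) d2(1) by (simp add: d_def)
    have close: "dist (t, x) (t', x') < min d1 d2" if "\<bar>t - t'\<bar> < d" "\<bar>x - x'\<bar> < d" for t t' x x' :: real
    proof -
      have "dist (t, x) (t', x') \<le> \<bar>t - t'\<bar> + \<bar>x - x'\<bar>"
        unfolding dist_Pair_Pair dist_real_def by (rule order_trans[OF sqrt_sum_squares_le_sum]) auto
      then show ?thesis using that by (simp add: d_def)
    qed
    have "\<forall>\<^sub>F n in sequentially. (b - a) / 2 ^ n < d"
      by (rule order_tendstoD(2)[OF mesh_tendsto_0 d])
    moreover have "\<forall>\<^sub>F n in sequentially. \<forall>s\<in>{a..b}. \<forall>t\<in>{a..b}.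
        \<bar>s - t\<bar> \<le> (b - a) / 2 ^ n \<longrightarrow> \<bar>w s - w t\<bar> < d"
      by (rule grid_osc[OF w ab d])
    moreover have "\<forall>\<^sub>F n in sequentially. \<forall>t\<in>{a..b}. dist (quad_var w a b n t) (t - a) < 1"
      by (intro uniform_limitD[OF uqv]) auto
    ultimately show "\<forall>\<^sub>F n in sequentially. \<forall>t\<in>{a..b}.
        dist (K t (w t) - K a (w a) - S n t - R1 n t - R2 n t) 0 < e"
    proof eventually_elim
      case (elim n)
      show ?case
      proof
        fix t assume t: "t \<in> {a..b}"
        define v where "v j = min (grid a b n j) t" for j
        define k where "k s = K s (w s)" for s
        have step: "\<bar>k (v (Suc j)) - k (v j) - Kx (grid a b n j) (w (grid a b n j)) * (w (v (Suc j)) - w (v j))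
            - h1 (grid a b n j) * (v (Suc j) - v j) - h2 (grid a b n j) * (w (v (Suc j)) - w (v j))\<^sup>2\<bar>
          \<le> e' * ((v (Suc j) - v j) + (w (v (Suc j)) - w (v j))\<^sup>2)" if j: "j < 2 ^ n" for j
        proof (cases "grid a b n j < t")
          case False
          then show ?thesis using grid_mono[OF ab, of j "Suc j" n] by (simp add: v_def)
        next
          case True
          then have vg: "grid a b n j = v j" by (simp add: v_def)
          let ?v = "v j" and ?u = "v (Suc j)"
          have mem: "?v \<in> {a..b}" "?u \<in> {a..b}"
            using min_grid_mem[OF ab t] j by (auto simp: v_def)
          have le: "?v \<le> ?u" "?u - ?v \<le> (b - a) / 2 ^ n"
            using min_grid_step[OF ab, of n j t] by (auto simp: v_def)
          have wd: "\<bar>w ?u - w ?v\<bar> < d" using elim(2) mem le by simp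
          have "\<exists>\<theta>\<in>{?v..?u}. K ?u (w ?u) - K ?v (w ?u) = Kt \<theta> (w ?u) * (?u - ?v)"
          proof (cases "?v = ?u")
            case False
            have "\<exists>\<theta>\<in>{?v<..<?u}. K ?u (w ?u) - K ?v (w ?u) = Kt \<theta> (w ?u) * (?u - ?v)"
              using False le mem
              by (intro mvt_simple[where f = "\<lambda>s. K s (w ?u)" and f' = "\<lambda>s. (*) (Kt s (w ?u))"])
                (auto intro!: has_derivative_subset[OF Kt[unfolded has_field_derivative_def]])
            then show ?thesis by (auto intro: less_imp_le)
          qed auto
          then obtain \<theta> where th: "\<theta> \<in> {?v..?u}" "K ?u (w ?u) - K ?v (w ?u) = Kt \<theta> (w ?u) * (?u - ?v)" by blast
          obtain z where z: "min (w ?v) (w ?u) \<le> z" "z \<le> max (w ?v) (w ?u)"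
            "K ?v (w ?u) = K ?v (w ?v) + Kx ?v (w ?v) * (w ?u - w ?v) + Kxx ?v z / 2 * (w ?u - w ?v)\<^sup>2"
            using taylor2[OF Kx[OF mem(1)] Kxx[OF mem(1)], of "w ?v" "w ?u"] by blast
          have inC: "(?v, w ?v) \<in> ?C" "(\<theta>, w ?u) \<in> ?C" "(?v, z) \<in> ?C"
            using mem th z R[OF mem(1)] R[OF mem(2)] by auto
          have "\<bar>Kt \<theta> (w ?u) - Kt ?v (w ?v)\<bar> \<le> e'"
            using d1(2)[OF inC(1,2)] close[of \<theta> ?v "w ?u" "w ?v"] th(1) le(2) elim(1) wd
            by (auto simp: dist_real_def)
          moreover have "\<bar>Kxx ?v z - Kxx ?v (w ?v)\<bar> \<le> e'"
            using d2(2)[OF inC(1,3)] close[of ?v ?v z "w ?v"] z(1,2) wd d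
            by (auto simp: dist_real_def min_def max_def split: if_splits)
          then have "\<bar>Kxx ?v z / 2 - Kxx ?v (w ?v) / 2\<bar> \<le> e'" using e'(1) by linarith
          moreover have "k ?u - k ?v - Kx ?v (w ?v) * (w ?u - w ?v) - h1 ?v * (?u - ?v) - h2 ?v * (w ?u - w ?v)\<^sup>2
            = (Kt \<theta> (w ?u) - Kt ?v (w ?v)) * (?u - ?v) + (Kxx ?v z / 2 - Kxx ?v (w ?v) / 2) * (w ?u - w ?v)\<^sup>2"
            using th(2) z(3) by (simp add: k_def h1_def h2_def algebra_simps)
          ultimately show ?thesis unfolding vg
            using le(1) by (simp only:) (rule abs_combination_le; simp)
        qed
        have "(\<Sum>j<2 ^ n. k (v (Suc j)) - k (v j)) = K t (w t) - K a (w a)"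
          using sum_grid_telescope[OF ab t, of k n] by (simp add: v_def k_def)
        then have "\<bar>K t (w t) - K a (w a) - S n t - R1 n t - R2 n t\<bar> =
          \<bar>\<Sum>j<2 ^ n. k (v (Suc j)) - k (v j) - Kx (grid a b n j) (w (grid a b n j)) * (w (v (Suc j)) - w (v j))
            - h1 (grid a b n j) * (v (Suc j) - v j) - h2 (grid a b n j) * (w (v (Suc j)) - w (v j))\<^sup>2\<bar>"
          by (simp add: sum_subtractf S_def R1_def R2_def v_def)
        also have "\<dots> \<le> (\<Sum>j<2 ^ n. e' * ((v (Suc j) - v j) + (w (v (Suc j)) - w (v j))\<^sup>2))"
          using step by (intro order_trans[OF sum_abs] sum_mono) auto
        also have "\<dots> = e' * ((t - a) + quad_var w a b n t)"
          using sum_grid_telescope[OF ab t, of "\<lambda>x. x" n]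
          by (simp add: sum_distrib_left[symmetric] sum.distrib v_def quad_var_def)
        also have "\<dots> < e' * (2 * (b - a) + 2)"
        proof -
          have "dist (quad_var w a b n t) (t - a) < 1" using elim t by auto
          then have "(t - a) + quad_var w a b n t < 2 * (b - a) + 2"
            using t unfolding dist_real_def by auto
          then show ?thesis using e' by (intro mult_strict_left_mono) auto
        qed
        also have "\<dots> = e" by (rule e')
        finally show "dist (K t (w t) - K a (w a) - S n t - R1 n t - R2 n t) 0 < e"
          by simp
      qed
    qed
  qed
  have R12: "uniform_limit {a..b} (\<lambda>n t. R1 n t + R2 n t) (\<lambda>t. integral {a..t} h1 + integral {a..t} h2) sequentially"
    unfolding R1_def R2_def
    by (intro uniform_limit_add riemann_sum_uniform_limit weighted_quad_var ab h1 h2 uqv)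
  \<comment> \<open>The expansion is solved for the first-order sums \<open>S\<close>: total change
    minus the two convergent sums minus the vanishing remainder.\<close>
  have "uniform_limit {a..b} (\<lambda>n t. (K t (w t) - K a (w a)) -
      (R1 n t + R2 n t) - (K t (w t) - K a (w a) - S n t - R1 n t - R2 n t))
     (\<lambda>t. (K t (w t) - K a (w a)) - (integral {a..t} h1 + integral {a..t} h2) - 0) sequentially"
    by (intro uniform_limit_minus uniform_limit_const R12 lim)
  then have "uniform_limit {a..b} S
     (\<lambda>t. K t (w t) - K a (w a) - (integral {a..t} h1 + integral {a..t} h2)) sequentially"
    by simp
  moreover have "integral {a..t} h1 + integral {a..t} h2 = integral {a..t} (\<lambda>s. Kt s (w s) + Kxx s (w s) / 2)"
    if "t \<in> {a..b}" for t
    using that unfolding h1_def[symmetric] h2_def[symmetric]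
    by (intro Henstock_Kurzweil_Integration.integral_add[symmetric] integrable_continuous_real
        continuous_on_subset[OF h1] continuous_on_subset[OF h2]) auto
  ultimately show ?thesis unfolding S_def
    by (auto elim!: uniform_limit_cong'[THEN iffD1, rotated -1])
qed

lemma uniform_limit_sum:
  fixes f :: "'i \<Rightarrow> nat \<Rightarrow> real \<Rightarrow> real"
  assumes "finite I" "\<And>i. i \<in> I \<Longrightarrow> uniform_limit S (f i) (l i) F"
  shows "uniform_limit S (\<lambda>n t. \<Sum>i\<in>I. f i n t) (\<lambda>t. \<Sum>i\<in>I. l i t) F"
  using assms
proof (induction I rule: finite_induct)
  case empty
  then show ?case by (simp add: uniform_limit_const)
next
  case (insert i I)
  then show ?case by (simp add: uniform_limit_add)
qed

section \<open>Step integrands along one path and refined partitions\<close>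

definition step_fun :: "nat \<Rightarrow> (nat \<Rightarrow> real) \<Rightarrow> (nat \<Rightarrow> real) \<Rightarrow> real \<Rightarrow> real" where
  "step_fun k p x s = (\<Sum>i<k. x i * indicator {p i<..p (Suc i)} s)"

definition step_int :: "nat \<Rightarrow> (nat \<Rightarrow> real) \<Rightarrow> (nat \<Rightarrow> real) \<Rightarrow> (real \<Rightarrow> real) \<Rightarrow> real \<Rightarrow> real" where
  "step_int k p x w t = (\<Sum>i<k. x i * (w (min (p (Suc i)) t) - w (min (p i) t)))"

text \<open>Cell \<open>i\<close> of \<open>p\<close> becomes the block of \<open>2 ^ n\<close>
  indices starting at \<open>i * 2 ^ n\<close>, cut by its own dyadic grid. A coefficient that
  belonged to cell \<open>i\<close> is therefore found at \<open>m div 2 ^ n\<close> for every index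
  \<open>m\<close> of the block.\<close>

definition refine :: "nat \<Rightarrow> (nat \<Rightarrow> real) \<Rightarrow> nat \<Rightarrow> real" where
  "refine n p m = grid (p (m div 2 ^ n)) (p (Suc (m div 2 ^ n))) n (m mod 2 ^ n)"

text \<open>The boundary index \<open>j = 2 ^ n\<close> is included: it is decoded as the first
  point of the next block, which is the right end of this one.\<close>

lemma refine_block:
  assumes "j \<le> 2 ^ n"
  shows "refine n p (i * 2 ^ n + j) = grid (p i) (p (Suc i)) n j"
proof (cases "j = 2 ^ n")
  case True
  then have "i * 2 ^ n + j = Suc i * 2 ^ n" by simp
  then show ?thesis by (simp only: refine_def nonzero_mult_div_cancel_right mod_mult_self2_is_0) (simp add: True)
next
  case False
  then show ?thesis using assms by (simp add: refine_def)
qed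

lemma refine_block_Suc:
  "j < 2 ^ n \<Longrightarrow> refine n p (Suc (i * 2 ^ n + j)) = grid (p i) (p (Suc i)) n (Suc j)"
  using refine_block[of "Suc j" n p i] by simp

lemma sum_refine:
  fixes f :: "nat \<Rightarrow> real"
  shows "(\<Sum>m<k * 2 ^ n. f m) = (\<Sum>i<k. \<Sum>j<2 ^ n. f (i * 2 ^ n + j))"
proof -
  have "sum f {i * 2 ^ n..<i * 2 ^ n + 2 ^ n} = (\<Sum>j<2 ^ n. f (i * 2 ^ n + j))" for i
    using sum.atLeastLessThan_shift_0[of f "i * 2 ^ n" "i * 2 ^ n + 2 ^ n"] by (simp add: lessThan_atLeast0)
  then show ?thesis
    by (simp add: sum.nat_group[symmetric])
qed

lemma step_int_refine:
  "step_int (k * 2 ^ n) (refine n p) y w t = (\<Sum>i<k. \<Sum>j<2 ^ n. y (i * 2 ^ n + j) *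
     (w (min (grid (p i) (p (Suc i)) n (Suc j)) t) - w (min (grid (p i) (p (Suc i)) n j) t)))"
  unfolding step_int_def sum_refine
  by (intro sum.cong refl) (simp add: refine_block refine_block_Suc)

text \<open>Written as differences of thresholds, the indicators of adjacent cells telescope in the
  endpoint.\<close>

lemma indicator_Ioc_diff:
  "a \<le> b \<Longrightarrow> indicator {a<..b} (s::real) = (if s \<le> b then 1 else 0) - (if s \<le> a then 1 else (0::real))"
  by (auto simp: indicator_def)

text \<open>One path \<open>w\<close> and one outcome of the coefficients. Below, \<open>z\<close>
  is the path \<open>z0\<close> plus the integral of the step function plus the drift \<delta> t;
  \<open>A\<close> is the clock, the time integral of the squared step function; \<open>D\<close> is
  the discount by this clock. The value \<kappa> = 0 serves the plain Ito formula and \<kappa> = 1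
  the expectation bound.\<close>

locale step_path =
  fixes k :: nat and p x :: "nat \<Rightarrow> real" and w :: "real \<Rightarrow> real" and T z0 \<delta> \<kappa> :: real
  assumes p0: "p 0 = 0" and p_step: "\<And>i. i < k \<Longrightarrow> p i \<le> p (Suc i)" and pk: "p k = T"
    and w: "continuous_on {0..T} w"
begin

definition z where "z t = z0 + step_int k p x w t + \<delta> * t"
definition A where "A t = step_int k p (\<lambda>i. (x i)\<^sup>2) (\<lambda>s. s) t"
definition D where "D t = exp (- \<kappa> * A t)"

lemma p_mono: "i \<le> j \<Longrightarrow> j \<le> k \<Longrightarrow> p i \<le> p j"
proof (induction j)
  case (Suc j)
  then show ?case using p_step[of j] by (cases "i = Suc j") force+
qed simp

lemma p_mem: "i \<le> k \<Longrightarrow> p i \<in> {0..T}"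
  using p_mono[of 0 i] p_mono[of i k] p0 pk by auto

lemma T_nonneg: "0 \<le> T"
  using p_mem[of 0] by auto

text \<open>Cells before \<open>i\<close> are complete at \<open>p i\<close> and cells after
  \<open>i\<close> have not begun at \<open>t\<close>, so only summand \<open>i\<close> changes
  between the two times.\<close>

lemma step_int_piece:
  assumes "i < k" "t \<in> {p i..p (Suc i)}"
  shows "step_int k p c f t = step_int k p c f (p i) + c i * (f t - f (p i))"
proof -
  have "step_int k p c f t - step_int k p c f (p i) =
    (\<Sum>j<k. if j = i then c i * (f t - f (p i)) else 0)"
    unfolding step_int_def sum_subtractf[symmetric]
  proof (intro sum.cong refl)
    fix j assume j: "j \<in> {..<k}"
    consider "j = i" | "j < i" | "j > i" by linarith
    then show "c j * (f (min (p (Suc j)) t) - f (min (p j) t)) -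
        c j * (f (min (p (Suc j)) (p i)) - f (min (p j) (p i))) =
        (if j = i then c i * (f t - f (p i)) else 0)"
    proof cases
      case 1
      have "min (p (Suc i)) t = t" "min (p i) t = p i" "min (p (Suc i)) (p i) = p i"
        using assms by auto
      then show ?thesis using 1 by simp
    next
      case 2
      then have "p (Suc j) \<le> p i" "p j \<le> p i" using assms by (auto intro!: p_mono)
      then show ?thesis using 2 assms by (simp add: min_def)
    next
      case 3
      then have "p (Suc i) \<le> p j" "p (Suc i) \<le> p (Suc j)" using j assms by (auto intro!: p_mono)
      then have "min (p (Suc j)) t = t" "min (p j) t = t" "min (p (Suc j)) (p i) = p i" "min (p j) (p i) = p i"
        using assms(2) by auto
      then show ?thesis using 3 by simp
    qed
  qed
  also have "\<dots> = c i * (f t - f (p i))" using assms by simp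
  finally show ?thesis by simp
qed

lemma continuous_step_int:
  assumes "continuous_on {0..T} f"
  shows "continuous_on {0..T} (step_int k p c f)"
proof -
  have "continuous_on {0..T} (\<lambda>t. f (min (p i) t))" if "i \<le> k" for i
    by (rule continuous_on_compose2[OF assms]) (use p_mem[OF that] in \<open>auto intro!: continuous_intros\<close>)
  then show ?thesis unfolding step_int_def by (intro continuous_intros) auto
qed

lemma continuous_z: "continuous_on {0..T} z"
  unfolding z_def by (intro continuous_intros continuous_step_int w)

lemma continuous_A: "continuous_on {0..T} A"
  unfolding A_def by (intro continuous_intros continuous_step_int)

lemma continuous_D: "continuous_on {0..T} D"
  unfolding D_def by (intro continuous_intros continuous_A)

lemma z_piece:
  assumes "i < k" "t \<in> {p i..p (Suc i)}"
  shows "z t = z (p i) + \<delta> * (t - p i) + x i * (w t - w (p i))"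
  using step_int_piece[OF assms, of x w] by (simp add: z_def algebra_simps)

lemma A_piece:
  assumes "i < k" "t \<in> {p i..p (Suc i)}"
  shows "A t = A (p i) + (x i)\<^sup>2 * (t - p i)"
  using step_int_piece[OF assms, of "\<lambda>i. (x i)\<^sup>2" "\<lambda>s. s"] by (simp add: A_def)

lemma step_int_0: "step_int k p c f 0 = 0"
proof -
  have "min (p i) 0 = 0" if "i \<le> k" for i using p_mem[OF that] by simp
  then show ?thesis unfolding step_int_def by (intro sum.neutral) auto
qed

lemma z_0: "z 0 = z0" and D_0: "D 0 = 1"
  by (simp_all add: z_def D_def A_def step_int_0)

lemma locate:
  assumes "s \<in> {0<..T}"
  obtains i where "i < k" "s \<in> {p i<..p (Suc i)}"
proof -
  define m where "m = (LEAST m. s \<le> p m)"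
  have sm: "s \<le> p m" unfolding m_def by (rule LeastI[of _ k]) (use assms pk in auto)
  have "m \<le> k" unfolding m_def by (rule Least_le) (use assms pk in auto)
  have "m \<noteq> 0" using sm assms p0 by (metis greaterThanAtMost_iff not_le)
  then obtain i where i: "m = Suc i" by (cases m) auto
  have "\<not> s \<le> p i" using not_less_Least[of i "\<lambda>m. s \<le> p m"] i m_def by auto
  then show thesis using that[of i] sm i \<open>m \<le> k\<close> by auto
qed

lemma locate_unique:
  assumes "i < k" "j < k" "s \<in> {p i<..p (Suc i)}" "s \<in> {p j<..p (Suc j)}"
  shows "i = j"
proof (rule ccontr)
  assume "i \<noteq> j"
  then consider "Suc i \<le> j" | "Suc j \<le> i" by linarith
  then show False
    using assms p_mono[of "Suc i" j] p_mono[of "Suc j" i] by cases auto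
qed

lemma step_fun_piece:
  assumes "i < k" "s \<in> {p i<..p (Suc i)}"
  shows "step_fun k p x s = x i"
proof -
  have "step_fun k p x s = (\<Sum>j<k. if j = i then x i else 0)"
    unfolding step_fun_def
  proof (intro sum.cong refl)
    fix j assume j: "j \<in> {..<k}"
    show "x j * indicator {p j<..p (Suc j)} s = (if j = i then x i else 0)"
    proof (cases "j = i")
      case True
      then show ?thesis using assms(2) by simp
    next
      case False
      have "s \<notin> {p j<..p (Suc j)}"
        using locate_unique[OF assms(1) _ assms(2)] j False by (metis lessThan_iff)
      then show ?thesis using False by simp
    qed
  qed
  then show ?thesis using assms by simp
qed

text \<open>The partition points form a null set, so closed cells may replace the half-open ones.
  The \<open>max\<close> turns a cell that starts after \<open>t\<close> into a single
  point.\<close>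

lemma integral_pieces:
  fixes u v :: "real \<Rightarrow> real"
  assumes u: "continuous_on {0..T} u" and v: "continuous_on {0..T} v" and t: "t \<in> {0..T}"
  shows "(LINT s:{0..t}|lborel. u s + v s * (step_fun k p x s)\<^sup>2) =
    (\<Sum>i<k. integral {p i..max (p i) (min (p (Suc i)) t)} (\<lambda>s. u s + v s * (x i)\<^sup>2))"
proof -
  define c where "c i = max (p i) (min (p (Suc i)) t)" for i
  have ci: "{p i..c i} \<subseteq> {0..T}" if "i < k" for i
    using that p_mem[of i] p_mem[of "Suc i"] p_step[of i] by (auto simp: c_def min_def max_def split: if_splits)
  have int: "set_integrable lborel {p i..c i} (\<lambda>s. u s + v s * (x i)\<^sup>2)" if "i < k" for i
    by (intro borel_integrable_atLeastAtMost' continuous_intros continuous_on_subset[OF u]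
        continuous_on_subset[OF v] ci that)
  have "AE s in lborel. s \<notin> p ` {..k}"
    by (intro AE_not_in finite_imp_null_set_lborel) auto
  then have ae: "AE s in lborel. indicator {0..t} s *\<^sub>R (u s + v s * (step_fun k p x s)\<^sup>2) =
    (\<Sum>i<k. indicator {p i..c i} s *\<^sub>R (u s + v s * (x i)\<^sup>2))"
  proof eventually_elim
    case (elim s)
    show ?case
    proof (cases "s \<in> {0..T}")
      case False
      then have "s \<notin> {p j..c j}" if "j < k" for j using ci[OF that] by blast
      moreover have "s \<notin> {0..t}" using False t by auto
      ultimately show ?thesis by (simp del: atLeastAtMost_iff)
    next
      case True
      moreover have "s \<noteq> 0" using elim p0 by (metis atMost_iff image_eqI le0)
      ultimately obtain i where i: "i < k" "s \<in> {p i<..p (Suc i)}" using locate[of s] by auto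
      have "(\<Sum>j<k. indicator {p j..c j} s *\<^sub>R (u s + v s * (x j)\<^sup>2)) =
        (\<Sum>j<k. if j = i then indicator {p i..c i} s *\<^sub>R (u s + v s * (x i)\<^sup>2) else 0)"
      proof (intro sum.cong refl)
        fix j assume j: "j \<in> {..<k}"
        have "s \<notin> {p j..c j}" if "j \<noteq> i"
        proof
          assume "s \<in> {p j..c j}"
          moreover have "c j \<le> p (Suc j)" using p_step[of j] j by (auto simp: c_def)
          moreover have "s \<noteq> p j" using elim j by auto
          ultimately have "s \<in> {p j<..p (Suc j)}" by auto
          then show False using locate_unique[OF i(1) _ i(2)] j that by auto
        qed
        then show "indicator {p j..c j} s *\<^sub>R (u s + v s * (x j)\<^sup>2) =
          (if j = i then indicator {p i..c i} s *\<^sub>R (u s + v s * (x i)\<^sup>2) else 0)"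
          by auto
      qed
      also have "\<dots> = indicator {p i..c i} s *\<^sub>R (u s + v s * (x i)\<^sup>2)"
        using i by simp
      also have "\<dots> = indicator {0..t} s *\<^sub>R (u s + v s * (step_fun k p x s)\<^sup>2)"
        using i True step_fun_piece[OF i] by (auto simp: indicator_def c_def)
      finally show ?thesis by simp
    qed
  qed
  have meas: "(\<lambda>s. indicator {0..t} s *\<^sub>R (u s + v s * (step_fun k p x s)\<^sup>2)) \<in> borel_measurable lborel"
  proof -
    have "set_borel_measurable lborel {0..T} u" "set_borel_measurable lborel {0..T} v"
      using borel_integrable_atLeastAtMost'[OF u] borel_integrable_atLeastAtMost'[OF v]
      by (auto simp: set_integrable_def set_borel_measurable_def)
    then have m: "(\<lambda>s. indicator {0..T} s *\<^sub>R u s) \<in> borel_measurable borel"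
      "(\<lambda>s. indicator {0..T} s *\<^sub>R v s) \<in> borel_measurable borel"
      by (auto simp: set_borel_measurable_def)
    \<comment> \<open>\<open>u\<close> and \<open>v\<close> are controlled only on
      \<open>{0..T}\<close>, hence the inner indicators; they equal 1 wherever the outer one
      does.\<close>
    have "(\<lambda>s. indicator {0..t} s *\<^sub>R (indicator {0..T} s *\<^sub>R u s + indicator {0..T} s *\<^sub>R v s * (step_fun k p x s)\<^sup>2))
      \<in> borel_measurable borel"
      using m unfolding step_fun_def by measurable
    also have "(\<lambda>s. indicator {0..t} s *\<^sub>R (indicator {0..T} s *\<^sub>R u s + indicator {0..T} s *\<^sub>R v s * (step_fun k p x s)\<^sup>2))
      = (\<lambda>s. indicator {0..t} s *\<^sub>R (u s + v s * (step_fun k p x s)\<^sup>2))"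
      using t by (auto simp: indicator_def)
    finally show ?thesis by simp
  qed
  have "(LINT s:{0..t}|lborel. u s + v s * (step_fun k p x s)\<^sup>2) =
    (\<integral>s. (\<Sum>i<k. indicator {p i..c i} s *\<^sub>R (u s + v s * (x i)\<^sup>2)) \<partial>lborel)"
    unfolding set_lebesgue_integral_def using int
    by (intro integral_cong_AE ae meas borel_measurable_sum) (auto simp: set_integrable_def)
  also have "\<dots> = (\<Sum>i<k. LINT s:{p i..c i}|lborel. u s + v s * (x i)\<^sup>2)"
    unfolding set_lebesgue_integral_def using int
    by (intro Bochner_Integration.integral_sum) (auto simp: set_integrable_def)
  also have "\<dots> = (\<Sum>i<k. integral {p i..c i} (\<lambda>s. u s + v s * (x i)\<^sup>2))"
    using int by (intro sum.cong set_borel_integral_eq_integral(2)) auto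
  finally show ?thesis by (simp add: c_def)
qed

lemma refine_step:
  assumes "m < k * 2 ^ n"
  shows "0 \<le> refine n p (Suc m) - refine n p m" "refine n p (Suc m) - refine n p m \<le> T / 2 ^ n"
    "refine n p m \<in> {0..T}" "refine n p (Suc m) \<in> {0..T}"
    "refine n p m \<in> {p (m div 2 ^ n)..p (Suc (m div 2 ^ n))}"
    "refine n p (Suc m) \<in> {p (m div 2 ^ n)..p (Suc (m div 2 ^ n))}"
proof -
  define i where "i = m div 2 ^ n"
  define j where "j = m mod 2 ^ n"
  have m: "m = i * 2 ^ n + j" "Suc m = i * 2 ^ n + Suc j" by (simp_all only: i_def j_def add_Suc_right div_mult_mod_eq)
  have j: "j < 2 ^ n" by (simp add: j_def)
  have i: "i < k" using assms unfolding i_def by (simp add: less_mult_imp_div_less)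
  have pi: "p i \<le> p (Suc i)" using p_step i by auto
  have eq: "refine n p m = grid (p i) (p (Suc i)) n j" "refine n p (Suc m) = grid (p i) (p (Suc i)) n (Suc j)"
    unfolding m using j by (simp_all add: refine_block refine_block_Suc)
  show "0 \<le> refine n p (Suc m) - refine n p m"
    unfolding eq using grid_mono[OF pi, of j "Suc j"] by simp
  have "p (Suc i) - p i \<le> T" using p_mem[of i] p_mem[of "Suc i"] i by auto
  then show "refine n p (Suc m) - refine n p m \<le> T / 2 ^ n"
    unfolding eq grid_step by (intro divide_right_mono) auto
  show "refine n p m \<in> {p (m div 2 ^ n)..p (Suc (m div 2 ^ n))}"
    "refine n p (Suc m) \<in> {p (m div 2 ^ n)..p (Suc (m div 2 ^ n))}"
    unfolding eq i_def[symmetric] using j by (intro grid_mem pi; simp)+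
  moreover have "{p i..p (Suc i)} \<subseteq> {0..T}"
    using p_mem[of i] p_mem[of "Suc i"] i by auto
  ultimately show "refine n p m \<in> {0..T}" "refine n p (Suc m) \<in> {0..T}" unfolding i_def by auto
qed

text \<open>Within a block the coefficient is constant, so the threshold differences of its refined
  cells telescope to that of the old cell.\<close>

lemma step_fun_refine:
  "step_fun k p x s = step_fun (k * 2 ^ n) (refine n p) (\<lambda>m. x (m div 2 ^ n)) s"
proof -
  define H where "H r = (if s \<le> r then 1 else (0::real))" for r
  have "step_fun (k * 2 ^ n) (refine n p) (\<lambda>m. x (m div 2 ^ n)) s
    = (\<Sum>m<k * 2 ^ n. x (m div 2 ^ n) * (H (refine n p (Suc m)) - H (refine n p m)))"
    unfolding step_fun_def using refine_step(1)
    by (intro sum.cong refl) (auto simp: indicator_Ioc_diff H_def)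
  also have "\<dots> = (\<Sum>i<k. \<Sum>j<2 ^ n. x i * (H (grid (p i) (p (Suc i)) n (Suc j)) - H (grid (p i) (p (Suc i)) n j)))"
    unfolding sum_refine
    by (intro sum.cong refl) (simp add: refine_block refine_block_Suc)
  also have "\<dots> = (\<Sum>i<k. x i * (H (p (Suc i)) - H (p i)))"
  proof -
    have "(\<Sum>j<2 ^ n. H (grid a b n (Suc j)) - H (grid a b n j)) = H b - H a" for a b
      using sum_lessThan_telescope[of "\<lambda>j. H (grid a b n j)" "2 ^ n"] by simp
    then show ?thesis by (simp only: sum_distrib_left[symmetric])
  qed
  also have "\<dots> = step_fun k p x s"
    unfolding step_fun_def using p_step by (intro sum.cong refl) (auto simp: indicator_Ioc_diff H_def)
  finally show ?thesis by simp
qed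

text \<open>At a given \<open>s\<close> at most one refined cell is active, and across it
  \<open>u\<close> varies little. The telescoping sum of thresholds, at most 1, expresses this count
  without locating the cell.\<close>

lemma step_fun_refine_uniform_limit:
  assumes u: "continuous_on {0..T} u"
  shows "uniform_limit {0..T}
    (\<lambda>n. step_fun (k * 2 ^ n) (refine n p) (\<lambda>m. u (refine n p m) * x (m div 2 ^ n)))
    (\<lambda>s. u s * step_fun k p x s) sequentially"
proof (rule uniform_limitI)
  fix e :: real assume "e > 0"
  define C where "C = (\<Sum>i<k. \<bar>x i\<bar>) + 1"
  have C: "C > 0" "\<And>i. i < k \<Longrightarrow> \<bar>x i\<bar> \<le> C"
  proof -
    show "C > 0" unfolding C_def by (intro add_nonneg_pos sum_nonneg) auto
    show "\<bar>x i\<bar> \<le> C" if "i < k" for i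
      using member_le_sum[of i "{..<k}" "\<lambda>i. \<bar>x i\<bar>"] that by (simp add: C_def)
  qed
  have "\<forall>\<^sub>F n in sequentially. \<forall>s\<in>{0..T}. \<forall>t\<in>{0..T}.
      \<bar>s - t\<bar> \<le> (T - 0) / 2 ^ n \<longrightarrow> \<bar>u s - u t\<bar> < e / (2 * C)"
    using C \<open>e > 0\<close> by (intro grid_osc[OF u T_nonneg]) auto
  then show "\<forall>\<^sub>F n in sequentially. \<forall>s\<in>{0..T}. dist
    (step_fun (k * 2 ^ n) (refine n p) (\<lambda>m. u (refine n p m) * x (m div 2 ^ n)) s) (u s * step_fun k p x s) < e"
  proof eventually_elim
    case (elim n)
    show ?case
    proof
      fix s assume s: "s \<in> {0..T}"
      let ?q = "refine n p"
      define H where "H r = (if s \<le> r then 1 else (0::real))" for r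
      have "\<bar>step_fun (k * 2 ^ n) ?q (\<lambda>m. u (?q m) * x (m div 2 ^ n)) s - u s * step_fun k p x s\<bar>
        = \<bar>\<Sum>m<k * 2 ^ n. (u (?q m) - u s) * x (m div 2 ^ n) * indicator {?q m<..?q (Suc m)} s\<bar>"
        unfolding step_fun_refine[of s n]
        unfolding step_fun_def sum_distrib_left sum_subtractf[symmetric]
        by (intro arg_cong[where f = abs] sum.cong refl) (simp add: algebra_simps)
      also have "\<dots> \<le> (\<Sum>m<k * 2 ^ n. (e / 2) * (H (?q (Suc m)) - H (?q m)))"
      proof (intro order_trans[OF sum_abs] sum_mono)
        fix m assume m: "m \<in> {..<k * 2 ^ n}"
        then have m': "m < k * 2 ^ n" by simp
        have Hm: "indicator {?q m<..?q (Suc m)} s = H (?q (Suc m)) - H (?q m)"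
          using refine_step(1)[OF m'] by (simp add: indicator_Ioc_diff H_def)
        show "\<bar>(u (?q m) - u s) * x (m div 2 ^ n) * indicator {?q m<..?q (Suc m)} s\<bar>
          \<le> (e / 2) * (H (?q (Suc m)) - H (?q m))"
        proof (cases "s \<in> {?q m<..?q (Suc m)}")
          case False
          then show ?thesis unfolding Hm[symmetric] by simp
        next
          case True
          have "\<bar>u (?q m) - u s\<bar> \<le> e / (2 * C)"
            using True elim s refine_step[OF m'] by (intro less_imp_le) auto
          moreover have "\<bar>x (m div 2 ^ n)\<bar> \<le> C"
            using m' by (intro C) (simp add: less_mult_imp_div_less)
          ultimately have "\<bar>(u (?q m) - u s) * x (m div 2 ^ n)\<bar> \<le> e / (2 * C) * C"
            unfolding abs_mult using C \<open>e > 0\<close> by (intro mult_mono) auto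
          then show ?thesis unfolding Hm[symmetric] using True C by simp
        qed
      qed
      also have "\<dots> = (e / 2) * (H (?q (k * 2 ^ n)) - H (?q 0))"
        using sum_lessThan_telescope[of "\<lambda>m. H (?q m)" "k * 2 ^ n"]
        by (simp only: sum_distrib_left[symmetric])
      also have "\<dots> \<le> (e / 2) * 1" using \<open>e > 0\<close> by (intro mult_left_mono) (auto simp: H_def)
      also have "\<dots> < e" using \<open>e > 0\<close> by simp
      finally show "dist (step_fun (k * 2 ^ n) ?q (\<lambda>m. u (?q m) * x (m div 2 ^ n)) s)
          (u s * step_fun k p x s) < e" by (simp add: dist_real_def)
    qed
  qed
qed

text \<open>On one cell of the partition \<open>z\<close> is an affine function of time and of the
  value of \<open>w\<close>, and \<open>D\<close> is an exponential function of time. So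
  \<open>foellmer_ito\<close> applies to K t y = E t * F (Z t y) on each cell, and the cells are
  added up.\<close>

lemma path_ito:
  assumes qv: "\<And>i t. i < k \<Longrightarrow> t \<in> rational_points (p i) (p (Suc i)) \<Longrightarrow>
      (\<lambda>n. quad_var w (p i) (p (Suc i)) n t) \<longlonglongrightarrow> t - p i"
    and F: "\<And>s. (F has_real_derivative F' s) (at s)"
    and F': "\<And>s. (F' has_real_derivative F'' s) (at s)"
    and F'': "continuous_on UNIV F''"
  shows "uniform_limit {0..T}
    (\<lambda>n. step_int (k * 2 ^ n) (refine n p)
       (\<lambda>m. D (refine n p m) * F' (z (refine n p m)) * x (m div 2 ^ n)) w)
    (\<lambda>t. D t * F (z t) - F z0 - (LINT s:{0..t}|lborel. D s * \<delta> * F' (z s)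
       + D s * (F'' (z s) / 2 - \<kappa> * F (z s)) * (step_fun k p x s)\<^sup>2)) sequentially"
proof -
  have cF: "continuous_on UNIV F" "continuous_on UNIV F'"
    using F F' by (auto intro!: DERIV_continuous_on)
  define u where "u s = D s * \<delta> * F' (z s)" for s
  define v where "v s = D s * (F'' (z s) / 2 - \<kappa> * F (z s))" for s
  have comp: "continuous_on {0..T} (\<lambda>s. G (z s))" if "continuous_on UNIV G" for G :: "real \<Rightarrow> real"
    using continuous_on_compose2[OF that continuous_z] by auto
  have cu: "continuous_on {0..T} u" and cv: "continuous_on {0..T} v"
    unfolding u_def v_def by (auto intro!: continuous_intros continuous_D comp cF F'')
  define V where "V t = D t * F (z t)" for t
  \<comment> \<open>Time clamped to cell \<open>i\<close>, so that the convergence on this cell can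
    be evaluated for every \<open>t\<close> in \<open>{0..T}\<close>.\<close>
  define c where "c i t = max (p i) (min (p (Suc i)) t)" for i t
  define P where "P i n t = (\<Sum>j<2 ^ n. D (grid (p i) (p (Suc i)) n j) * F' (z (grid (p i) (p (Suc i)) n j)) * x i *
      (w (min (grid (p i) (p (Suc i)) n (Suc j)) t) - w (min (grid (p i) (p (Suc i)) n j) t)))" for i n t
  have piece: "uniform_limit {p i..p (Suc i)} (P i)
    (\<lambda>t. V t - V (p i) - integral {p i..t} (\<lambda>s. u s + v s * (x i)\<^sup>2)) sequentially" if i: "i < k" for i
  proof -
    define a where "a = p i"
    define b where "b = p (Suc i)"
    have ab: "a \<le> b" using p_step[OF i] by (simp add: a_def b_def)
    have sub: "{a..b} \<subseteq> {0..T}" using p_mem[of i] p_mem[of "Suc i"] i by (auto simp: a_def b_def)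
    define E where "E t = exp (- \<kappa> * (A a + (x i)\<^sup>2 * (t - a)))" for t
    define Z where "Z t y = z a + \<delta> * (t - a) + x i * (y - w a)" for t y
    have Dz: "D t = E t" "z t = Z t (w t)" if "t \<in> {a..b}" for t
      using z_piece[OF i, of t] A_piece[OF i, of t] that by (auto simp: D_def E_def Z_def a_def b_def)
    have dE: "(E has_real_derivative - \<kappa> * (x i)\<^sup>2 * E t) (at t within S)" for t S
      unfolding E_def by (auto intro!: derivative_eq_intros)
    have dZt: "((\<lambda>s. Z s y) has_real_derivative \<delta>) (at t within S)" for t y S
      unfolding Z_def by (auto intro!: derivative_eq_intros)
    have dZy: "(Z t has_real_derivative x i) (at y)" for t y
      unfolding Z_def by (auto intro!: derivative_eq_intros)
    have cE: "continuous_on S E" for S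
      using dE by (intro DERIV_continuous_on)
    have cE': "continuous_on S (\<lambda>q. E (fst q))" for S :: "(real \<times> real) set"
      by (intro continuous_on_compose2[OF cE[of UNIV]] continuous_intros) auto
    have cZ: "continuous_on S (\<lambda>q. G (Z (fst q) (snd q)))" if "continuous_on UNIV G" for S and G :: "real \<Rightarrow> real"
      unfolding Z_def by (intro continuous_on_compose2[OF that] continuous_intros) auto
    have "uniform_limit {a..b}
      (\<lambda>n t. \<Sum>j<2 ^ n. (E (grid a b n j) * F' (Z (grid a b n j) (w (grid a b n j))) * x i) *
         (w (min (grid a b n (Suc j)) t) - w (min (grid a b n j) t)))
      (\<lambda>t. E t * F (Z t (w t)) - E a * F (Z a (w a)) - integral {a..t} (\<lambda>s.
         E s * (\<delta> * F' (Z s (w s)) - \<kappa> * (x i)\<^sup>2 * F (Z s (w s))) + E s * F'' (Z s (w s)) * (x i)\<^sup>2 / 2)) sequentially"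
    proof (rule foellmer_ito[where K = "\<lambda>t y. E t * F (Z t y)"
          and Kt = "\<lambda>t y. E t * (\<delta> * F' (Z t y) - \<kappa> * (x i)\<^sup>2 * F (Z t y))"
          and Kx = "\<lambda>t y. E t * F' (Z t y) * x i"
          and Kxx = "\<lambda>t y. E t * F'' (Z t y) * (x i)\<^sup>2", OF ab continuous_on_subset[OF w sub]])
      show "\<And>t. t \<in> rational_points a b \<Longrightarrow> (\<lambda>n. quad_var w a b n t) \<longlonglongrightarrow> t - a"
        using qv[OF i] by (simp add: a_def b_def)
      show "((\<lambda>s. E s * F (Z s y)) has_real_derivative
          E t * (\<delta> * F' (Z t y) - \<kappa> * (x i)\<^sup>2 * F (Z t y))) (at t within {a..b})" for t y
        by (rule DERIV_cong[OF DERIV_mult[OF dE DERIV_chain2[OF F dZt]]]) (simp add: algebra_simps)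
      show "((\<lambda>y. E t * F (Z t y)) has_real_derivative E t * F' (Z t y) * x i) (at y)" for t y
        by (rule DERIV_cong[OF DERIV_cmult[OF DERIV_chain2[OF F dZy]]]) (simp add: algebra_simps)
      show "((\<lambda>y. E t * F' (Z t y) * x i) has_real_derivative E t * F'' (Z t y) * (x i)\<^sup>2) (at y)" for t y
        by (rule DERIV_cong[OF DERIV_cmult_right[OF DERIV_cmult[OF DERIV_chain2[OF F' dZy]]]])
          (simp add: algebra_simps power2_eq_square)
    qed (intro continuous_intros cE' cZ cF F'')+
    then have *: "uniform_limit {a..b}
      (\<lambda>n t. \<Sum>j<2 ^ n. (D (grid a b n j) * F' (z (grid a b n j)) * x i) *
         (w (min (grid a b n (Suc j)) t) - w (min (grid a b n j) t)))
      (\<lambda>t. E t * F (Z t (w t)) - E a * F (Z a (w a)) - integral {a..t} (\<lambda>s.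
         E s * (\<delta> * F' (Z s (w s)) - \<kappa> * (x i)\<^sup>2 * F (Z s (w s))) + E s * F'' (Z s (w s)) * (x i)\<^sup>2 / 2)) sequentially"
      using Dz grid_mem[OF ab] by simp
    have "E t * F (Z t (w t)) - E a * F (Z a (w a)) - integral {a..t} (\<lambda>s.
         E s * (\<delta> * F' (Z s (w s)) - \<kappa> * (x i)\<^sup>2 * F (Z s (w s))) + E s * F'' (Z s (w s)) * (x i)\<^sup>2 / 2)
       = V t - V a - integral {a..t} (\<lambda>s. u s + v s * (x i)\<^sup>2)" if t: "t \<in> {a..b}" for t
    proof -
      have "integral {a..t} (\<lambda>s. u s + v s * (x i)\<^sup>2) = integral {a..t} (\<lambda>s.
         E s * (\<delta> * F' (Z s (w s)) - \<kappa> * (x i)\<^sup>2 * F (Z s (w s))) + E s * F'' (Z s (w s)) * (x i)\<^sup>2 / 2)"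
        using t by (intro Henstock_Kurzweil_Integration.integral_cong)
          (auto simp: u_def v_def Dz algebra_simps)
      then show ?thesis using t ab Dz by (simp add: V_def)
    qed
    then show ?thesis using uniform_limit_cong'[OF _ _, THEN iffD1, OF _ _ *]
      unfolding P_def a_def[symmetric] b_def[symmetric] by auto
  qed
  have "uniform_limit {0..T} (\<lambda>n t. P i n (c i t))
    (\<lambda>t. V (c i t) - V (p i) - integral {p i..c i t} (\<lambda>s. u s + v s * (x i)\<^sup>2)) sequentially" if i: "i < k" for i
  proof (rule uniform_limitI)
    fix e :: real assume "e > 0"
    have "c i t \<in> {p i..p (Suc i)}" for t using p_step[OF i] by (auto simp: c_def)
    with uniform_limitD[OF piece[OF i] \<open>e > 0\<close>]
    show "\<forall>\<^sub>F n in sequentially. \<forall>t\<in>{0..T}. dist (P i n (c i t))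
      (V (c i t) - V (p i) - integral {p i..c i t} (\<lambda>s. u s + v s * (x i)\<^sup>2)) < e"
      by (auto elim!: eventually_mono)
  qed
  then have lim: "uniform_limit {0..T} (\<lambda>n t. \<Sum>i<k. P i n (c i t))
    (\<lambda>t. \<Sum>i<k. V (c i t) - V (p i) - integral {p i..c i t} (\<lambda>s. u s + v s * (x i)\<^sup>2)) sequentially"
    by (intro uniform_limit_sum) auto
  \<comment> \<open>Clamping to the cell and stopping at \<open>t\<close> give the same increments
    of \<open>w\<close>: for \<open>t\<close> before \<open>p i\<close> both vanish, and afterwards
    \<open>c i t\<close> and \<open>t\<close> cut the cell at the same point.\<close>
  have lhs: "(\<Sum>i<k. P i n (c i t)) = step_int (k * 2 ^ n) (refine n p)
       (\<lambda>m. D (refine n p m) * F' (z (refine n p m)) * x (m div 2 ^ n)) w t" for n t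
    unfolding step_int_refine P_def
  proof (intro sum.cong refl)
    fix i j assume "i \<in> {..<k}" and j: "j \<in> {..<2 ^ n :: nat}"
    then have i: "i < k" by simp
    let ?g = "grid (p i) (p (Suc i)) n"
    have mem: "?g j \<in> {p i..p (Suc i)}" "?g (Suc j) \<in> {p i..p (Suc i)}"
      using j by (auto intro!: grid_mem p_step i simp del: atLeastAtMost_iff)
    have "w (min (?g (Suc j)) (c i t)) - w (min (?g j) (c i t)) = w (min (?g (Suc j)) t) - w (min (?g j) t)"
    proof (cases "t < p i")
      case True
      then have "c i t = p i" using p_step[OF i] by (auto simp: c_def)
      moreover have "min (?g j) (p i) = p i" "min (?g (Suc j)) (p i) = p i"
        "min (?g j) t = t" "min (?g (Suc j)) t = t"
        using mem True by auto
      ultimately show ?thesis by simp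
    next
      case False
      then have "min (?g j) (c i t) = min (?g j) t" "min (?g (Suc j)) (c i t) = min (?g (Suc j)) t"
        using mem by (auto simp: c_def min_def max_def)
      then show ?thesis by simp
    qed
    then show "D (?g j) * F' (z (?g j)) * x i * (w (min (?g (Suc j)) (c i t)) - w (min (?g j) (c i t))) =
      D (refine n p (i * 2 ^ n + j)) * F' (z (refine n p (i * 2 ^ n + j))) * x ((i * 2 ^ n + j) div 2 ^ n) *
      (w (min (?g (Suc j)) t) - w (min (?g j) t))"
      using j by (simp add: refine_block)
  qed
  have rhs: "(\<Sum>i<k. V (c i t) - V (p i) - integral {p i..c i t} (\<lambda>s. u s + v s * (x i)\<^sup>2)) =
    D t * F (z t) - F z0 - (LINT s:{0..t}|lborel. D s * \<delta> * F' (z s)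
       + D s * (F'' (z s) / 2 - \<kappa> * F (z s)) * (step_fun k p x s)\<^sup>2)" if t: "t \<in> {0..T}" for t
  proof -
    \<comment> \<open>Either the cell has begun, and clamped and stopped endpoints agree, or both
      increments are 0. The stopped increments telescope.\<close>
    have "(\<Sum>i<k. V (c i t) - V (p i)) = (\<Sum>i<k. V (min (p (Suc i)) t) - V (min (p i) t))"
    proof (intro sum.cong refl)
      fix i assume "i \<in> {..<k}"
      then have "p i \<le> p (Suc i)" using p_step by simp
      then have "min (p (Suc i)) t = c i t \<and> min (p i) t = p i \<or>
          p i = c i t \<and> min (p i) t = min (p (Suc i)) t"
        by (auto simp: c_def)
      then show "V (c i t) - V (p i) = V (min (p (Suc i)) t) - V (min (p i) t)" by auto
    qed
    also have "\<dots> = V t - V 0" using t p0 pk by (subst sum_lessThan_telescope) simp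
    finally show ?thesis
      using integral_pieces[OF cu cv t] unfolding c_def
      by (simp add: sum_subtractf u_def v_def V_def D_0 z_0)
  qed
  show ?thesis
    using lim unfolding lhs by (auto elim!: uniform_limit_cong'[THEN iffD1, rotated -1] simp: rhs)
qed

end

section \<open>Integrals of \<open>L\<^sup>2\<close>-convergent integrands\<close>

lemma nn_set_integral_eq_set_integral:
  fixes f :: "'a \<Rightarrow> real"
  assumes "set_integrable M A f" "\<And>x. x \<in> A \<Longrightarrow> 0 \<le> f x"
  shows "(\<integral>\<^sup>+ x\<in>A. ennreal (f x) \<partial>M) = ennreal (LINT x:A|M. f x)"
proof -
  have "(\<integral>\<^sup>+ x\<in>A. ennreal (f x) \<partial>M) = (\<integral>\<^sup>+ x. ennreal (indicator A x *\<^sub>R f x) \<partial>M)"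
    by (intro nn_integral_cong) (auto simp: indicator_def)
  also have "\<dots> = ennreal (\<integral>x. indicator A x *\<^sub>R f x \<partial>M)"
    using assms by (intro nn_integral_eq_integral) (auto simp: set_integrable_def indicator_def)
  finally show ?thesis by (simp add: set_lebesgue_integral_def)
qed

lemma set_integral_abs_le:
  fixes f g :: "real \<Rightarrow> real"
  assumes "set_integrable lborel {0..T} f" "set_integrable lborel {0..T} g"
    "\<And>s. s \<in> {0..T} \<Longrightarrow> \<bar>f s\<bar> \<le> g s" "t \<le> T"
  shows "\<bar>LINT s:{0..t}|lborel. f s\<bar> \<le> (LINT s:{0..T}|lborel. g s)"
proof -
  have f: "set_integrable lborel {0..t} f"
    by (rule set_integrable_subset[OF assms(1)]) (use assms in auto)
  have "norm (\<integral>s. indicator {0..t} s *\<^sub>R f s \<partial>lborel) \<le> (\<integral>s. indicator {0..T} s *\<^sub>R g s \<partial>lborel)"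
  proof (rule order_trans[OF integral_norm_bound], rule integral_mono)
    fix s :: real
    show "norm (indicator {0..t} s *\<^sub>R f s :: real) \<le> indicator {0..T} s *\<^sub>R g s"
      using assms(3)[of s] assms(4) order_trans[OF abs_ge_zero assms(3)[of s]] by (auto simp: indicator_def)
  qed (use f assms(2) in \<open>auto simp: set_integrable_def\<close>)
  then show ?thesis by (simp add: set_lebesgue_integral_def)
qed

lemma set_integral_uniform_limit:
  fixes u :: "real \<Rightarrow> real"
  assumes T: "0 \<le> T" and u: "\<And>n. continuous_on {0..T} (un n)" "continuous_on {0..T} u"
    and lim: "uniform_limit {0..T} un u sequentially"
  shows "uniform_limit {0..T} (\<lambda>n t. LINT s:{0..t}|lborel. un n s) (\<lambda>t. LINT s:{0..t}|lborel. u s) sequentially"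
proof (rule uniform_limitI)
  fix e :: real assume "e > 0"
  define e' where "e' = e / (T + 1)"
  have e': "e' > 0" "e' * T < e" using T \<open>e > 0\<close> by (auto simp: e'_def divide_simps)
  have int: "set_integrable lborel {0..T} (un n)" "set_integrable lborel {0..T} u" for n
    by (auto intro: borel_integrable_atLeastAtMost' u)
  show "\<forall>\<^sub>F n in sequentially. \<forall>t\<in>{0..T}. dist (LINT s:{0..t}|lborel. un n s) (LINT s:{0..t}|lborel. u s) < e"
    using uniform_limitD[OF lim e'(1)]
  proof eventually_elim
    case (elim n)
    show ?case
    proof
      fix t assume t: "t \<in> {0..T}"
      have sub: "set_integrable lborel {0..t} (un n)" "set_integrable lborel {0..t} u"
        using t by (auto intro: set_integrable_subset[OF int(1)] set_integrable_subset[OF int(2)])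
      have "\<bar>LINT s:{0..t}|lborel. un n s - u s\<bar> \<le> (LINT s:{0..T}|lborel. e')"
        by (rule set_integral_abs_le) (use elim int t in \<open>auto simp: dist_real_def less_imp_le
            intro!: set_integral_diff borel_integrable_atLeastAtMost'\<close>)
      also have "\<dots> = e' * T" using T by (simp add: set_lebesgue_integral_def mult.commute)
      also have "\<dots> < e" by (rule e')
      finally show "dist (LINT s:{0..t}|lborel. un n s) (LINT s:{0..t}|lborel. u s) < e"
        using set_integral_diff(2)[OF sub] by (simp add: dist_real_def)
    qed
  qed
qed

text \<open>Put the difference into the form (a - b) (\<phi> + d)^2 + b (d^2 + 2 \<phi> d) and use
  Young's inequality 2 |d| \<le> \<eta> + d^2 / \<eta> in the mixed term. With the closeness of the
  weights measured by \<open>\<eta>\<^sup>2\<close>, integrating against an L2 error below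
  \<open>\<eta>\<^sup>2\<close> leaves a multiple of \<eta>.\<close>

lemma square_diff_bound:
  fixes a b d \<phi> \<eta> :: real
  assumes "\<bar>a - b\<bar> \<le> \<eta>\<^sup>2" "\<bar>b\<bar> \<le> B" "\<bar>\<phi>\<bar> \<le> C" "0 < \<eta>"
  shows "\<bar>a * (\<phi> + d)\<^sup>2 - b * \<phi>\<^sup>2\<bar> \<le> (2 * \<eta>\<^sup>2 + B + B * C / \<eta>) * d\<^sup>2 + (2 * \<eta>\<^sup>2 * C\<^sup>2 + B * C * \<eta>)"
proof -
  have B: "0 \<le> B" and C: "0 \<le> C" using assms by linarith+
  have "a * (\<phi> + d)\<^sup>2 - b * \<phi>\<^sup>2 = (a - b) * (\<phi> + d)\<^sup>2 + b * (d\<^sup>2 + 2 * \<phi> * d)"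
    by (simp add: algebra_simps power2_eq_square)
  moreover have "\<bar>(a - b) * (\<phi> + d)\<^sup>2\<bar> \<le> \<eta>\<^sup>2 * (2 * C\<^sup>2 + 2 * d\<^sup>2)"
  proof -
    have "(\<phi> + d)\<^sup>2 \<le> 2 * \<phi>\<^sup>2 + 2 * d\<^sup>2" using zero_le_power2[of "\<phi> - d"] by (simp add: power2_eq_square algebra_simps)
    moreover have "\<phi>\<^sup>2 \<le> C\<^sup>2" using assms(3) C by (metis abs_le_square_iff abs_of_nonneg)
    ultimately show ?thesis unfolding abs_mult using assms by (intro mult_mono) auto
  qed
  moreover have "\<bar>b * (d\<^sup>2 + 2 * \<phi> * d)\<bar> \<le> B * (d\<^sup>2 + C * (\<eta> + d\<^sup>2 / \<eta>))"
  proof -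
    have "2 * \<bar>d\<bar> \<le> \<eta> + d\<^sup>2 / \<eta>"
    proof -
      have "0 \<le> (\<eta> - \<bar>d\<bar>)\<^sup>2 / \<eta>" using assms(4) by simp
      also have "(\<eta> - \<bar>d\<bar>)\<^sup>2 / \<eta> = \<eta> + d\<^sup>2 / \<eta> - 2 * \<bar>d\<bar>"
        using assms(4) by (simp add: power2_eq_square field_simps)
      finally show ?thesis by simp
    qed
    then have "\<bar>\<phi>\<bar> * (2 * \<bar>d\<bar>) \<le> C * (\<eta> + d\<^sup>2 / \<eta>)"
      using assms by (intro mult_mono) auto
    then have "\<bar>d\<^sup>2 + 2 * \<phi> * d\<bar> \<le> d\<^sup>2 + C * (\<eta> + d\<^sup>2 / \<eta>)"
      by (intro order_trans[OF abs_triangle_ineq]) (simp add: abs_mult)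
    then show ?thesis unfolding abs_mult using assms B by (intro mult_mono) auto
  qed
  ultimately have "\<bar>a * (\<phi> + d)\<^sup>2 - b * \<phi>\<^sup>2\<bar> \<le> \<eta>\<^sup>2 * (2 * C\<^sup>2 + 2 * d\<^sup>2) + B * (d\<^sup>2 + C * (\<eta> + d\<^sup>2 / \<eta>))"
    by linarith
  then show ?thesis by (simp add: algebra_simps)
qed

text \<open>The situation on one path: step functions \<open>f n\<close> converge to the integrand
  \<phi> in L2, and the weights \<open>a n\<close> converge uniformly to \<open>b\<close>. The
  bounds on \<open>f n\<close> depend on \<open>n\<close> and give integrability only; the estimates
  go through the L2 error.\<close>

locale l2_limit =
  fixes T :: real and f :: "nat \<Rightarrow> real \<Rightarrow> real" and \<phi> :: "real \<Rightarrow> real"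
    and a :: "nat \<Rightarrow> real \<Rightarrow> real" and b :: "real \<Rightarrow> real"
  assumes T: "0 \<le> T"
    and f_meas: "\<And>n. f n \<in> borel_measurable borel"
    and f_bdd: "\<And>n. \<exists>B. \<forall>s. \<bar>f n s\<bar> \<le> B"
    and phi: "continuous_on {0..T} \<phi>"
    and lim: "(\<lambda>n. \<integral>\<^sup>+ s\<in>{0..T}. ennreal ((f n s - \<phi> s)\<^sup>2) \<partial>lborel) \<longlonglongrightarrow> 0"
    and a: "\<And>n. continuous_on {0..T} (a n)"
    and b: "continuous_on {0..T} b"
    and ab: "uniform_limit {0..T} a b sequentially"
begin

lemma bounded_integrable:
  assumes "\<And>s. s \<in> {0..T} \<Longrightarrow> \<bar>h s\<bar> \<le> (B::real)" "set_borel_measurable borel {0..T} h"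
  shows "set_integrable lborel {0..T} h"
  unfolding set_integrable_def
proof (rule Bochner_Integration.integrable_bound)
  have "set_integrable lborel {0..T} (\<lambda>_. B)" by (intro borel_integrable_atLeastAtMost') auto
  then show "integrable lborel (\<lambda>s. indicator {0..T} s *\<^sub>R B)" by (simp add: set_integrable_def)
  show "AE s in lborel. norm (indicator {0..T} s *\<^sub>R h s) \<le> norm (indicator {0..T} s *\<^sub>R B)"
    using assms(1) by (auto simp: indicator_def intro!: AE_I2 order_trans[OF assms(1)])
qed (use assms(2) in \<open>auto simp: set_borel_measurable_def\<close>)

lemma continuous_bound:
  assumes "continuous_on {0..T} h"
  obtains B :: real where "\<And>s. s \<in> {0..T} \<Longrightarrow> \<bar>h s\<bar> \<le> B" "0 \<le> B"
proof -
  have "bounded (h ` {0..T})" using assms by (intro compact_imp_bounded compact_continuous_image) auto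
  then obtain B where "\<And>s. s \<in> {0..T} \<Longrightarrow> \<bar>h s\<bar> \<le> B" unfolding bounded_iff by (metis image_eqI real_norm_def)
  then show thesis using that[of "max B 0"] by (simp add: max.coboundedI1)
qed

lemma continuous_measurable:
  assumes "continuous_on {0..T} (h :: real \<Rightarrow> real)"
  shows "(\<lambda>s. indicator {0..T} s * h s) \<in> borel_measurable borel"
  using borel_measurable_continuous_on_indicator[OF _ assms] by simp

lemma integrable_af:
  assumes "continuous_on {0..T} h"
  shows "set_integrable lborel {0..T} (\<lambda>s. h s * (f n s)\<^sup>2)"
proof -
  obtain B where B: "\<And>s. s \<in> {0..T} \<Longrightarrow> \<bar>h s\<bar> \<le> B" "0 \<le> B" using continuous_bound[OF assms] by blast
  obtain B' where B': "\<And>s. \<bar>f n s\<bar> \<le> B'" using f_bdd by blast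
  have "\<bar>h s * (f n s)\<^sup>2\<bar> \<le> B * B'\<^sup>2" if "s \<in> {0..T}" for s
    unfolding abs_mult using B(1)[OF that] B(2) power_mono[OF B'[of s], of 2] by (intro mult_mono) auto
  moreover have "(\<lambda>s. (indicator {0..T} s * h s) * (f n s)\<^sup>2) \<in> borel_measurable borel"
    using continuous_measurable[OF assms] f_meas[of n] by measurable
  then have "set_borel_measurable borel {0..T} (\<lambda>s. h s * (f n s)\<^sup>2)"
    by (simp add: set_borel_measurable_def mult.assoc)
  ultimately show ?thesis by (rule bounded_integrable)
qed

lemma integrable_d: "set_integrable lborel {0..T} (\<lambda>s. (f n s - \<phi> s)\<^sup>2)"
proof -
  obtain B where B: "\<And>s. s \<in> {0..T} \<Longrightarrow> \<bar>\<phi> s\<bar> \<le> B" "0 \<le> B" using continuous_bound[OF phi] by blast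
  obtain B' where B': "\<And>s. \<bar>f n s\<bar> \<le> B'" using f_bdd by blast
  have "\<bar>(f n s - \<phi> s)\<^sup>2\<bar> \<le> (B' + B)\<^sup>2" if "s \<in> {0..T}" for s
  proof -
    have "\<bar>f n s - \<phi> s\<bar> \<le> B' + B" using B(1)[OF that] B'[of s] by linarith
    then have "\<bar>f n s - \<phi> s\<bar>\<^sup>2 \<le> (B' + B)\<^sup>2" by (intro power_mono) auto
    then show ?thesis by simp
  qed
  moreover have "(\<lambda>s. (indicator {0..T} s * f n s - indicator {0..T} s * \<phi> s)\<^sup>2) \<in> borel_measurable borel"
    using continuous_measurable[OF phi] f_meas[of n] by measurable
  then have "set_borel_measurable borel {0..T} (\<lambda>s. (f n s - \<phi> s)\<^sup>2)"
    unfolding set_borel_measurable_def by (rule measurable_cong[THEN iffD1, rotated]) (auto simp: indicator_def)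
  ultimately show ?thesis by (rule bounded_integrable)
qed

definition err where "err n = (LINT s:{0..T}|lborel. (f n s - \<phi> s)\<^sup>2)"

lemma err_nonneg: "0 \<le> err n"
  unfolding err_def set_lebesgue_integral_def by (intro integral_nonneg_AE) auto

lemma err_lim: "err \<longlonglongrightarrow> 0"
proof -
  have "(\<integral>\<^sup>+ s\<in>{0..T}. ennreal ((f n s - \<phi> s)\<^sup>2) \<partial>lborel) = ennreal (err n)" for n
    unfolding err_def by (intro nn_set_integral_eq_set_integral integrable_d) auto
  then have "(\<lambda>n. ennreal (err n)) \<longlonglongrightarrow> ennreal 0" using lim by simp
  then show ?thesis by (rule tendsto_ennrealD) (auto simp: err_nonneg)
qed

lemma integral_square_uniform_limit:
  "uniform_limit {0..T} (\<lambda>n t. LINT s:{0..t}|lborel. a n s * (f n s)\<^sup>2)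
    (\<lambda>t. LINT s:{0..t}|lborel. b s * (\<phi> s)\<^sup>2) sequentially"
proof (rule uniform_limitI)
  fix e :: real assume "e > 0"
  obtain B where B: "\<And>s. s \<in> {0..T} \<Longrightarrow> \<bar>b s\<bar> \<le> B" "0 \<le> B" using continuous_bound[OF b] by blast
  obtain C where C: "\<And>s. s \<in> {0..T} \<Longrightarrow> \<bar>\<phi> s\<bar> \<le> C" "0 \<le> C" using continuous_bound[OF phi] by blast
  \<comment> \<open>\<open>Q\<close> collects the coefficients of \<eta> in the chain of estimates
    that ends the proof, plus 1 to make it positive.\<close>
  define Q where "Q = 2 + B + B * C + (2 * C\<^sup>2 + B * C) * T + 1"
  have Q: "Q > 0" unfolding Q_def using B(2) C(2) T by (intro add_nonneg_pos add_nonneg_nonneg mult_nonneg_nonneg) auto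
  define \<eta> where "\<eta> = min 1 (e / (2 * Q))"
  have eta: "0 < \<eta>" "\<eta> \<le> 1" "\<eta> * Q < e"
  proof -
    show "0 < \<eta>" "\<eta> \<le> 1" using Q \<open>e > 0\<close> by (auto simp: \<eta>_def)
    have "\<eta> * Q \<le> e / (2 * Q) * Q" using Q by (intro mult_right_mono) (auto simp: \<eta>_def)
    then show "\<eta> * Q < e" using Q \<open>e > 0\<close> by simp
  qed
  have eta2: "\<eta>\<^sup>2 \<le> \<eta>" "0 < \<eta>\<^sup>2" using eta by (auto simp: power2_eq_square mult_left_le)
  have "\<forall>\<^sub>F n in sequentially. err n < \<eta>\<^sup>2" using order_tendstoD(2)[OF err_lim eta2(2)] .
  moreover have "\<forall>\<^sub>F n in sequentially. \<forall>s\<in>{0..T}. dist (a n s) (b s) < \<eta>\<^sup>2"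
    using uniform_limitD[OF ab eta2(2)] .
  ultimately show "\<forall>\<^sub>F n in sequentially. \<forall>t\<in>{0..T}. dist (LINT s:{0..t}|lborel. a n s * (f n s)\<^sup>2)
    (LINT s:{0..t}|lborel. b s * (\<phi> s)\<^sup>2) < e"
  proof eventually_elim
    case (elim n)
    show ?case
    proof
      fix t assume t: "t \<in> {0..T}"
      define c1 where "c1 = 2 * \<eta>\<^sup>2 + B + B * C / \<eta>"
      define c2 where "c2 = 2 * \<eta>\<^sup>2 * C\<^sup>2 + B * C * \<eta>"
      have i1: "set_integrable lborel {0..T} (\<lambda>s. a n s * (f n s)\<^sup>2)" by (rule integrable_af[OF a])
      have i2: "set_integrable lborel {0..T} (\<lambda>s. b s * (\<phi> s)\<^sup>2)"
        by (intro borel_integrable_atLeastAtMost' continuous_intros b phi)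
      have i3: "set_integrable lborel {0..T} (\<lambda>s. c2)"
        by (intro borel_integrable_atLeastAtMost') auto
      have sub: "set_integrable lborel {0..t} (\<lambda>s. a n s * (f n s)\<^sup>2)" "set_integrable lborel {0..t} (\<lambda>s. b s * (\<phi> s)\<^sup>2)"
        using t by (auto intro: set_integrable_subset[OF i1] set_integrable_subset[OF i2])
      have "\<bar>LINT s:{0..t}|lborel. a n s * (f n s)\<^sup>2 - b s * (\<phi> s)\<^sup>2\<bar>
        \<le> (LINT s:{0..T}|lborel. c1 * (f n s - \<phi> s)\<^sup>2 + c2)"
      proof (rule set_integral_abs_le)
        show "\<bar>a n s * (f n s)\<^sup>2 - b s * (\<phi> s)\<^sup>2\<bar> \<le> c1 * (f n s - \<phi> s)\<^sup>2 + c2" if "s \<in> {0..T}" for s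
          using square_diff_bound[of "a n s" "b s" \<eta> B "\<phi> s" C "f n s - \<phi> s"] elim that B C eta
          by (auto simp: c1_def c2_def dist_real_def less_imp_le)
      qed (use t in \<open>auto intro!: set_integral_diff(1) i1 i2 set_integral_add(1) i3 integrable_d\<close>)
      also have "\<dots> = c1 * err n + c2 * T"
        using set_integral_add(2)[OF set_integrable_mult_right[OF integrable_d, of c1 n] i3] T
        by (simp add: err_def set_lebesgue_integral_def mult.commute)
      also have "\<dots> \<le> c1 * \<eta>\<^sup>2 + c2 * T"
        using elim B(2) C(2) eta by (intro add_right_mono mult_left_mono) (auto simp: c1_def less_imp_le)
      also have "\<dots> = \<eta>\<^sup>2 * (2 * \<eta>\<^sup>2) + \<eta>\<^sup>2 * B + \<eta> * (B * C) + \<eta>\<^sup>2 * (2 * C\<^sup>2 * T) + \<eta> * (B * C * T)"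
        using eta(1) by (simp add: c1_def c2_def algebra_simps power2_eq_square)
      also have "\<dots> \<le> \<eta> * (2 * 1) + \<eta> * B + \<eta> * (B * C) + \<eta> * (2 * C\<^sup>2 * T) + \<eta> * (B * C * T)"
        using eta2 eta B(2) C(2) T by (intro add_mono mult_mono order_refl) auto
      also have "\<dots> \<le> \<eta> * Q" using eta(1) by (simp add: Q_def algebra_simps)
      also have "\<dots> < e" by (rule eta)
      finally show "dist (LINT s:{0..t}|lborel. a n s * (f n s)\<^sup>2) (LINT s:{0..t}|lborel. b s * (\<phi> s)\<^sup>2) < e"
        using set_integral_diff(2)[OF sub] by (simp add: dist_real_def)
    qed
  qed
qed

text \<open>The error splits into a (f - \<phi>) + (a - b) \<phi>. The weights are bounded by
  \<open>B + g n\<close> with \<open>g n\<close> their uniform distance to \<open>b\<close>, so both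
  squares vanish in the limit.\<close>

lemma product_l2_limit:
  "(\<lambda>n. \<integral>\<^sup>+ s\<in>{0..T}. ennreal ((a n s * f n s - b s * \<phi> s)\<^sup>2) \<partial>lborel) \<longlonglongrightarrow> 0"
proof -
  obtain B where B: "\<And>s. s \<in> {0..T} \<Longrightarrow> \<bar>b s\<bar> \<le> B" "0 \<le> B" using continuous_bound[OF b] by blast
  obtain C where C: "\<And>s. s \<in> {0..T} \<Longrightarrow> \<bar>\<phi> s\<bar> \<le> C" "0 \<le> C" using continuous_bound[OF phi] by blast
  define g where "g n = (SUP s\<in>{0..T}. \<bar>a n s - b s\<bar>)" for n
  have bdd: "bdd_above ((\<lambda>s. \<bar>a n s - b s\<bar>) ` {0..T})" for n
    by (intro bounded_imp_bdd_above compact_imp_bounded compact_continuous_image continuous_intros a b) auto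
  have g: "\<bar>a n s - b s\<bar> \<le> g n" if "s \<in> {0..T}" for n s
    unfolding g_def by (rule cSUP_upper[OF that bdd])
  have g0: "0 \<le> g n" for n using g[of 0 n] T by (meson abs_ge_zero atLeastAtMost_iff order_refl order_trans)
  have g_lim: "g \<longlonglongrightarrow> 0"
  proof (rule LIMSEQ_I)
    fix r :: real assume "0 < r"
    then have "\<forall>\<^sub>F n in sequentially. \<forall>s\<in>{0..T}. dist (a n s) (b s) < r / 2"
      by (intro uniform_limitD[OF ab]) auto
    then obtain N where N: "\<And>n s. n \<ge> N \<Longrightarrow> s \<in> {0..T} \<Longrightarrow> dist (a n s) (b s) < r / 2"
      unfolding eventually_sequentially by blast
    have "g n \<le> r / 2" if "n \<ge> N" for n
      unfolding g_def using N[OF that] T by (intro cSUP_least) (auto simp: dist_real_def less_imp_le)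
    then show "\<exists>N. \<forall>n\<ge>N. norm (g n - 0) < r" using g0 \<open>0 < r\<close> by (intro exI[of _ N]) force
  qed
  have le: "(\<integral>\<^sup>+ s\<in>{0..T}. ennreal ((a n s * f n s - b s * \<phi> s)\<^sup>2) \<partial>lborel)
    \<le> ennreal (2 * (B + g n)\<^sup>2 * err n + 2 * (g n)\<^sup>2 * C\<^sup>2 * T)" for n
  proof -
    have pw: "(a n s * f n s - b s * \<phi> s)\<^sup>2 \<le> 2 * (B + g n)\<^sup>2 * (f n s - \<phi> s)\<^sup>2 + 2 * (g n)\<^sup>2 * C\<^sup>2"
      if s: "s \<in> {0..T}" for s
    proof -
      have "a n s * f n s - b s * \<phi> s = a n s * (f n s - \<phi> s) + (a n s - b s) * \<phi> s"
        by (simp add: algebra_simps)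
      also have "(\<dots>)\<^sup>2 \<le> 2 * (a n s * (f n s - \<phi> s))\<^sup>2 + 2 * ((a n s - b s) * \<phi> s)\<^sup>2"
        using zero_le_power2[of "a n s * (f n s - \<phi> s) - (a n s - b s) * \<phi> s"]
        by (simp add: power2_eq_square algebra_simps)
      also have "\<dots> \<le> 2 * ((B + g n)\<^sup>2 * (f n s - \<phi> s)\<^sup>2) + 2 * ((g n)\<^sup>2 * C\<^sup>2)"
      proof -
        have "\<bar>a n s\<bar> \<le> B + g n" using B(1)[OF s] g[OF s, of n] by linarith
        then have "\<bar>a n s\<bar>\<^sup>2 \<le> (B + g n)\<^sup>2" by (intro power_mono) auto
        moreover have "\<bar>a n s - b s\<bar>\<^sup>2 \<le> (g n)\<^sup>2" using g[OF s, of n] by (intro power_mono) auto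
        moreover have "\<bar>\<phi> s\<bar>\<^sup>2 \<le> C\<^sup>2" using C(1)[OF s] by (intro power_mono) auto
        ultimately show ?thesis unfolding power_mult_distrib by (intro add_mono mult_left_mono mult_mono) auto
      qed
      finally show ?thesis by (simp add: mult.assoc)
    qed
    have i3: "set_integrable lborel {0..T} (\<lambda>s. 2 * (g n)\<^sup>2 * C\<^sup>2)"
      by (intro borel_integrable_atLeastAtMost') auto
    have "(\<integral>\<^sup>+ s\<in>{0..T}. ennreal ((a n s * f n s - b s * \<phi> s)\<^sup>2) \<partial>lborel)
      \<le> (\<integral>\<^sup>+ s\<in>{0..T}. ennreal (2 * (B + g n)\<^sup>2 * (f n s - \<phi> s)\<^sup>2 + 2 * (g n)\<^sup>2 * C\<^sup>2) \<partial>lborel)"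
    proof (intro nn_integral_mono)
      fix s :: real
      show "ennreal ((a n s * f n s - b s * \<phi> s)\<^sup>2) * indicator {0..T} s \<le>
        ennreal (2 * (B + g n)\<^sup>2 * (f n s - \<phi> s)\<^sup>2 + 2 * (g n)\<^sup>2 * C\<^sup>2) * indicator {0..T} s"
        using ennreal_leI[OF pw, of s] by (cases "s \<in> {0..T}") simp_all
    qed
    also have "\<dots> = ennreal (LINT s:{0..T}|lborel. 2 * (B + g n)\<^sup>2 * (f n s - \<phi> s)\<^sup>2 + 2 * (g n)\<^sup>2 * C\<^sup>2)"
      by (intro nn_set_integral_eq_set_integral set_integral_add(1) set_integrable_mult_right i3) (auto intro: integrable_d)
    also have "(LINT s:{0..T}|lborel. 2 * (B + g n)\<^sup>2 * (f n s - \<phi> s)\<^sup>2 + 2 * (g n)\<^sup>2 * C\<^sup>2)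
      = 2 * (B + g n)\<^sup>2 * err n + 2 * (g n)\<^sup>2 * C\<^sup>2 * T"
      using set_integral_add(2)[OF set_integrable_mult_right[OF integrable_d, of "2 * (B + g n)\<^sup>2" n] i3] T
      by (simp add: err_def set_lebesgue_integral_def mult.commute)
    finally show ?thesis .
  qed
  have "(\<lambda>n. 2 * (B + g n)\<^sup>2 * err n + 2 * (g n)\<^sup>2 * C\<^sup>2 * T) \<longlonglongrightarrow> 2 * (B + 0)\<^sup>2 * 0 + 2 * 0\<^sup>2 * C\<^sup>2 * T"
    by (intro tendsto_intros g_lim err_lim)
  then have up: "(\<lambda>n. ennreal (2 * (B + g n)\<^sup>2 * err n + 2 * (g n)\<^sup>2 * C\<^sup>2 * T)) \<longlonglongrightarrow> 0"
    using tendsto_ennrealI by fastforce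
  show ?thesis
    by (rule tendsto_sandwich[OF _ _ tendsto_const up]) (use le in auto)
qed

end

section \<open>The filtration of a Brownian motion\<close>

text \<open>Rounding down stays inside \<open>{0..s}\<close>, so a path that is continuous on
  \<open>{0..T}\<close> only can be evaluated along these times. They range over a countable set,
  which is the source of the measurability results below.\<close>

definition floor_time :: "nat \<Rightarrow> real \<Rightarrow> real" where
  "floor_time n s = real (nat \<lfloor>s * 2 ^ n\<rfloor>) / 2 ^ n"

lemma floor_time_le: "0 \<le> s \<Longrightarrow> floor_time n s \<le> s" "0 \<le> floor_time n s"
  by (auto simp: floor_time_def field_simps of_nat_nat)

lemma floor_time_tendsto:
  assumes "0 \<le> s"
  shows "(\<lambda>n. floor_time n s) \<longlonglongrightarrow> s"
proof (rule tendsto_sandwich)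
  have "s * 2 ^ n - 1 \<le> real (nat \<lfloor>s * 2 ^ n\<rfloor>)" for n using assms by (simp add: of_nat_nat)
  then have "(s * 2 ^ n - 1) / 2 ^ n \<le> floor_time n s" for n
    unfolding floor_time_def by (intro divide_right_mono) auto
  then show "\<forall>\<^sub>F n in sequentially. s - 1 / 2 ^ n \<le> floor_time n s"
    by (simp add: diff_divide_distrib)
  show "\<forall>\<^sub>F n in sequentially. floor_time n s \<le> s" using floor_time_le assms by auto
  have "(\<lambda>n. s - 1 / 2 ^ n) \<longlonglongrightarrow> s - 0" by (intro tendsto_intros mesh_tendsto_0)
  then show "(\<lambda>n. s - 1 / 2 ^ n) \<longlonglongrightarrow> s" by simp
qed auto

lemma continuous_jointly_measurable:
  fixes X :: "real \<Rightarrow> 'a \<Rightarrow> real"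
  assumes X: "\<And>s. s \<in> {0..t} \<Longrightarrow> X s \<in> borel_measurable Q"
    and cont: "\<And>\<omega>. \<omega> \<in> space Q \<Longrightarrow> continuous_on {0..t} (\<lambda>s. X s \<omega>)"
  shows "(\<lambda>(s, \<omega>). X s \<omega>) \<in> borel_measurable (restrict_space borel {0..t} \<Otimes>\<^sub>M Q)"
proof (cases "0 \<le> t")
  case False
  then have "space (restrict_space borel {0..t} \<Otimes>\<^sub>M Q) = {}" by (auto simp: space_pair_measure)
  then show ?thesis by (auto simp: measurable_def)
next
  case True
  let ?R = "restrict_space borel {0..t} \<Otimes>\<^sub>M Q"
  have fst_meas: "fst \<in> borel_measurable ?R"
    using measurable_fst[of "restrict_space borel {0..t}" Q] by (metis measurable_restrict_space2_iff)
  \<comment> \<open>The \<open>min\<close> keeps all times \<open>i / 2 ^ n\<close> of the countable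
    family inside \<open>{0..t}\<close>, where \<open>X\<close> is measurable; it leaves the rounded
    times themselves unchanged.\<close>
  define Y where "Y n = (\<lambda>q :: real \<times> 'a. X (min t (real (nat \<lfloor>fst q * 2 ^ n\<rfloor>) / 2 ^ n)) (snd q))" for n :: nat
  have "Y n \<in> borel_measurable ?R" for n
    unfolding Y_def
  proof (rule measurable_compose_countable[where f = "\<lambda>i q. X (min t (real i / 2 ^ n)) (snd q)"])
    show "(\<lambda>q. X (min t (real i / 2 ^ n)) (snd q)) \<in> borel_measurable ?R" for i :: nat
      using X[of "min t (real i / 2 ^ n)"] True by (intro measurable_compose[OF measurable_snd]) auto
    show "(\<lambda>q. nat \<lfloor>fst q * 2 ^ n\<rfloor>) \<in> measurable ?R (count_space UNIV)"
      using fst_meas by measurable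
  qed
  moreover have "(\<lambda>n. Y n q) \<longlonglongrightarrow> (\<lambda>(s, \<omega>). X s \<omega>) q" if q: "q \<in> space ?R" for q
  proof -
    obtain s \<omega> where q': "q = (s, \<omega>)" "s \<in> {0..t}" "\<omega> \<in> space Q"
      using q by (auto simp: space_pair_measure space_restrict_space)
    have "min t (floor_time n s) = floor_time n s" "floor_time n s \<in> {0..t}" for n
      using floor_time_le[where s = s and n = n] q'(2) by auto
    then have "Y n q = X (floor_time n s) \<omega>" for n by (simp add: Y_def q' floor_time_def)
    moreover have "(\<lambda>n. X (floor_time n s) \<omega>) \<longlonglongrightarrow> X s \<omega>"
      using continuous_on_tendsto_compose[OF cont[OF q'(3)] floor_time_tendsto[of s] q'(2)] q'(2)
        \<open>\<And>n. floor_time n s \<in> {0..t}\<close> by auto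
    ultimately show ?thesis by (simp add: q')
  qed
  ultimately show ?thesis by (rule borel_measurable_LIMSEQ_real[where u = Y, rotated])
qed

lemma uniform_limit_iff_SUP:
  fixes f :: "nat \<Rightarrow> real \<Rightarrow> real"
  shows "uniform_limit S f l sequentially \<longleftrightarrow> (\<lambda>n. SUP t\<in>S. ennreal \<bar>f n t - l t\<bar>) \<longlonglongrightarrow> 0"
proof
  assume u: "uniform_limit S f l sequentially"
  show "(\<lambda>n. SUP t\<in>S. ennreal \<bar>f n t - l t\<bar>) \<longlonglongrightarrow> 0"
  proof (rule order_tendstoI)
    fix y :: ennreal assume "0 < y"
    then obtain e where e: "0 < e" "e < y" using dense by blast
    then obtain r where r: "e = ennreal r" "0 < r"
      by (metis enn2real_positive_iff ennreal_enn2real order.strict_trans2 top_greatest)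
    show "\<forall>\<^sub>F n in sequentially. (SUP t\<in>S. ennreal \<bar>f n t - l t\<bar>) < y"
      using uniform_limitD[OF u r(2)]
    proof eventually_elim
      case (elim n)
      have "(SUP t\<in>S. ennreal \<bar>f n t - l t\<bar>) \<le> e"
        unfolding r(1) using elim by (intro SUP_least ennreal_leI) (auto simp: dist_real_def less_imp_le)
      then show ?case using e by simp
    qed
  qed auto
next
  assume lim: "(\<lambda>n. SUP t\<in>S. ennreal \<bar>f n t - l t\<bar>) \<longlonglongrightarrow> 0"
  show "uniform_limit S f l sequentially"
  proof (rule uniform_limitI)
    fix e :: real assume "0 < e"
    then have "\<forall>\<^sub>F n in sequentially. (SUP t\<in>S. ennreal \<bar>f n t - l t\<bar>) < ennreal e"
      using order_tendstoD(2)[OF lim, of "ennreal e"] by simp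
    then show "\<forall>\<^sub>F n in sequentially. \<forall>t\<in>S. dist (f n t) (l t) < e"
    proof eventually_elim
      case (elim n)
      show ?case
      proof
        fix t assume "t \<in> S"
        then have "ennreal \<bar>f n t - l t\<bar> \<le> (SUP t\<in>S. ennreal \<bar>f n t - l t\<bar>)" by (rule SUP_upper)
        also have "\<dots> < ennreal e" by fact
        finally show "dist (f n t) (l t) < e" by (simp add: dist_real_def ennreal_less_iff)
      qed
    qed
  qed
qed

text \<open>Rounded times approach every \<open>t\<close>, and continuity carries the bound over. A
  countable supremum is measurable, which makes the uniform distance of two processes a random
  variable.\<close>

lemma SUP_continuous_countable:
  fixes h :: "real \<Rightarrow> real"
  assumes "0 \<le> T" and h: "continuous_on {0..T} h"
  shows "(SUP t\<in>{0..T}. ennreal \<bar>h t\<bar>) = (SUP i. ennreal \<bar>h (min T (real (fst i) / 2 ^ snd i))\<bar>)"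
proof (rule antisym)
  show "(SUP t\<in>{0..T}. ennreal \<bar>h t\<bar>) \<le> (SUP i. ennreal \<bar>h (min T (real (fst i) / 2 ^ snd i))\<bar>)"
  proof (rule SUP_least)
    fix t assume t: "t \<in> {0..T}"
    have mem: "floor_time n t \<in> {0..T}" for n using floor_time_le[where s = t and n = n] t by auto
    have "(\<lambda>n. h (floor_time n t)) \<longlonglongrightarrow> h t"
      using continuous_on_tendsto_compose[OF h floor_time_tendsto[of t] t] t mem by auto
    then have lim: "(\<lambda>n. ennreal \<bar>h (floor_time n t)\<bar>) \<longlonglongrightarrow> ennreal \<bar>h t\<bar>"
      by (intro tendsto_ennrealI tendsto_rabs)
    have "ennreal \<bar>h (floor_time n t)\<bar> \<le> (SUP i. ennreal \<bar>h (min T (real (fst i) / 2 ^ snd i))\<bar>)" for n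
    proof -
      have "floor_time n t = min T (real (nat \<lfloor>t * 2 ^ n\<rfloor>) / 2 ^ n)"
        using mem[of n] by (simp add: floor_time_def)
      then show ?thesis
        using SUP_upper[of "(nat \<lfloor>t * 2 ^ n\<rfloor>, n)" UNIV "\<lambda>i. ennreal \<bar>h (min T (real (fst i) / 2 ^ snd i))\<bar>"]
        by (simp only: fst_conv snd_conv UNIV_I simp_thms)
    qed
    then show "ennreal \<bar>h t\<bar> \<le> (SUP i. ennreal \<bar>h (min T (real (fst i) / 2 ^ snd i))\<bar>)"
      by (intro LIMSEQ_le_const2[OF lim]) auto
  qed
  show "(SUP i. ennreal \<bar>h (min T (real (fst i) / 2 ^ snd i))\<bar>) \<le> (SUP t\<in>{0..T}. ennreal \<bar>h t\<bar>)"
    using assms(1) by (intro SUP_least SUP_upper) auto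
qed

lemma (in complete_measure) measurable_AE_eq:
  assumes f: "f \<in> measurable M N" and g: "g \<in> space M \<rightarrow> space N" and ae: "AE x in M. f x = g x"
  shows "g \<in> measurable M N"
proof (rule measurableI)
  show "g x \<in> space N" if "x \<in> space M" for x using g that by auto
  fix A assume "A \<in> sets N"
  then have "f -` A \<inter> space M \<in> sets M" using f by (rule measurable_sets[rotated])
  moreover have "AE x in M. x \<in> f -` A \<inter> space M \<longleftrightarrow> x \<in> g -` A \<inter> space M"
    using ae by eventually_elim auto
  ultimately show "g -` A \<inter> space M \<in> sets M" using in_sets_AE by blast
qed

text \<open>Borel-Cantelli: the probabilities of exceeding \<open>1 / 2 ^ n\<close> are summable, so
  almost surely only finitely many of these events occur.\<close>

lemma AE_tendsto_0_fast:
  fixes \<psi> :: "nat \<Rightarrow> 'a \<Rightarrow> ennreal"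
  assumes "finite_measure Q" and meas: "\<And>n. \<psi> n \<in> borel_measurable Q"
    and le: "\<And>n. measure Q {\<omega>\<in>space Q. \<psi> n \<omega> > ennreal (1 / 2 ^ n)} \<le> 1 / 2 ^ n"
  shows "AE \<omega> in Q. (\<lambda>n. \<psi> n \<omega>) \<longlonglongrightarrow> 0"
proof -
  interpret finite_measure Q by fact
  have "AE \<omega> in Q. \<forall>\<^sub>F n in sequentially. \<omega> \<in> space Q - {\<omega>\<in>space Q. \<psi> n \<omega> > ennreal (1 / 2 ^ n)}"
  proof (rule borel_cantelli_AE1)
    show "{\<omega>\<in>space Q. \<psi> n \<omega> > ennreal (1 / 2 ^ n)} \<in> sets Q" for n
      using meas[of n] by measurable
    show "summable (\<lambda>n. measure Q {\<omega>\<in>space Q. \<psi> n \<omega> > ennreal (1 / 2 ^ n)})"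
    proof (rule summable_comparison_test')
      show "summable (\<lambda>n. (1 / 2 :: real) ^ n)" by (intro summable_geometric) simp
    qed (use le in \<open>auto simp: power_one_over\<close>)
  qed (simp add: less_top emeasure_eq_measure)
  then show ?thesis
  proof eventually_elim
    case (elim \<omega>)
    have up: "(\<lambda>n. ennreal (1 / 2 ^ n)) \<longlonglongrightarrow> 0"
      using tendsto_ennrealI[OF mesh_tendsto_0[of 1]] by simp
    show ?case
      by (rule tendsto_sandwich[OF _ _ tendsto_const up]) (use elim in \<open>auto elim!: eventually_mono simp: not_less\<close>)
  qed
qed

text \<open>Where the event is not measurable, \<open>measure\<close> takes the junk value \<open>0\<close>.\<close>

lemma vanishes_in_probI_AE:
  fixes Z :: "nat \<Rightarrow> 'a \<Rightarrow> ennreal"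
  assumes "finite_measure Q" and ae: "AE \<omega> in Q. (\<lambda>n. Z n \<omega>) \<longlonglongrightarrow> 0"
  shows "vanishes_in_prob Q Z"
  unfolding vanishes_in_prob_def
proof (intro allI impI)
  interpret finite_measure Q by fact
  fix \<epsilon> :: real assume "\<epsilon> > 0"
  define A where "A n = (if {\<omega>\<in>space Q. Z n \<omega> > ennreal \<epsilon>} \<in> sets Q then {\<omega>\<in>space Q. Z n \<omega> > ennreal \<epsilon>} else {})" for n
  have A: "A n \<in> sets Q" for n by (simp add: A_def)
  have eq: "measure Q {\<omega>\<in>space Q. Z n \<omega> > ennreal \<epsilon>} = measure Q (A n)" for n
    by (simp add: A_def measure_notin_sets)
  have "(\<lambda>n. \<integral>\<omega>. indicator (A n) \<omega> \<partial>Q) \<longlonglongrightarrow> (\<integral>\<omega>. 0 \<partial>Q :: real)"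
  proof (rule integral_dominated_convergence[where w = "\<lambda>_. 1"])
    show "AE \<omega> in Q. (\<lambda>n. indicator (A n) \<omega> :: real) \<longlonglongrightarrow> 0"
      using ae
    proof eventually_elim
      case (elim \<omega>)
      have "\<forall>\<^sub>F n in sequentially. Z n \<omega> < ennreal \<epsilon>" using order_tendstoD(2)[OF elim] \<open>\<epsilon> > 0\<close> by simp
      then have "\<forall>\<^sub>F n in sequentially. indicator (A n) \<omega> = (0 :: real)"
        by eventually_elim (auto simp: A_def indicator_def)
      then show ?case by (rule tendsto_eventually)
    qed
  qed (use A in \<open>auto simp: indicator_def\<close>)
  then show "(\<lambda>n. measure Q {\<omega>\<in>space Q. Z n \<omega> > ennreal \<epsilon>}) \<longlonglongrightarrow> 0"
    using A by (simp add: eq)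
qed

section \<open>The augmented filtration as an intersection of \<sigma>-algebras\<close>

definition path_generators :: "'a measure \<Rightarrow> (real \<Rightarrow> 'a \<Rightarrow> real) \<Rightarrow> real \<Rightarrow> 'a set set" where
  "path_generators M W r = {W u -` A \<inter> space M | u A. u \<in> {0..r} \<and> A \<in> sets borel} \<union> null_sets (completion M)"

lemma path_generators_Pow: "path_generators M W r \<subseteq> Pow (space M)"
  using sets.sets_into_space[of _ "completion M"] by (auto simp: path_generators_def null_sets_def)

lemma path_generators_mono: "r \<le> r' \<Longrightarrow> path_generators M W r \<subseteq> path_generators M W r'"
proof
  fix B assume "r \<le> r'" "B \<in> path_generators M W r"
  then consider u A where "B = W u -` A \<inter> space M" "u \<in> {0..r'}" "A \<in> sets borel"
    | "B \<in> null_sets (completion M)"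
    by (auto simp: path_generators_def)
  then show "B \<in> path_generators M W r'"
    by cases (auto simp: path_generators_def)
qed

text \<open>An intersection of \<sigma>-algebras is one already, so the outer \<open>sigma\<close>
  in \<open>canonical_filtration\<close> adds no sets.\<close>

lemma sets_canonical_filtration:
  "sets (canonical_filtration M T W t) =
    (\<Inter>\<epsilon>\<in>{0<..}. sigma_sets (space M) (path_generators M W (min (t + \<epsilon>) T)))"
proof -
  define S where "S \<epsilon> = sigma_sets (space M) (path_generators M W (min (t + \<epsilon>) T))" for \<epsilon>
  have S: "S \<epsilon> \<subseteq> Pow (space M)" for \<epsilon>
    unfolding S_def using sigma_sets_into_sp[OF path_generators_Pow] by blast
  have "sets (canonical_filtration M T W t) = sigma_sets (space M) (\<Inter>\<epsilon>\<in>{0<..}. S \<epsilon>)"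
    unfolding canonical_filtration_def path_generators_def[symmetric] S_def[symmetric]
  proof (rule sets_measure_of)
    have "(\<Inter>\<epsilon>\<in>{0<..}. S \<epsilon>) \<subseteq> S 1" by (rule INT_lower) simp
    then show "(\<Inter>\<epsilon>\<in>{0<..}. S \<epsilon>) \<subseteq> Pow (space M)" using S[of 1] by (rule order_trans)
  qed
  also have "\<dots> = (\<Inter>\<epsilon>\<in>{0<..}. S \<epsilon>)"
  proof
    have "sigma_sets (space M) (\<Inter>\<epsilon>\<in>{0<..}. S \<epsilon>) \<subseteq> S \<epsilon>" if "\<epsilon> > 0" for \<epsilon>
    proof -
      have "sigma_sets (space M) (\<Inter>\<epsilon>\<in>{0<..}. S \<epsilon>) \<subseteq> sigma_sets (space M) (S \<epsilon>)"
        using that by (intro sigma_sets_mono') auto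
      also have "\<dots> = S \<epsilon>" unfolding S_def by (rule sigma_sets_sigma_sets_eq[OF path_generators_Pow])
      finally show ?thesis .
    qed
    then show "sigma_sets (space M) (\<Inter>\<epsilon>\<in>{0<..}. S \<epsilon>) \<subseteq> (\<Inter>\<epsilon>\<in>{0<..}. S \<epsilon>)" by auto
  qed (auto intro: sigma_sets.Basic)
  finally show ?thesis unfolding S_def .
qed

lemma space_canonical_filtration [simp]: "space (canonical_filtration M T W t) = space M"
  by (simp add: canonical_filtration_def space_measure_of_conv)

lemma canonical_filtration_mono:
  "s \<le> t \<Longrightarrow> sets (canonical_filtration M T W s) \<subseteq> sets (canonical_filtration M T W t)"
  unfolding sets_canonical_filtration
proof (rule INF_mono)
  fix \<epsilon> :: real assume "s \<le> t" "\<epsilon> \<in> {0<..}"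
  then show "\<exists>\<epsilon>'\<in>{0<..}. sigma_sets (space M) (path_generators M W (min (s + \<epsilon>') T))
      \<subseteq> sigma_sets (space M) (path_generators M W (min (t + \<epsilon>) T))"
    by (intro bexI[of _ \<epsilon>] sigma_sets_mono' path_generators_mono) auto
qed

lemma measurable_finer:
  assumes "f \<in> measurable A N" "sets A \<subseteq> sets B" "space A = space B"
  shows "f \<in> measurable B N"
  using assms by (auto simp: measurable_def)

lemma canonical_filtration_measurable_mono:
  "f \<in> borel_measurable (canonical_filtration M T W s) \<Longrightarrow> s \<le> t \<Longrightarrow>
    f \<in> borel_measurable (canonical_filtration M T W t)"
  by (erule measurable_finer) (simp_all add: canonical_filtration_mono)

text \<open>Taking \<epsilon> = r - s in the intersection. Because of the right limits an event at
  time \<open>s\<close> is tied to the path up to a strictly later \<open>r\<close>, and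
  independence from increments is therefore first obtained from \<open>r\<close> on.\<close>

lemma canonical_filtration_sigma_sets:
  assumes "B \<in> sets (canonical_filtration M T W s)" "s < r" "r \<le> T"
  shows "B \<in> sigma_sets (space M) (path_generators M W r)"
proof -
  have "B \<in> sigma_sets (space M) (path_generators M W (min (s + (r - s)) T))"
    using assms unfolding sets_canonical_filtration by (metis INT_E diff_gt_0_iff_gt greaterThan_iff)
  then show ?thesis using assms by simp
qed

section \<open>Measurability of adapted processes and simple integrals\<close>

locale bm_setting = prob_space M for M :: "'a measure" +
  fixes T :: real and W :: "real \<Rightarrow> 'a \<Rightarrow> real"
  assumes T: "0 < T" and bm: "brownian_motion M T W"
begin

abbreviation F :: "real \<Rightarrow> 'a measure" where "F \<equiv> canonical_filtration M T W"

sublocale N: prob_space "completion M" by (rule prob_space_completion)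

lemma W_measurable: "t \<in> {0..T} \<Longrightarrow> W t \<in> borel_measurable M"
  using bm by (simp add: brownian_motion_def)

lemma AE_W_0: "AE \<omega> in completion M. W 0 \<omega> = 0"
  using bm by (auto simp: brownian_motion_def intro: AE_completion)

lemma AE_W_continuous: "AE \<omega> in completion M. continuous_on {0..T} (\<lambda>t. W t \<omega>)"
  using bm by (intro AE_completion) (simp add: brownian_motion_def)

lemma F_le_completion:
  assumes "B \<in> sets (F t)"
  shows "B \<in> sets (completion M)"
proof -
  have "path_generators M W (min (t + 1) T) \<subseteq> sets (completion M)"
    unfolding path_generators_def
    using measurable_sets[OF W_measurable] by (auto intro: sets_completionI_sets)
  then have "sigma_sets (space M) (path_generators M W (min (t + 1) T)) \<subseteq> sets (completion M)"
    using sets.sigma_sets_subset[of _ "completion M"] by simp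
  moreover have "B \<in> sigma_sets (space M) (path_generators M W (min (t + 1) T))"
    using assms unfolding sets_canonical_filtration by auto
  ultimately show ?thesis by blast
qed

lemma F_measurable_completion:
  "f \<in> borel_measurable (F t) \<Longrightarrow> f \<in> borel_measurable (completion M)"
  by (erule measurable_finer) (auto intro: F_le_completion)

lemma W_F_measurable:
  assumes "u \<in> {0..T}" "u \<le> t"
  shows "W u \<in> borel_measurable (F t)"
proof (rule measurableI)
  fix A :: "real set" assume "A \<in> sets borel"
  then have "W u -` A \<inter> space M \<in> path_generators M W (min (t + \<epsilon>) T)" if "\<epsilon> > 0" for \<epsilon>
    using assms that by (auto simp: path_generators_def)
  then show "W u -` A \<inter> space (F t) \<in> sets (F t)"
    unfolding sets_canonical_filtration by (auto intro: sigma_sets.Basic)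
qed simp

lemma adapted_completion:
  "adapted F T X \<Longrightarrow> t \<in> {0..T} \<Longrightarrow> X t \<in> borel_measurable (completion M)"
  by (rule F_measurable_completion[of _ t]) (simp add: adapted_def)

lemma progressive_continuous:
  assumes "adapted F T X" "continuous_paths M T X"
  shows "progressive F T X"
  unfolding progressive_def
proof
  fix t assume t: "t \<in> {0..T}"
  show "(\<lambda>(s, \<omega>). X s \<omega>) \<in> borel_measurable (restrict_space borel {0..t} \<Otimes>\<^sub>M F t)"
  proof (rule continuous_jointly_measurable)
    show "X s \<in> borel_measurable (F t)" if "s \<in> {0..t}" for s
      using assms(1) that t by (intro canonical_filtration_measurable_mono[of "X s" M T W s t]) (auto simp: adapted_def)
    show "continuous_on {0..t} (\<lambda>s. X s \<omega>)" if "\<omega> \<in> space (F t)" for \<omega>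
      using assms(2) that t by (auto simp: continuous_paths_def intro: continuous_on_subset)
  qed
qed

text \<open>The form of measurability that integration over time uses: relative to the completion
  rather than the filtration. Progressive processes have it, and so do measurable processes with
  continuous paths.\<close>

definition joint :: "(real \<Rightarrow> 'a \<Rightarrow> real) \<Rightarrow> bool" where
  "joint H \<longleftrightarrow> (\<lambda>(s, \<omega>). H s \<omega>) \<in> borel_measurable (restrict_space borel {0..T} \<Otimes>\<^sub>M completion M)"

lemma progressive_joint:
  assumes "progressive F T H"
  shows "joint H"
proof -
  have "(\<lambda>(s, \<omega>). H s \<omega>) \<in> borel_measurable (restrict_space borel {0..T} \<Otimes>\<^sub>M F T)"
    using assms T by (auto simp: progressive_def)
  moreover have "sets (restrict_space borel {0..T} \<Otimes>\<^sub>M F T) \<subseteq> sets (restrict_space borel {0..T} \<Otimes>\<^sub>M completion M)"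
    unfolding sets_pair_measure space_canonical_filtration space_completion
    using F_le_completion by (intro sigma_sets_mono') blast
  ultimately show ?thesis
    unfolding joint_def by (rule measurable_finer) (simp add: space_pair_measure)
qed

lemma joint_continuous:
  assumes "\<And>t. t \<in> {0..T} \<Longrightarrow> X t \<in> borel_measurable (completion M)"
    "\<And>\<omega>. \<omega> \<in> space M \<Longrightarrow> continuous_on {0..T} (\<lambda>s. X s \<omega>)"
  shows "joint X"
  unfolding joint_def by (rule continuous_jointly_measurable) (use assms in auto)

lemma simple_process_measurable:
  assumes "is_simple_process F T (k, p, \<xi>)" "i < k"
  shows "\<xi> i \<in> borel_measurable (F (p i))" "\<xi> i \<in> borel_measurable (completion M)"
proof -
  show "\<xi> i \<in> borel_measurable (F (p i))" using assms by (simp add: is_simple_process_def)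
  then show "\<xi> i \<in> borel_measurable (completion M)" by (rule F_measurable_completion)
qed

lemma simple_value_eq: "simple_value (k, p, \<xi>) s \<omega> = step_fun k p (\<lambda>i. \<xi> i \<omega>) s"
  unfolding simple_value_def step_fun_def by simp

lemma simple_integral_eq: "simple_integral_W W (k, p, \<xi>) t \<omega> = step_int k p (\<lambda>i. \<xi> i \<omega>) (\<lambda>t. W t \<omega>) t"
  unfolding simple_integral_W_def step_int_def by simp

lemma joint_simple_value:
  assumes "is_simple_process F T \<Phi>"
  shows "joint (simple_value \<Phi>)"
proof -
  obtain k p \<xi> where \<Phi>: "\<Phi> = (k, p, \<xi>)" by (cases \<Phi>) auto
  let ?R = "restrict_space borel {0..T} \<Otimes>\<^sub>M completion M"
  have fst_meas: "fst \<in> borel_measurable ?R"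
    using measurable_fst[of "restrict_space borel {0..T}" "completion M"] by (metis measurable_restrict_space2_iff)
  have "(\<lambda>q. \<Sum>i<k. \<xi> i (snd q) * indicator {p i<..p (Suc i)} (fst q)) \<in> borel_measurable ?R"
  proof (intro borel_measurable_sum borel_measurable_times)
    fix i assume "i \<in> {..<k}"
    then have "\<xi> i \<in> borel_measurable (completion M)"
      using simple_process_measurable(2)[OF assms[unfolded \<Phi>]] by simp
    then show "(\<lambda>q. \<xi> i (snd q)) \<in> borel_measurable ?R"
      by (rule measurable_compose[OF measurable_snd])
    show "(\<lambda>q. indicator {p i<..p (Suc i)} (fst q) :: real) \<in> borel_measurable ?R"
      by (rule measurable_compose[OF fst_meas]) simp
  qed
  then show ?thesis by (simp add: joint_def \<Phi> simple_value_def case_prod_beta')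
qed

lemma simple_points:
  assumes "is_simple_process F T (k, p, \<xi>)"
  shows "i \<le> j \<Longrightarrow> j \<le> k \<Longrightarrow> p i \<le> p j" "i \<le> k \<Longrightarrow> p i \<in> {0..T}"
proof -
  have p: "0 \<le> p 0" "\<And>i. i < k \<Longrightarrow> p i \<le> p (Suc i)" "p k \<le> T"
    using assms by (auto simp: is_simple_process_def)
  show mono: "p i \<le> p j" if "i \<le> j" "j \<le> k" for i j
    using that
  proof (induction j)
    case (Suc j)
    then show ?case using p(2)[of j] by (cases "i = Suc j") force+
  qed simp
  show "p i \<in> {0..T}" if "i \<le> k" using p(1,3) mono[of 0 i] mono[of i k] that by auto
qed

text \<open>A coefficient with \<open>p i > t\<close> belongs to a later \<sigma>-algebra than
  \<open>F t\<close>, but then both endpoints of its cell are cut to \<open>t\<close> and the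
  summand is 0.\<close>

lemma simple_sum_F_measurable:
  assumes \<Phi>: "is_simple_process F T (k, p, \<xi>)" and t: "t \<in> {0..T}"
    and f: "\<And>s. s \<in> {0..t} \<Longrightarrow> (\<lambda>\<omega>. f \<omega> s) \<in> borel_measurable (F t)"
    and c: "\<And>i. i < k \<Longrightarrow> c i \<in> borel_measurable (F (p i))"
  shows "(\<lambda>\<omega>. step_int k p (\<lambda>i. c i \<omega>) (f \<omega>) t) \<in> borel_measurable (F t)"
  unfolding step_int_def
proof (intro borel_measurable_sum)
  fix i assume "i \<in> {..<k}"
  then have i: "i < k" by simp
  have p: "p i \<in> {0..T}" "p (Suc i) \<in> {0..T}" "p i \<le> p (Suc i)" using simple_points[OF \<Phi>] i by auto
  show "(\<lambda>\<omega>. c i \<omega> * (f \<omega> (min (p (Suc i)) t) - f \<omega> (min (p i) t))) \<in> borel_measurable (F t)"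
  proof (cases "p i \<le> t")
    case True
    then have "c i \<in> borel_measurable (F t)"
      using c[OF i] by (rule canonical_filtration_measurable_mono[rotated])
    then show ?thesis using p t by (intro borel_measurable_times borel_measurable_diff f) auto
  next
    case False
    then have "min (p (Suc i)) t = t" "min (p i) t = t" using p by auto
    then show ?thesis by simp
  qed
qed

lemma simple_integral_F_measurable:
  assumes "is_simple_process F T \<Phi>" "t \<in> {0..T}"
  shows "simple_integral_W W \<Phi> t \<in> borel_measurable (F t)"
proof -
  obtain k p \<xi> where \<Phi>: "\<Phi> = (k, p, \<xi>)" by (cases \<Phi>) auto
  have "(\<lambda>\<omega>. step_int k p (\<lambda>i. \<xi> i \<omega>) (\<lambda>s. W s \<omega>) t) \<in> borel_measurable (F t)"
    by (rule simple_sum_F_measurable) (use assms \<Phi> simple_process_measurable(1)[OF assms(1)[unfolded \<Phi>]] in \<open>auto intro!: W_F_measurable\<close>)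
  then show ?thesis by (simp add: \<Phi> simple_integral_eq[abs_def])
qed

lemma simple_integral_continuous:
  assumes "is_simple_process F T \<Phi>" "continuous_on {0..T} (\<lambda>t. W t \<omega>)"
  shows "continuous_on {0..T} (\<lambda>t. simple_integral_W W \<Phi> t \<omega>)"
proof -
  obtain k p \<xi> where \<Phi>: "\<Phi> = (k, p, \<xi>)" by (cases \<Phi>) auto
  have "continuous_on {0..T} (\<lambda>t. W (min (p i) t) \<omega>)" if "i \<le> k" for i
    by (rule continuous_on_compose2[OF assms(2)])
      (use simple_points(2)[OF assms(1)[unfolded \<Phi>] that] in \<open>auto intro!: continuous_intros\<close>)
  then show ?thesis unfolding \<Phi> simple_integral_eq step_int_def
    by (intro continuous_on_sum continuous_on_mult continuous_on_diff continuous_on_const) simp_all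
qed

lemma joint_nn_integral_measurable:
  assumes "joint H"
  shows "(\<lambda>\<omega>. \<integral>\<^sup>+ s\<in>{0..T}. ennreal (H s \<omega>) \<partial>lborel) \<in> borel_measurable (completion M)"
proof -
  interpret R: sigma_finite_measure "restrict_space lborel {0..T::real}"
    by (rule sigma_finite_measure_restrict_space[OF lborel.sigma_finite_measure_axioms]) simp
  have eq: "sets (restrict_space lborel {0..T} \<Otimes>\<^sub>M completion M) = sets (restrict_space borel {0..T} \<Otimes>\<^sub>M completion M)"
    by (intro sets_pair_measure_cong) (auto simp: sets_restrict_space)
  have "(\<lambda>(s, \<omega>). H s \<omega>) \<in> borel_measurable (restrict_space lborel {0..T} \<Otimes>\<^sub>M completion M)"
    using assms by (simp add: joint_def measurable_cong_sets[OF eq refl])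
  then have "(\<lambda>(s, \<omega>). ennreal (H s \<omega>)) \<in> borel_measurable (restrict_space lborel {0..T} \<Otimes>\<^sub>M completion M)"
    unfolding case_prod_beta' by measurable
  from measurable_pair_swap[OF this]
  have "(\<lambda>(\<omega>, s). ennreal (H s \<omega>)) \<in> borel_measurable (completion M \<Otimes>\<^sub>M restrict_space lborel {0..T})"
    by simp
  then have "(\<lambda>\<omega>. \<integral>\<^sup>+ s. ennreal (H s \<omega>) \<partial>restrict_space lborel {0..T}) \<in> borel_measurable (completion M)"
    by (rule R.borel_measurable_nn_integral)
  then show ?thesis by (simp add: nn_integral_restrict_space)
qed

end

section \<open>Almost sure approximation of Ito integrals\<close>

context bm_setting
begin

lemma joint_binary:
  assumes "joint G" "joint H" and [measurable]: "(\<lambda>(x, y). f x y) \<in> borel_measurable (borel \<Otimes>\<^sub>M borel)"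
  shows "joint (\<lambda>s \<omega>. f (G s \<omega>) (H s \<omega>))"
proof -
  have "(\<lambda>q. (\<lambda>(x, y). f x y) ((\<lambda>(s, \<omega>). G s \<omega>) q, (\<lambda>(s, \<omega>). H s \<omega>) q))
    \<in> borel_measurable (restrict_space borel {0..T} \<Otimes>\<^sub>M completion M)"
    by (rule measurable_compose[OF measurable_Pair[OF assms(1,2)[unfolded joint_def]] assms(3)])
  then show ?thesis by (simp add: joint_def case_prod_beta')
qed

lemma joint_sq_diff: "joint G \<Longrightarrow> joint H \<Longrightarrow> joint (\<lambda>s \<omega>. (G s \<omega> - H s \<omega>)\<^sup>2)"
  by (rule joint_binary[where f = "\<lambda>x y. (x - y)\<^sup>2"]) measurable

lemma joint_section:
  assumes "joint H" "\<omega> \<in> space M"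
  shows "(\<lambda>s. ennreal (H s \<omega>) * indicator {0..T} s) \<in> borel_measurable lborel"
proof -
  have "(\<lambda>s. (\<lambda>(s, \<omega>). H s \<omega>) (s, \<omega>)) \<in> borel_measurable (restrict_space borel {0..T})"
    by (rule measurable_compose[OF measurable_Pair2' assms(1)[unfolded joint_def]]) (simp add: assms)
  then have "(\<lambda>s. ennreal (H s \<omega>)) \<in> borel_measurable (restrict_space borel {0..T})" by simp
  then show ?thesis by (subst (asm) borel_measurable_restrict_space_iff_ennreal) auto
qed

definition sup_dist :: "'a simple_process \<Rightarrow> (real \<Rightarrow> 'a \<Rightarrow> real) \<Rightarrow> 'a \<Rightarrow> ennreal" where
  "sup_dist \<Phi> Y \<omega> = (SUP t\<in>{0..T}. ennreal \<bar>simple_integral_W W \<Phi> t \<omega> - Y t \<omega>\<bar>)"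

definition l2_dist :: "(real \<Rightarrow> 'a \<Rightarrow> real) \<Rightarrow> (real \<Rightarrow> 'a \<Rightarrow> real) \<Rightarrow> 'a \<Rightarrow> ennreal" where
  "l2_dist G H \<omega> = (\<integral>\<^sup>+ s\<in>{0..T}. ennreal ((G s \<omega> - H s \<omega>)\<^sup>2) \<partial>lborel)"

lemma l2_dist_measurable: "joint G \<Longrightarrow> joint H \<Longrightarrow> l2_dist G H \<in> borel_measurable (completion M)"
  unfolding l2_dist_def[abs_def] by (intro joint_nn_integral_measurable joint_sq_diff)

text \<open>\<open>l2_dist\<close> is a squared distance, which is where the factors 2 come
  from.\<close>

lemma l2_dist_triangle:
  assumes "joint G" "joint H" "joint K" "\<omega> \<in> space M"
  shows "l2_dist G K \<omega> \<le> 2 * l2_dist G H \<omega> + 2 * l2_dist H K \<omega>"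
proof -
  have m: "(\<lambda>s. ennreal ((G s \<omega> - H s \<omega>)\<^sup>2) * indicator {0..T} s) \<in> borel_measurable lborel"
    "(\<lambda>s. ennreal ((H s \<omega> - K s \<omega>)\<^sup>2) * indicator {0..T} s) \<in> borel_measurable lborel"
    by (intro joint_section joint_sq_diff assms)+
  have "l2_dist G K \<omega> \<le> (\<integral>\<^sup>+ s. 2 * (ennreal ((G s \<omega> - H s \<omega>)\<^sup>2) * indicator {0..T} s)
      + 2 * (ennreal ((H s \<omega> - K s \<omega>)\<^sup>2) * indicator {0..T} s) \<partial>lborel)"
    unfolding l2_dist_def
  proof (intro nn_integral_mono)
    fix s :: real
    have "(G s \<omega> - K s \<omega>)\<^sup>2 \<le> 2 * (G s \<omega> - H s \<omega>)\<^sup>2 + 2 * (H s \<omega> - K s \<omega>)\<^sup>2"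
      using zero_le_power2[of "(G s \<omega> - H s \<omega>) - (H s \<omega> - K s \<omega>)"]
      by (simp add: power2_eq_square algebra_simps)
    then have "ennreal ((G s \<omega> - K s \<omega>)\<^sup>2) \<le> ennreal (2 * (G s \<omega> - H s \<omega>)\<^sup>2 + 2 * (H s \<omega> - K s \<omega>)\<^sup>2)"
      by (rule ennreal_leI)
    also have "\<dots> = 2 * ennreal ((G s \<omega> - H s \<omega>)\<^sup>2) + 2 * ennreal ((H s \<omega> - K s \<omega>)\<^sup>2)"
      by (simp add: ennreal_plus ennreal_mult')
    finally show "ennreal ((G s \<omega> - K s \<omega>)\<^sup>2) * indicator {0..T} s \<le>
      2 * (ennreal ((G s \<omega> - H s \<omega>)\<^sup>2) * indicator {0..T} s)
      + 2 * (ennreal ((H s \<omega> - K s \<omega>)\<^sup>2) * indicator {0..T} s)"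
      by (cases "s \<in> {0..T}") simp_all
  qed
  also have "\<dots> = 2 * l2_dist G H \<omega> + 2 * l2_dist H K \<omega>"
    unfolding l2_dist_def using m by (simp add: nn_integral_add nn_integral_cmult)
  finally show ?thesis .
qed

text \<open>The paths are continuous almost surely, so the supremum agrees off a null set with the
  one over dyadic times; the completion makes this enough for measurability.\<close>

lemma sup_dist_measurable:
  assumes \<Phi>: "is_simple_process F T \<Phi>"
    and Y: "\<And>t. t \<in> {0..T} \<Longrightarrow> Y t \<in> borel_measurable (completion M)"
    and cont: "AE \<omega> in completion M. continuous_on {0..T} (\<lambda>t. Y t \<omega>)"
  shows "sup_dist \<Phi> Y \<in> borel_measurable (completion M)"
proof (rule completion.measurable_AE_eq)
  define f where "f i \<omega> = ennreal \<bar>simple_integral_W W \<Phi> (min T (real (fst i) / 2 ^ snd i)) \<omega> -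
      Y (min T (real (fst i) / 2 ^ snd i)) \<omega>\<bar>" for i :: "nat \<times> nat" and \<omega>
  have "f i \<in> borel_measurable (completion M)" for i
  proof -
    have mem: "min T (real (fst i) / 2 ^ snd i) \<in> {0..T}" using T by auto
    have [measurable]: "simple_integral_W W \<Phi> (min T (real (fst i) / 2 ^ snd i)) \<in> borel_measurable (completion M)"
      by (rule F_measurable_completion[OF simple_integral_F_measurable[OF \<Phi> mem]])
    have [measurable]: "Y (min T (real (fst i) / 2 ^ snd i)) \<in> borel_measurable (completion M)" by (rule Y[OF mem])
    show ?thesis unfolding f_def by measurable
  qed
  then show "(\<lambda>\<omega>. SUP i. f i \<omega>) \<in> borel_measurable (completion M)"
    by (intro borel_measurable_SUP) auto
  show "AE \<omega> in completion M. (SUP i. f i \<omega>) = sup_dist \<Phi> Y \<omega>"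
    using AE_W_continuous cont
  proof eventually_elim
    case (elim \<omega>)
    have "continuous_on {0..T} (\<lambda>t. simple_integral_W W \<Phi> t \<omega> - Y t \<omega>)"
      by (intro continuous_on_diff simple_integral_continuous \<Phi> elim)
    from SUP_continuous_countable[OF less_imp_le[OF T] this] show ?case by (simp add: sup_dist_def f_def)
  qed
qed auto

text \<open>The almost sure counterpart of \<open>has_ito_integral\<close>: one sequence of simple
  processes that works on almost every path. Progressiveness of \<open>H\<close> and adaptedness of
  \<open>Y\<close> are kept apart and return in \<open>has_ito_integralI\<close>, so limits can be
  taken for this relation alone.\<close>

definition ito_approx :: "(real \<Rightarrow> 'a \<Rightarrow> real) \<Rightarrow> (real \<Rightarrow> 'a \<Rightarrow> real) \<Rightarrow> bool" where
  "ito_approx H Y \<longleftrightarrow> (\<exists>\<Phi>. (\<forall>n. is_simple_process F T (\<Phi> n)) \<and>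
     (AE \<omega> in completion M. (\<lambda>n. l2_dist (simple_value (\<Phi> n)) H \<omega>) \<longlonglongrightarrow> 0 \<and>
       uniform_limit {0..T} (\<lambda>n t. simple_integral_W W (\<Phi> n) t \<omega>) (\<lambda>t. Y t \<omega>) sequentially))"

lemma uniform_limit_sup_dist:
  "uniform_limit {0..T} (\<lambda>n t. simple_integral_W W (\<Phi> n) t \<omega>) (\<lambda>t. Y t \<omega>) sequentially
    \<longleftrightarrow> (\<lambda>n. sup_dist (\<Phi> n) Y \<omega>) \<longlonglongrightarrow> 0"
  unfolding uniform_limit_iff_SUP sup_dist_def ..

text \<open>Choose for each \<open>n\<close> an index \<open>r n\<close> at which both distances
  exceed \<open>1 / 2 ^ n\<close> with probability at most \<open>1 / 2 ^ n\<close>. Borel-Cantelli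
  applies to this choice even if \<open>r\<close> is not increasing.\<close>

lemma has_ito_integral_imp_ito_approx:
  assumes ito: "has_ito_integral M T W H Y"
  shows "ito_approx H Y"
proof -
  obtain \<Phi> where \<Phi>: "\<And>n. is_simple_process F T (\<Phi> n)"
    "vanishes_in_prob (completion M) (\<lambda>n. l2_dist (simple_value (\<Phi> n)) H)"
    "vanishes_in_prob (completion M) (\<lambda>n. sup_dist (\<Phi> n) Y)"
    using ito unfolding has_ito_integral_def l2_dist_def[abs_def] sup_dist_def[abs_def] by blast
  have m1: "l2_dist (simple_value (\<Phi> n)) H \<in> borel_measurable (completion M)" for n
    using ito \<Phi>(1) by (intro l2_dist_measurable joint_simple_value progressive_joint)
      (auto simp: has_ito_integral_def)
  have m2: "sup_dist (\<Phi> n) Y \<in> borel_measurable (completion M)" for n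
    using ito \<Phi>(1) by (intro sup_dist_measurable adapted_completion)
      (auto simp: has_ito_integral_def continuous_paths_def intro!: AE_I2)
  have ex: "\<exists>r. measure (completion M) {\<omega> \<in> space (completion M). l2_dist (simple_value (\<Phi> r)) H \<omega> > ennreal (1 / 2 ^ n)} \<le> 1 / 2 ^ n
    \<and> measure (completion M) {\<omega> \<in> space (completion M). sup_dist (\<Phi> r) Y \<omega> > ennreal (1 / 2 ^ n)} \<le> 1 / 2 ^ n" for n :: nat
  proof -
    have pos: "(1 / 2 ^ n :: real) > 0" by simp
    have "\<forall>\<^sub>F r in sequentially. measure (completion M) {\<omega> \<in> space (completion M). l2_dist (simple_value (\<Phi> r)) H \<omega> > ennreal (1 / 2 ^ n)} < 1 / 2 ^ n"
      using \<Phi>(2) pos unfolding vanishes_in_prob_def by (intro order_tendstoD(2)[OF _ pos]) blast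
    moreover have "\<forall>\<^sub>F r in sequentially. measure (completion M) {\<omega> \<in> space (completion M). sup_dist (\<Phi> r) Y \<omega> > ennreal (1 / 2 ^ n)} < 1 / 2 ^ n"
      using \<Phi>(3) pos unfolding vanishes_in_prob_def by (intro order_tendstoD(2)[OF _ pos]) blast
    ultimately have "\<forall>\<^sub>F r in sequentially. measure (completion M) {\<omega> \<in> space (completion M). l2_dist (simple_value (\<Phi> r)) H \<omega> > ennreal (1 / 2 ^ n)} < 1 / 2 ^ n
      \<and> measure (completion M) {\<omega> \<in> space (completion M). sup_dist (\<Phi> r) Y \<omega> > ennreal (1 / 2 ^ n)} < 1 / 2 ^ n"
      by eventually_elim auto
    then show ?thesis using eventually_happens'[OF sequentially_bot] less_imp_le by blast
  qed
  from choice[OF allI[OF ex]] obtain r where r': "\<forall>n. measure (completion M) {\<omega> \<in> space (completion M). l2_dist (simple_value (\<Phi> (r n))) H \<omega> > ennreal (1 / 2 ^ n)} \<le> 1 / 2 ^ n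
    \<and> measure (completion M) {\<omega> \<in> space (completion M). sup_dist (\<Phi> (r n)) Y \<omega> > ennreal (1 / 2 ^ n)} \<le> 1 / 2 ^ n"
    by (rule exE)
  note r = r'[rule_format, THEN conjunct1] r'[rule_format, THEN conjunct2]
  have "AE \<omega> in completion M. (\<lambda>n. l2_dist (simple_value (\<Phi> (r n))) H \<omega>) \<longlonglongrightarrow> 0"
    by (rule AE_tendsto_0_fast[OF N.finite_measure_axioms m1 r(1)])
  moreover have "AE \<omega> in completion M. (\<lambda>n. sup_dist (\<Phi> (r n)) Y \<omega>) \<longlonglongrightarrow> 0"
    by (rule AE_tendsto_0_fast[OF N.finite_measure_axioms m2 r(2)])
  ultimately have "AE \<omega> in completion M. (\<lambda>n. l2_dist (simple_value (\<Phi> (r n))) H \<omega>) \<longlonglongrightarrow> 0 \<and>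
    uniform_limit {0..T} (\<lambda>n t. simple_integral_W W (\<Phi> (r n)) t \<omega>) (\<lambda>t. Y t \<omega>) sequentially"
    by eventually_elim (simp add: uniform_limit_sup_dist[where \<Phi> = "\<lambda>n. \<Phi> (r n)"])
  then show ?thesis
    unfolding ito_approx_def using \<Phi>(1) by (intro exI[of _ "\<lambda>n. \<Phi> (r n)"] conjI allI)
qed

lemma has_ito_integralI:
  assumes approx: "ito_approx H Y" and "progressive F T H"
    and "AE \<omega> in completion M. (\<integral>\<^sup>+ s\<in>{0..T}. ennreal ((H s \<omega>)\<^sup>2) \<partial>lborel) < \<infinity>"
    and "adapted F T Y" "continuous_paths M T Y"
  shows "has_ito_integral M T W H Y"
proof -
  obtain \<Phi> where \<Phi>: "\<And>n. is_simple_process F T (\<Phi> n)"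
    "AE \<omega> in completion M. (\<lambda>n. l2_dist (simple_value (\<Phi> n)) H \<omega>) \<longlonglongrightarrow> 0 \<and>
       (\<lambda>n. sup_dist (\<Phi> n) Y \<omega>) \<longlonglongrightarrow> 0"
    using approx unfolding ito_approx_def uniform_limit_sup_dist by blast
  have "vanishes_in_prob (completion M) (\<lambda>n. l2_dist (simple_value (\<Phi> n)) H)"
    by (rule vanishes_in_probI_AE[OF N.finite_measure_axioms]) (use \<Phi>(2) in auto)
  moreover have "vanishes_in_prob (completion M) (\<lambda>n. sup_dist (\<Phi> n) Y)"
    by (rule vanishes_in_probI_AE[OF N.finite_measure_axioms]) (use \<Phi>(2) in auto)
  ultimately show ?thesis
    using assms \<Phi>(1) unfolding has_ito_integral_def l2_dist_def[abs_def] sup_dist_def[abs_def] by blast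
qed

lemma ito_approx_AE_cong:
  assumes "ito_approx H Y" "AE \<omega> in completion M. \<forall>t\<in>{0..T}. H t \<omega> = H' t \<omega> \<and> Y t \<omega> = Y' t \<omega>"
  shows "ito_approx H' Y'"
proof -
  obtain \<Phi> where \<Phi>: "\<And>n. is_simple_process F T (\<Phi> n)"
    "AE \<omega> in completion M. (\<lambda>n. l2_dist (simple_value (\<Phi> n)) H \<omega>) \<longlonglongrightarrow> 0 \<and>
       uniform_limit {0..T} (\<lambda>n t. simple_integral_W W (\<Phi> n) t \<omega>) (\<lambda>t. Y t \<omega>) sequentially"
    using assms(1) unfolding ito_approx_def by blast
  have "AE \<omega> in completion M. (\<lambda>n. l2_dist (simple_value (\<Phi> n)) H' \<omega>) \<longlonglongrightarrow> 0 \<and>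
       uniform_limit {0..T} (\<lambda>n t. simple_integral_W W (\<Phi> n) t \<omega>) (\<lambda>t. Y' t \<omega>) sequentially"
    using \<Phi>(2) assms(2)
  proof eventually_elim
    case (elim \<omega>)
    have "l2_dist G H \<omega> = l2_dist G H' \<omega>" for G
      unfolding l2_dist_def using elim(2) by (intro nn_integral_cong) (auto simp: indicator_def)
    moreover have "uniform_limit {0..T} (\<lambda>n t. simple_integral_W W (\<Phi> n) t \<omega>) (\<lambda>t. Y' t \<omega>) sequentially
      = uniform_limit {0..T} (\<lambda>n t. simple_integral_W W (\<Phi> n) t \<omega>) (\<lambda>t. Y t \<omega>) sequentially"
      using elim(2) by (intro uniform_limit_cong') auto
    ultimately show ?case using elim(1) by simp
  qed
  then show ?thesis using \<Phi>(1) unfolding ito_approx_def by blast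
qed

text \<open>A diagonal argument. For each \<open>n\<close> a simple process is taken whose two
  distances to \<open>H n\<close> and \<open>Y n\<close> together exceed \<open>1 / 2 ^ n\<close>
  with probability at most \<open>1 / 2 ^ n\<close>. Borel-Cantelli makes these distances vanish
  almost surely, and the triangle inequality passes from \<open>H n\<close> and \<open>Y n\<close>
  to the limits.\<close>

lemma ito_approx_closed:
  assumes approx: "\<And>n. ito_approx (H n) (Y n)"
    and joint: "\<And>n. joint (H n)" "joint H'"
    and Y: "\<And>n t. t \<in> {0..T} \<Longrightarrow> Y n t \<in> borel_measurable (completion M)"
    and cont: "\<And>n. AE \<omega> in completion M. continuous_on {0..T} (\<lambda>t. Y n t \<omega>)"
    and lim: "AE \<omega> in completion M. (\<lambda>n. l2_dist (H n) H' \<omega>) \<longlonglongrightarrow> 0 \<and>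
       uniform_limit {0..T} (\<lambda>n t. Y n t \<omega>) (\<lambda>t. Y' t \<omega>) sequentially"
  shows "ito_approx H' Y'"
proof -
  have ex: "\<exists>\<Phi>. is_simple_process F T \<Phi> \<and> measure (completion M)
    {\<omega>\<in>space (completion M). l2_dist (simple_value \<Phi>) (H n) \<omega> + sup_dist \<Phi> (Y n) \<omega> > ennreal (1 / 2 ^ n)} \<le> 1 / 2 ^ n" for n :: nat
  proof -
    obtain \<Psi> where \<Psi>: "\<And>m. is_simple_process F T (\<Psi> m)"
      "AE \<omega> in completion M. (\<lambda>m. l2_dist (simple_value (\<Psi> m)) (H n) \<omega>) \<longlonglongrightarrow> 0 \<and>
         (\<lambda>m. sup_dist (\<Psi> m) (Y n) \<omega>) \<longlonglongrightarrow> 0"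
      using approx[of n] unfolding ito_approx_def uniform_limit_sup_dist by blast
    have "AE \<omega> in completion M. (\<lambda>m. l2_dist (simple_value (\<Psi> m)) (H n) \<omega> + sup_dist (\<Psi> m) (Y n) \<omega>) \<longlonglongrightarrow> 0"
      using \<Psi>(2)
    proof eventually_elim
      case (elim \<omega>)
      then show ?case using tendsto_add[of "\<lambda>m. l2_dist (simple_value (\<Psi> m)) (H n) \<omega>" 0 sequentially] by fastforce
    qed
    then have "vanishes_in_prob (completion M) (\<lambda>m \<omega>. l2_dist (simple_value (\<Psi> m)) (H n) \<omega> + sup_dist (\<Psi> m) (Y n) \<omega>)"
      by (rule vanishes_in_probI_AE[OF N.finite_measure_axioms])
    then have "(\<lambda>m. measure (completion M) {\<omega>\<in>space (completion M).
        l2_dist (simple_value (\<Psi> m)) (H n) \<omega> + sup_dist (\<Psi> m) (Y n) \<omega> > ennreal (1 / 2 ^ n)}) \<longlonglongrightarrow> 0"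
      unfolding vanishes_in_prob_def by simp
    then have "\<forall>\<^sub>F m in sequentially. measure (completion M) {\<omega>\<in>space (completion M).
        l2_dist (simple_value (\<Psi> m)) (H n) \<omega> + sup_dist (\<Psi> m) (Y n) \<omega> > ennreal (1 / 2 ^ n)} < 1 / 2 ^ n"
      by (rule order_tendstoD) simp
    then show ?thesis using eventually_happens'[OF sequentially_bot] less_imp_le \<Psi>(1) by blast
  qed
  from choice[OF allI[OF ex]] obtain \<Phi> where \<Phi>': "\<forall>n. is_simple_process F T (\<Phi> n) \<and> measure (completion M)
    {\<omega>\<in>space (completion M). l2_dist (simple_value (\<Phi> n)) (H n) \<omega> + sup_dist (\<Phi> n) (Y n) \<omega> > ennreal (1 / 2 ^ n)} \<le> 1 / 2 ^ n"
    by (rule exE)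
  note \<Phi> = \<Phi>'[rule_format, THEN conjunct1] \<Phi>'[rule_format, THEN conjunct2]
  have "AE \<omega> in completion M. (\<lambda>n. l2_dist (simple_value (\<Phi> n)) (H n) \<omega> + sup_dist (\<Phi> n) (Y n) \<omega>) \<longlonglongrightarrow> 0"
  proof (rule AE_tendsto_0_fast[OF N.finite_measure_axioms _ \<Phi>(2)])
    show "(\<lambda>\<omega>. l2_dist (simple_value (\<Phi> n)) (H n) \<omega> + sup_dist (\<Phi> n) (Y n) \<omega>) \<in> borel_measurable (completion M)" for n
      by (intro borel_measurable_add l2_dist_measurable joint_simple_value sup_dist_measurable \<Phi> joint Y cont)
  qed
  with lim AE_space have "AE \<omega> in completion M. (\<lambda>n. l2_dist (simple_value (\<Phi> n)) H' \<omega>) \<longlonglongrightarrow> 0 \<and>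
       uniform_limit {0..T} (\<lambda>n t. simple_integral_W W (\<Phi> n) t \<omega>) (\<lambda>t. Y' t \<omega>) sequentially"
  proof eventually_elim
    case (elim \<omega>)
    have l1: "(\<lambda>n. l2_dist (simple_value (\<Phi> n)) (H n) \<omega>) \<longlonglongrightarrow> 0"
      by (rule tendsto_sandwich[OF _ _ tendsto_const elim(3)]) auto
    have l2: "(\<lambda>n. sup_dist (\<Phi> n) (Y n) \<omega>) \<longlonglongrightarrow> 0"
      by (rule tendsto_sandwich[OF _ _ tendsto_const elim(3)]) auto
    have "(\<lambda>n. 2 * l2_dist (simple_value (\<Phi> n)) (H n) \<omega> + 2 * l2_dist (H n) H' \<omega>) \<longlonglongrightarrow> 2 * 0 + 2 * 0"
      using elim(1) l1 by (intro tendsto_add ennreal_tendsto_cmult) auto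
    then have up: "(\<lambda>n. 2 * l2_dist (simple_value (\<Phi> n)) (H n) \<omega> + 2 * l2_dist (H n) H' \<omega>) \<longlonglongrightarrow> 0" by simp
    have "(\<lambda>n. l2_dist (simple_value (\<Phi> n)) H' \<omega>) \<longlonglongrightarrow> 0"
      by (rule tendsto_sandwich[OF _ _ tendsto_const up])
        (use elim(2) in \<open>auto intro!: always_eventually l2_dist_triangle joint_simple_value \<Phi> joint\<close>)
    moreover have "uniform_limit {0..T} (\<lambda>n t. simple_integral_W W (\<Phi> n) t \<omega> - Y n t \<omega>) (\<lambda>t. 0) sequentially"
      using l2 unfolding uniform_limit_iff_SUP sup_dist_def by simp
    then have "uniform_limit {0..T} (\<lambda>n t. (simple_integral_W W (\<Phi> n) t \<omega> - Y n t \<omega>) + Y n t \<omega>) (\<lambda>t. 0 + Y' t \<omega>) sequentially"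
      by (rule uniform_limit_add) (use elim(1) in auto)
    then have "uniform_limit {0..T} (\<lambda>n t. simple_integral_W W (\<Phi> n) t \<omega>) (\<lambda>t. Y' t \<omega>) sequentially" by simp
    ultimately show ?case by blast
  qed
  then show ?thesis using \<Phi>(1) unfolding ito_approx_def by blast
qed

end

section \<open>Brownian increments\<close>

text \<open>The expected sum of the squares is finite, so the sum is finite almost surely and its
  terms tend to 0.\<close>

lemma AE_tendsto_0_summable:
  fixes X :: "nat \<Rightarrow> 'a \<Rightarrow> real"
  assumes int: "\<And>n. integrable Q (\<lambda>\<omega>. (X n \<omega>)\<^sup>2)" and meas: "\<And>n. X n \<in> borel_measurable Q"
    and le: "\<And>n. (\<integral>\<omega>. (X n \<omega>)\<^sup>2 \<partial>Q) \<le> C / 2 ^ n"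
  shows "AE \<omega> in Q. (\<lambda>n. X n \<omega>) \<longlonglongrightarrow> 0"
proof -
  note [measurable] = meas
  have sum: "summable (\<lambda>n. C / 2 ^ n)"
    using summable_mult[OF summable_geometric[of "1/2 :: real"], of C] by (simp add: power_one_over)
  have C: "0 \<le> C / 2 ^ n" for n
    by (rule order_trans[OF _ le]) (intro integral_nonneg_AE, simp)
  have "(\<integral>\<^sup>+ \<omega>. (\<Sum>n. ennreal ((X n \<omega>)\<^sup>2)) \<partial>Q) = (\<Sum>n. \<integral>\<^sup>+ \<omega>. ennreal ((X n \<omega>)\<^sup>2) \<partial>Q)"
    by (rule nn_integral_suminf) measurable
  also have "\<dots> \<le> (\<Sum>n. ennreal (C / 2 ^ n))"
    using le int by (intro suminf_le) (auto simp: nn_integral_eq_integral intro!: ennreal_leI)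
  also have "\<dots> = ennreal (\<Sum>n. C / 2 ^ n)"
    using C sum by (intro suminf_ennreal2) auto
  also have "\<dots> < \<infinity>" by simp
  finally have "AE \<omega> in Q. (\<Sum>n. ennreal ((X n \<omega>)\<^sup>2)) \<noteq> \<infinity>"
    by (intro nn_integral_PInf_AE) auto
  then show ?thesis
  proof eventually_elim
    case (elim \<omega>)
    then have "summable (\<lambda>n. (X n \<omega>)\<^sup>2)" by (intro summable_suminf_not_top) auto
    then have "(\<lambda>n. (X n \<omega>)\<^sup>2) \<longlonglongrightarrow> 0" by (rule summable_LIMSEQ_zero)
    then have "(\<lambda>n. sqrt ((X n \<omega>)\<^sup>2)) \<longlonglongrightarrow> sqrt 0" by (rule tendsto_real_sqrt)
    then show ?case by (simp add: tendsto_rabs_zero_iff)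
  qed
qed

context bm_setting
begin

lemma increment_moments:
  assumes "0 \<le> s" "s \<le> t" "t \<le> T"
  shows "integrable M (\<lambda>\<omega>. W t \<omega> - W s \<omega>)" "(\<integral>\<omega>. W t \<omega> - W s \<omega> \<partial>M) = 0"
    "integrable M (\<lambda>\<omega>. (W t \<omega> - W s \<omega>)\<^sup>2)" "(\<integral>\<omega>. (W t \<omega> - W s \<omega>)\<^sup>2 \<partial>M) = t - s"
    "integrable M (\<lambda>\<omega>. (W t \<omega> - W s \<omega>) ^ 4)" "(\<integral>\<omega>. (W t \<omega> - W s \<omega>) ^ 4 \<partial>M) = 3 * (t - s)\<^sup>2"
proof -
  have "integrable M (\<lambda>\<omega>. W t \<omega> - W s \<omega>) \<and> (\<integral>\<omega>. W t \<omega> - W s \<omega> \<partial>M) = 0 \<and>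
    integrable M (\<lambda>\<omega>. (W t \<omega> - W s \<omega>)\<^sup>2) \<and> (\<integral>\<omega>. (W t \<omega> - W s \<omega>)\<^sup>2 \<partial>M) = t - s \<and>
    integrable M (\<lambda>\<omega>. (W t \<omega> - W s \<omega>) ^ 4) \<and> (\<integral>\<omega>. (W t \<omega> - W s \<omega>) ^ 4 \<partial>M) = 3 * (t - s)\<^sup>2"
  \<comment> \<open>For \<open>s = t\<close> the normal law degenerates and
    \<open>brownian_motion\<close> provides no density; the increment is identically 0.\<close>
  proof (cases "s = t")
    case False
    then have st: "s < t" using assms by simp
    define \<sigma> where "\<sigma> = sqrt (t - s)"
    have \<sigma>: "0 < \<sigma>" "\<sigma>\<^sup>2 = t - s" using st by (auto simp: \<sigma>_def)
    have D: "distributed M lborel (\<lambda>\<omega>. W t \<omega> - W s \<omega>) (normal_density 0 \<sigma>)"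
      using bm assms st unfolding brownian_motion_def \<sigma>_def by blast
    have int: "integrable M (\<lambda>\<omega>. (W t \<omega> - W s \<omega>) ^ m) \<and> (\<integral>\<omega>. (W t \<omega> - W s \<omega>) ^ m \<partial>M) = c"
      if "has_bochner_integral lborel (\<lambda>x. normal_density 0 \<sigma> x * x ^ m) c" for m c
      using that distributed_integrable[OF D, of "\<lambda>x. x ^ m"] distributed_integral[OF D, of "\<lambda>x. x ^ m"]
      by (auto simp: has_bochner_integral_iff)
    have "has_bochner_integral lborel (\<lambda>x. normal_density 0 \<sigma> x * x ^ 1) 0"
      using normal_moment_odd[OF \<sigma>(1), of 0 0] by simp
    note 1 = int[OF this]
    have "has_bochner_integral lborel (\<lambda>x. normal_density 0 \<sigma> x * x ^ 2) (\<sigma>\<^sup>2)"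
      using normal_moment_even[OF \<sigma>(1), of 0 1] by simp
    note 2 = int[OF this]
    have "has_bochner_integral lborel (\<lambda>x. normal_density 0 \<sigma> x * x ^ 4) (3 * (\<sigma>\<^sup>2)\<^sup>2)"
      using normal_moment_even[OF \<sigma>(1), of 0 2] \<sigma>(1)
      by (simp add: fact_numeral power_divide field_simps)
    note 4 = int[OF this]
    show ?thesis using 1 2 4 by (simp add: \<sigma>)
  qed simp
  then show "integrable M (\<lambda>\<omega>. W t \<omega> - W s \<omega>)" "(\<integral>\<omega>. W t \<omega> - W s \<omega> \<partial>M) = 0"
    "integrable M (\<lambda>\<omega>. (W t \<omega> - W s \<omega>)\<^sup>2)" "(\<integral>\<omega>. (W t \<omega> - W s \<omega>)\<^sup>2 \<partial>M) = t - s"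
    "integrable M (\<lambda>\<omega>. (W t \<omega> - W s \<omega>) ^ 4)" "(\<integral>\<omega>. (W t \<omega> - W s \<omega>) ^ 4 \<partial>M) = 3 * (t - s)\<^sup>2"
    by blast+
qed

text \<open>The centred squares of the increments are independent with mean 0, so mixed terms drop
  out. A cell of length h contributes 3 h^2 - 2 h h + h^2 = 2 h^2, and bounding one factor h by the
  mesh leaves the sum of the lengths.\<close>

lemma quad_var_L2:
  assumes ab: "0 \<le> a" "a \<le> b" "b \<le> T" and t: "t \<in> {a..b}"
  shows "integrable M (\<lambda>\<omega>. (quad_var (\<lambda>s. W s \<omega>) a b n t - (t - a))\<^sup>2)"
    "(\<integral>\<omega>. (quad_var (\<lambda>s. W s \<omega>) a b n t - (t - a))\<^sup>2 \<partial>M) \<le> 2 * (b - a)\<^sup>2 / 2 ^ n"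
proof -
  define v where "v j = min (grid a b n j) t" for j
  define h where "h j = v (Suc j) - v j" for j
  define \<zeta> where "\<zeta> j \<omega> = (W (v (Suc j)) \<omega> - W (v j) \<omega>)\<^sup>2 - h j" for j \<omega>
  let ?I = "{..<2 ^ n :: nat}"
  have v: "v j \<in> {a..b}" if "j \<le> 2 ^ n" for j using min_grid_mem[OF ab(2) t that] by (simp add: v_def)
  have v_step: "v j \<le> v (Suc j)" "h j \<le> (b - a) / 2 ^ n" for j
    using min_grid_step[OF ab(2), of n j t] by (auto simp: v_def h_def)
  have pts: "0 \<le> v j" "v j \<le> v (Suc j)" "v (Suc j) \<le> T" if "j < 2 ^ n" for j
    using v[of j] v[of "Suc j"] v_step(1)[of j] that ab by auto
  note mom = increment_moments[OF pts]
  have ind: "indep_vars (\<lambda>_. borel) (\<lambda>j \<omega>. W (v (Suc j)) \<omega> - W (v j) \<omega>) ?I"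
  proof -
    have "\<forall>(n::nat) p. 0 \<le> p 0 \<longrightarrow> (\<forall>i<n. p i \<le> p (Suc i)) \<longrightarrow> p n \<le> T \<longrightarrow>
        indep_vars (\<lambda>_. borel) (\<lambda>i \<omega>. W (p (Suc i)) \<omega> - W (p i) \<omega>) {..<n}"
      using bm unfolding brownian_motion_def by blast
    from this[rule_format, of v "2 ^ n"] show ?thesis
      using v[of 0] v[of "2 ^ n"] v_step(1) ab by auto
  qed
  have ind\<zeta>: "indep_vars (\<lambda>_. borel) \<zeta> ?I"
    unfolding \<zeta>_def by (rule indep_vars_compose2[OF ind]) measurable
  have sq: "(\<zeta> j \<omega>)\<^sup>2 = (W (v (Suc j)) \<omega> - W (v j) \<omega>) ^ 4 - 2 * h j * (W (v (Suc j)) \<omega> - W (v j) \<omega>)\<^sup>2 + (h j)\<^sup>2" for j \<omega>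
    by (simp add: \<zeta>_def power2_eq_square power4_eq_xxxx algebra_simps)
  have \<zeta>: "integrable M (\<zeta> j)" "(\<integral>\<omega>. \<zeta> j \<omega> \<partial>M) = 0" "integrable M (\<lambda>\<omega>. (\<zeta> j \<omega>)\<^sup>2)"
    "(\<integral>\<omega>. (\<zeta> j \<omega>)\<^sup>2 \<partial>M) = 2 * (h j)\<^sup>2" if "j \<in> ?I" for j
  proof -
    have j: "j < 2 ^ n" using that by simp
    show "integrable M (\<zeta> j)" unfolding \<zeta>_def using mom[OF j j j] by (intro Bochner_Integration.integrable_diff) auto
    show "(\<integral>\<omega>. \<zeta> j \<omega> \<partial>M) = 0" unfolding \<zeta>_def using mom[OF j j j] by (simp add: prob_space h_def)
    show "integrable M (\<lambda>\<omega>. (\<zeta> j \<omega>)\<^sup>2)" unfolding sq using mom[OF j j j] by auto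
    show "(\<integral>\<omega>. (\<zeta> j \<omega>)\<^sup>2 \<partial>M) = 2 * (h j)\<^sup>2"
    proof -
      have "(\<integral>\<omega>. (\<zeta> j \<omega>)\<^sup>2 \<partial>M) = (\<integral>\<omega>. (W (v (Suc j)) \<omega> - W (v j) \<omega>) ^ 4 \<partial>M)
        - 2 * h j * (\<integral>\<omega>. (W (v (Suc j)) \<omega> - W (v j) \<omega>)\<^sup>2 \<partial>M) + (h j)\<^sup>2"
        unfolding sq using mom[OF j j j] by (simp add: prob_space)
      also have "\<dots> = 2 * (h j)\<^sup>2"
        using mom(4,6)[OF j j j] by (simp add: h_def[symmetric] power2_eq_square)
      finally show ?thesis .
    qed
  qed
  have cross: "integrable M (\<lambda>\<omega>. \<zeta> i \<omega> * \<zeta> j \<omega>)" "(\<integral>\<omega>. \<zeta> i \<omega> * \<zeta> j \<omega> \<partial>M) = (if i = j then 2 * (h j)\<^sup>2 else 0)"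
    if ij: "i \<in> ?I" "j \<in> ?I" for i j
  proof -
    have "integrable M (\<lambda>\<omega>. \<zeta> i \<omega> * \<zeta> j \<omega>) \<and> (\<integral>\<omega>. \<zeta> i \<omega> * \<zeta> j \<omega> \<partial>M) = (if i = j then 2 * (h j)\<^sup>2 else 0)"
    proof (cases "i = j")
      case True
      then show ?thesis using \<zeta>[OF ij(2)] by (simp add: power2_eq_square)
    next
      case False
      have iv: "indep_vars (\<lambda>_. borel) \<zeta> {i, j}"
        by (rule indep_vars_subset[OF ind\<zeta>]) (use ij in auto)
      have "integrable M (\<lambda>\<omega>. \<Prod>l\<in>{i, j}. \<zeta> l \<omega>)"
        by (rule indep_vars_integrable[OF _ iv]) (use \<zeta>(1) ij in auto)
      moreover have "(\<integral>\<omega>. (\<Prod>l\<in>{i, j}. \<zeta> l \<omega>) \<partial>M) = (\<Prod>l\<in>{i, j}. \<integral>\<omega>. \<zeta> l \<omega> \<partial>M)"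
        by (rule indep_vars_lebesgue_integral[OF _ iv]) (use \<zeta>(1) ij in auto)
      ultimately show ?thesis using False \<zeta>(2) ij by simp
    qed
    then show "integrable M (\<lambda>\<omega>. \<zeta> i \<omega> * \<zeta> j \<omega>)" "(\<integral>\<omega>. \<zeta> i \<omega> * \<zeta> j \<omega> \<partial>M) = (if i = j then 2 * (h j)\<^sup>2 else 0)"
      by blast+
  qed
  have sum_h: "(\<Sum>j\<in>?I. h j) = t - a"
    using sum_grid_telescope[OF ab(2) t, of "\<lambda>x. x" n] by (simp add: h_def v_def)
  have eq: "(quad_var (\<lambda>s. W s \<omega>) a b n t - (t - a))\<^sup>2 = (\<Sum>i\<in>?I. \<Sum>j\<in>?I. \<zeta> i \<omega> * \<zeta> j \<omega>)" for \<omega>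
  proof -
    have "quad_var (\<lambda>s. W s \<omega>) a b n t - (t - a) = (\<Sum>j\<in>?I. \<zeta> j \<omega>)"
      by (simp add: \<zeta>_def sum_subtractf sum_h quad_var_def v_def)
    then show ?thesis by (simp add: power2_eq_square sum_product)
  qed
  show "integrable M (\<lambda>\<omega>. (quad_var (\<lambda>s. W s \<omega>) a b n t - (t - a))\<^sup>2)"
    unfolding eq using cross by (intro Bochner_Integration.integrable_sum) auto
  have "(\<integral>\<omega>. (quad_var (\<lambda>s. W s \<omega>) a b n t - (t - a))\<^sup>2 \<partial>M) = (\<Sum>i\<in>?I. \<Sum>j\<in>?I. if i = j then 2 * (h j)\<^sup>2 else 0)"
    unfolding eq using cross
    by (subst Bochner_Integration.integral_sum; (intro Bochner_Integration.integrable_sum sum.cong refl; auto)?)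
  also have "\<dots> = (\<Sum>j\<in>?I. 2 * (h j)\<^sup>2)" by simp
  also have "\<dots> \<le> (\<Sum>j\<in>?I. 2 * ((b - a) / 2 ^ n) * h j)"
  proof (rule sum_mono)
    fix j
    have "0 \<le> h j" using v_step(1) by (simp add: h_def)
    then have "h j * h j \<le> (b - a) / 2 ^ n * h j" using v_step(2) by (intro mult_right_mono) auto
    then have "2 * (h j * h j) \<le> 2 * ((b - a) / 2 ^ n * h j)" by linarith
    then show "2 * (h j)\<^sup>2 \<le> 2 * ((b - a) / 2 ^ n) * h j" by (simp only: power2_eq_square mult.assoc)
  qed
  also have "\<dots> = 2 * ((b - a) / 2 ^ n) * (t - a)" by (simp only: sum_distrib_left[symmetric] sum_h)
  also have "\<dots> \<le> 2 * ((b - a) / 2 ^ n) * (b - a)" using t ab by (intro mult_left_mono) auto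
  also have "\<dots> = 2 * (b - a)\<^sup>2 / 2 ^ n" by (simp add: power2_eq_square)
  finally show "(\<integral>\<omega>. (quad_var (\<lambda>s. W s \<omega>) a b n t - (t - a))\<^sup>2 \<partial>M) \<le> 2 * (b - a)\<^sup>2 / 2 ^ n" .
qed

text \<open>The second moments decay like \<open>1 / 2 ^ n\<close> along dyadic grids. This is
  summable, so the full sequence converges almost surely at each of countably many times.\<close>

lemma AE_quad_var:
  assumes ab: "0 \<le> a" "a \<le> b" "b \<le> T"
  shows "AE \<omega> in completion M. \<forall>t\<in>rational_points a b. (\<lambda>n. quad_var (\<lambda>s. W s \<omega>) a b n t) \<longlonglongrightarrow> t - a"
proof -
  have sub: "rational_points a b \<subseteq> {a..b}"
  proof
    fix t assume "t \<in> rational_points a b"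
    then obtain r l :: nat where t: "t = a + (b - a) * real r / real l" "r \<le> l" by (auto simp: rational_points_def)
    define x where "x = real r / real l"
    have x: "0 \<le> x" "x \<le> 1" using t(2) by (auto simp: x_def divide_le_eq_1)
    have "t = a + (b - a) * x" using t(1) by (simp add: x_def)
    moreover have "0 \<le> (b - a) * x" using ab(2) x by (intro mult_nonneg_nonneg) auto
    moreover have "(b - a) * x \<le> (b - a) * 1" using ab(2) x by (intro mult_left_mono) auto
    ultimately show "t \<in> {a..b}" by simp
  qed
  have "rational_points a b = (\<lambda>(r, l). a + (b - a) * real r / real l) ` {(r, l). r \<le> l}"
    by (auto simp: rational_points_def)
  then have cnt: "countable (rational_points a b)" by (metis countableI_type countable_image)
  have "AE \<omega> in M. (\<lambda>n. quad_var (\<lambda>s. W s \<omega>) a b n t - (t - a)) \<longlonglongrightarrow> 0" if t: "t \<in> rational_points a b" for t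
  proof (rule AE_tendsto_0_summable)
    have t': "t \<in> {a..b}" using sub t by blast
    show "integrable M (\<lambda>\<omega>. (quad_var (\<lambda>s. W s \<omega>) a b n t - (t - a))\<^sup>2)"
      "(\<integral>\<omega>. (quad_var (\<lambda>s. W s \<omega>) a b n t - (t - a))\<^sup>2 \<partial>M) \<le> 2 * (b - a)\<^sup>2 / 2 ^ n" for n
      using quad_var_L2[OF ab t'] by auto
    show "(\<lambda>\<omega>. quad_var (\<lambda>s. W s \<omega>) a b n t - (t - a)) \<in> borel_measurable M" for n
      unfolding quad_var_def
    proof (intro borel_measurable_diff borel_measurable_sum borel_measurable_power borel_measurable_const)
      fix j assume "j \<in> {..<2 ^ n :: nat}"
      then show "W (min (grid a b n (Suc j)) t) \<in> borel_measurable M" "W (min (grid a b n j) t) \<in> borel_measurable M"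
        using min_grid_mem[OF ab(2) t', of "Suc j" n] min_grid_mem[OF ab(2) t', of j n] ab
        by (auto intro!: W_measurable)
    qed
  qed
  then have "AE \<omega> in M. \<forall>t\<in>rational_points a b. (\<lambda>n. quad_var (\<lambda>s. W s \<omega>) a b n t - (t - a)) \<longlonglongrightarrow> 0"
    by (intro AE_ball_countable'[OF _ cnt])
  then have "AE \<omega> in M. \<forall>t\<in>rational_points a b. (\<lambda>n. quad_var (\<lambda>s. W s \<omega>) a b n t) \<longlonglongrightarrow> t - a"
    by eventually_elim (auto simp: LIM_zero_iff)
  then show ?thesis by (rule AE_completion)
qed

text \<open>Since \<open>W 0 = 0\<close> almost surely, each earlier value of \<open>W\<close> is a
  sum of increments along the ordered times. The event is thus, up to a null set, a condition on
  increments before \<open>r\<close>, and these are jointly independent of the last increment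
  \<open>W t - W r\<close>.\<close>

lemma indep_past_event:
  assumes r: "0 \<le> r" "r \<le> t" "t \<le> T"
    and Q: "finite Q" "\<And>u A. (u, A) \<in> Q \<Longrightarrow> u \<in> {0..r} \<and> A \<in> sets borel"
    and E: "E \<in> sets (completion M)" "AE \<omega> in completion M. \<omega> \<in> E \<longleftrightarrow> (\<forall>(u, A)\<in>Q. W u \<omega> \<in> A)"
    and B: "B \<in> sets borel"
  shows "N.prob (E \<inter> ((\<lambda>\<omega>. W t \<omega> - W r \<omega>) -` B \<inter> space M)) =
    N.prob E * N.prob ((\<lambda>\<omega>. W t \<omega> - W r \<omega>) -` B \<inter> space M)"
proof -
  \<comment> \<open>0 is inserted so that increments add up to values of \<open>W\<close>, and
    \<open>r\<close> so that appending \<open>t\<close> creates exactly the increment from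
    \<open>r\<close> to \<open>t\<close>.\<close>
  define us where "us = sorted_list_of_set (insert 0 (insert r (fst ` Q)))"
  have fin: "finite (insert 0 (insert r (fst ` Q)))" using Q(1) by simp
  have us: "set us = insert 0 (insert r (fst ` Q))" "sorted us"
    unfolding us_def by (rule set_sorted_list_of_set[OF fin], rule sorted_sorted_list_of_set)
  have ne: "us \<noteq> []" using us(1) by auto
  define n where "n = length us - 1"
  have len: "length us = Suc n" using ne by (simp add: n_def)
  define p where "p i = (if i \<le> n then us ! i else t)" for i
  have us_mem: "u \<in> {0..r}" if "u \<in> set us" for u using that us(1) Q(2) r(1) by auto
  have p_mem: "p i \<in> {0..r}" if "i \<le> n" for i using us_mem[of "us ! i"] that len by (simp add: p_def)
  have ex: "\<exists>i\<le>n. p i = u" if "u \<in> set us" for u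
    using that len by (auto simp: in_set_conv_nth p_def less_Suc_eq_le)
  have p_mono: "p i \<le> p j" if "i \<le> j" "j \<le> n" for i j
    using that us(2) len by (auto simp: p_def intro: sorted_nth_mono)
  obtain i0 where i0: "i0 \<le> n" "p i0 = 0" using ex[of 0] us(1) by auto
  have p0: "p 0 = 0" using p_mono[of 0 i0] i0 p_mem[of 0] by auto
  obtain i1 where i1: "i1 \<le> n" "p i1 = r" using ex[of r] us(1) by auto
  have pn: "p n = r" using p_mono[of i1 n] i1 p_mem[of n] by auto
  have pS: "p (Suc n) = t" by (simp add: p_def)
  define X where "X i \<omega> = W (p (Suc i)) \<omega> - W (p i) \<omega>" for i \<omega>
  have step: "p i \<le> p (Suc i)" if "i < Suc n" for i
    using that p_mono[of i "Suc i"] pn pS r(2) by (cases "i = n") auto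
  have ind: "indep_vars (\<lambda>_. borel) X {..<Suc n}"
  proof -
    have "\<forall>(n::nat) p. 0 \<le> p 0 \<longrightarrow> (\<forall>i<n. p i \<le> p (Suc i)) \<longrightarrow> p n \<le> T \<longrightarrow>
        indep_vars (\<lambda>_. borel) (\<lambda>i \<omega>. W (p (Suc i)) \<omega> - W (p i) \<omega>) {..<n}"
      using bm unfolding brownian_motion_def by blast
    from this[rule_format, of p "Suc n"] show ?thesis
      using p0 step pS r(3) unfolding X_def by auto
  qed
  have indr: "indep_var (PiM {..<n} (\<lambda>_. borel)) (\<lambda>\<omega>. restrict (\<lambda>i. X i \<omega>) {..<n})
      (PiM {n} (\<lambda>_. borel)) (\<lambda>\<omega>. restrict (\<lambda>i. X i \<omega>) {n})"
    by (rule indep_var_restrict[OF ind]) auto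
  define idx where "idx u = (SOME i. i \<le> n \<and> p i = u)" for u
  have idx: "idx u \<le> n" "p (idx u) = u" if "u \<in> set us" for u
    using someI_ex[of "\<lambda>i. i \<le> n \<and> p i = u"] ex[OF that] by (auto simp: idx_def)
  have Qus: "u \<in> set us" if "(u, A) \<in> Q" for u A using that us(1) by (auto intro: image_eqI[of _ fst "(u, A)"])
  \<comment> \<open>The conditions on \<open>W u\<close>, rewritten for the vector of increments:
    \<open>idx u\<close> increments lead from time 0 to time \<open>u\<close>.\<close>
  define C where "C = {x \<in> space (PiM {..<n} (\<lambda>_. borel :: real measure)). \<forall>q\<in>Q. (\<Sum>i<idx (fst q). x i) \<in> snd q}"
  have C: "C \<in> sets (PiM {..<n} (\<lambda>_. borel :: real measure))"
    unfolding C_def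
  proof (rule sets.sets_Collect_finite_All[OF _ Q(1)])
    show "{x \<in> space (PiM {..<n} (\<lambda>_. borel :: real measure)). (\<Sum>i<idx (fst q). x i) \<in> snd q}
      \<in> sets (PiM {..<n} (\<lambda>_. borel))" if "q \<in> Q" for q
    proof -
      obtain u A where q: "q = (u, A)" by (cases q)
      have "idx u \<le> n" using idx(1)[OF Qus] that q by auto
      then have [measurable]: "(\<lambda>x. \<Sum>i<idx u. x i) \<in> borel_measurable (PiM {..<n} (\<lambda>_. borel :: real measure))"
        by (intro borel_measurable_sum measurable_component_singleton) auto
      have [measurable]: "A \<in> sets borel" using Q(2) that q by auto
      show ?thesis unfolding q by simp
    qed
  qed
  define D where "D = {x \<in> space (PiM {n} (\<lambda>_. borel :: real measure)). x n \<in> B}"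
  have D: "D \<in> sets (PiM {n} (\<lambda>_. borel :: real measure))"
  proof -
    have [measurable]: "(\<lambda>x. x n) \<in> borel_measurable (PiM {n} (\<lambda>_. borel :: real measure))"
      by (rule measurable_component_singleton) simp
    note B[measurable]
    show ?thesis unfolding D_def by simp
  qed
  let ?E = "(\<lambda>\<omega>. restrict (\<lambda>i. X i \<omega>) {..<n}) -` C \<inter> space M"
  let ?D = "(\<lambda>\<omega>. W t \<omega> - W r \<omega>) -` B \<inter> space M"
  have Deq: "(\<lambda>\<omega>. restrict (\<lambda>i. X i \<omega>) {n}) -` D \<inter> space M = ?D"
    using pn pS by (auto simp: D_def space_PiM X_def)
  have Emeas: "?E \<in> sets M" and Dmeas: "?D \<in> sets M"
    using measurable_sets[OF indep_var_rv1[OF indr] C] measurable_sets[OF indep_var_rv2[OF indr] D] Deq by auto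
  have mult: "prob (?E \<inter> ?D) = prob ?E * prob ?D"
  proof -
    have "(\<lambda>\<omega>. (restrict (\<lambda>i. X i \<omega>) {..<n}, restrict (\<lambda>i. X i \<omega>) {n})) -` (C \<times> D) \<inter> space M = ?E \<inter> ?D"
      using Deq by blast
    then show ?thesis using indep_varD[OF indr C D] Deq by simp
  qed
  have ae: "AE \<omega> in completion M. \<omega> \<in> E \<longleftrightarrow> \<omega> \<in> ?E"
    using E(2) AE_W_0 AE_space
  proof eventually_elim
    case (elim \<omega>)
    have "(\<Sum>i<idx u. X i \<omega>) = W u \<omega>" if "(u, A) \<in> Q" for u A
      using sum_lessThan_telescope[of "\<lambda>i. W (p i) \<omega>" "idx u"] idx(2)[OF Qus[OF that]] elim(2) p0
      by (simp add: X_def)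
    moreover have "(\<Sum>i<idx u. restrict (\<lambda>i. X i \<omega>) {..<n} i) = (\<Sum>i<idx u. X i \<omega>)" if "(u, A) \<in> Q" for u A
      using idx(1)[OF Qus[OF that]] by (intro sum.cong) auto
    ultimately have "(\<forall>q\<in>Q. (\<Sum>i<idx (fst q). restrict (\<lambda>i. X i \<omega>) {..<n} i) \<in> snd q) \<longleftrightarrow> (\<forall>(u, A)\<in>Q. W u \<omega> \<in> A)"
      by (force simp: case_prod_beta')
    then show ?case using elim(1,3) by (auto simp: C_def space_PiM)
  qed
  have "N.prob E = N.prob ?E"
    by (rule measure_eq_AE[OF ae E(1)]) (use Emeas in auto)
  moreover have "N.prob (E \<inter> ?D) = N.prob (?E \<inter> ?D)"
    by (rule measure_eq_AE) (use ae Emeas Dmeas E(1) in auto)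
  moreover have "?E \<inter> ?D \<in> sets M" using Emeas Dmeas by blast
  ultimately show ?thesis using mult Emeas Dmeas by simp
qed

text \<open>A \<pi>-system argument. The class \<A> of events almost surely equal to finitely many
  conditions on \<open>W\<close> before \<open>r\<close> is stable under intersection and contains
  the generators of the augmented \<sigma>-algebra, null sets included. Independence of \<A> from
  the increment extends to the generated \<sigma>-algebras.\<close>

lemma indep_past:
  assumes sr: "0 \<le> s" "s < r" "r \<le> t" "t \<le> T" and Y: "Y \<in> borel_measurable (F s)"
  shows "N.indep_var borel Y borel (\<lambda>\<omega>. W t \<omega> - W r \<omega>)"
proof -
  let ?D = "\<lambda>\<omega>. W t \<omega> - W r \<omega>"
  define \<A> where "\<A> = {E \<in> sets (completion M). \<exists>Q. finite Q \<and> (\<forall>u A. (u, A) \<in> Q \<longrightarrow> u \<in> {0..r} \<and> A \<in> sets borel) \<and>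
    (AE \<omega> in completion M. \<omega> \<in> E \<longleftrightarrow> (\<forall>(u, A)\<in>Q. W u \<omega> \<in> A))}"
  define \<B> where "\<B> = {?D -` B \<inter> space M | B. B \<in> sets borel}"
  have Dm: "?D \<in> borel_measurable M" using sr by (intro borel_measurable_diff W_measurable) auto
  have B_sets: "?D -` B \<inter> space M \<in> sets M" if "B \<in> sets borel" for B
    using measurable_sets[OF Dm that] .
  have "N.indep_set \<A> \<B>"
  proof (rule N.indep_setI)
    show "N.prob (a \<inter> b) = N.prob a * N.prob b" if "a \<in> \<A>" "b \<in> \<B>" for a b
      using that sr unfolding \<A>_def \<B>_def by (auto intro!: indep_past_event)
  qed (use B_sets in \<open>auto simp: \<A>_def \<B>_def\<close>)
  moreover have "Int_stable \<A>"
  proof (rule Int_stableI)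
    fix a b assume "a \<in> \<A>" "b \<in> \<A>"
    then obtain Q Q' where Q: "a \<in> sets (completion M)" "b \<in> sets (completion M)" "finite Q" "finite Q'"
      "\<forall>u A. (u, A) \<in> Q \<longrightarrow> u \<in> {0..r} \<and> A \<in> sets borel" "\<forall>u A. (u, A) \<in> Q' \<longrightarrow> u \<in> {0..r} \<and> A \<in> sets borel"
      "AE \<omega> in completion M. \<omega> \<in> a \<longleftrightarrow> (\<forall>(u, A)\<in>Q. W u \<omega> \<in> A)"
      "AE \<omega> in completion M. \<omega> \<in> b \<longleftrightarrow> (\<forall>(u, A)\<in>Q'. W u \<omega> \<in> A)"
      unfolding \<A>_def by blast
    have "AE \<omega> in completion M. \<omega> \<in> a \<inter> b \<longleftrightarrow> (\<forall>(u, A)\<in>Q \<union> Q'. W u \<omega> \<in> A)"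
      using Q(7,8) by eventually_elim auto
    then show "a \<inter> b \<in> \<A>" using Q unfolding \<A>_def by (auto intro!: exI[of _ "Q \<union> Q'"])
  qed
  moreover have "Int_stable \<B>"
  proof (rule Int_stableI)
    fix a b assume "a \<in> \<B>" "b \<in> \<B>"
    then obtain A B where "a = ?D -` A \<inter> space M" "b = ?D -` B \<inter> space M" "A \<in> sets borel" "B \<in> sets borel"
      by (auto simp: \<B>_def)
    then show "a \<inter> b \<in> \<B>" unfolding \<B>_def by (intro CollectI exI[of _ "A \<inter> B"]) auto
  qed
  ultimately have ind: "N.indep_set (sigma_sets (space M) \<A>) (sigma_sets (space M) \<B>)"
    using N.indep_set_sigma_sets by simp
  have gen: "path_generators M W r \<subseteq> \<A>"
  proof
    fix E assume "E \<in> path_generators M W r"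
    then consider u A where "E = W u -` A \<inter> space M" "u \<in> {0..r}" "A \<in> sets borel"
      | "E \<in> null_sets (completion M)"
      by (auto simp: path_generators_def)
    then show "E \<in> \<A>"
    proof cases
      case 1
      then have "E \<in> sets (completion M)" using sr measurable_sets[OF W_measurable, of u A] by auto
      moreover have "AE \<omega> in completion M. \<omega> \<in> E \<longleftrightarrow> (\<forall>(u, A)\<in>{(u, A)}. W u \<omega> \<in> A)"
        using 1 by (intro AE_I2) auto
      ultimately show ?thesis using 1 unfolding \<A>_def by (auto intro!: exI[of _ "{(u, A)}"])
    next
      case 2
      \<comment> \<open>A null set is almost surely the impossible event that \<open>W 0\<close>
        lies in the empty set, so it fits the format of \<A>.\<close>
      have "AE \<omega> in completion M. \<omega> \<in> E \<longleftrightarrow> (\<forall>(u, A)\<in>{(0, {})}. W u \<omega> \<in> A)"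
        using AE_not_in[OF 2] by eventually_elim auto
      then show ?thesis using 2 sr unfolding \<A>_def by (auto intro!: exI[of _ "{(0, {})}"])
    qed
  qed
  have YF: "Y -` A \<inter> space M \<in> sigma_sets (space M) \<A>" if "A \<in> sets borel" for A
  proof -
    have "Y -` A \<inter> space M \<in> sets (F s)" using measurable_sets[OF Y that] by simp
    then have "Y -` A \<inter> space M \<in> sigma_sets (space M) (path_generators M W r)"
      by (rule canonical_filtration_sigma_sets) (use sr in auto)
    then show ?thesis using sigma_sets_mono'[OF gen] by blast
  qed
  have AN: "\<A> \<subseteq> sets (completion M)" "\<B> \<subseteq> sets (completion M)" using B_sets by (auto simp: \<A>_def \<B>_def)
  show ?thesis
    unfolding N.indep_var_eq
  proof (intro conjI)
    show "N.random_variable borel Y" by (rule F_measurable_completion[OF Y])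
    show "N.random_variable borel ?D" using Dm by (rule measurable_completion)
    have sA: "sigma_sets (space M) {Y -` A \<inter> space M |A. A \<in> sets borel} \<subseteq> sigma_sets (space M) \<A>"
      using YF by (intro sigma_sets_mono) auto
    show "N.indep_set (sigma_sets (space (completion M)) {Y -` A \<inter> space (completion M) |A. A \<in> sets borel})
      (sigma_sets (space (completion M)) {?D -` A \<inter> space (completion M) |A. A \<in> sets borel})"
      unfolding space_completion \<B>_def[symmetric]
    proof (rule N.indep_setI)
      show "sigma_sets (space M) {Y -` A \<inter> space M |A. A \<in> sets borel} \<subseteq> N.events"
        using sA sets.sigma_sets_subset[OF AN(1)] by simp
      show "sigma_sets (space M) \<B> \<subseteq> N.events" using sets.sigma_sets_subset[OF AN(2)] by simp
      show "N.prob (a \<inter> b) = N.prob a * N.prob b"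
        if "a \<in> sigma_sets (space M) {Y -` A \<inter> space M |A. A \<in> sets borel}" "b \<in> sigma_sets (space M) \<B>" for a b
        using N.indep_setD[OF ind, of a b] sA that by blast
    qed
  qed
qed

lemma increment_moments_completion:
  assumes "0 \<le> s" "s \<le> t" "t \<le> T"
  shows "integrable (completion M) (\<lambda>\<omega>. W t \<omega> - W s \<omega>)" "(\<integral>\<omega>. W t \<omega> - W s \<omega> \<partial>completion M) = 0"
    "integrable (completion M) (\<lambda>\<omega>. (W t \<omega> - W s \<omega>)\<^sup>2)" "(\<integral>\<omega>. (W t \<omega> - W s \<omega>)\<^sup>2 \<partial>completion M) = t - s"
proof -
  have [measurable]: "W t \<in> borel_measurable M" "W s \<in> borel_measurable M"
    using assms by (auto intro!: W_measurable)
  show "integrable (completion M) (\<lambda>\<omega>. W t \<omega> - W s \<omega>)" "(\<integral>\<omega>. W t \<omega> - W s \<omega> \<partial>completion M) = 0"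
    "integrable (completion M) (\<lambda>\<omega>. (W t \<omega> - W s \<omega>)\<^sup>2)" "(\<integral>\<omega>. (W t \<omega> - W s \<omega>)\<^sup>2 \<partial>completion M) = t - s"
    using increment_moments(1-4)[OF assms] by (simp_all add: integrable_completion integral_completion)
qed

lemma integrable_product_L2:
  fixes Y D :: "'b \<Rightarrow> real"
  assumes "Y \<in> borel_measurable Q" "D \<in> borel_measurable Q"
    "integrable Q (\<lambda>\<omega>. (Y \<omega>)\<^sup>2)" "integrable Q (\<lambda>\<omega>. (D \<omega>)\<^sup>2)"
  shows "integrable Q (\<lambda>\<omega>. Y \<omega> * D \<omega>)"
proof (rule Bochner_Integration.integrable_bound)
  show "integrable Q (\<lambda>\<omega>. (Y \<omega>)\<^sup>2 + (D \<omega>)\<^sup>2)" using assms by auto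
  have "\<bar>y * d\<bar> \<le> y\<^sup>2 + d\<^sup>2" for y d :: real
  proof -
    have "2 * \<bar>y * d\<bar> \<le> y\<^sup>2 + d\<^sup>2"
      using zero_le_power2[of "\<bar>y\<bar> - \<bar>d\<bar>"] by (simp add: power2_diff abs_mult)
    then show ?thesis using abs_ge_zero[of "y * d"] by linarith
  qed
  then show "AE \<omega> in Q. norm (Y \<omega> * D \<omega>) \<le> norm ((Y \<omega>)\<^sup>2 + (D \<omega>)\<^sup>2)" by simp
qed (use assms in measurable)

text \<open>Right-continuity of the filtration only gives independence of \<open>F s\<close> from increments after
  some \<open>r > s\<close>; the increment over \<open>{s..r}\<close> is absorbed in the limit \<open>r \<rightarrow> s\<close>.\<close>

lemma expectation_past_times_increment:
  assumes st: "0 \<le> s" "s \<le> t" "t \<le> T" and Y: "Y \<in> borel_measurable (F s)"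
    and Y2: "integrable (completion M) (\<lambda>\<omega>. (Y \<omega>)\<^sup>2)"
  shows "integrable (completion M) (\<lambda>\<omega>. Y \<omega> * (W t \<omega> - W s \<omega>))"
    "(\<integral>\<omega>. Y \<omega> * (W t \<omega> - W s \<omega>) \<partial>completion M) = 0"
proof -
  have Ym: "Y \<in> borel_measurable (completion M)" by (rule F_measurable_completion[OF Y])
  have Wm: "W u \<in> borel_measurable (completion M)" if "u \<in> {0..T}" for u
    using W_measurable[OF that] by (rule measurable_completion)
  have prod_int: "integrable (completion M) (\<lambda>\<omega>. Y \<omega> * (W v \<omega> - W u \<omega>))" if "0 \<le> u" "u \<le> v" "v \<le> T" for u v
    by (rule integrable_product_L2) (use that Ym Y2 Wm increment_moments_completion[OF that] in auto)
  show "integrable (completion M) (\<lambda>\<omega>. Y \<omega> * (W t \<omega> - W s \<omega>))" by (rule prod_int[OF st])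
  define e where "e = \<bar>\<integral>\<omega>. Y \<omega> * (W t \<omega> - W s \<omega>) \<partial>completion M\<bar>"
  define c where "c = (\<integral>\<omega>. (Y \<omega>)\<^sup>2 \<partial>completion M) + 1"
  have c: "c \<ge> 1" unfolding c_def by (simp add: integral_nonneg_AE)
  have Y1: "integrable (completion M) Y"
    using integrable_product_L2[OF Ym borel_measurable_const Y2, of 1] by simp
  \<comment> \<open>With \<open>r = s + d\<^sup>2\<close> and weights \<open>d\<close> and
    \<open>1 / d\<close> in Young's inequality, the piece from \<open>s\<close> to \<open>r\<close>
    costs d E[Y^2] + (r - s) / d, which is \<open>c * d\<close>.\<close>
  have bound: "e \<le> c * d" if d: "0 < d" "s + d\<^sup>2 \<le> t" for d
  proof -
    define r where "r = s + d\<^sup>2"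
    have r: "s < r" "r \<le> t" "0 \<le> r" "r \<le> T" using d st by (auto simp: r_def)
    have "(\<integral>\<omega>. Y \<omega> * (W t \<omega> - W r \<omega>) \<partial>completion M) = 0"
      using N.indep_var_lebesgue_integral[OF indep_past[OF st(1) r(1,2) st(3) Y] Y1]
        increment_moments_completion[OF r(3,2) st(3)] by simp
    moreover have "(\<integral>\<omega>. Y \<omega> * (W t \<omega> - W s \<omega>) \<partial>completion M) =
      (\<integral>\<omega>. Y \<omega> * (W t \<omega> - W r \<omega>) + Y \<omega> * (W r \<omega> - W s \<omega>) \<partial>completion M)"
      by (simp add: algebra_simps)
    ultimately have "e = \<bar>\<integral>\<omega>. Y \<omega> * (W r \<omega> - W s \<omega>) \<partial>completion M\<bar>"
      using prod_int[of r t] prod_int[of s r] r st by (simp add: e_def)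
    also have "\<dots> \<le> (\<integral>\<omega>. \<bar>Y \<omega> * (W r \<omega> - W s \<omega>)\<bar> \<partial>completion M)"
      using integral_norm_bound[of "completion M" "\<lambda>\<omega>. Y \<omega> * (W r \<omega> - W s \<omega>)"] by simp
    also have "\<dots> \<le> (\<integral>\<omega>. d * (Y \<omega>)\<^sup>2 + (1 / d) * (W r \<omega> - W s \<omega>)\<^sup>2 \<partial>completion M)"
    proof (rule integral_mono)
      fix \<omega>
      have "\<bar>y * x\<bar> \<le> d * y\<^sup>2 + (1 / d) * x\<^sup>2" for x y :: real
      proof -
        have "0 \<le> (d * \<bar>y\<bar> - \<bar>x\<bar>)\<^sup>2 / d" using d by simp
        also have "\<dots> = d * y\<^sup>2 + (1 / d) * x\<^sup>2 - 2 * \<bar>y * x\<bar>"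
          using d by (simp add: power2_diff abs_mult field_simps power2_eq_square)
        finally show ?thesis using abs_ge_zero[of "y * x"] by linarith
      qed
      then show "\<bar>Y \<omega> * (W r \<omega> - W s \<omega>)\<bar> \<le> d * (Y \<omega>)\<^sup>2 + (1 / d) * (W r \<omega> - W s \<omega>)\<^sup>2" .
    qed (use prod_int[of s r] r st Y2 increment_moments_completion(3)[of s r] in auto)
    also have "\<dots> = d * (c - 1) + (1 / d) * (r - s)"
      using Y2 increment_moments_completion[of s r] r st by (simp add: c_def)
    also have "\<dots> = c * d" using d by (simp add: r_def power2_eq_square algebra_simps)
    finally show ?thesis .
  qed
  have "e \<le> 0"
  proof (rule ccontr)
    assume "\<not> e \<le> 0"
    then have e: "e > 0" by simp
    have "s \<noteq> t"
    proof
      assume "s = t" then have "e = 0" by (simp add: e_def)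
      then show False using e by simp
    qed
    then have "s < t" using st by simp
    \<comment> \<open>The first entry keeps \<open>s + d\<^sup>2 \<le> t\<close>, the second makes
      \<open>c * d\<close> at most \<open>e / 2\<close>.\<close>
    define d where "d = min (sqrt (t - s)) (e / (2 * c))"
    have d: "0 < d" "d \<le> sqrt (t - s)" "d \<le> e / (2 * c)" using e c \<open>s < t\<close> by (auto simp: d_def)
    have "d\<^sup>2 \<le> (sqrt (t - s))\<^sup>2" using d by (intro power_mono) auto
    then have "e \<le> c * d" using d \<open>s < t\<close> by (intro bound) auto
    also have "\<dots> \<le> c * (e / (2 * c))" using d c by (intro mult_left_mono) auto
    also have "\<dots> = e / 2" using c by simp
    finally show False using e by simp
  qed
  then show "(\<integral>\<omega>. Y \<omega> * (W t \<omega> - W s \<omega>) \<partial>completion M) = 0" by (simp add: e_def)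
qed

end

section \<open>Integrals of simple processes\<close>

text \<open>A bound in L2 gives uniform integrability, here by hand. Fatou bounds the second moment
  of \<open>Y\<close> by \<open>C\<close>. The part of |X - Y| up to \<open>K\<close> vanishes by
  dominated convergence, and the part above \<open>K\<close> is at most (X - Y)^2 / K \<le> (2 X^2 +
  2 Y^2) / K, of mean at most \<open>4 * C / K\<close>.\<close>

lemma (in prob_space) L2_bounded_limit:
  fixes X :: "nat \<Rightarrow> 'a \<Rightarrow> real"
  assumes meas: "\<And>n. X n \<in> borel_measurable M" "Y \<in> borel_measurable M"
    and int: "\<And>n. integrable M (\<lambda>\<omega>. (X n \<omega>)\<^sup>2)" and le: "\<And>n. (\<integral>\<omega>. (X n \<omega>)\<^sup>2 \<partial>M) \<le> C"
    and zero: "\<And>n. (\<integral>\<omega>. X n \<omega> \<partial>M) = 0"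
    and lim: "AE \<omega> in M. (\<lambda>n. X n \<omega>) \<longlonglongrightarrow> Y \<omega>"
  shows "integrable M Y" "(\<integral>\<omega>. Y \<omega> \<partial>M) = 0"
proof -
  note [measurable] = meas
  have C: "0 \<le> C" by (rule order_trans[OF _ le[of 0]]) (intro integral_nonneg_AE, simp)
  have "(\<integral>\<^sup>+ \<omega>. ennreal ((Y \<omega>)\<^sup>2) \<partial>M) = (\<integral>\<^sup>+ \<omega>. liminf (\<lambda>n. ennreal ((X n \<omega>)\<^sup>2)) \<partial>M)"
  proof (rule nn_integral_cong_AE)
    show "AE \<omega> in M. ennreal ((Y \<omega>)\<^sup>2) = liminf (\<lambda>n. ennreal ((X n \<omega>)\<^sup>2))"
      using lim
    proof eventually_elim
      case (elim \<omega>)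
      have "(\<lambda>n. ennreal ((X n \<omega>)\<^sup>2)) \<longlonglongrightarrow> ennreal ((Y \<omega>)\<^sup>2)"
        by (intro tendsto_ennrealI tendsto_power elim)
      then show ?case by (rule lim_imp_Liminf[OF sequentially_bot, symmetric])
    qed
  qed
  also have "\<dots> \<le> liminf (\<lambda>n. \<integral>\<^sup>+ \<omega>. ennreal ((X n \<omega>)\<^sup>2) \<partial>M)"
    by (intro nn_integral_liminf) measurable
  also have "\<dots> \<le> ennreal C"
  proof (rule Liminf_le)
    show "\<forall>\<^sub>F n in sequentially. (\<integral>\<^sup>+ \<omega>. ennreal ((X n \<omega>)\<^sup>2) \<partial>M) \<le> ennreal C"
      using int le by (intro always_eventually allI) (simp add: nn_integral_eq_integral ennreal_leI)
  qed simp
  finally have nnY: "(\<integral>\<^sup>+ \<omega>. ennreal ((Y \<omega>)\<^sup>2) \<partial>M) \<le> ennreal C" .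
  then have Y2: "integrable M (\<lambda>\<omega>. (Y \<omega>)\<^sup>2)"
    by (intro integrableI_bounded) (auto simp: le_less_trans)
  have YC: "(\<integral>\<omega>. (Y \<omega>)\<^sup>2 \<partial>M) \<le> C"
    using nnY C Y2 by (simp add: nn_integral_eq_integral ennreal_le_iff)
  have L1: "integrable M f" if "integrable M (\<lambda>\<omega>. (f \<omega>)\<^sup>2)" "f \<in> borel_measurable M" for f :: "'a \<Rightarrow> real"
    using square_integrable_imp_integrable[OF that(2,1)] .
  have X1: "integrable M (X n)" for n by (rule L1[OF int meas(1)])
  show Y1: "integrable M Y" by (rule L1[OF Y2 meas(2)])
  have bound: "\<bar>\<integral>\<omega>. Y \<omega> \<partial>M\<bar> \<le> 4 * C / K" if K: "K > 0" for K
  proof -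
    have "(\<lambda>n. \<integral>\<omega>. min \<bar>X n \<omega> - Y \<omega>\<bar> K \<partial>M) \<longlonglongrightarrow> (\<integral>\<omega>. 0 \<partial>M)"
    proof (rule integral_dominated_convergence[where w = "\<lambda>_. K"])
      show "AE \<omega> in M. (\<lambda>n. min \<bar>X n \<omega> - Y \<omega>\<bar> K) \<longlonglongrightarrow> 0"
        using lim
      proof eventually_elim
        case (elim \<omega>)
        have "(\<lambda>n. min \<bar>X n \<omega> - Y \<omega>\<bar> K) \<longlonglongrightarrow> min \<bar>Y \<omega> - Y \<omega>\<bar> K"
          by (intro tendsto_intros elim)
        then show ?case using K by simp
      qed
      show "AE \<omega> in M. norm (min \<bar>X n \<omega> - Y \<omega>\<bar> K) \<le> K" for n
        using K by (auto intro!: AE_I2)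
    qed (use K in measurable)
    then have "(\<lambda>n. (\<integral>\<omega>. min \<bar>X n \<omega> - Y \<omega>\<bar> K \<partial>M) + 4 * C / K) \<longlonglongrightarrow> 0 + 4 * C / K"
      by (intro tendsto_add tendsto_const) simp
    moreover have "\<bar>\<integral>\<omega>. Y \<omega> \<partial>M\<bar> \<le> (\<integral>\<omega>. min \<bar>X n \<omega> - Y \<omega>\<bar> K \<partial>M) + 4 * C / K" for n
    proof -
      have m1: "integrable M (\<lambda>\<omega>. min \<bar>X n \<omega> - Y \<omega>\<bar> K)"
        by (rule integrable_const_bound[where B = K]) (use K in \<open>auto intro!: AE_I2\<close>)
      have m2: "integrable M (\<lambda>\<omega>. (2 * (X n \<omega>)\<^sup>2 + 2 * (Y \<omega>)\<^sup>2) / K)"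
        using int[of n] Y2 by auto
      have "(\<integral>\<omega>. Y \<omega> \<partial>M) = - (\<integral>\<omega>. X n \<omega> - Y \<omega> \<partial>M)" using X1 Y1 zero by simp
      then have "\<bar>\<integral>\<omega>. Y \<omega> \<partial>M\<bar> \<le> (\<integral>\<omega>. \<bar>X n \<omega> - Y \<omega>\<bar> \<partial>M)"
        using integral_norm_bound[of M "\<lambda>\<omega>. X n \<omega> - Y \<omega>"] by simp
      also have "\<dots> \<le> (\<integral>\<omega>. min \<bar>X n \<omega> - Y \<omega>\<bar> K + (2 * (X n \<omega>)\<^sup>2 + 2 * (Y \<omega>)\<^sup>2) / K \<partial>M)"
      proof (rule integral_mono)
        fix \<omega>
        have "\<bar>x - y\<bar> \<le> min \<bar>x - y\<bar> K + (2 * x\<^sup>2 + 2 * y\<^sup>2) / K" for x y :: real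
        proof (cases "\<bar>x - y\<bar> \<le> K")
          case False
          then have "K * \<bar>x - y\<bar> \<le> \<bar>x - y\<bar> * \<bar>x - y\<bar>" using K by (intro mult_right_mono) auto
          also have "\<dots> \<le> 2 * x\<^sup>2 + 2 * y\<^sup>2"
            using zero_le_power2[of "x + y"] by (simp add: power2_eq_square algebra_simps)
          finally have "\<bar>x - y\<bar> \<le> (2 * x\<^sup>2 + 2 * y\<^sup>2) / K" using K by (simp add: pos_le_divide_eq mult.commute)
          then show ?thesis using K by (simp add: min_def)
        qed (use K in simp)
        then show "\<bar>X n \<omega> - Y \<omega>\<bar> \<le> min \<bar>X n \<omega> - Y \<omega>\<bar> K + (2 * (X n \<omega>)\<^sup>2 + 2 * (Y \<omega>)\<^sup>2) / K" .
      qed (use m1 m2 X1 Y1 in auto)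
      also have "\<dots> = (\<integral>\<omega>. min \<bar>X n \<omega> - Y \<omega>\<bar> K \<partial>M) + (\<integral>\<omega>. (2 * (X n \<omega>)\<^sup>2 + 2 * (Y \<omega>)\<^sup>2) / K \<partial>M)"
        using m1 m2 by (rule Bochner_Integration.integral_add)
      also have "(\<integral>\<omega>. (2 * (X n \<omega>)\<^sup>2 + 2 * (Y \<omega>)\<^sup>2) / K \<partial>M)
        = (2 * (\<integral>\<omega>. (X n \<omega>)\<^sup>2 \<partial>M) + 2 * (\<integral>\<omega>. (Y \<omega>)\<^sup>2 \<partial>M)) / K"
        using int[of n] Y2 by simp
      also have "\<dots> \<le> 4 * C / K" using le[of n] YC K by (intro divide_right_mono) auto
      finally show ?thesis by simp
    qed
    ultimately show ?thesis using LIMSEQ_le_const by fastforce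
  qed
  show "(\<integral>\<omega>. Y \<omega> \<partial>M) = 0"
  proof (rule ccontr)
    assume ne: "(\<integral>\<omega>. Y \<omega> \<partial>M) \<noteq> 0"
    define y where "y = \<bar>\<integral>\<omega>. Y \<omega> \<partial>M\<bar>"
    have y: "y > 0" using ne by (simp add: y_def)
    \<comment> \<open>This \<open>K\<close> turns the bound into y \<le> y * 4 C / (4 C + 1), which
      is below \<open>y\<close>.\<close>
    have "y \<le> 4 * C / ((4 * C + 1) / y)" unfolding y_def by (rule bound) (use C y in \<open>auto simp: y_def\<close>)
    also have "\<dots> = y * (4 * C / (4 * C + 1))" by simp
    also have "\<dots> < y * 1" using y C by (intro mult_strict_left_mono) (auto simp: divide_less_eq)
    finally show False by simp
  qed
qed

context bm_setting
begin

text \<open>The inequality half of the Ito isometry, by induction over the cells: the integral up to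
  \<open>p m\<close> times the coefficient is known at time \<open>p m\<close>, so its product with
  the next increment has mean 0 by \<open>expectation_past_times_increment\<close>.\<close>

lemma simple_integral_L2:
  assumes \<Phi>: "is_simple_process F T (k, p, \<xi>)" and t: "t \<in> {0..T}"
    and C: "\<And>i \<omega>. i < k \<Longrightarrow> \<omega> \<in> space M \<Longrightarrow> \<bar>\<xi> i \<omega>\<bar> \<le> C" "0 \<le> C"
  shows "integrable (completion M) (\<lambda>\<omega>. (simple_integral_W W (k, p, \<xi>) t \<omega>)\<^sup>2)"
    "(\<integral>\<omega>. (simple_integral_W W (k, p, \<xi>) t \<omega>)\<^sup>2 \<partial>completion M) \<le> C\<^sup>2 * T"
    "(\<integral>\<omega>. simple_integral_W W (k, p, \<xi>) t \<omega> \<partial>completion M) = 0"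
proof -
  define I where "I m \<omega> = step_int m p (\<lambda>i. \<xi> i \<omega>) (\<lambda>s. W s \<omega>) t" for m \<omega>
  have pT: "p i \<in> {0..T}" if "i \<le> k" for i using simple_points(2)[OF \<Phi> that] .
  have p_mono: "p i \<le> p j" if "i \<le> j" "j \<le> k" for i j using simple_points(1)[OF \<Phi> that] .
  have meas: "I m \<in> borel_measurable (F (p m))" if "m \<le> k" for m
    unfolding I_def[abs_def] step_int_def
  proof (intro borel_measurable_sum borel_measurable_times borel_measurable_diff)
    fix i assume "i \<in> {..<m}"
    then have i: "i < k" "p i \<le> p m" "p (Suc i) \<le> p m" "p i \<in> {0..T}" "p (Suc i) \<in> {0..T}"
      using that by (auto intro!: p_mono pT simp del: atLeastAtMost_iff)
    show "\<xi> i \<in> borel_measurable (F (p m))"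
      using simple_process_measurable(1)[OF \<Phi> i(1)] i(2) by (rule canonical_filtration_measurable_mono)
    show "W (min (p (Suc i)) t) \<in> borel_measurable (F (p m))" "W (min (p i) t) \<in> borel_measurable (F (p m))"
      using i t by (auto intro!: W_F_measurable)
  qed
  have main: "integrable (completion M) (\<lambda>\<omega>. (I m \<omega>)\<^sup>2) \<and> (\<integral>\<omega>. (I m \<omega>)\<^sup>2 \<partial>completion M) \<le> C\<^sup>2 * min (p m) t
     \<and> (\<integral>\<omega>. I m \<omega> \<partial>completion M) = 0" if "m \<le> k" for m
    using that
  proof (induction m)
    case 0
    then show ?case using pT[of 0] t by (simp add: I_def step_int_def)
  next
    case (Suc m)
    then have m: "m < k" and IH: "integrable (completion M) (\<lambda>\<omega>. (I m \<omega>)\<^sup>2)"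
      "(\<integral>\<omega>. (I m \<omega>)\<^sup>2 \<partial>completion M) \<le> C\<^sup>2 * min (p m) t" "(\<integral>\<omega>. I m \<omega> \<partial>completion M) = 0" by auto
    show ?case
    \<comment> \<open>In this case cell \<open>m\<close> starts after \<open>t\<close> and both the
      integral and the bound stand still.\<close>
    proof (cases "t \<le> p m")
      case True
      then have "min (p (Suc m)) t = t" "min (p m) t = t" using p_mono[of m "Suc m"] m by auto
      then have "I (Suc m) = I m" by (simp add: I_def fun_eq_iff step_int_def)
      then show ?thesis using IH \<open>min (p (Suc m)) t = t\<close> \<open>min (p m) t = t\<close> by simp
    next
      case False
      define s where "s = p m"
      define v where "v = min (p (Suc m)) t"
      define d where "d \<omega> = W v \<omega> - W s \<omega>" for \<omega>
      have sv: "0 \<le> s" "s \<le> v" "v \<le> T" "min (p m) t = s"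
        using False p_mono[of m "Suc m"] pT[of m] m t by (auto simp: s_def v_def)
      have step: "I (Suc m) \<omega> = I m \<omega> + \<xi> m \<omega> * d \<omega>" for \<omega>
        using sv(4) by (simp add: I_def step_int_def d_def v_def)
      have \<xi>F: "\<xi> m \<in> borel_measurable (F s)" unfolding s_def by (rule simple_process_measurable(1)[OF \<Phi> m])
      have IF: "I m \<in> borel_measurable (F s)" unfolding s_def using meas m by simp
      note [measurable] = F_measurable_completion[OF \<xi>F] F_measurable_completion[OF IF]
      have dm [measurable]: "d \<in> borel_measurable (completion M)"
        unfolding d_def[abs_def] using sv by (intro borel_measurable_diff measurable_completion W_measurable) auto
      have \<xi>2: "(\<xi> m \<omega>)\<^sup>2 \<le> C\<^sup>2" if "\<omega> \<in> space M" for \<omega>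
        using power_mono[OF C(1)[OF m that], of 2] by simp
      have i1: "integrable (completion M) (\<lambda>\<omega>. (\<xi> m \<omega>)\<^sup>2)"
        by (rule N.integrable_const_bound[where B = "C\<^sup>2"]) (use \<xi>2 in \<open>auto intro!: AE_I2\<close>)
      have i2: "integrable (completion M) (\<lambda>\<omega>. (I m \<omega> * \<xi> m \<omega>)\<^sup>2)"
      proof (rule Bochner_Integration.integrable_bound)
        show "integrable (completion M) (\<lambda>\<omega>. C\<^sup>2 * (I m \<omega>)\<^sup>2)" using IH(1) by simp
        show "AE \<omega> in completion M. norm ((I m \<omega> * \<xi> m \<omega>)\<^sup>2) \<le> norm (C\<^sup>2 * (I m \<omega>)\<^sup>2)"
          using \<xi>2 by (intro AE_I2) (auto simp: power_mult_distrib mult.commute[of "C\<^sup>2"] intro!: mult_left_mono)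
      qed measurable
      have IxF: "(\<lambda>\<omega>. I m \<omega> * \<xi> m \<omega>) \<in> borel_measurable (F s)" using IF \<xi>F by simp
      note e1 = expectation_past_times_increment[OF sv(1-3) \<xi>F i1, folded d_def]
      note e2 = expectation_past_times_increment[OF sv(1-3) IxF i2, folded d_def]
      note mom = increment_moments_completion[OF sv(1-3), folded d_def]
      have i3: "integrable (completion M) (\<lambda>\<omega>. (\<xi> m \<omega> * d \<omega>)\<^sup>2)"
      proof (rule Bochner_Integration.integrable_bound)
        show "integrable (completion M) (\<lambda>\<omega>. C\<^sup>2 * (d \<omega>)\<^sup>2)" using mom(3) by simp
        show "AE \<omega> in completion M. norm ((\<xi> m \<omega> * d \<omega>)\<^sup>2) \<le> norm (C\<^sup>2 * (d \<omega>)\<^sup>2)"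
          using \<xi>2 by (intro AE_I2) (auto simp: power_mult_distrib intro!: mult_right_mono)
      qed measurable
      have "(\<integral>\<omega>. (\<xi> m \<omega> * d \<omega>)\<^sup>2 \<partial>completion M) \<le> (\<integral>\<omega>. C\<^sup>2 * (d \<omega>)\<^sup>2 \<partial>completion M)"
        using i3 mom(3) \<xi>2 by (intro integral_mono) (auto simp: power_mult_distrib intro!: mult_right_mono)
      then have e3: "(\<integral>\<omega>. (\<xi> m \<omega> * d \<omega>)\<^sup>2 \<partial>completion M) \<le> C\<^sup>2 * (v - s)" using mom by simp
      have sq: "(I (Suc m) \<omega>)\<^sup>2 = (I m \<omega>)\<^sup>2 + 2 * (I m \<omega> * \<xi> m \<omega> * d \<omega>) + (\<xi> m \<omega> * d \<omega>)\<^sup>2" for \<omega>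
        by (simp add: step power2_eq_square algebra_simps)
      have int: "integrable (completion M) (\<lambda>\<omega>. (I (Suc m) \<omega>)\<^sup>2)"
        unfolding sq using IH(1) e2(1) i3 by auto
      have "(\<integral>\<omega>. (I (Suc m) \<omega>)\<^sup>2 \<partial>completion M) =
        (\<integral>\<omega>. (I m \<omega>)\<^sup>2 \<partial>completion M) + (\<integral>\<omega>. (\<xi> m \<omega> * d \<omega>)\<^sup>2 \<partial>completion M)"
        unfolding sq using IH(1) e2 i3 by simp
      also have "\<dots> \<le> C\<^sup>2 * s + C\<^sup>2 * (v - s)" using IH(2) e3 sv(4) by simp
      also have "\<dots> = C\<^sup>2 * min (p (Suc m)) t" by (simp add: v_def algebra_simps)
      finally have le: "(\<integral>\<omega>. (I (Suc m) \<omega>)\<^sup>2 \<partial>completion M) \<le> C\<^sup>2 * min (p (Suc m)) t" .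
      have I1: "integrable (completion M) (I m)"
        by (rule N.square_integrable_imp_integrable) (use IH(1) in auto)
      have "(\<integral>\<omega>. I (Suc m) \<omega> \<partial>completion M) = 0" unfolding step using I1 e1 IH(3) by simp
      then show ?thesis using int le by blast
    qed
  qed
  have eq: "simple_integral_W W (k, p, \<xi>) t \<omega> = I k \<omega>" for \<omega> by (simp add: I_def simple_integral_eq)
  show "integrable (completion M) (\<lambda>\<omega>. (simple_integral_W W (k, p, \<xi>) t \<omega>)\<^sup>2)"
    "(\<integral>\<omega>. simple_integral_W W (k, p, \<xi>) t \<omega> \<partial>completion M) = 0"
    unfolding eq using main[of k] by auto
  have "C\<^sup>2 * min (p k) t \<le> C\<^sup>2 * T" using t by (intro mult_left_mono) auto
  then show "(\<integral>\<omega>. (simple_integral_W W (k, p, \<xi>) t \<omega>)\<^sup>2 \<partial>completion M) \<le> C\<^sup>2 * T"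
    unfolding eq using main[of k] by auto
qed

section \<open>Extending simple processes to partitions of the whole time interval\<close>

lemma sum_pad: "(\<Sum>i<Suc (Suc k). f i) = f 0 + (\<Sum>i<k. f (Suc i)) + (f (Suc k) :: real)"
  by (subst sum.lessThan_Suc, subst sum.lessThan_Suc_shift) simp

text \<open>Cells with coefficient 0 are added before \<open>p 0\<close> and after
  \<open>p k\<close>, because \<open>step_path\<close> works with partitions of all of
  \<open>{0..T}\<close> whereas \<open>is_simple_process\<close> lets the partition start late and
  end early.\<close>

definition pad :: "'a simple_process \<Rightarrow> 'a simple_process" where
  "pad = (\<lambda>(k, p, \<xi>). (Suc (Suc k), \<lambda>j. if j = 0 then 0 else if j \<le> Suc k then p (j - 1) else T,
     \<lambda>j. if j = 0 \<or> j = Suc k then (\<lambda>_. 0) else \<xi> (j - 1)))"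

lemma pad:
  assumes "is_simple_process F T \<Phi>"
  obtains k p \<xi> where "pad \<Phi> = (k, p, \<xi>)" "is_simple_process F T (k, p, \<xi>)" "p 0 = 0" "p k = T"
    "simple_value (k, p, \<xi>) = simple_value \<Phi>" "simple_integral_W W (k, p, \<xi>) = simple_integral_W W \<Phi>"
proof -
  obtain k p \<xi> where \<Phi>: "\<Phi> = (k, p, \<xi>)" by (cases \<Phi>) auto
  note s = assms[unfolded \<Phi>]
  define p' where "p' j = (if j = 0 then 0 else if j \<le> Suc k then p (j - 1) else T)" for j
  define \<xi>' where "\<xi>' j = (if j = 0 \<or> j = Suc k then (\<lambda>_. 0) else \<xi> (j - 1))" for j
  have "pad \<Phi> = (Suc (Suc k), p', \<xi>')" by (simp add: pad_def \<Phi> p'_def[abs_def] \<xi>'_def[abs_def])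
  moreover have "is_simple_process F T (Suc (Suc k), p', \<xi>')"
    unfolding is_simple_process_def prod.case
  proof (intro conjI allI impI)
    fix i assume i: "i < Suc (Suc k)"
    consider "i = 0" | "i = Suc k" | j where "i = Suc j" "j < k" using i by (cases i) force+
    note cases = this
    show "p' i \<le> p' (Suc i)"
      by (rule cases) (use simple_points(2)[OF s, of 0] simple_points(2)[OF s, of k]
        simple_points(1)[OF s, of "i - 1" i] in \<open>auto simp: p'_def\<close>)
    show "\<xi>' i \<in> borel_measurable (F (p' i))"
      by (rule cases) (use simple_process_measurable(1)[OF s] in \<open>auto simp: p'_def \<xi>'_def\<close>)
    show "\<exists>B. \<forall>\<omega>\<in>space (F (p' i)). \<bar>\<xi>' i \<omega>\<bar> \<le> B"
    proof (rule cases)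
      fix j assume j: "i = Suc j" "j < k"
      then have "\<exists>B. \<forall>\<omega>\<in>space M. \<bar>\<xi> j \<omega>\<bar> \<le> B" using s by (simp add: is_simple_process_def)
      then show ?thesis using j by (simp add: \<xi>'_def)
    qed (auto simp: \<xi>'_def)
  qed (use T in \<open>auto simp: p'_def\<close>)
  moreover have "simple_value (Suc (Suc k), p', \<xi>') = simple_value \<Phi>"
    unfolding \<Phi> simple_value_def prod.case
    unfolding sum_pad by (intro ext) (simp add: p'_def \<xi>'_def)
  moreover have "simple_integral_W W (Suc (Suc k), p', \<xi>') = simple_integral_W W \<Phi>"
    unfolding \<Phi> simple_integral_W_def prod.case
    unfolding sum_pad by (intro ext) (simp add: p'_def \<xi>'_def)
  ultimately show thesis by (intro that) (auto simp: p'_def)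
qed

end

lemma uniform_limit_imp_l2:
  fixes f :: "nat \<Rightarrow> real \<Rightarrow> real"
  assumes "0 \<le> T" and lim: "uniform_limit {0..T} f h sequentially"
  shows "(\<lambda>n. \<integral>\<^sup>+ s\<in>{0..T}. ennreal ((f n s - h s)\<^sup>2) \<partial>lborel) \<longlonglongrightarrow> 0"
proof (rule order_tendstoI)
  fix y :: ennreal assume "0 < y"
  obtain e where e: "0 < e" "ennreal (e\<^sup>2 * T) < y"
  proof -
    have "(\<lambda>n. ennreal ((1 / 2 ^ n)\<^sup>2 * T)) \<longlonglongrightarrow> ennreal (0\<^sup>2 * T)"
      by (intro tendsto_ennrealI tendsto_intros mesh_tendsto_0)
    then have "\<forall>\<^sub>F n in sequentially. ennreal ((1 / 2 ^ n)\<^sup>2 * T) < y"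
      by (rule order_tendstoD(2)) (use \<open>0 < y\<close> in simp)
    then obtain n :: nat where "ennreal ((1 / 2 ^ n)\<^sup>2 * T) < y"
      using eventually_happens'[OF sequentially_bot] by blast
    then show thesis by (intro that[of "1 / 2 ^ n"]) auto
  qed
  show "\<forall>\<^sub>F n in sequentially. (\<integral>\<^sup>+ s\<in>{0..T}. ennreal ((f n s - h s)\<^sup>2) \<partial>lborel) < y"
    using uniform_limitD[OF lim e(1)]
  proof eventually_elim
    case (elim n)
    have "(\<integral>\<^sup>+ s\<in>{0..T}. ennreal ((f n s - h s)\<^sup>2) \<partial>lborel) \<le> (\<integral>\<^sup>+ s\<in>{0..T}. ennreal (e\<^sup>2) \<partial>lborel)"
    proof (intro nn_integral_mono)
      fix s :: real
      have "(f n s - h s)\<^sup>2 \<le> e\<^sup>2" if "s \<in> {0..T}"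
        using elim that power_mono[of "\<bar>f n s - h s\<bar>" e 2] by (force simp: dist_real_def)
      then show "ennreal ((f n s - h s)\<^sup>2) * indicator {0..T} s \<le> ennreal (e\<^sup>2) * indicator {0..T} s"
        by (cases "s \<in> {0..T}") (simp_all add: ennreal_leI)
    qed
    also have "\<dots> = ennreal (e\<^sup>2 * T)"
      using assms(1) by (simp add: nn_integral_cmult ennreal_mult')
    finally show ?case using e(2) by simp
  qed
qed simp

lemma comp_measurable:
  fixes g :: "real \<Rightarrow> real" and f :: "'b \<Rightarrow> real"
  shows "continuous_on UNIV g \<Longrightarrow> f \<in> borel_measurable Q \<Longrightarrow> (\<lambda>\<omega>. g (f \<omega>)) \<in> borel_measurable Q"
  by (rule measurable_compose[OF _ borel_measurable_continuous_onI])

context bm_setting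
begin

definition good :: "'a set" where
  "good = {\<omega> \<in> space M. continuous_on {0..T} (\<lambda>t. W t \<omega>)}"

lemma AE_good: "AE \<omega> in completion M. \<omega> \<in> good"
  using AE_W_continuous AE_space by eventually_elim (simp add: good_def)

lemma good_sets: "good \<in> sets (completion M)"
proof (rule completion.in_sets_AE)
  show "AE \<omega> in completion M. \<omega> \<in> space M \<longleftrightarrow> \<omega> \<in> good"
    using AE_good AE_space by eventually_elim simp
qed (auto simp: good_def)

end

section \<open>Ito's formula for integrals of simple processes\<close>

locale simple_ito = bm_setting M T W for M :: "'a measure" and T W +
  fixes k :: nat and p :: "nat \<Rightarrow> real" and \<xi> :: "nat \<Rightarrow> 'a \<Rightarrow> real"
    and z0 \<delta> \<kappa> :: real and G G' G'' :: "real \<Rightarrow> real"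
  assumes simple: "is_simple_process F T (k, p, \<xi>)" and p0: "p 0 = 0" and pk: "p k = T"
    and G: "\<And>s. (G has_real_derivative G' s) (at s)"
    and G': "\<And>s. (G' has_real_derivative G'' s) (at s)"
    and G'': "continuous_on UNIV G''"
begin

definition Z :: "real \<Rightarrow> 'a \<Rightarrow> real" where
  "Z t \<omega> = z0 + simple_integral_W W (k, p, \<xi>) t \<omega> + \<delta> * t"

definition E :: "real \<Rightarrow> 'a \<Rightarrow> real" where
  "E t \<omega> = exp (- \<kappa> * step_int k p (\<lambda>i. (\<xi> i \<omega>)\<^sup>2) (\<lambda>s. s) t)"

text \<open>By Ito's formula this is the stochastic integral of E G'(Z) \<phi> with \<phi> the
  simple process; it is defined by the other side of the formula, which makes sense on every
  path.\<close>

definition Y :: "real \<Rightarrow> 'a \<Rightarrow> real" where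
  "Y t \<omega> = E t \<omega> * G (Z t \<omega>) - G z0 - (LINT s:{0..t}|lborel. E s \<omega> * \<delta> * G' (Z s \<omega>)
     + E s \<omega> * (G'' (Z s \<omega>) / 2 - \<kappa> * G (Z s \<omega>)) * (simple_value (k, p, \<xi>) s \<omega>)\<^sup>2)"

text \<open>The truncation keeps the coefficients bounded; on each path it is eventually inactive.\<close>

definition \<Psi> :: "nat \<Rightarrow> 'a simple_process" where
  "\<Psi> n = (k * 2 ^ n, refine n p, \<lambda>m \<omega>. max (- real n) (min (real n)
     (E (refine n p m) \<omega> * G' (Z (refine n p m) \<omega>))) * \<xi> (m div 2 ^ n) \<omega>)"

lemma cont_G: "continuous_on UNIV G" "continuous_on UNIV G'"
  using G G' by (auto intro!: DERIV_continuous_on)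

lemma step_path:
  assumes "continuous_on {0..T} (\<lambda>t. W t \<omega>)"
  shows "step_path k p (\<lambda>t. W t \<omega>) T"
  by unfold_locales (use p0 pk simple assms in \<open>auto simp: is_simple_process_def\<close>)

lemma path_z:
  assumes "continuous_on {0..T} (\<lambda>t. W t \<omega>)"
  shows "step_path.z k p (\<lambda>i. \<xi> i \<omega>) (\<lambda>t. W t \<omega>) z0 \<delta> t = Z t \<omega>"
    "step_path.D k p (\<lambda>i. \<xi> i \<omega>) \<kappa> t = E t \<omega>"
proof -
  interpret step_path k p "\<lambda>i. \<xi> i \<omega>" "\<lambda>t. W t \<omega>" T z0 \<delta> \<kappa> by (rule step_path[OF assms])
  show "z t = Z t \<omega>" by (simp add: z_def Z_def simple_integral_eq)
  show "D t = E t \<omega>" by (simp add: D_def A_def E_def)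
qed

lemma continuous_Z: "continuous_on {0..T} (\<lambda>t. W t \<omega>) \<Longrightarrow> continuous_on {0..T} (\<lambda>t. Z t \<omega>)"
  unfolding Z_def by (intro continuous_intros simple_integral_continuous[OF simple])

lemma continuous_E: "continuous_on {0..T} (\<lambda>t. E t \<omega>)"
proof -
  have "continuous_on {0..T} (\<lambda>t. min (p i) t)" for i by (intro continuous_intros)
  then show ?thesis unfolding E_def step_int_def by (intro continuous_intros)
qed

lemma refine_mem:
  assumes "m < k * 2 ^ n"
  shows "refine n p m \<in> {0..T}" "refine n p (Suc m) \<in> {0..T}" "refine n p m \<le> refine n p (Suc m)"
    "p (m div 2 ^ n) \<le> refine n p m" "m div 2 ^ n < k"
proof -
  have "step_path k p (\<lambda>t. 0) T"
    by unfold_locales (use p0 pk simple in \<open>auto simp: is_simple_process_def\<close>)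
  then interpret step_path k p \<xi>0 "\<lambda>t. 0" T z0 \<delta> \<kappa> for \<xi>0 .
  show "refine n p m \<in> {0..T}" "refine n p (Suc m) \<in> {0..T}" "refine n p m \<le> refine n p (Suc m)"
    "p (m div 2 ^ n) \<le> refine n p m"
    using refine_step[OF assms] by auto
  show "m div 2 ^ n < k" using assms by (simp add: less_mult_imp_div_less)
qed

lemma Z_measurable: "t \<in> {0..T} \<Longrightarrow> Z t \<in> borel_measurable (F t)"
  unfolding Z_def[abs_def]
  by (intro borel_measurable_add borel_measurable_const simple_integral_F_measurable[OF simple])

lemma E_measurable:
  assumes "t \<in> {0..T}"
  shows "E t \<in> borel_measurable (F t)"
proof -
  have "(\<lambda>\<omega>. step_int k p (\<lambda>i. (\<xi> i \<omega>)\<^sup>2) (\<lambda>s. s) t) \<in> borel_measurable (F t)"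
    by (rule simple_sum_F_measurable[OF simple assms, where f = "\<lambda>_ s. s"])
      (use simple_process_measurable(1)[OF simple] in auto)
  from measurable_compose[OF borel_measurable_times[OF borel_measurable_const this] borel_measurable_exp]
  show ?thesis unfolding E_def[abs_def] .
qed

text \<open>The coefficients are evaluated at left ends of refined cells, and such a point lies
  after the partition point at which its \<xi> becomes known.\<close>

lemma simple_\<Psi>: "is_simple_process F T (\<Psi> n)"
  unfolding \<Psi>_def is_simple_process_def prod.case
proof (intro conjI allI impI)
  have block: "refine n p (i * 2 ^ n) = p i" for i
    using refine_block[of 0 n p i] by simp
  show "0 \<le> refine n p 0" using block[of 0] p0 by simp
  show "refine n p (k * 2 ^ n) \<le> T" using block[of k] pk by simp
  fix m assume m: "m < k * 2 ^ n"
  note r = refine_mem[OF m]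
  let ?q = "refine n p m"
  show "?q \<le> refine n p (Suc m)" by (rule r)
  have \<xi>m: "\<xi> (m div 2 ^ n) \<in> borel_measurable (F ?q)"
    by (rule canonical_filtration_measurable_mono[OF simple_process_measurable(1)[OF simple r(5)] r(4)])
  have [measurable]: "(\<lambda>\<omega>. E ?q \<omega> * G' (Z ?q \<omega>)) \<in> borel_measurable (F ?q)"
    by (intro borel_measurable_times E_measurable comp_measurable[OF cont_G(2)] Z_measurable r)
  note \<xi>m[measurable]
  show "(\<lambda>\<omega>. max (- real n) (min (real n) (E ?q \<omega> * G' (Z ?q \<omega>))) * \<xi> (m div 2 ^ n) \<omega>) \<in> borel_measurable (F ?q)"
    by measurable
  have "\<exists>B. \<forall>\<omega>\<in>space M. \<bar>\<xi> (m div 2 ^ n) \<omega>\<bar> \<le> B"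
    using simple r(5) by (simp add: is_simple_process_def)
  then obtain B where B: "\<And>\<omega>. \<omega> \<in> space M \<Longrightarrow> \<bar>\<xi> (m div 2 ^ n) \<omega>\<bar> \<le> B" by blast
  have "\<bar>max (- real n) (min (real n) x) * \<xi> (m div 2 ^ n) \<omega>\<bar> \<le> real n * B" if "\<omega> \<in> space M" for x \<omega>
    unfolding abs_mult using B[OF that] by (intro mult_mono) auto
  then show "\<exists>B. \<forall>\<omega>\<in>space (F ?q). \<bar>max (- real n) (min (real n) (E ?q \<omega> * G' (Z ?q \<omega>))) * \<xi> (m div 2 ^ n) \<omega>\<bar> \<le> B"
    by auto
qed

lemma truncation_inactive:
  assumes "continuous_on {0..T} (\<lambda>t. W t \<omega>)"
  shows "\<forall>\<^sub>F n in sequentially. \<forall>m<k * 2 ^ n.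
    max (- real n) (min (real n) (E (refine n p m) \<omega> * G' (Z (refine n p m) \<omega>))) =
    E (refine n p m) \<omega> * G' (Z (refine n p m) \<omega>)"
proof -
  have "continuous_on {0..T} (\<lambda>t. E t \<omega> * G' (Z t \<omega>))"
    by (intro continuous_on_mult continuous_E continuous_on_compose2[OF cont_G(2) continuous_Z[OF assms]]) auto
  then have "bounded ((\<lambda>t. E t \<omega> * G' (Z t \<omega>)) ` {0..T})"
    by (intro compact_imp_bounded compact_continuous_image) auto
  then obtain B where "\<forall>x\<in>(\<lambda>t. E t \<omega> * G' (Z t \<omega>)) ` {0..T}. \<bar>x\<bar> \<le> B"
    unfolding bounded_real by (rule exE)
  then have B: "\<bar>E t \<omega> * G' (Z t \<omega>)\<bar> \<le> B" if "t \<in> {0..T}" for t using that by simp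
  obtain N where N: "B \<le> real N" using real_arch_simple by blast
  have "max (- real n) (min (real n) (E (refine n p m) \<omega> * G' (Z (refine n p m) \<omega>))) =
    E (refine n p m) \<omega> * G' (Z (refine n p m) \<omega>)" if "n \<ge> N" "m < k * 2 ^ n" for n m
    using B[OF refine_mem(1)[OF that(2)]] N that(1) by (auto simp: max_def min_def abs_le_iff)
  then show ?thesis unfolding eventually_sequentially by (intro exI[of _ N] allI impI)
qed

lemma AE_all_quad_var: "AE \<omega> in completion M. \<forall>i<k. \<forall>t\<in>rational_points (p i) (p (Suc i)).
    (\<lambda>n. quad_var (\<lambda>s. W s \<omega>) (p i) (p (Suc i)) n t) \<longlonglongrightarrow> t - p i"
proof -
  have "AE \<omega> in completion M. \<forall>i\<in>{..<k}. \<forall>t\<in>rational_points (p i) (p (Suc i)).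
    (\<lambda>n. quad_var (\<lambda>s. W s \<omega>) (p i) (p (Suc i)) n t) \<longlonglongrightarrow> t - p i"
  proof (rule AE_finite_allI)
    fix i assume "i \<in> {..<k}"
    then have "p i \<in> {0..T}" "p (Suc i) \<in> {0..T}" "p i \<le> p (Suc i)"
      using simple_points[OF simple] by auto
    then show "AE \<omega> in completion M. \<forall>t\<in>rational_points (p i) (p (Suc i)).
      (\<lambda>n. quad_var (\<lambda>s. W s \<omega>) (p i) (p (Suc i)) n t) \<longlonglongrightarrow> t - p i"
      by (intro AE_quad_var) auto
  qed simp
  then show ?thesis by eventually_elim auto
qed

lemma AE_ito: "AE \<omega> in completion M.
    uniform_limit {0..T} (\<lambda>n t. simple_integral_W W (\<Psi> n) t \<omega>) (\<lambda>t. Y t \<omega>) sequentially \<and>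
    uniform_limit {0..T} (\<lambda>n t. simple_value (\<Psi> n) t \<omega>)
      (\<lambda>t. E t \<omega> * G' (Z t \<omega>) * simple_value (k, p, \<xi>) t \<omega>) sequentially"
  using AE_all_quad_var AE_W_continuous
proof eventually_elim
  case (elim \<omega>)
  interpret step_path k p "\<lambda>i. \<xi> i \<omega>" "\<lambda>t. W t \<omega>" T z0 \<delta> \<kappa> by (rule step_path[OF elim(2)])
  note zE = path_z[OF elim(2)]
  have u: "continuous_on {0..T} (\<lambda>t. E t \<omega> * G' (Z t \<omega>))"
    by (intro continuous_on_mult continuous_E continuous_on_compose2[OF cont_G(2) continuous_Z[OF elim(2)]]) auto
  have 1: "uniform_limit {0..T}
    (\<lambda>n. step_int (k * 2 ^ n) (refine n p)
       (\<lambda>m. E (refine n p m) \<omega> * G' (Z (refine n p m) \<omega>) * \<xi> (m div 2 ^ n) \<omega>) (\<lambda>t. W t \<omega>)) (\<lambda>t. Y t \<omega>) sequentially"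
    using path_ito[of G G' G'', OF _ G G' G''] elim(1) unfolding zE Y_def simple_value_eq by simp
  have 2: "uniform_limit {0..T}
    (\<lambda>n. step_fun (k * 2 ^ n) (refine n p) (\<lambda>m. E (refine n p m) \<omega> * G' (Z (refine n p m) \<omega>) * \<xi> (m div 2 ^ n) \<omega>))
    (\<lambda>t. E t \<omega> * G' (Z t \<omega>) * simple_value (k, p, \<xi>) t \<omega>) sequentially"
    using step_fun_refine_uniform_limit[OF u] unfolding simple_value_eq by simp
  have ev1: "\<forall>\<^sub>F n in sequentially. \<forall>t\<in>{0..T}. simple_integral_W W (\<Psi> n) t \<omega> =
      step_int (k * 2 ^ n) (refine n p)
       (\<lambda>m. E (refine n p m) \<omega> * G' (Z (refine n p m) \<omega>) * \<xi> (m div 2 ^ n) \<omega>) (\<lambda>t. W t \<omega>) t"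
    using truncation_inactive[OF elim(2)]
    by eventually_elim (auto simp: \<Psi>_def simple_integral_eq step_int_def intro!: sum.cong)
  have ev2: "\<forall>\<^sub>F n in sequentially. \<forall>t\<in>{0..T}. simple_value (\<Psi> n) t \<omega> =
      step_fun (k * 2 ^ n) (refine n p)
       (\<lambda>m. E (refine n p m) \<omega> * G' (Z (refine n p m) \<omega>) * \<xi> (m div 2 ^ n) \<omega>) t"
    using truncation_inactive[OF elim(2)]
    by eventually_elim (auto simp: \<Psi>_def simple_value_eq step_fun_def intro!: sum.cong)
  show ?case
    using uniform_limit_cong[OF ev1, THEN iffD2, OF _ 1] uniform_limit_cong[OF ev2, THEN iffD2, OF _ 2] by simp
qed

lemma continuous_Y:
  assumes "continuous_on {0..T} (\<lambda>t. W t \<omega>)"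
    "uniform_limit {0..T} (\<lambda>n t. simple_integral_W W (\<Psi> n) t \<omega>) (\<lambda>t. Y t \<omega>) sequentially"
  shows "continuous_on {0..T} (\<lambda>t. Y t \<omega>)"
  by (rule uniform_limit_theorem[OF _ assms(2)])
    (auto intro!: always_eventually simple_integral_continuous simple_\<Psi> assms(1))

lemma AE_continuous_Y: "AE \<omega> in completion M. continuous_on {0..T} (\<lambda>t. Y t \<omega>)"
  using AE_ito AE_W_continuous by eventually_elim (auto intro: continuous_Y)

text \<open>Obtained from the almost sure limit of simple integrals rather than from the time
  integral in the definition; the completion takes care of the null set.\<close>

lemma Y_measurable:
  assumes "t \<in> {0..T}"
  shows "Y t \<in> borel_measurable (completion M)"
proof -
  define X where "X n \<omega> = simple_integral_W W (\<Psi> n) t \<omega>" for n \<omega>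
  have [measurable]: "X n \<in> borel_measurable (completion M)" for n
    unfolding X_def[abs_def]
    by (rule F_measurable_completion[OF simple_integral_F_measurable[OF simple_\<Psi> assms, unfolded]])
  show ?thesis
  proof (rule completion.measurable_AE_eq)
    show "(\<lambda>\<omega>. lim (\<lambda>n. X n \<omega>)) \<in> borel_measurable (completion M)" by measurable
    show "AE \<omega> in completion M. lim (\<lambda>n. X n \<omega>) = Y t \<omega>"
      using AE_ito
    proof eventually_elim
      case (elim \<omega>)
      then have "(\<lambda>n. X n \<omega>) \<longlonglongrightarrow> Y t \<omega>" unfolding X_def using tendsto_uniform_limitI[OF conjunct1 assms] by blast
      then show ?case by (rule limI)
    qed
  qed auto
qed

text \<open>Paths of \<open>Z\<close> are continuous where those of \<open>W\<close> are. Setting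
  the coefficient to 0 off \<open>good\<close> makes all its paths continuous, which is what
  \<open>joint_continuous\<close> asks for.\<close>

lemma joint_coefficient:
  assumes g: "continuous_on UNIV g"
  shows "joint (\<lambda>t \<omega>. (if \<omega> \<in> good then E t \<omega> * g (Z t \<omega>) else 0) * simple_value (k, p, \<xi>) t \<omega>)"
proof (rule joint_binary[where f = "\<lambda>x y. x * y", OF _ joint_simple_value[OF simple]])
  show "joint (\<lambda>t \<omega>. if \<omega> \<in> good then E t \<omega> * g (Z t \<omega>) else 0)"
  proof (rule joint_continuous)
    fix t assume t: "t \<in> {0..T}"
    have "(\<lambda>\<omega>. E t \<omega> * g (Z t \<omega>)) \<in> borel_measurable (completion M)"
      by (intro borel_measurable_times comp_measurable[OF g] F_measurable_completion[OF E_measurable[OF t]]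
          F_measurable_completion[OF Z_measurable[OF t]])
    then show "(\<lambda>\<omega>. if \<omega> \<in> good then E t \<omega> * g (Z t \<omega>) else 0) \<in> borel_measurable (completion M)"
      using good_sets by (intro measurable_If_set) auto
  next
    fix \<omega>
    show "continuous_on {0..T} (\<lambda>t. if \<omega> \<in> good then E t \<omega> * g (Z t \<omega>) else 0)"
    proof (cases "\<omega> \<in> good")
      case True
      then have "continuous_on {0..T} (\<lambda>t. W t \<omega>)" by (simp add: good_def)
      then have "continuous_on {0..T} (\<lambda>t. E t \<omega> * g (Z t \<omega>))"
        by (intro continuous_on_mult continuous_E continuous_on_compose2[OF g continuous_Z]) auto
      then show ?thesis using True by simp
    qed simp
  qed
qed measurable

lemma ito_approx_simple:
  "ito_approx (\<lambda>t \<omega>. (if \<omega> \<in> good then E t \<omega> * G' (Z t \<omega>) else 0) * simple_value (k, p, \<xi>) t \<omega>) Y"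
  unfolding ito_approx_def
proof (intro exI[of _ \<Psi>] conjI allI simple_\<Psi>)
  show "AE \<omega> in completion M. (\<lambda>n. l2_dist (simple_value (\<Psi> n))
      (\<lambda>t \<omega>. (if \<omega> \<in> good then E t \<omega> * G' (Z t \<omega>) else 0) * simple_value (k, p, \<xi>) t \<omega>) \<omega>) \<longlonglongrightarrow> 0 \<and>
    uniform_limit {0..T} (\<lambda>n t. simple_integral_W W (\<Psi> n) t \<omega>) (\<lambda>t. Y t \<omega>) sequentially"
    using AE_ito AE_good
  proof eventually_elim
    case (elim \<omega>)
    then show ?case
      unfolding l2_dist_def using uniform_limit_imp_l2[OF less_imp_le[OF T]] by simp
  qed
qed

text \<open>For \<kappa> \<ge> 0 the discount \<open>E\<close> is at most 1, and truncation does not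
  enlarge absolute values. So the coefficients of all approximating simple processes share the bound
  \<open>B * C'\<close>, their integrals are bounded in L2, and the mean 0 survives the
  limit.\<close>

lemma expectation_Y:
  assumes bdd: "\<And>s. \<bar>G' s\<bar> \<le> B" and "0 \<le> \<kappa>" and t: "t \<in> {0..T}"
  shows "integrable (completion M) (Y t)" "(\<integral>\<omega>. Y t \<omega> \<partial>completion M) = 0"
proof -
  have "\<exists>C. \<forall>i<k. \<forall>\<omega>\<in>space M. \<bar>\<xi> i \<omega>\<bar> \<le> C"
  proof -
    have "\<forall>i. \<exists>C. i < k \<longrightarrow> (\<forall>\<omega>\<in>space M. \<bar>\<xi> i \<omega>\<bar> \<le> C)"
      using simple by (auto simp: is_simple_process_def)
    from choice[OF this] obtain C where C: "\<forall>i. i < k \<longrightarrow> (\<forall>\<omega>\<in>space M. \<bar>\<xi> i \<omega>\<bar> \<le> C i)" ..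
    have "\<bar>\<xi> i \<omega>\<bar> \<le> (\<Sum>i<k. \<bar>C i\<bar>)" if "i < k" "\<omega> \<in> space M" for i \<omega>
    proof -
      have "\<bar>\<xi> i \<omega>\<bar> \<le> \<bar>C i\<bar>" using C that by force
      also have "\<dots> \<le> (\<Sum>i<k. \<bar>C i\<bar>)" using that by (intro member_le_sum) auto
      finally show ?thesis .
    qed
    then show ?thesis by blast
  qed
  then obtain C where C: "\<And>i \<omega>. i < k \<Longrightarrow> \<omega> \<in> space M \<Longrightarrow> \<bar>\<xi> i \<omega>\<bar> \<le> C" by blast
  define C' where "C' = max C 0"
  have C': "\<And>i \<omega>. i < k \<Longrightarrow> \<omega> \<in> space M \<Longrightarrow> \<bar>\<xi> i \<omega>\<bar> \<le> C'" "0 \<le> C'"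
    using C by (auto simp: C'_def max.coboundedI1)
  have B: "0 \<le> B" using bdd[of 0] by linarith
  have E1: "0 \<le> E s \<omega>" "E s \<omega> \<le> 1" for s \<omega>
  proof -
    show "0 \<le> E s \<omega>" by (simp add: E_def)
    have "0 \<le> step_int k p (\<lambda>i. (\<xi> i \<omega>)\<^sup>2) (\<lambda>s. s) s"
      unfolding step_int_def
    proof (intro sum_nonneg mult_nonneg_nonneg)
      fix i assume "i \<in> {..<k}"
      then have "p i \<le> p (Suc i)" using simple_points(1)[OF simple, of i "Suc i"] by auto
      then show "0 \<le> min (p (Suc i)) s - min (p i) s" by auto
    qed simp
    then show "E s \<omega> \<le> 1" using \<open>0 \<le> \<kappa>\<close> by (simp add: E_def)
  qed
  have trunc: "\<bar>max (- real n) (min (real n) x)\<bar> \<le> \<bar>x\<bar>" for n x by (auto simp: max_def min_def)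
  have bound: "\<bar>max (- real n) (min (real n) (E q \<omega> * G' (Z q \<omega>))) * \<xi> (m div 2 ^ n) \<omega>\<bar> \<le> B * C'"
    if "m < k * 2 ^ n" "\<omega> \<in> space M" for m n q \<omega>
  proof -
    have "\<bar>E q \<omega> * G' (Z q \<omega>)\<bar> \<le> 1 * B" unfolding abs_mult using E1 bdd by (intro mult_mono) auto
    then have "\<bar>max (- real n) (min (real n) (E q \<omega> * G' (Z q \<omega>)))\<bar> \<le> B" using trunc order_trans by fastforce
    then show ?thesis unfolding abs_mult using C'(1)[OF refine_mem(5)[OF that(1)] that(2)] C'(2) B
      by (intro mult_mono) auto
  qed
  note L2 = simple_integral_L2[OF simple_\<Psi>[unfolded \<Psi>_def] t, where C = "B * C'", OF bound mult_nonneg_nonneg[OF B C'(2)], folded \<Psi>_def]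
  have m: "simple_integral_W W (\<Psi> n) t \<in> borel_measurable (completion M)" for n
    by (rule F_measurable_completion[OF simple_integral_F_measurable[OF simple_\<Psi> t]])
  have lim: "AE \<omega> in completion M. (\<lambda>n. simple_integral_W W (\<Psi> n) t \<omega>) \<longlonglongrightarrow> Y t \<omega>"
    using AE_ito by eventually_elim (rule tendsto_uniform_limitI[OF conjunct1 t])
  show "integrable (completion M) (Y t)" "(\<integral>\<omega>. Y t \<omega> \<partial>completion M) = 0"
    by (rule N.L2_bounded_limit[OF m Y_measurable[OF t] L2 lim]; assumption)+
qed

end

section \<open>The Ito formula for squared Bessel processes\<close>

text \<open>The bounded limit eventually confines all values to one compact interval, where
  \<open>G\<close> is uniformly continuous.\<close>

lemma uniform_limit_continuous_compose:
  fixes f :: "nat \<Rightarrow> real \<Rightarrow> real" and G :: "real \<Rightarrow> real"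
  assumes lim: "uniform_limit S f l sequentially" and bdd: "bounded (l ` S)" and G: "continuous_on UNIV G"
  shows "uniform_limit S (\<lambda>n s. G (f n s)) (\<lambda>s. G (l s)) sequentially"
proof (rule uniform_limitI)
  fix e :: real assume "e > 0"
  obtain B where "\<forall>x\<in>l ` S. \<bar>x\<bar> \<le> B" using bdd unfolding bounded_real by (rule exE)
  then have B: "\<bar>l s\<bar> \<le> B" if "s \<in> S" for s using that by simp
  have "uniformly_continuous_on {- (B + 1)..B + 1} G"
    by (intro compact_uniformly_continuous continuous_on_subset[OF G]) auto
  then obtain d where d: "d > 0" "\<And>x x'. x \<in> {- (B + 1)..B + 1} \<Longrightarrow> x' \<in> {- (B + 1)..B + 1} \<Longrightarrow> dist x' x < d \<Longrightarrow> dist (G x') (G x) < e"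
    using \<open>e > 0\<close> unfolding uniformly_continuous_on_def by metis
  have "min d 1 > 0" using d(1) by simp
  from uniform_limitD[OF lim this]
  show "\<forall>\<^sub>F n in sequentially. \<forall>s\<in>S. dist (G (f n s)) (G (l s)) < e"
  proof eventually_elim
    case (elim n)
    show ?case
    proof
      fix s assume s: "s \<in> S"
      have "\<bar>f n s - l s\<bar> < 1" "dist (f n s) (l s) < d" using elim s by (auto simp: dist_real_def)
      then show "dist (G (f n s)) (G (l s)) < e" using B[OF s] by (intro d(2)) auto
    qed
  qed
qed

lemma bounded_continuous_image:
  fixes f :: "real \<Rightarrow> real"
  shows "continuous_on {a..b} f \<Longrightarrow> bounded (f ` {a..b})"
  by (intro compact_imp_bounded compact_continuous_image) auto

lemma continuous_set_integral:
  fixes f :: "real \<Rightarrow> real"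
  assumes f: "continuous_on {0..T} f"
  shows "continuous_on {0..T} (\<lambda>t. LINT s:{0..t}|lborel. f s)"
proof -
  have "(LINT s:{0..t}|lborel. f s) = integral {0..t} f" if "t \<in> {0..T}" for t
    by (rule set_borel_integral_eq_integral(2), rule borel_integrable_atLeastAtMost',
        rule continuous_on_subset[OF f]) (use that in auto)
  moreover have "continuous_on {0..T} (\<lambda>t. integral {0..t} f)"
    by (rule indefinite_integral_continuous_1[OF integrable_continuous_real[OF f]])
  ultimately show ?thesis
    by (subst continuous_on_cong[OF refl, where g = "\<lambda>t. integral {0..t} f"]) auto
qed

lemma step_fun_measurable: "step_fun k p x \<in> borel_measurable borel"
  unfolding step_fun_def[abs_def] by measurable

lemma step_fun_bounded: "\<exists>B. \<forall>s. \<bar>step_fun k p x s\<bar> \<le> B"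
proof (intro exI[of _ "\<Sum>i<k. \<bar>x i\<bar>"] allI)
  show "\<bar>step_fun k p x s\<bar> \<le> (\<Sum>i<k. \<bar>x i\<bar>)" for s
    unfolding step_fun_def by (intro order_trans[OF sum_abs] sum_mono) (auto simp: indicator_def)
qed

lemma (in step_path) A_eq_integral:
  assumes "t \<in> {0..T}"
  shows "A t = (LINT s:{0..t}|lborel. (step_fun k p x s)\<^sup>2)"
proof -
  have "(LINT s:{0..t}|lborel. 0 + 1 * (step_fun k p x s)\<^sup>2) =
    (\<Sum>i<k. integral {p i..max (p i) (min (p (Suc i)) t)} (\<lambda>s. 0 + 1 * (x i)\<^sup>2))"
    by (rule integral_pieces[OF _ _ assms]) auto
  also have "\<dots> = (\<Sum>i<k. (x i)\<^sup>2 * (min (p (Suc i)) t - min (p i) t))"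
  proof (intro sum.cong refl)
    fix i assume "i \<in> {..<k}"
    then have "p i \<le> p (Suc i)" using p_step by simp
    then show "integral {p i..max (p i) (min (p (Suc i)) t)} (\<lambda>s. 0 + 1 * (x i)\<^sup>2) =
      (x i)\<^sup>2 * (min (p (Suc i)) t - min (p i) t)"
      by (auto simp: max_def min_def)
  qed
  finally show ?thesis by (simp add: A_def step_int_def)
qed

section \<open>Squared Bessel processes as limits of simple integrals\<close>

locale besq = bm_setting M T W for M :: "'a measure" and T W +
  fixes \<delta> s0 :: real and S :: "real \<Rightarrow> 'a \<Rightarrow> real"
  assumes S_adapted: "adapted F T S" and S_continuous: "continuous_paths M T S"
    and S_ito: "has_ito_integral M T W (\<lambda>t \<omega>. 2 * sqrt \<bar>S t \<omega>\<bar>) (\<lambda>t \<omega>. S t \<omega> - s0 - \<delta> * t)"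
begin

definition clock :: "real \<Rightarrow> 'a \<Rightarrow> real" where
  "clock t \<omega> = (LINT s:{0..t}|lborel. (2 * sqrt \<bar>S s \<omega>\<bar>)\<^sup>2)"

definition disc :: "real \<Rightarrow> real \<Rightarrow> 'a \<Rightarrow> real" where
  "disc \<kappa> t \<omega> = exp (- \<kappa> * clock t \<omega>)"

text \<open>The expression of \<open>simple_ito.Y\<close> with the limit objects inserted:
  \<open>S\<close> for \<open>Z\<close>, \<open>disc\<close> for \<open>E\<close> and
  \<open>2 * sqrt \<bar>S\<bar>\<close> for the simple integrand.\<close>

definition limitY :: "real \<Rightarrow> (real \<Rightarrow> real) \<Rightarrow> (real \<Rightarrow> real) \<Rightarrow> (real \<Rightarrow> real) \<Rightarrow> real \<Rightarrow> 'a \<Rightarrow> real" where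
  "limitY \<kappa> G G' G'' t \<omega> = disc \<kappa> t \<omega> * G (S t \<omega>) - G s0 -
     ((LINT s:{0..t}|lborel. disc \<kappa> s \<omega> * \<delta> * G' (S s \<omega>))
      + (LINT s:{0..t}|lborel. disc \<kappa> s \<omega> * (G'' (S s \<omega>) / 2 - \<kappa> * G (S s \<omega>)) * (2 * sqrt \<bar>S s \<omega>\<bar>)\<^sup>2))"

lemma S_path: "\<omega> \<in> space M \<Longrightarrow> continuous_on {0..T} (\<lambda>t. S t \<omega>)"
  using S_continuous by (simp add: continuous_paths_def)

lemma S_measurable: "t \<in> {0..T} \<Longrightarrow> S t \<in> borel_measurable (F t)"
  using S_adapted by (simp add: adapted_def)

end

locale besq_approx = besq M T W \<delta> s0 S for M :: "'a measure" and T W \<delta> s0 S +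
  fixes k :: "nat \<Rightarrow> nat" and p :: "nat \<Rightarrow> nat \<Rightarrow> real" and \<xi> :: "nat \<Rightarrow> nat \<Rightarrow> 'a \<Rightarrow> real"
  assumes simple: "\<And>n. is_simple_process F T (k n, p n, \<xi> n)" and p0: "\<And>n. p n 0 = 0" and pk: "\<And>n. p n (k n) = T"
    and approx: "AE \<omega> in completion M. (\<lambda>n. l2_dist (simple_value (k n, p n, \<xi> n)) (\<lambda>t \<omega>. 2 * sqrt \<bar>S t \<omega>\<bar>) \<omega>) \<longlonglongrightarrow> 0 \<and>
       uniform_limit {0..T} (\<lambda>n t. simple_integral_W W (k n, p n, \<xi> n) t \<omega>) (\<lambda>t. S t \<omega> - s0 - \<delta> * t) sequentially"
begin

abbreviation Zn :: "nat \<Rightarrow> real \<Rightarrow> 'a \<Rightarrow> real" where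
  "Zn n \<equiv> simple_ito.Z W (k n) (p n) (\<xi> n) s0 \<delta>"

abbreviation En :: "real \<Rightarrow> nat \<Rightarrow> real \<Rightarrow> 'a \<Rightarrow> real" where
  "En \<kappa> n \<equiv> simple_ito.E (k n) (p n) (\<xi> n) \<kappa>"

abbreviation fn :: "nat \<Rightarrow> real \<Rightarrow> 'a \<Rightarrow> real" where
  "fn n \<equiv> simple_value (k n, p n, \<xi> n)"

text \<open>Collects the conditions of full measure, so that the limits below are statements about a
  single path.\<close>

definition regular :: "'a \<Rightarrow> bool" where
  "regular \<omega> \<longleftrightarrow> \<omega> \<in> space M \<and> \<omega> \<in> good \<and>
    (\<lambda>n. l2_dist (fn n) (\<lambda>t \<omega>. 2 * sqrt \<bar>S t \<omega>\<bar>) \<omega>) \<longlonglongrightarrow> 0 \<and>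
    uniform_limit {0..T} (\<lambda>n t. simple_integral_W W (k n, p n, \<xi> n) t \<omega>) (\<lambda>t. S t \<omega> - s0 - \<delta> * t) sequentially"

lemma AE_regular: "AE \<omega> in completion M. regular \<omega>"
  using approx AE_good AE_space by eventually_elim (auto simp: regular_def)

lemma simple_ito:
  assumes "\<And>s. (G has_real_derivative G' s) (at s)" "\<And>s. (G' has_real_derivative G'' s) (at s)"
    "continuous_on UNIV G''"
  shows "simple_ito M T W (k n) (p n) (\<xi> n) G G' G''"
  by unfold_locales (use assms simple p0 pk in auto)

text \<open>\<open>Z\<close> and \<open>E\<close> do not depend on the transformed function; this
  trivial instance gives access to their properties without fixing one.\<close>

lemma simple_ito_0: "simple_ito M T W (k n) (p n) (\<xi> n) (\<lambda>_. 0) (\<lambda>_. 0) (\<lambda>_. 0)"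
  by (rule simple_ito) auto

lemma regular_continuous:
  assumes "regular \<omega>"
  shows "continuous_on {0..T} (\<lambda>t. W t \<omega>)" "continuous_on {0..T} (\<lambda>t. Zn n t \<omega>)"
    "continuous_on {0..T} (\<lambda>t. En \<kappa> n t \<omega>)" "continuous_on {0..T} (\<lambda>t. S t \<omega>)"
    "continuous_on {0..T} (\<lambda>t. clock t \<omega>)" "continuous_on {0..T} (\<lambda>t. disc \<kappa> t \<omega>)"
proof -
  show W: "continuous_on {0..T} (\<lambda>t. W t \<omega>)" using assms by (simp add: regular_def good_def)
  show "continuous_on {0..T} (\<lambda>t. Zn n t \<omega>)" by (rule simple_ito.continuous_Z[OF simple_ito_0 W])
  show "continuous_on {0..T} (\<lambda>t. En \<kappa> n t \<omega>)" by (rule simple_ito.continuous_E[OF simple_ito_0])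
  show S: "continuous_on {0..T} (\<lambda>t. S t \<omega>)" using assms by (intro S_path) (simp add: regular_def)
  have "continuous_on {0..T} (\<lambda>s. (2 * sqrt \<bar>S s \<omega>\<bar>)\<^sup>2)" by (intro continuous_intros S)
  then show c: "continuous_on {0..T} (\<lambda>t. clock t \<omega>)"
    unfolding clock_def by (rule continuous_set_integral)
  show "continuous_on {0..T} (\<lambda>t. disc \<kappa> t \<omega>)" unfolding disc_def by (intro continuous_intros c)
qed

lemma regular_l2_limit:
  assumes "regular \<omega>" "\<And>n. continuous_on {0..T} (a n)" "continuous_on {0..T} b" "uniform_limit {0..T} a b sequentially"
  shows "l2_limit T (\<lambda>n s. fn n s \<omega>) (\<lambda>s. 2 * sqrt \<bar>S s \<omega>\<bar>) a b"
proof
  show "(\<lambda>s. fn n s \<omega>) \<in> borel_measurable borel" for n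
    unfolding simple_value_eq by (rule step_fun_measurable)
  show "\<exists>B. \<forall>s. \<bar>fn n s \<omega>\<bar> \<le> B" for n unfolding simple_value_eq by (rule step_fun_bounded)
  show "continuous_on {0..T} (\<lambda>s. 2 * sqrt \<bar>S s \<omega>\<bar>)"
    by (intro continuous_intros regular_continuous(4)[OF assms(1)])
  show "(\<lambda>n. \<integral>\<^sup>+ s\<in>{0..T}. ennreal ((fn n s \<omega> - 2 * sqrt \<bar>S s \<omega>\<bar>)\<^sup>2) \<partial>lborel) \<longlonglongrightarrow> 0"
    using assms(1) by (simp add: regular_def l2_dist_def)
qed (use assms T in auto)

lemma limit_Z:
  assumes "regular \<omega>"
  shows "uniform_limit {0..T} (\<lambda>n t. Zn n t \<omega>) (\<lambda>t. S t \<omega>) sequentially"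
proof -
  have "uniform_limit {0..T} (\<lambda>n t. s0 + simple_integral_W W (k n, p n, \<xi> n) t \<omega> + \<delta> * t)
      (\<lambda>t. s0 + (S t \<omega> - s0 - \<delta> * t) + \<delta> * t) sequentially"
    using assms unfolding regular_def by (intro uniform_limit_add uniform_limit_const) auto
  then show ?thesis unfolding simple_ito.Z_def[OF simple_ito_0] by simp
qed

text \<open>The clock is an integral of squares, so it converges uniformly by
  \<open>l2_limit\<close> with constant weight 1, and the exponential is continuous.\<close>

lemma limit_E:
  assumes "regular \<omega>"
  shows "uniform_limit {0..T} (\<lambda>n t. En \<kappa> n t \<omega>) (\<lambda>t. disc \<kappa> t \<omega>) sequentially"
proof -
  interpret l2_limit T "\<lambda>n s. fn n s \<omega>" "\<lambda>s. 2 * sqrt \<bar>S s \<omega>\<bar>" "\<lambda>_ _. 1" "\<lambda>_. 1"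
    by (rule regular_l2_limit[OF assms]) (auto intro: uniform_limit_const)
  have "uniform_limit {0..T} (\<lambda>n t. LINT s:{0..t}|lborel. (fn n s \<omega>)\<^sup>2) (\<lambda>t. clock t \<omega>) sequentially"
    using integral_square_uniform_limit by (simp add: clock_def)
  then have "uniform_limit {0..T} (\<lambda>n t. exp (- \<kappa> * (LINT s:{0..t}|lborel. (fn n s \<omega>)\<^sup>2)))
      (\<lambda>t. exp (- \<kappa> * clock t \<omega>)) sequentially"
    by (rule uniform_limit_continuous_compose[where G = "\<lambda>x. exp (- \<kappa> * x)"])
      (auto intro!: continuous_intros bounded_continuous_image regular_continuous(5)[OF assms])
  moreover have "En \<kappa> n t \<omega> = exp (- \<kappa> * (LINT s:{0..t}|lborel. (fn n s \<omega>)\<^sup>2))" if "t \<in> {0..T}" for n t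
  proof -
    interpret sp: step_path "k n" "p n" "\<lambda>i. \<xi> n i \<omega>" "\<lambda>t. W t \<omega>" T s0 \<delta> \<kappa>
      by (rule simple_ito.step_path[OF simple_ito_0 regular_continuous(1)[OF assms]])
    show ?thesis using sp.A_eq_integral[OF that]
      by (simp add: simple_ito.E_def[OF simple_ito_0] sp.A_def simple_value_eq)
  qed
  ultimately show ?thesis unfolding disc_def
    by (subst uniform_limit_cong'[where g = "\<lambda>n t. exp (- \<kappa> * (LINT s:{0..t}|lborel. (fn n s \<omega>)\<^sup>2))"]) auto
qed

lemma limit_compose:
  assumes "regular \<omega>" "continuous_on UNIV G"
  shows "uniform_limit {0..T} (\<lambda>n t. En \<kappa> n t \<omega> * G (Zn n t \<omega>)) (\<lambda>t. disc \<kappa> t \<omega> * G (S t \<omega>)) sequentially"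
    "continuous_on {0..T} (\<lambda>t. En \<kappa> n t \<omega> * G (Zn n t \<omega>))" "continuous_on {0..T} (\<lambda>t. disc \<kappa> t \<omega> * G (S t \<omega>))"
proof -
  note c = regular_continuous[OF assms(1)]
  have GS: "continuous_on {0..T} (\<lambda>t. G (S t \<omega>))" by (rule continuous_on_compose2[OF assms(2) c(4)]) auto
  have "continuous_on {0..T} (\<lambda>t. G (Zn n t \<omega>))" by (rule continuous_on_compose2[OF assms(2) c(2)]) auto
  then show "continuous_on {0..T} (\<lambda>t. En \<kappa> n t \<omega> * G (Zn n t \<omega>))"
    by (intro continuous_on_mult c)
  show "continuous_on {0..T} (\<lambda>t. disc \<kappa> t \<omega> * G (S t \<omega>))" by (intro continuous_on_mult c GS)
  show "uniform_limit {0..T} (\<lambda>n t. En \<kappa> n t \<omega> * G (Zn n t \<omega>)) (\<lambda>t. disc \<kappa> t \<omega> * G (S t \<omega>)) sequentially"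
    by (rule uniform_lim_mult[OF limit_E[OF assms(1)]
          uniform_limit_continuous_compose[OF limit_Z[OF assms(1)] bounded_continuous_image[OF c(4)] assms(2)]
          bounded_continuous_image[OF c(6)] bounded_continuous_image[OF GS]])
qed

lemma limit_square_integral:
  assumes "regular \<omega>" "continuous_on UNIV G"
  shows "uniform_limit {0..T} (\<lambda>n t. LINT s:{0..t}|lborel. En \<kappa> n s \<omega> * G (Zn n s \<omega>) * (fn n s \<omega>)\<^sup>2)
    (\<lambda>t. LINT s:{0..t}|lborel. disc \<kappa> s \<omega> * G (S s \<omega>) * (2 * sqrt \<bar>S s \<omega>\<bar>)\<^sup>2) sequentially"
    "set_integrable lborel {0..T} (\<lambda>s. En \<kappa> n s \<omega> * G (Zn n s \<omega>) * (fn n s \<omega>)\<^sup>2)"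
    "(\<lambda>n. \<integral>\<^sup>+ s\<in>{0..T}. ennreal ((En \<kappa> n s \<omega> * G (Zn n s \<omega>) * fn n s \<omega> - disc \<kappa> s \<omega> * G (S s \<omega>) * (2 * sqrt \<bar>S s \<omega>\<bar>))\<^sup>2) \<partial>lborel) \<longlonglongrightarrow> 0"
proof -
  interpret l2_limit T "\<lambda>n s. fn n s \<omega>" "\<lambda>s. 2 * sqrt \<bar>S s \<omega>\<bar>"
    "\<lambda>n t. En \<kappa> n t \<omega> * G (Zn n t \<omega>)" "\<lambda>t. disc \<kappa> t \<omega> * G (S t \<omega>)"
    by (rule regular_l2_limit[OF assms(1) limit_compose(2)[OF assms] limit_compose(3)[OF assms] limit_compose(1)[OF assms]])
  show "uniform_limit {0..T} (\<lambda>n t. LINT s:{0..t}|lborel. En \<kappa> n s \<omega> * G (Zn n s \<omega>) * (fn n s \<omega>)\<^sup>2)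
    (\<lambda>t. LINT s:{0..t}|lborel. disc \<kappa> s \<omega> * G (S s \<omega>) * (2 * sqrt \<bar>S s \<omega>\<bar>)\<^sup>2) sequentially"
    by (rule integral_square_uniform_limit)
  show "set_integrable lborel {0..T} (\<lambda>s. En \<kappa> n s \<omega> * G (Zn n s \<omega>) * (fn n s \<omega>)\<^sup>2)"
    by (rule integrable_af[OF a])
  show "(\<lambda>n. \<integral>\<^sup>+ s\<in>{0..T}. ennreal ((En \<kappa> n s \<omega> * G (Zn n s \<omega>) * fn n s \<omega> - disc \<kappa> s \<omega> * G (S s \<omega>) * (2 * sqrt \<bar>S s \<omega>\<bar>))\<^sup>2) \<partial>lborel) \<longlonglongrightarrow> 0"
    by (rule product_l2_limit)
qed

context
  fixes G G' G'' :: "real \<Rightarrow> real"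
  assumes G: "\<And>s. (G has_real_derivative G' s) (at s)" "\<And>s. (G' has_real_derivative G'' s) (at s)"
    "continuous_on UNIV G''"
begin

lemma cont_G: "continuous_on UNIV G" "continuous_on UNIV G'"
  using G by (auto intro!: DERIV_continuous_on)

abbreviation Yn :: "real \<Rightarrow> nat \<Rightarrow> real \<Rightarrow> 'a \<Rightarrow> real" where
  "Yn \<kappa> n \<equiv> simple_ito.Y W (k n) (p n) (\<xi> n) s0 \<delta> \<kappa> G G' G''"

lemma Yn_eq:
  assumes "regular \<omega>" "t \<in> {0..T}"
  shows "Yn \<kappa> n t \<omega> = En \<kappa> n t \<omega> * G (Zn n t \<omega>) - G s0 - ((LINT s:{0..t}|lborel. En \<kappa> n s \<omega> * (\<delta> * G' (Zn n s \<omega>)))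
     + (LINT s:{0..t}|lborel. En \<kappa> n s \<omega> * (G'' (Zn n s \<omega>) / 2 - \<kappa> * G (Zn n s \<omega>)) * (fn n s \<omega>)\<^sup>2))"
proof -
  have c1: "continuous_on UNIV (\<lambda>x. \<delta> * G' x)" by (intro continuous_intros cont_G)
  have c2: "continuous_on UNIV (\<lambda>x. G'' x / 2 - \<kappa> * G x)" by (intro continuous_intros cont_G G) auto
  have i1: "set_integrable lborel {0..t} (\<lambda>s. En \<kappa> n s \<omega> * (\<delta> * G' (Zn n s \<omega>)))"
    by (rule set_integrable_subset[OF borel_integrable_atLeastAtMost'[OF limit_compose(2)[OF assms(1) c1]]]) (use assms in auto)
  have i2: "set_integrable lborel {0..t} (\<lambda>s. En \<kappa> n s \<omega> * (G'' (Zn n s \<omega>) / 2 - \<kappa> * G (Zn n s \<omega>)) * (fn n s \<omega>)\<^sup>2)"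
    by (rule set_integrable_subset[OF limit_square_integral(2)[OF assms(1) c2]]) (use assms in auto)
  show ?thesis
    unfolding simple_ito.Y_def[OF simple_ito[OF G]] mult.assoc[of _ \<delta>]
    by (subst set_integral_add(2)[OF i1 i2]) simp
qed

lemma limit_Y:
  assumes "regular \<omega>"
  shows "uniform_limit {0..T} (\<lambda>n t. Yn \<kappa> n t \<omega>) (\<lambda>t. limitY \<kappa> G G' G'' t \<omega>) sequentially"
proof -
  have c1: "continuous_on UNIV (\<lambda>x. \<delta> * G' x)" by (intro continuous_intros cont_G)
  have c2: "continuous_on UNIV (\<lambda>x. G'' x / 2 - \<kappa> * G x)" by (intro continuous_intros cont_G G) auto
  have "uniform_limit {0..T} (\<lambda>n t. En \<kappa> n t \<omega> * G (Zn n t \<omega>) - G s0 - ((LINT s:{0..t}|lborel. En \<kappa> n s \<omega> * (\<delta> * G' (Zn n s \<omega>)))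
     + (LINT s:{0..t}|lborel. En \<kappa> n s \<omega> * (G'' (Zn n s \<omega>) / 2 - \<kappa> * G (Zn n s \<omega>)) * (fn n s \<omega>)\<^sup>2)))
     (\<lambda>t. disc \<kappa> t \<omega> * G (S t \<omega>) - G s0 - ((LINT s:{0..t}|lborel. disc \<kappa> s \<omega> * (\<delta> * G' (S s \<omega>)))
      + (LINT s:{0..t}|lborel. disc \<kappa> s \<omega> * (G'' (S s \<omega>) / 2 - \<kappa> * G (S s \<omega>)) * (2 * sqrt \<bar>S s \<omega>\<bar>)\<^sup>2))) sequentially"
    by (intro uniform_limit_minus uniform_limit_add uniform_limit_const limit_compose[OF assms cont_G(1)]
        set_integral_uniform_limit limit_compose[OF assms c1] limit_square_integral[OF assms c2] less_imp_le[OF T])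
  then show ?thesis
    unfolding limitY_def by (subst uniform_limit_cong'[OF Yn_eq[OF assms] refl]) (simp_all add: mult.assoc)
qed

text \<open>The case \<kappa> = 0, where the discount is identically 1. On every regular path both
  the integrands and the right-hand sides converge, and \<open>ito_approx_closed\<close> does the
  rest.\<close>

lemma ito_formula: "ito_approx (\<lambda>t \<omega>. G' (S t \<omega>) * (2 * sqrt \<bar>S t \<omega>\<bar>)) (limitY 0 G G' G'')"
proof (rule ito_approx_closed)
  note si = simple_ito[OF G]
  show "ito_approx (\<lambda>t \<omega>. (if \<omega> \<in> good then En 0 n t \<omega> * G' (Zn n t \<omega>) else 0) * fn n t \<omega>) (Yn 0 n)" for n
    by (rule simple_ito.ito_approx_simple[OF si])
  show "joint (\<lambda>t \<omega>. (if \<omega> \<in> good then En 0 n t \<omega> * G' (Zn n t \<omega>) else 0) * fn n t \<omega>)" for n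
    by (rule simple_ito.joint_coefficient[OF si cont_G(2)])
  show "joint (\<lambda>t \<omega>. G' (S t \<omega>) * (2 * sqrt \<bar>S t \<omega>\<bar>))"
  proof (rule joint_continuous)
    show "(\<lambda>\<omega>. G' (S t \<omega>) * (2 * sqrt \<bar>S t \<omega>\<bar>)) \<in> borel_measurable (completion M)" if "t \<in> {0..T}" for t
      using F_measurable_completion[OF S_measurable[OF that]]
      by (intro comp_measurable[where g = "\<lambda>x. G' x * (2 * sqrt \<bar>x\<bar>)"] continuous_intros cont_G)
    show "continuous_on {0..T} (\<lambda>t. G' (S t \<omega>) * (2 * sqrt \<bar>S t \<omega>\<bar>))" if "\<omega> \<in> space M" for \<omega>
      by (intro continuous_intros S_path that continuous_on_compose2[OF cont_G(2) S_path]) auto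
  qed
  show "Yn 0 n t \<in> borel_measurable (completion M)" if "t \<in> {0..T}" for n t
    by (rule simple_ito.Y_measurable[OF si that])
  show "AE \<omega> in completion M. continuous_on {0..T} (\<lambda>t. Yn 0 n t \<omega>)" for n
    by (rule simple_ito.AE_continuous_Y[OF si])
  show "AE \<omega> in completion M. (\<lambda>n. l2_dist (\<lambda>t \<omega>. (if \<omega> \<in> good then En 0 n t \<omega> * G' (Zn n t \<omega>) else 0) * fn n t \<omega>)
        (\<lambda>t \<omega>. G' (S t \<omega>) * (2 * sqrt \<bar>S t \<omega>\<bar>)) \<omega>) \<longlonglongrightarrow> 0 \<and>
      uniform_limit {0..T} (\<lambda>n t. Yn 0 n t \<omega>) (\<lambda>t. limitY 0 G G' G'' t \<omega>) sequentially"
    using AE_regular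
  proof eventually_elim
    case (elim \<omega>)
    then have "\<omega> \<in> good" by (simp add: regular_def)
    moreover have "disc 0 t \<omega> = 1" for t by (simp add: disc_def)
    ultimately show ?case
      using limit_square_integral(3)[OF elim cont_G(2), of 0] limit_Y[OF elim] by (simp add: l2_dist_def)
  qed
qed

end

end

lemma (in besq) obtain_approx:
  obtains k p \<xi> where "besq_approx M T W \<delta> s0 S k p \<xi>"
proof -
  obtain \<Phi> where \<Phi>: "\<And>n. is_simple_process F T (\<Phi> n)"
    "AE \<omega> in completion M. (\<lambda>n. l2_dist (simple_value (\<Phi> n)) (\<lambda>t \<omega>. 2 * sqrt \<bar>S t \<omega>\<bar>) \<omega>) \<longlonglongrightarrow> 0 \<and>
       uniform_limit {0..T} (\<lambda>n t. simple_integral_W W (\<Phi> n) t \<omega>) (\<lambda>t. S t \<omega> - s0 - \<delta> * t) sequentially"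
    using has_ito_integral_imp_ito_approx[OF S_ito] unfolding ito_approx_def by (elim exE conjE) auto
  define k where "k n = fst (pad (\<Phi> n))" for n
  define p where "p n = fst (snd (pad (\<Phi> n)))" for n
  define \<xi> where "\<xi> n = snd (snd (pad (\<Phi> n)))" for n
  have *: "is_simple_process F T (k n, p n, \<xi> n) \<and> p n 0 = 0 \<and> p n (k n) = T \<and>
    simple_value (k n, p n, \<xi> n) = simple_value (\<Phi> n) \<and> simple_integral_W W (k n, p n, \<xi> n) = simple_integral_W W (\<Phi> n)" for n
    by (rule pad[OF \<Phi>(1)[of n]]) (simp add: k_def p_def \<xi>_def)
  show thesis
    by (rule that[of k p \<xi>], unfold_locales) (use * \<Phi>(2) in auto)
qed

section \<open>Non-negativity\<close>

lemma measurable_set_integral: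
  fixes H :: "real \<Rightarrow> 'a \<Rightarrow> real"
  assumes "(\<lambda>(s, \<omega>). H s \<omega>) \<in> borel_measurable (restrict_space borel {0..t} \<Otimes>\<^sub>M Q)"
  shows "(\<lambda>\<omega>. LINT s:{0..t}|lborel. H s \<omega>) \<in> borel_measurable Q"
proof -
  interpret R: sigma_finite_measure "restrict_space lborel {0..t::real}"
    by (rule sigma_finite_measure_restrict_space[OF lborel.sigma_finite_measure_axioms]) simp
  have eq: "sets (restrict_space lborel {0..t} \<Otimes>\<^sub>M Q) = sets (restrict_space borel {0..t} \<Otimes>\<^sub>M Q)"
    by (intro sets_pair_measure_cong) (auto simp: sets_restrict_space)
  have "(\<lambda>(s, \<omega>). H s \<omega>) \<in> borel_measurable (restrict_space lborel {0..t} \<Otimes>\<^sub>M Q)"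
    using assms by (simp add: measurable_cong_sets[OF eq refl])
  from measurable_pair_swap[OF this]
  have "(\<lambda>(\<omega>, s). H s \<omega>) \<in> borel_measurable (Q \<Otimes>\<^sub>M restrict_space lborel {0..t})" by simp
  then have "(\<lambda>\<omega>. \<integral>s. H s \<omega> \<partial>restrict_space lborel {0..t}) \<in> borel_measurable Q"
    by (rule R.borel_measurable_lebesgue_integral)
  then show ?thesis by (simp add: integral_restrict_space set_lebesgue_integral_def)
qed

lemma (in bm_setting) joint_set_integral:
  assumes "joint H" "t \<in> {0..T}"
  shows "(\<lambda>\<omega>. LINT s:{0..t}|lborel. H s \<omega>) \<in> borel_measurable (completion M)"
proof -
  have "(\<lambda>q. (fst q, snd q)) \<in> restrict_space borel {0..t} \<Otimes>\<^sub>M completion M \<rightarrow>\<^sub>M restrict_space borel {0..T} \<Otimes>\<^sub>M completion M"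
  proof (rule measurable_Pair)
    have "fst \<in> borel_measurable (restrict_space borel {0..t} \<Otimes>\<^sub>M completion M)"
      using measurable_fst[of "restrict_space borel {0..t}" "completion M"] by (metis measurable_restrict_space2_iff)
    then show "fst \<in> restrict_space borel {0..t} \<Otimes>\<^sub>M completion M \<rightarrow>\<^sub>M restrict_space borel {0..T}"
      using assms(2) by (intro measurable_restrict_space2) (auto simp: space_pair_measure space_restrict_space)
  qed (rule measurable_snd)
  from measurable_compose[OF this assms(1)[unfolded joint_def]]
  show ?thesis by (intro measurable_set_integral) (simp add: case_prod_beta')
qed

section \<open>Expectation bounds under the discount\<close>

context besq_approx
begin

text \<open>Ito's formula for the constant function 1 with \<kappa> = 1: its derivative is 0, so the
  stochastic integral vanishes and the discounted integral of \<phi>^2 equals 1 minus the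
  discount.\<close>

lemma AE_discounted_clock:
  assumes t: "t \<in> {0..T}"
  shows "AE \<omega> in completion M. \<forall>n. (LINT s:{0..t}|lborel. En 1 n s \<omega> * (fn n s \<omega>)\<^sup>2) \<le> 1"
proof -
  have "AE \<omega> in completion M. (LINT s:{0..t}|lborel. En 1 n s \<omega> * (fn n s \<omega>)\<^sup>2) \<le> 1" for n
  proof -
    interpret one: simple_ito M T W "k n" "p n" "\<xi> n" s0 \<delta> 1 "\<lambda>_. 1" "\<lambda>_. 0" "\<lambda>_. 0"
      by (rule simple_ito) auto
    have zero: "simple_integral_W W (one.\<Psi> m) t \<omega> = 0" for m \<omega>
      by (simp add: one.\<Psi>_def simple_integral_eq step_int_def)
    show ?thesis
      using one.AE_ito
    proof eventually_elim
      case (elim \<omega>)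
      have "(\<lambda>m. simple_integral_W W (one.\<Psi> m) t \<omega>) \<longlonglongrightarrow> one.Y t \<omega>"
        using tendsto_uniform_limitI[OF conjunct1[OF elim] t] .
      then have "one.Y t \<omega> = 0" using zero LIMSEQ_unique[OF _ tendsto_const] by simp
      then have "En 1 n t \<omega> - 1 + (LINT s:{0..t}|lborel. En 1 n s \<omega> * (fn n s \<omega>)\<^sup>2) = 0"
        by (simp add: one.Y_def set_lebesgue_integral_def)
      moreover have "0 \<le> En 1 n t \<omega>" by (simp add: one.E_def)
      ultimately show ?case by linarith
    qed
  qed
  then show ?thesis by (simp add: AE_all_countable)
qed

text \<open>The discount \<open>exp (- \<integral>\<phi>\<^sup>2)\<close> makes \<open>\<integral>exp (- \<integral>\<phi>\<^sup>2) \<phi>\<^sup>2\<close> bounded by \<open>1\<close>, so that expectations pass to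
  the limit although the approximating coefficients \<open>\<phi>\<close> are not uniformly integrable.\<close>

lemma expectation_bound:
  assumes G: "\<And>s. (G has_real_derivative G' s) (at s)" "\<And>s. (G' has_real_derivative G'' s) (at s)"
    "continuous_on UNIV G''"
    and sign: "\<And>s. 0 \<le> G s" "\<And>s. G' s \<le> 0" "\<And>s. 0 \<le> G'' s" "G s0 = 0" "0 \<le> \<delta>"
    and bdd: "\<And>s. \<bar>G' s\<bar> \<le> B1" "\<And>s. G'' s \<le> B2"
    and t: "t \<in> {0..T}"
  shows "(\<integral>\<^sup>+\<omega>. ennreal (disc 1 t \<omega> * G (S t \<omega>)) \<partial>completion M) \<le>
    ennreal (\<integral>\<omega>. (LINT s:{0..t}|lborel. disc 1 s \<omega> * (G'' (S s \<omega>) / 2) * (2 * sqrt \<bar>S s \<omega>\<bar>)\<^sup>2) \<partial>completion M)"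
proof -
  note si = simple_ito[OF G]
  note cG = cont_G[OF G]
  have c2: "continuous_on UNIV (\<lambda>x. G'' x / 2)" by (intro continuous_intros G) auto
  define R where "R n \<omega> = (LINT s:{0..t}|lborel. En 1 n s \<omega> * (G'' (Zn n s \<omega>) / 2) * (fn n s \<omega>)\<^sup>2)" for n \<omega>
  define R' where "R' \<omega> = (LINT s:{0..t}|lborel. disc 1 s \<omega> * (G'' (S s \<omega>) / 2) * (2 * sqrt \<bar>S s \<omega>\<bar>)\<^sup>2)" for \<omega>
  \<comment> \<open>Adding the second-order term \<open>R n\<close> to the mean-zero
    \<open>Yn\<close> leaves E G(Z), minus the drift term with G' \<le> 0, plus the discount term
    with G \<ge> 0. Hence \<open>X n\<close> dominates E G(Z) and has the same mean as
    \<open>R n\<close>.\<close>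
  define X where "X n \<omega> = Yn G G' G'' 1 n t \<omega> + R n \<omega>" for n \<omega>
  have E0: "0 \<le> En 1 n s \<omega>" for n s \<omega> by (simp add: simple_ito.E_def[OF si])
  have B2: "0 \<le> B2" using sign(3)[of 0] bdd(2)[of 0] by linarith
  have R_meas: "R n \<in> borel_measurable (completion M)" for n
  proof (rule completion.measurable_AE_eq)
    have "joint (\<lambda>s \<omega>. ((if \<omega> \<in> good then En 1 n s \<omega> * (G'' (Zn n s \<omega>) / 2) else 0) * fn n s \<omega>) * fn n s \<omega>)"
      by (rule joint_binary[where f = "(*)", OF simple_ito.joint_coefficient[OF si c2] joint_simple_value[OF simple]]) measurable
    then show "(\<lambda>\<omega>. LINT s:{0..t}|lborel. ((if \<omega> \<in> good then En 1 n s \<omega> * (G'' (Zn n s \<omega>) / 2) else 0) * fn n s \<omega>) * fn n s \<omega>)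
      \<in> borel_measurable (completion M)"
      by (rule joint_set_integral[OF _ t])
    show "AE \<omega> in completion M. (LINT s:{0..t}|lborel. ((if \<omega> \<in> good then En 1 n s \<omega> * (G'' (Zn n s \<omega>) / 2) else 0) * fn n s \<omega>) * fn n s \<omega>) = R n \<omega>"
      using AE_good by eventually_elim (simp add: R_def power2_eq_square mult.assoc)
  qed auto
  have R_bound: "AE \<omega> in completion M. \<forall>n. 0 \<le> R n \<omega> \<and> R n \<omega> \<le> B2 / 2"
    using AE_discounted_clock[OF t] AE_regular
  proof eventually_elim
    case (elim \<omega>)
    show ?case
    proof (intro allI conjI)
      fix n
      show "0 \<le> R n \<omega>"
        unfolding R_def set_lebesgue_integral_def using E0 sign(3)
        by (intro integral_nonneg_AE AE_I2) (auto simp: indicator_def)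
      have i1: "set_integrable lborel {0..t} (\<lambda>s. En 1 n s \<omega> * (G'' (Zn n s \<omega>) / 2) * (fn n s \<omega>)\<^sup>2)"
        by (rule set_integrable_subset[OF limit_square_integral(2)[OF elim(2) c2]]) (use t in auto)
      have i2: "set_integrable lborel {0..t} (\<lambda>s. En 1 n s \<omega> * (B2 / 2) * (fn n s \<omega>)\<^sup>2)"
        by (rule set_integrable_subset[OF limit_square_integral(2)[OF elim(2), of "\<lambda>_. B2 / 2"]]) (use t in auto)
      have "R n \<omega> \<le> (LINT s:{0..t}|lborel. En 1 n s \<omega> * (B2 / 2) * (fn n s \<omega>)\<^sup>2)"
        unfolding R_def using E0 bdd(2)
        by (intro set_integral_mono i1 i2 mult_right_mono mult_left_mono) auto
      also have "\<dots> = (LINT s:{0..t}|lborel. (B2 / 2) * (En 1 n s \<omega> * (fn n s \<omega>)\<^sup>2))"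
        by (simp add: mult_ac)
      also have "\<dots> = B2 / 2 * (LINT s:{0..t}|lborel. En 1 n s \<omega> * (fn n s \<omega>)\<^sup>2)"
        by (rule set_integral_mult_right)
      also have "\<dots> \<le> B2 / 2 * 1" using elim(1) B2 by (intro mult_left_mono) auto
      finally show "R n \<omega> \<le> B2 / 2" by simp
    qed
  qed
  have R_lim: "AE \<omega> in completion M. (\<lambda>n. R n \<omega>) \<longlonglongrightarrow> R' \<omega>"
    using AE_regular
  proof eventually_elim
    case (elim \<omega>)
    show ?case unfolding R_def R'_def by (rule tendsto_uniform_limitI[OF limit_square_integral(1)[OF elim c2] t])
  qed
  have R'_meas: "R' \<in> borel_measurable (completion M)"
  proof (rule completion.measurable_AE_eq)
    show "(\<lambda>\<omega>. lim (\<lambda>n. R n \<omega>)) \<in> borel_measurable (completion M)" using R_meas by measurable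
    show "AE \<omega> in completion M. lim (\<lambda>n. R n \<omega>) = R' \<omega>" using R_lim by eventually_elim (rule limI)
  qed auto
  have ER: "(\<lambda>n. \<integral>\<omega>. R n \<omega> \<partial>completion M) \<longlonglongrightarrow> (\<integral>\<omega>. R' \<omega> \<partial>completion M)"
  proof (rule integral_dominated_convergence[OF R'_meas R_meas _ R_lim, where w = "\<lambda>_. B2 / 2"])
    show "AE \<omega> in completion M. norm (R n \<omega>) \<le> B2 / 2" for n
      using R_bound by eventually_elim auto
  qed simp
  have R_int: "integrable (completion M) (R n)" for n
    by (rule N.integrable_const_bound[where B = "B2 / 2"]) (use R_bound R_meas in auto)
  have X_ge: "AE \<omega> in completion M. \<forall>n. 0 \<le> En 1 n t \<omega> * G (Zn n t \<omega>) \<and> En 1 n t \<omega> * G (Zn n t \<omega>) \<le> X n \<omega>"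
    using AE_regular
  proof eventually_elim
    case (elim \<omega>)
    show ?case
    proof
      fix n
      have i1: "set_integrable lborel {0..t} (\<lambda>s. En 1 n s \<omega> * (G'' (Zn n s \<omega>) / 2) * (fn n s \<omega>)\<^sup>2)"
        by (rule set_integrable_subset[OF limit_square_integral(2)[OF elim c2]]) (use t in auto)
      have i2: "set_integrable lborel {0..t} (\<lambda>s. En 1 n s \<omega> * G (Zn n s \<omega>) * (fn n s \<omega>)\<^sup>2)"
        by (rule set_integrable_subset[OF limit_square_integral(2)[OF elim cG(1)]]) (use t in auto)
      have "(LINT s:{0..t}|lborel. En 1 n s \<omega> * (G'' (Zn n s \<omega>) / 2 - 1 * G (Zn n s \<omega>)) * (fn n s \<omega>)\<^sup>2)
        = (LINT s:{0..t}|lborel. En 1 n s \<omega> * (G'' (Zn n s \<omega>) / 2) * (fn n s \<omega>)\<^sup>2 - En 1 n s \<omega> * G (Zn n s \<omega>) * (fn n s \<omega>)\<^sup>2)"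
        by (simp add: algebra_simps)
      also have "\<dots> = R n \<omega> - (LINT s:{0..t}|lborel. En 1 n s \<omega> * G (Zn n s \<omega>) * (fn n s \<omega>)\<^sup>2)"
        unfolding R_def by (rule set_integral_diff(2)[OF i1 i2])
      finally have "X n \<omega> = En 1 n t \<omega> * G (Zn n t \<omega>) - (LINT s:{0..t}|lborel. En 1 n s \<omega> * (\<delta> * G' (Zn n s \<omega>)))
        + (LINT s:{0..t}|lborel. En 1 n s \<omega> * G (Zn n s \<omega>) * (fn n s \<omega>)\<^sup>2)"
        unfolding X_def Yn_eq[OF G elim t] using sign(4) by simp
      moreover have "0 \<le> (LINT s:{0..t}|lborel. En 1 n s \<omega> * G (Zn n s \<omega>) * (fn n s \<omega>)\<^sup>2)"
        unfolding set_lebesgue_integral_def using E0 sign(1)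
        by (intro integral_nonneg_AE AE_I2) (auto simp: indicator_def)
      moreover have "0 \<le> (LINT s:{0..t}|lborel. - (En 1 n s \<omega> * (\<delta> * G' (Zn n s \<omega>))))"
        unfolding set_lebesgue_integral_def using E0 sign(2,5)
        by (intro integral_nonneg_AE AE_I2) (auto simp: indicator_def intro!: mult_nonneg_nonneg mult_nonneg_nonpos)
      then have "(LINT s:{0..t}|lborel. En 1 n s \<omega> * (\<delta> * G' (Zn n s \<omega>))) \<le> 0"
        by (simp add: set_lebesgue_integral_def)
      moreover have "0 \<le> En 1 n t \<omega> * G (Zn n t \<omega>)" using E0 sign(1) by simp
      ultimately show "0 \<le> En 1 n t \<omega> * G (Zn n t \<omega>) \<and> En 1 n t \<omega> * G (Zn n t \<omega>) \<le> X n \<omega>" by linarith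
    qed
  qed
  have X_int: "integrable (completion M) (X n)" "(\<integral>\<omega>. X n \<omega> \<partial>completion M) = (\<integral>\<omega>. R n \<omega> \<partial>completion M)" for n
    using simple_ito.expectation_Y[OF si bdd(1) zero_le_one t] R_int[of n]
    unfolding X_def by simp_all
  have m: "(\<lambda>\<omega>. ennreal (En 1 n t \<omega> * G (Zn n t \<omega>))) \<in> borel_measurable (completion M)" for n
  proof -
    have [measurable]: "En 1 n t \<in> borel_measurable (completion M)" "(\<lambda>\<omega>. G (Zn n t \<omega>)) \<in> borel_measurable (completion M)"
      using F_measurable_completion[OF simple_ito.E_measurable[OF si t]]
        comp_measurable[OF cG(1) F_measurable_completion[OF simple_ito.Z_measurable[OF si t]]] by auto
    show ?thesis by measurable
  qed
  \<comment> \<open>Fatou on the left, where only non-negativity is at hand. On the right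
    \<open>R n\<close> is bounded by \<open>B2 / 2\<close>, so its means converge.\<close>
  have "(\<integral>\<^sup>+\<omega>. ennreal (disc 1 t \<omega> * G (S t \<omega>)) \<partial>completion M) =
    (\<integral>\<^sup>+\<omega>. liminf (\<lambda>n. ennreal (En 1 n t \<omega> * G (Zn n t \<omega>))) \<partial>completion M)"
  proof (rule nn_integral_cong_AE)
    show "AE \<omega> in completion M. ennreal (disc 1 t \<omega> * G (S t \<omega>)) = liminf (\<lambda>n. ennreal (En 1 n t \<omega> * G (Zn n t \<omega>)))"
      using AE_regular
    proof eventually_elim
      case (elim \<omega>)
      have "(\<lambda>n. ennreal (En 1 n t \<omega> * G (Zn n t \<omega>))) \<longlonglongrightarrow> ennreal (disc 1 t \<omega> * G (S t \<omega>))"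
        by (intro tendsto_ennrealI tendsto_uniform_limitI[OF limit_compose(1)[OF elim cG(1)] t])
      then show ?case by (rule lim_imp_Liminf[OF sequentially_bot, symmetric])
    qed
  qed
  also have "\<dots> \<le> liminf (\<lambda>n. \<integral>\<^sup>+\<omega>. ennreal (En 1 n t \<omega> * G (Zn n t \<omega>)) \<partial>completion M)"
    by (rule nn_integral_liminf[OF m])
  also have "\<dots> \<le> liminf (\<lambda>n. ennreal (\<integral>\<omega>. R n \<omega> \<partial>completion M))"
  proof (rule Liminf_mono, intro always_eventually allI)
    fix n
    have "(\<integral>\<^sup>+\<omega>. ennreal (En 1 n t \<omega> * G (Zn n t \<omega>)) \<partial>completion M) \<le> (\<integral>\<^sup>+\<omega>. ennreal (X n \<omega>) \<partial>completion M)"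
      by (rule nn_integral_mono_AE) (use X_ge in \<open>eventually_elim, auto intro: ennreal_leI\<close>)
    also have "\<dots> = ennreal (\<integral>\<omega>. X n \<omega> \<partial>completion M)"
    proof (rule nn_integral_eq_integral[OF X_int(1)])
      show "AE \<omega> in completion M. 0 \<le> X n \<omega>"
        using X_ge by eventually_elim (meson order_trans)
    qed
    finally show "(\<integral>\<^sup>+\<omega>. ennreal (En 1 n t \<omega> * G (Zn n t \<omega>)) \<partial>completion M) \<le> ennreal (\<integral>\<omega>. R n \<omega> \<partial>completion M)"
      by (simp add: X_int(2))
  qed
  also have "\<dots> = ennreal (\<integral>\<omega>. R' \<omega> \<partial>completion M)"
    by (rule lim_imp_Liminf[OF sequentially_bot tendsto_ennrealI[OF ER]])
  finally show ?thesis unfolding R'_def .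
qed

end

section \<open>Gluing smooth functions, and an approximation of the negative part\<close>

lemma has_real_derivative_glue:
  fixes f g f' g' :: "real \<Rightarrow> real"
  assumes f: "\<And>s. s \<le> c \<Longrightarrow> (f has_real_derivative f' s) (at s)"
    and g: "\<And>s. c \<le> s \<Longrightarrow> (g has_real_derivative g' s) (at s)"
    and eq: "f c = g c" "f' c = g' c"
  shows "((\<lambda>s. if s < c then f s else g s) has_real_derivative (if s < c then f' s else g' s)) (at s)"
proof -
  consider "s < c" | "s > c" | "s = c" by linarith
  then show ?thesis
  proof cases
    case 1
    have "((\<lambda>s. if s < c then f s else g s) has_real_derivative f' s) (at s)"
      by (rule has_field_derivative_transform_within_open[OF f, of s "{..<c}"]) (use 1 in auto)
    then show ?thesis using 1 by simp
  next
    case 2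
    have "((\<lambda>s. if s < c then f s else g s) has_real_derivative g' s) (at s)"
      by (rule has_field_derivative_transform_within_open[OF g, of s "{c<..}"]) (use 2 in auto)
    then show ?thesis using 2 by simp
  next
    case 3
    let ?h = "\<lambda>s. if s < c then f s else g s"
    have l: "((\<lambda>y. (f y - f c) / (y - c)) \<longlongrightarrow> g' c) (at c)" "((\<lambda>y. (g y - g c) / (y - c)) \<longlongrightarrow> g' c) (at c)"
      using f[of c] g[of c] eq by (auto simp: has_field_derivative_iff)
    have "((\<lambda>y. (?h y - ?h c) / (y - c)) \<longlongrightarrow> g' c) (at_left c)"
      by (rule Lim_transform_eventually[OF filterlim_at_split[THEN iffD1, OF l(1), THEN conjunct1]])
        (auto simp: eventually_at_left_field eq intro!: exI[of _ "c - 1"])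
    moreover have "((\<lambda>y. (?h y - ?h c) / (y - c)) \<longlongrightarrow> g' c) (at_right c)"
      by (rule Lim_transform_eventually[OF filterlim_at_split[THEN iffD1, OF l(2), THEN conjunct2]])
        (auto simp: eventually_at_right_field eq intro!: exI[of _ "c + 1"])
    ultimately have "((\<lambda>y. (?h y - ?h c) / (y - c)) \<longlongrightarrow> g' c) (at c)"
      by (simp add: filterlim_at_split)
    then show ?thesis using 3 by (simp add: has_field_derivative_iff)
  qed
qed

lemma continuous_on_glue:
  fixes f g :: "real \<Rightarrow> real"
  assumes "continuous_on {..c} f" "continuous_on {c..} g" "f c = g c"
  shows "continuous_on UNIV (\<lambda>s. if s < c then f s else g s)"
proof -
  have "continuous_on ({..c} \<union> {c..}) (\<lambda>s. if s < c then f s else g s)"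
  proof (rule continuous_on_closed_Un)
    show "continuous_on {..c} (\<lambda>s. if s < c then f s else g s)"
      by (rule continuous_on_eq[OF assms(1)]) (use assms(3) in auto)
    show "continuous_on {c..} (\<lambda>s. if s < c then f s else g s)"
      by (rule continuous_on_eq[OF assms(2)]) auto
  qed auto
  moreover have "{..c} \<union> {c..} = UNIV" by auto
  ultimately show ?thesis by simp
qed

text \<open>A \<open>C\<^sup>2\<close> approximation of the negative part; for \<open>s \<le> 0\<close> it equals \<open>(-s)\<^sup>3 / (\<epsilon> - s)\<^sup>2\<close>.\<close>

definition ramp :: "real \<Rightarrow> real \<Rightarrow> real" where
  "ramp \<epsilon> s = (if s < 0 then (\<epsilon> - s) - 3 * \<epsilon> + 3 * \<epsilon>\<^sup>2 * inverse (\<epsilon> - s) - \<epsilon> ^ 3 * (inverse (\<epsilon> - s))\<^sup>2 else 0)"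

definition ramp' :: "real \<Rightarrow> real \<Rightarrow> real" where
  "ramp' \<epsilon> s = (if s < 0 then - 1 + 3 * \<epsilon>\<^sup>2 * (inverse (\<epsilon> - s))\<^sup>2 - 2 * \<epsilon> ^ 3 * (inverse (\<epsilon> - s)) ^ 3 else 0)"

definition ramp'' :: "real \<Rightarrow> real \<Rightarrow> real" where
  "ramp'' \<epsilon> s = (if s < 0 then 6 * \<epsilon>\<^sup>2 * (inverse (\<epsilon> - s)) ^ 3 - 6 * \<epsilon> ^ 3 * (inverse (\<epsilon> - s)) ^ 4 else 0)"

context
  fixes \<epsilon> :: real
  assumes \<epsilon>: "0 < \<epsilon>"
begin

lemma inverse_shift_derivative:
  "s \<le> 0 \<Longrightarrow> ((\<lambda>s. inverse (\<epsilon> - s)) has_real_derivative (inverse (\<epsilon> - s))\<^sup>2) (at s)"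
  using \<epsilon> by (auto intro!: derivative_eq_intros simp: power2_eq_square)

lemma ramp_derivative: "(ramp \<epsilon> has_real_derivative ramp' \<epsilon> s) (at s)"
  unfolding ramp_def[abs_def] ramp'_def
proof (rule has_real_derivative_glue)
  fix s :: real assume "s \<le> 0"
  note d = inverse_shift_derivative[OF this]
  show "((\<lambda>s. (\<epsilon> - s) - 3 * \<epsilon> + 3 * \<epsilon>\<^sup>2 * inverse (\<epsilon> - s) - \<epsilon> ^ 3 * (inverse (\<epsilon> - s))\<^sup>2) has_real_derivative
      - 1 + 3 * \<epsilon>\<^sup>2 * (inverse (\<epsilon> - s))\<^sup>2 - 2 * \<epsilon> ^ 3 * (inverse (\<epsilon> - s)) ^ 3) (at s)"
    by (rule derivative_eq_intros d refl | simp)+ (simp add: eval_nat_numeral)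
qed (use \<epsilon> in \<open>auto simp: eval_nat_numeral field_simps\<close>)

lemma ramp'_derivative: "(ramp' \<epsilon> has_real_derivative ramp'' \<epsilon> s) (at s)"
  unfolding ramp'_def[abs_def] ramp''_def
proof (rule has_real_derivative_glue)
  fix s :: real assume "s \<le> 0"
  note d = inverse_shift_derivative[OF this]
  show "((\<lambda>s. - 1 + 3 * \<epsilon>\<^sup>2 * (inverse (\<epsilon> - s))\<^sup>2 - 2 * \<epsilon> ^ 3 * (inverse (\<epsilon> - s)) ^ 3) has_real_derivative
      6 * \<epsilon>\<^sup>2 * (inverse (\<epsilon> - s)) ^ 3 - 6 * \<epsilon> ^ 3 * (inverse (\<epsilon> - s)) ^ 4) (at s)"
    by (rule derivative_eq_intros d refl | simp)+ (simp add: eval_nat_numeral)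
qed (use \<epsilon> in \<open>auto simp: eval_nat_numeral field_simps\<close>)

lemma ramp''_continuous: "continuous_on UNIV (ramp'' \<epsilon>)"
  unfolding ramp''_def[abs_def]
  by (rule continuous_on_glue) (use \<epsilon> in \<open>auto intro!: continuous_intros simp: eval_nat_numeral\<close>)

text \<open>The definition is expanded in powers of 1 / (\<epsilon> - s), which suits
  differentiation; the factored forms here and below show signs and sizes.\<close>

lemma ramp_eq:
  assumes "s < 0"
  shows "ramp \<epsilon> s = (- s) ^ 3 * (inverse (\<epsilon> - s))\<^sup>2"
proof -
  have "(\<epsilon> - s) * inverse (\<epsilon> - s) = 1" using assms \<epsilon> by simp
  then have "(\<epsilon> - s) - 3 * \<epsilon> + 3 * \<epsilon>\<^sup>2 * inverse (\<epsilon> - s) - \<epsilon> ^ 3 * (inverse (\<epsilon> - s))\<^sup>2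
    = (- s) ^ 3 * (inverse (\<epsilon> - s))\<^sup>2" by algebra
  then show ?thesis using assms by (simp add: ramp_def)
qed

lemma ramp''_eq:
  assumes "s < 0"
  shows "ramp'' \<epsilon> s = 6 * \<epsilon>\<^sup>2 * (- s) * (inverse (\<epsilon> - s)) ^ 4"
proof -
  have "(\<epsilon> - s) * inverse (\<epsilon> - s) = 1" using assms \<epsilon> by simp
  then have "6 * \<epsilon>\<^sup>2 * (inverse (\<epsilon> - s)) ^ 3 - 6 * \<epsilon> ^ 3 * (inverse (\<epsilon> - s)) ^ 4
    = 6 * \<epsilon>\<^sup>2 * (- s) * (inverse (\<epsilon> - s)) ^ 4" by algebra
  then show ?thesis using assms by (simp add: ramp''_def)
qed

lemma ramp'_eq:
  assumes "s < 0"
  shows "ramp' \<epsilon> s = - ((1 - \<epsilon> / (\<epsilon> - s))\<^sup>2 * (1 + 2 * (\<epsilon> / (\<epsilon> - s))))"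
  using assms by (simp add: ramp'_def divide_inverse eval_nat_numeral algebra_simps)

lemma ramp_nonneg: "0 \<le> ramp \<epsilon> s"
proof (cases "s < 0")
  case True
  then have "0 \<le> (- s) ^ 3 * (inverse (\<epsilon> - s))\<^sup>2"
    using \<epsilon> by (intro mult_nonneg_nonneg zero_le_power) auto
  then show ?thesis using ramp_eq[OF True] by simp
qed (simp add: ramp_def)

lemma ramp'_bounds: "ramp' \<epsilon> s \<le> 0" "\<bar>ramp' \<epsilon> s\<bar> \<le> 3"
proof -
  have "ramp' \<epsilon> s \<le> 0 \<and> - 3 \<le> ramp' \<epsilon> s"
  proof (cases "s < 0")
    case True
    define a where "a = \<epsilon> / (\<epsilon> - s)"
    have a: "0 \<le> a" "a \<le> 1" using True \<epsilon> by (auto simp: a_def divide_le_eq_1)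
    have "0 \<le> (1 - a)\<^sup>2 * (1 + 2 * a)" using a by (intro mult_nonneg_nonneg) auto
    moreover have "(1 - a)\<^sup>2 * (1 + 2 * a) \<le> 1 * 3" using a by (intro mult_mono power_le_one) auto
    ultimately show ?thesis using ramp'_eq[OF True] by (simp add: a_def)
  qed (simp add: ramp'_def)
  then show "ramp' \<epsilon> s \<le> 0" "\<bar>ramp' \<epsilon> s\<bar> \<le> 3" by auto
qed

lemma ramp''_nonneg: "0 \<le> ramp'' \<epsilon> s"
proof (cases "s < 0")
  case True
  then have "0 \<le> 6 * \<epsilon>\<^sup>2 * (- s) * (inverse (\<epsilon> - s)) ^ 4"
    using \<epsilon> by (intro mult_nonneg_nonneg zero_le_power) auto
  then show ?thesis using ramp''_eq[OF True] by simp
qed (simp add: ramp''_def)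

lemma ramp''_bound: "ramp'' \<epsilon> s \<le> 6 / \<epsilon>"
proof (cases "s < 0")
  case True
  have "ramp'' \<epsilon> s \<le> 6 * \<epsilon>\<^sup>2 * (inverse (\<epsilon> - s)) ^ 3" using True \<epsilon> by (simp add: ramp''_def)
  also have "\<dots> \<le> 6 * \<epsilon>\<^sup>2 * (inverse \<epsilon>) ^ 3"
    using True \<epsilon> by (intro mult_left_mono power_mono le_imp_inverse_le) auto
  also have "\<dots> = 6 / \<epsilon>" using \<epsilon> by (simp add: eval_nat_numeral field_simps)
  finally show ?thesis .
qed (use \<epsilon> in \<open>simp add: ramp''_def\<close>)

text \<open>The point of the cubic factor: \<open>ramp''\<close> vanishes linearly at 0, so s^2
  appears in the numerator and is absorbed by two of the four powers of \<epsilon> - s. The result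
  is bounded uniformly in \<epsilon> and tends to 0 with \<epsilon> for each fixed \<open>s\<close>
  \<noteq> 0.\<close>

lemma weighted_ramp''_bound: "\<bar>s\<bar> * ramp'' \<epsilon> s \<le> 6 * (\<epsilon> / (\<epsilon> + \<bar>s\<bar>))\<^sup>2" "\<bar>s\<bar> * ramp'' \<epsilon> s \<le> 6"
proof -
  have a: "(\<epsilon> / (\<epsilon> + \<bar>s\<bar>))\<^sup>2 \<le> 1" using \<epsilon> by (intro power_le_one) auto
  show 1: "\<bar>s\<bar> * ramp'' \<epsilon> s \<le> 6 * (\<epsilon> / (\<epsilon> + \<bar>s\<bar>))\<^sup>2"
  proof (cases "s < 0")
    case True
    define v where "v = \<epsilon> - s"
    have v: "v > 0" "- s \<le> v" using True \<epsilon> by (auto simp: v_def)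
    have "\<bar>s\<bar> * ramp'' \<epsilon> s = 6 * \<epsilon>\<^sup>2 * (- s)\<^sup>2 / v ^ 4"
      using True ramp''_eq[OF True] by (simp add: v_def power2_eq_square divide_inverse power_inverse)
    also have "\<dots> \<le> 6 * \<epsilon>\<^sup>2 * v\<^sup>2 / v ^ 4"
      using v True by (intro divide_right_mono mult_left_mono power_mono) auto
    also have "\<dots> = 6 * (\<epsilon> / v)\<^sup>2" using v by (simp add: power_divide eval_nat_numeral)
    finally show ?thesis using True by (simp add: v_def)
  qed (simp add: ramp''_def)
  show "\<bar>s\<bar> * ramp'' \<epsilon> s \<le> 6" using 1 a by linarith
qed

end

lemma ramp_tendsto:
  assumes "\<And>n. 0 < \<epsilon> n" "\<epsilon> \<longlonglongrightarrow> 0"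
  shows "(\<lambda>n. ramp (\<epsilon> n) s) \<longlonglongrightarrow> max (- s) 0"
proof (cases "s < 0")
  case True
  have "(\<lambda>n. (\<epsilon> n - s) - 3 * \<epsilon> n + 3 * (\<epsilon> n)\<^sup>2 * inverse (\<epsilon> n - s) - (\<epsilon> n) ^ 3 * (inverse (\<epsilon> n - s))\<^sup>2) \<longlonglongrightarrow>
    (0 - s) - 3 * 0 + 3 * 0\<^sup>2 * inverse (0 - s) - 0 ^ 3 * (inverse (0 - s))\<^sup>2"
    using True by (intro tendsto_intros assms) auto
  then show ?thesis using True by (simp add: ramp_def max_def)
qed (simp add: ramp_def max_def)

lemma weighted_ramp''_tendsto:
  assumes \<epsilon>: "\<And>n. 0 < \<epsilon> n" "\<epsilon> \<longlonglongrightarrow> 0"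
  shows "(\<lambda>n. \<bar>s\<bar> * ramp'' (\<epsilon> n) s) \<longlonglongrightarrow> 0"
proof (cases "s = 0")
  case False
  have up: "(\<lambda>n. 6 * (\<epsilon> n / (\<epsilon> n + \<bar>s\<bar>))\<^sup>2) \<longlonglongrightarrow> 6 * (0 / (0 + \<bar>s\<bar>))\<^sup>2"
    using False by (intro tendsto_intros \<epsilon>) auto
  then have up0: "(\<lambda>n. 6 * (\<epsilon> n / (\<epsilon> n + \<bar>s\<bar>))\<^sup>2) \<longlonglongrightarrow> 0" by simp
  show ?thesis
    by (rule tendsto_sandwich[OF _ _ tendsto_const up0])
      (intro always_eventually allI mult_nonneg_nonneg weighted_ramp''_bound(1) ramp''_nonneg \<epsilon>(1) abs_ge_zero)+
qed simp

section \<open>The discounted negative part has expectation zero\<close>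

context besq
begin

lemma clock_measurable:
  assumes t: "t \<in> {0..T}"
  shows "clock t \<in> borel_measurable (completion M)"
proof -
  have "joint (\<lambda>u \<omega>. (2 * sqrt \<bar>S u \<omega>\<bar>)\<^sup>2)"
  proof (rule joint_continuous)
    show "(\<lambda>\<omega>. (2 * sqrt \<bar>S u \<omega>\<bar>)\<^sup>2) \<in> borel_measurable (completion M)" if "u \<in> {0..T}" for u
      by (rule comp_measurable[OF _ F_measurable_completion[OF S_measurable[OF that]]]) (intro continuous_intros)
    show "continuous_on {0..T} (\<lambda>u. (2 * sqrt \<bar>S u \<omega>\<bar>)\<^sup>2)" if "\<omega> \<in> space M" for \<omega>
      by (intro continuous_intros S_path that)
  qed
  from joint_set_integral[OF this t] show ?thesis unfolding clock_def[abs_def] .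
qed

text \<open>\<open>expectation_bound\<close> for the ramps, which vanish at
  \<open>s0 \<ge> 0\<close>. The right side tends to 0 by dominated convergence, since its integrand
  is at most 2 * 6 = 12; Fatou then shows that the discounted negative part has mean 0, and the
  discount is positive.\<close>

lemma AE_nonneg_at:
  assumes \<delta>: "0 \<le> \<delta>" and s0: "0 \<le> s0" and t: "t \<in> {0..T}"
  shows "AE \<omega> in completion M. 0 \<le> S t \<omega>"
proof -
  obtain k p \<xi> where "besq_approx M T W \<delta> s0 S k p \<xi>" by (rule obtain_approx)
  then interpret besq_approx M T W \<delta> s0 S k p \<xi> .
  define \<epsilon> :: "nat \<Rightarrow> real" where "\<epsilon> n = 1 / 2 ^ n" for n
  have \<epsilon>: "0 < \<epsilon> n" "\<epsilon> \<longlonglongrightarrow> 0" for n unfolding \<epsilon>_def[abs_def] by (auto intro: mesh_tendsto_0)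
  define R where "R n \<omega> = (LINT s:{0..t}|lborel. disc 1 s \<omega> * (ramp'' (\<epsilon> n) (S s \<omega>) / 2) * (2 * sqrt \<bar>S s \<omega>\<bar>)\<^sup>2)" for n \<omega>
  have disc: "0 < disc 1 s \<omega>" "disc 1 s \<omega> \<le> 1" for s \<omega>
  proof -
    have "0 \<le> clock s \<omega>" unfolding clock_def set_lebesgue_integral_def by (intro integral_nonneg_AE AE_I2) auto
    then show "0 < disc 1 s \<omega>" "disc 1 s \<omega> \<le> 1" by (auto simp: disc_def)
  qed
  have integrand: "disc 1 s \<omega> * (ramp'' (\<epsilon> n) (S s \<omega>) / 2) * (2 * sqrt \<bar>S s \<omega>\<bar>)\<^sup>2
    = disc 1 s \<omega> * (2 * (\<bar>S s \<omega>\<bar> * ramp'' (\<epsilon> n) (S s \<omega>)))" for n s \<omega>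
    by (simp add: power_mult_distrib)
  have range: "0 \<le> disc 1 s \<omega> * (2 * (\<bar>S s \<omega>\<bar> * ramp'' (\<epsilon> n) (S s \<omega>)))"
    "disc 1 s \<omega> * (2 * (\<bar>S s \<omega>\<bar> * ramp'' (\<epsilon> n) (S s \<omega>))) \<le> 12" for n s \<omega>
  proof -
    show "0 \<le> disc 1 s \<omega> * (2 * (\<bar>S s \<omega>\<bar> * ramp'' (\<epsilon> n) (S s \<omega>)))"
      using disc(1)[of s \<omega>] ramp''_nonneg[OF \<epsilon>(1)] by (intro mult_nonneg_nonneg) auto
    have "disc 1 s \<omega> * (2 * (\<bar>S s \<omega>\<bar> * ramp'' (\<epsilon> n) (S s \<omega>))) \<le> 1 * (2 * 6)"
      using disc[of s \<omega>] weighted_ramp''_bound(2)[OF \<epsilon>(1)] ramp''_nonneg[OF \<epsilon>(1)] by (intro mult_mono) auto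
    then show "disc 1 s \<omega> * (2 * (\<bar>S s \<omega>\<bar> * ramp'' (\<epsilon> n) (S s \<omega>))) \<le> 12" by simp
  qed
  have cont: "continuous_on {0..T} (\<lambda>s. disc 1 s \<omega> * (2 * (\<bar>S s \<omega>\<bar> * ramp'' (\<epsilon> n) (S s \<omega>))))" if "\<omega> \<in> space M" for n \<omega>
  proof -
    have c: "continuous_on {0..T} (\<lambda>t. clock t \<omega>)"
      unfolding clock_def by (intro continuous_set_integral continuous_intros S_path that)
    have "continuous_on {0..T} (\<lambda>s. ramp'' (\<epsilon> n) (S s \<omega>))"
      by (rule continuous_on_compose2[OF ramp''_continuous[OF \<epsilon>(1)] S_path[OF that]]) auto
    then show ?thesis unfolding disc_def by (intro continuous_intros c S_path that)
  qed
  have int12: "integrable lborel (\<lambda>s. indicator {0..t} s *\<^sub>R (12 :: real))"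
    using borel_integrable_atLeastAtMost'[of 0 t "\<lambda>_. 12 :: real"] by (simp add: set_integrable_def)
  have setint: "set_integrable lborel {0..t} (\<lambda>s. disc 1 s \<omega> * (2 * (\<bar>S s \<omega>\<bar> * ramp'' (\<epsilon> n) (S s \<omega>))))"
    if "\<omega> \<in> space M" for n \<omega>
    by (rule set_integrable_subset[OF borel_integrable_atLeastAtMost'[OF cont[OF that]]]) (use t in auto)
  have R_lim: "(\<lambda>n. R n \<omega>) \<longlonglongrightarrow> 0" if "\<omega> \<in> space M" for \<omega>
  proof -
    have "(\<lambda>n. \<integral>s. indicator {0..t} s *\<^sub>R (disc 1 s \<omega> * (2 * (\<bar>S s \<omega>\<bar> * ramp'' (\<epsilon> n) (S s \<omega>)))) \<partial>lborel)
      \<longlonglongrightarrow> (\<integral>s. 0 \<partial>(lborel :: real measure))"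
    proof (rule integral_dominated_convergence[where w = "\<lambda>s. indicator {0..t} s *\<^sub>R 12"])
      show "integrable lborel (\<lambda>s. indicator {0..t} s *\<^sub>R (12 :: real))" by (rule int12)
      show "(\<lambda>s. indicator {0..t} s *\<^sub>R (disc 1 s \<omega> * (2 * (\<bar>S s \<omega>\<bar> * ramp'' (\<epsilon> n) (S s \<omega>))))) \<in> borel_measurable lborel" for n
        using setint[OF that] by (simp add: set_integrable_def)
      show "AE s in lborel. (\<lambda>n. indicator {0..t} s *\<^sub>R (disc 1 s \<omega> * (2 * (\<bar>S s \<omega>\<bar> * ramp'' (\<epsilon> n) (S s \<omega>))))) \<longlonglongrightarrow> 0"
      proof (rule AE_I2)
        fix s
        have "(\<lambda>n. indicator {0..t} s *\<^sub>R (disc 1 s \<omega> * (2 * (\<bar>S s \<omega>\<bar> * ramp'' (\<epsilon> n) (S s \<omega>))))) \<longlonglongrightarrow>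
          indicator {0..t} s *\<^sub>R (disc 1 s \<omega> * (2 * 0))"
          by (intro tendsto_intros weighted_ramp''_tendsto \<epsilon>)
        then show "(\<lambda>n. indicator {0..t} s *\<^sub>R (disc 1 s \<omega> * (2 * (\<bar>S s \<omega>\<bar> * ramp'' (\<epsilon> n) (S s \<omega>))))) \<longlonglongrightarrow> 0"
          by simp
      qed
      show "AE s in lborel. norm (indicator {0..t} s *\<^sub>R (disc 1 s \<omega> * (2 * (\<bar>S s \<omega>\<bar> * ramp'' (\<epsilon> n) (S s \<omega>)))))
        \<le> indicator {0..t} s *\<^sub>R 12" for n
        using range[of _ \<omega> n] by (intro AE_I2) (auto simp: indicator_def abs_of_nonneg)
    qed simp
    then show ?thesis unfolding R_def integrand set_lebesgue_integral_def by simp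
  qed
  have R_meas: "R n \<in> borel_measurable (completion M)" for n
  proof -
    have "joint (\<lambda>s \<omega>. disc 1 s \<omega> * (2 * (\<bar>S s \<omega>\<bar> * ramp'' (\<epsilon> n) (S s \<omega>))))"
    proof (rule joint_continuous)
      fix s assume s: "s \<in> {0..T}"
      have S_m: "S u \<in> borel_measurable (completion M)" if "u \<in> {0..T}" for u
        by (rule F_measurable_completion[OF S_measurable[OF that]])
      note clock_measurable[OF s, measurable]
      have [measurable]: "(\<lambda>\<omega>. ramp'' (\<epsilon> n) (S s \<omega>)) \<in> borel_measurable (completion M)"
        by (rule comp_measurable[OF ramp''_continuous[OF \<epsilon>(1)] S_m[OF s]])
      note S_m[OF s, measurable]
      show "(\<lambda>\<omega>. disc 1 s \<omega> * (2 * (\<bar>S s \<omega>\<bar> * ramp'' (\<epsilon> n) (S s \<omega>)))) \<in> borel_measurable (completion M)"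
        unfolding disc_def by measurable
    qed (rule cont)
    then show ?thesis unfolding R_def[abs_def] integrand by (rule joint_set_integral[OF _ t])
  qed
  have R_bound: "\<bar>R n \<omega>\<bar> \<le> 12 * t" if "\<omega> \<in> space M" for n \<omega>
  proof -
    have "\<bar>LINT s:{0..t}|lborel. disc 1 s \<omega> * (2 * (\<bar>S s \<omega>\<bar> * ramp'' (\<epsilon> n) (S s \<omega>)))\<bar> \<le> (LINT s:{0..t}|lborel. 12)"
      by (rule set_integral_abs_le[OF setint[OF that]]) (use int12 range in \<open>auto simp: set_integrable_def abs_of_nonneg\<close>)
    also have "\<dots> = 12 * t" using t by (simp add: set_lebesgue_integral_def)
    finally show ?thesis unfolding R_def integrand .
  qed
  have "(\<lambda>n. \<integral>\<omega>. R n \<omega> \<partial>completion M) \<longlonglongrightarrow> (\<integral>\<omega>. 0 \<partial>completion M)"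
    by (rule integral_dominated_convergence[OF _ R_meas, where w = "\<lambda>_. 12 * t"])
      (use R_lim R_bound in \<open>auto intro!: AE_I2\<close>)
  then have ER: "(\<lambda>n. ennreal (\<integral>\<omega>. R n \<omega> \<partial>completion M)) \<longlonglongrightarrow> 0"
    using tendsto_ennrealI by fastforce
  have S_m: "S t \<in> borel_measurable (completion M)" by (rule F_measurable_completion[OF S_measurable[OF t]])
  have clock_m: "disc 1 t \<in> borel_measurable (completion M)"
  proof -
    note clock_measurable[OF t, measurable]
    show ?thesis unfolding disc_def[abs_def] by measurable
  qed
  have ramp_m: "(\<lambda>\<omega>. ramp (\<epsilon> n) (S t \<omega>)) \<in> borel_measurable (completion M)" for n
    by (rule comp_measurable[OF DERIV_continuous_on[OF ramp_derivative[OF \<epsilon>(1)]] S_m])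
  note [measurable] = S_m clock_m ramp_m
  have "(\<integral>\<^sup>+\<omega>. ennreal (disc 1 t \<omega> * max (- S t \<omega>) 0) \<partial>completion M) =
    (\<integral>\<^sup>+\<omega>. liminf (\<lambda>n. ennreal (disc 1 t \<omega> * ramp (\<epsilon> n) (S t \<omega>))) \<partial>completion M)"
  proof (rule nn_integral_cong)
    fix \<omega>
    have "(\<lambda>n. ennreal (disc 1 t \<omega> * ramp (\<epsilon> n) (S t \<omega>))) \<longlonglongrightarrow> ennreal (disc 1 t \<omega> * max (- S t \<omega>) 0)"
      by (intro tendsto_ennrealI tendsto_intros ramp_tendsto \<epsilon>)
    then show "ennreal (disc 1 t \<omega> * max (- S t \<omega>) 0) = liminf (\<lambda>n. ennreal (disc 1 t \<omega> * ramp (\<epsilon> n) (S t \<omega>)))"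
      by (rule lim_imp_Liminf[OF sequentially_bot, symmetric])
  qed
  also have "\<dots> \<le> liminf (\<lambda>n. \<integral>\<^sup>+\<omega>. ennreal (disc 1 t \<omega> * ramp (\<epsilon> n) (S t \<omega>)) \<partial>completion M)"
    by (rule nn_integral_liminf) measurable
  also have "\<dots> \<le> liminf (\<lambda>n. ennreal (\<integral>\<omega>. R n \<omega> \<partial>completion M))"
  proof (rule Liminf_mono, intro always_eventually allI)
    fix n
    show "(\<integral>\<^sup>+\<omega>. ennreal (disc 1 t \<omega> * ramp (\<epsilon> n) (S t \<omega>)) \<partial>completion M) \<le> ennreal (\<integral>\<omega>. R n \<omega> \<partial>completion M)"
      unfolding R_def
      by (rule expectation_bound[OF ramp_derivative[OF \<epsilon>(1)] ramp'_derivative[OF \<epsilon>(1)] ramp''_continuous[OF \<epsilon>(1)]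
            ramp_nonneg[OF \<epsilon>(1)] ramp'_bounds(1)[OF \<epsilon>(1)] ramp''_nonneg[OF \<epsilon>(1)] _ \<delta>
            ramp'_bounds(2)[OF \<epsilon>(1)] ramp''_bound[OF \<epsilon>(1)] t])
        (use s0 in \<open>simp add: ramp_def\<close>)
  qed
  also have "\<dots> = 0" by (rule lim_imp_Liminf[OF sequentially_bot ER])
  finally have "(\<integral>\<^sup>+\<omega>. ennreal (disc 1 t \<omega> * max (- S t \<omega>) 0) \<partial>completion M) = 0" by simp
  then have "AE \<omega> in completion M. ennreal (disc 1 t \<omega> * max (- S t \<omega>) 0) = 0"
    by (subst (asm) nn_integral_0_iff_AE) measurable
  then show ?thesis
  proof eventually_elim
    case (elim \<omega>)
    then have "disc 1 t \<omega> * max (- S t \<omega>) 0 \<le> 0" by (simp add: ennreal_eq_0_iff)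
    then show ?case using disc(1)[of t \<omega>] by (auto simp: mult_le_0_iff)
  qed
qed

text \<open>Countably many dyadic times share one null set, and continuity extends the sign to all
  times.\<close>

lemma nonneg:
  assumes "0 \<le> \<delta>" "0 \<le> s0"
  shows "AE \<omega> in completion M. \<forall>t\<in>{0..T}. 0 \<le> S t \<omega>"
proof -
  have mem: "min T (real (fst i) / 2 ^ snd i) \<in> {0..T}" for i :: "nat \<times> nat" using T by auto
  have "AE \<omega> in completion M. \<forall>i :: nat \<times> nat. 0 \<le> S (min T (real (fst i) / 2 ^ snd i)) \<omega>"
    unfolding AE_all_countable by (rule allI, rule AE_nonneg_at[OF assms mem])
  then show ?thesis
    using AE_space
  proof eventually_elim
    case (elim \<omega>)
    show ?case
    proof
      fix t assume t: "t \<in> {0..T}"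
      have mem: "floor_time n t \<in> {0..T}" for n using floor_time_le[where s = t and n = n] t by auto
      have "(\<lambda>n. S (floor_time n t) \<omega>) \<longlonglongrightarrow> S t \<omega>"
        using continuous_on_tendsto_compose[OF S_path floor_time_tendsto[of t] t] elim(2) t mem by auto
      moreover have "0 \<le> S (floor_time n t) \<omega>" for n
        using elim(1)[rule_format, of "(nat \<lfloor>t * 2 ^ n\<rfloor>, n)"] mem[of n] by (simp add: floor_time_def)
      ultimately show "0 \<le> S t \<omega>" by (intro LIMSEQ_le_const) auto
    qed
  qed
qed

end

section \<open>The domain of the operator\<close>

definition taylor_ext :: "real \<Rightarrow> (real \<Rightarrow> real) \<Rightarrow> (real \<Rightarrow> real) \<Rightarrow> (real \<Rightarrow> real) \<Rightarrow> real \<Rightarrow> real" where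
  "taylor_ext e F F1 F2 s = (if s < e then F e + F1 e * (s - e) + F2 e / 2 * (s - e)\<^sup>2 else F s)"

definition taylor_ext' :: "real \<Rightarrow> (real \<Rightarrow> real) \<Rightarrow> (real \<Rightarrow> real) \<Rightarrow> real \<Rightarrow> real" where
  "taylor_ext' e F1 F2 s = (if s < e then F1 e + F2 e * (s - e) else F1 s)"

definition taylor_ext'' :: "real \<Rightarrow> (real \<Rightarrow> real) \<Rightarrow> real \<Rightarrow> real" where
  "taylor_ext'' e F2 s = (if s < e then F2 e else F2 s)"

text \<open>\<open>F2\<close> may blow up at 0, but more slowly than 1 / s. The values
  \<open>F 0\<close> and \<open>F1 0\<close> are the right limits, so uniform statements can include
  the point 0.\<close>

locale singular_C2 =
  fixes F F1 F2 :: "real \<Rightarrow> real"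
  assumes d1: "\<And>s. 0 < s \<Longrightarrow> (F has_real_derivative F1 s) (at s)"
    and d2: "\<And>s. 0 < s \<Longrightarrow> (F1 has_real_derivative F2 s) (at s)"
    and c2: "continuous_on {0<..} F2"
    and l0: "(F \<longlongrightarrow> F 0) (at_right 0)" and l1: "(F1 \<longlongrightarrow> F1 0) (at_right 0)"
    and l2: "((\<lambda>s. s * F2 s) \<longlongrightarrow> 0) (at_right 0)"
begin

lemma taylor_ext_derivative:
  assumes "0 < e"
  shows "(taylor_ext e F F1 F2 has_real_derivative taylor_ext' e F1 F2 s) (at s)"
    "(taylor_ext' e F1 F2 has_real_derivative taylor_ext'' e F2 s) (at s)"
    "continuous_on UNIV (taylor_ext'' e F2)"
proof -
  show "(taylor_ext e F F1 F2 has_real_derivative taylor_ext' e F1 F2 s) (at s)"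
    unfolding taylor_ext_def[abs_def] taylor_ext'_def
    by (rule has_real_derivative_glue) (use assms in \<open>auto intro!: d1 derivative_eq_intros\<close>)
  show "(taylor_ext' e F1 F2 has_real_derivative taylor_ext'' e F2 s) (at s)"
    unfolding taylor_ext'_def[abs_def] taylor_ext''_def
    by (rule has_real_derivative_glue) (use assms in \<open>auto intro!: d2 derivative_eq_intros\<close>)
  show "continuous_on UNIV (taylor_ext'' e F2)"
    unfolding taylor_ext''_def[abs_def]
    by (rule continuous_on_glue) (use assms in \<open>auto intro!: continuous_on_subset[OF c2]\<close>)
qed

text \<open>Nothing changes above e. Below e the polynomial adds terms of size e F1(e), e F2(e) and
  e^2 F2(e), which are small because e and e F2(e) are; moreover |s F2(e)| \<le> |e F2(e)|
  there.\<close>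

lemma taylor_ext_limit:
  assumes r: "0 < r"
  shows "\<forall>\<^sub>F n in sequentially. \<forall>s\<ge>0. \<bar>taylor_ext (1 / 2 ^ n) F F1 F2 s - F s\<bar> < r \<and>
    \<bar>taylor_ext' (1 / 2 ^ n) F1 F2 s - F1 s\<bar> < r \<and> \<bar>s * taylor_ext'' (1 / 2 ^ n) F2 s - s * F2 s\<bar> < r"
proof -
  \<comment> \<open>The bound by 1 gives |F1 e| \<le> |F1 0| + 1 near 0, so the denominator keeps
    the linear term below \<open>r / 8\<close>. The other errors are at most h \<le>
    \<open>r / 8\<close> each.\<close>
  define h where "h = min 1 (r / (8 * (\<bar>F1 0\<bar> + 1)))"
  have h: "0 < h" "h \<le> 1" "h * (\<bar>F1 0\<bar> + 1) \<le> r / 8" "h \<le> r / 8"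
  proof -
    have p: "\<bar>F1 0\<bar> + 1 > 0" by (simp add: add_nonneg_pos)
    show "0 < h" "h \<le> 1" using r p by (auto simp: h_def)
    have "h * (\<bar>F1 0\<bar> + 1) \<le> r / (8 * (\<bar>F1 0\<bar> + 1)) * (\<bar>F1 0\<bar> + 1)"
      using p by (intro mult_right_mono) (auto simp: h_def)
    also have "\<dots> = r / 8" using p by (simp add: field_simps)
    finally show *: "h * (\<bar>F1 0\<bar> + 1) \<le> r / 8" .
    have "h * 1 \<le> h * (\<bar>F1 0\<bar> + 1)" using \<open>0 < h\<close> by (intro mult_left_mono) auto
    then show "h \<le> r / 8" using * by simp
  qed
  have "\<forall>\<^sub>F s in at_right 0. \<bar>F s - F 0\<bar> < h \<and> \<bar>F1 s - F1 0\<bar> < h \<and> \<bar>s * F2 s\<bar> < h"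
    using tendstoD[OF l0 h(1)] tendstoD[OF l1 h(1)] tendstoD[OF l2 h(1)]
    by eventually_elim (auto simp: dist_real_def)
  then obtain b where b: "0 < b" "\<And>s. 0 < s \<Longrightarrow> s < b \<Longrightarrow> \<bar>F s - F 0\<bar> < h \<and> \<bar>F1 s - F1 0\<bar> < h \<and> \<bar>s * F2 s\<bar> < h"
    unfolding eventually_at_right_field by auto
  have near: "\<bar>F s - F 0\<bar> < h \<and> \<bar>F1 s - F1 0\<bar> < h \<and> \<bar>s * F2 s\<bar> < h" if "0 \<le> s" "s < b" for s
    using b(2)[of s] that h(1) by (cases "s = 0") auto
  have "\<forall>\<^sub>F n in sequentially. 1 / 2 ^ n < min b h"
    using order_tendstoD(2)[OF mesh_tendsto_0[of 1], of "min b h"] b(1) h(1) by simp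
  then show ?thesis
  proof eventually_elim
    case (elim n)
    define e :: real where "e = 1 / 2 ^ n"
    have e: "0 < e" "e < b" "e < h" using elim by (auto simp: e_def)
    show ?case unfolding e_def[symmetric]
    proof (intro allI impI)
      fix s :: real assume s: "0 \<le> s"
      show "\<bar>taylor_ext e F F1 F2 s - F s\<bar> < r \<and> \<bar>taylor_ext' e F1 F2 s - F1 s\<bar> < r \<and>
        \<bar>s * taylor_ext'' e F2 s - s * F2 s\<bar> < r"
      proof (cases "s < e")
        case False
        then show ?thesis using r by (simp add: taylor_ext_def taylor_ext'_def taylor_ext''_def)
      next
        case True
        note ns = near[OF s less_trans[OF True e(2)]] and ne = near[OF less_imp_le[OF e(1)] e(2)]
        have se: "\<bar>s - e\<bar> \<le> e" using s True by simp
        have F2e: "\<bar>F2 e * (s - e)\<bar> \<le> h"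
        proof -
          have "\<bar>F2 e * (s - e)\<bar> \<le> \<bar>F2 e\<bar> * e" unfolding abs_mult using se by (intro mult_left_mono) auto
          also have "\<dots> = \<bar>e * F2 e\<bar>" using e(1) by (simp add: abs_mult)
          finally show ?thesis using ne by simp
        qed
        have F1e: "\<bar>F1 e * (s - e)\<bar> \<le> r / 8"
        proof -
          have "\<bar>F1 e\<bar> \<le> \<bar>F1 0\<bar> + 1" using ne h(2) by linarith
          then have "\<bar>F1 e * (s - e)\<bar> \<le> (\<bar>F1 0\<bar> + 1) * h"
            unfolding abs_mult using se e by (intro mult_mono) auto
          then show ?thesis using h(3) by (simp add: mult.commute)
        qed
        have F2e2: "\<bar>F2 e / 2 * (s - e)\<^sup>2\<bar> \<le> h"
        proof -
          have "\<bar>F2 e / 2 * (s - e)\<^sup>2\<bar> = \<bar>F2 e * (s - e)\<bar> * (\<bar>s - e\<bar> / 2)"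
            by (simp add: abs_mult power2_eq_square)
          also have "\<dots> \<le> h * 1" using F2e se e h by (intro mult_mono) auto
          finally show ?thesis by simp
        qed
        have "\<bar>taylor_ext e F F1 F2 s - F s\<bar> < r"
          using True ns ne F1e F2e2 h(4) r unfolding taylor_ext_def by (simp add: abs_if split: if_splits)
        moreover have "\<bar>taylor_ext' e F1 F2 s - F1 s\<bar> < r"
          using True ns ne F2e h(4) r unfolding taylor_ext'_def by (simp add: abs_if split: if_splits)
        moreover have "\<bar>s * F2 e\<bar> \<le> \<bar>e * F2 e\<bar>"
          unfolding abs_mult using s True by (intro mult_right_mono) auto
        then have "\<bar>s * taylor_ext'' e F2 s - s * F2 s\<bar> < r"
          using True ns ne h(4) r unfolding taylor_ext''_def by (simp only: if_True) linarith
        ultimately show ?thesis by blast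
      qed
    qed
  qed
qed

end

section \<open>Behaviour of a domain function at 0 and the generator in the variable s = x^2\<close>

locale domain_function =
  fixes \<delta> :: real and f :: "real \<Rightarrow> real"
  assumes \<delta>: "0 \<le> \<delta>" "\<delta> < 1" and f: "f \<in> D_L \<delta>"
begin

lemma f_continuous: "continuous_on UNIV f"
  using f by (simp add: D_L_def)

text \<open>The derivatives on the right half-line. The process is non-negative, so the formula is
  computed with these; the left half of \<open>f\<close> enters only through the two-sided
  \<open>deriv f 0\<close>.\<close>

definition f1 :: "real \<Rightarrow> real" where
  "f1 = (SOME f1. \<exists>f2. continuous_on {0..} f1 \<and> continuous_on {0..} f2 \<and>
    (\<forall>x\<ge>0. (f has_real_derivative f1 x) (at x within {0..})) \<and>
    (\<forall>x\<ge>0. (f1 has_real_derivative f2 x) (at x within {0..})))"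

definition f2 :: "real \<Rightarrow> real" where
  "f2 = (SOME f2. continuous_on {0..} f1 \<and> continuous_on {0..} f2 \<and>
    (\<forall>x\<ge>0. (f has_real_derivative f1 x) (at x within {0..})) \<and>
    (\<forall>x\<ge>0. (f1 has_real_derivative f2 x) (at x within {0..})))"

lemma right_derivatives:
  "continuous_on {0..} f1 \<and> continuous_on {0..} f2 \<and>
    (\<forall>x\<ge>0. (f has_real_derivative f1 x) (at x within {0..})) \<and>
    (\<forall>x\<ge>0. (f1 has_real_derivative f2 x) (at x within {0..}))"
proof -
  have "C_k_on 2 {0..} f" using f by (simp add: D_L_def)
  then obtain D where D: "D 0 = f" "\<forall>i<2. \<forall>x\<in>{0..}. (D i has_real_derivative D (Suc i) x) (at x within {0..})"
    "\<forall>i\<le>2. continuous_on {0..} (D i)"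
    unfolding C_k_on_def by blast
  have "\<exists>f1 f2. continuous_on {0..} f1 \<and> continuous_on {0..} f2 \<and>
    (\<forall>x\<ge>0. (f has_real_derivative f1 x) (at x within {0..})) \<and>
    (\<forall>x\<ge>0. (f1 has_real_derivative f2 x) (at x within {0..}))"
    using D(1) D(2)[rule_format, of 0] D(2)[rule_format, of 1] D(3)
    by (intro exI[of _ "D (Suc 0)"] exI[of _ "D (Suc (Suc 0))"]) auto
  then have "\<exists>f2. continuous_on {0..} f1 \<and> continuous_on {0..} f2 \<and>
    (\<forall>x\<ge>0. (f has_real_derivative f1 x) (at x within {0..})) \<and>
    (\<forall>x\<ge>0. (f1 has_real_derivative f2 x) (at x within {0..}))"
    unfolding f1_def by (rule someI_ex)
  then show ?thesis unfolding f2_def by (rule someI_ex)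
qed

lemma cont_f1: "continuous_on {0..} f1" and cont_f2: "continuous_on {0..} f2"
  using right_derivatives by blast+

lemma
  assumes "0 < x"
  shows f_right: "(f has_real_derivative f1 x) (at x)"
    and f1_right: "(f1 has_real_derivative f2 x) (at x)"
proof -
  have "at x within {0..} = at x"
    using assms by (intro at_within_interior) (simp add: interior_Ici[of "- 1"])
  moreover have "(f has_real_derivative f1 x) (at x within {0..})" "(f1 has_real_derivative f2 x) (at x within {0..})"
    using right_derivatives assms by auto
  ultimately show "(f has_real_derivative f1 x) (at x)" "(f1 has_real_derivative f2 x) (at x)" by simp_all
qed

definition g where "g = (SOME g. \<exists>G. L_extensions \<delta> f g G)"
definition H where "H = (SOME G. L_extensions \<delta> f g G)"

lemma extensions: "L_extensions \<delta> f g H"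
proof -
  have "\<exists>g G. L_extensions \<delta> f g G" using f by (simp add: D_L_def)
  then have "\<exists>G. L_extensions \<delta> f g G" unfolding g_def by (rule someI_ex)
  then show ?thesis unfolding H_def by (rule someI_ex)
qed

lemma cont_g: "continuous_on UNIV g" and cont_H: "continuous_on UNIV H"
  using extensions by (auto simp: L_extensions_def)

lemma deriv_off_0: "x \<noteq> 0 \<Longrightarrow> deriv f x = g x * \<bar>x\<bar> powr (1 - \<delta>)"
  using extensions by (simp add: L_extensions_def mult.assoc powr_add[symmetric])

lemma g_weight_continuous: "continuous_on UNIV (\<lambda>x. g x * \<bar>x\<bar> powr (1 - \<delta>))"
  using \<delta> by (intro continuous_on_mult cont_g continuous_on_powr' continuous_intros) auto

text \<open>\<open>g\<close> is bounded near 0 and the exponent 1 - \<delta> is positive, so f' = g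
  |x| powr (1 - \<delta>) tends to 0.\<close>

lemma f1_0: "f1 0 = 0"
proof -
  have "(f1 \<longlongrightarrow> f1 0) (at 0 within {0..})"
    using cont_f1 by (simp add: continuous_on_def)
  then have "(f1 \<longlongrightarrow> f1 0) (at_right 0)" by (rule tendsto_within_subset) auto
  moreover have "isCont (\<lambda>x. g x * \<bar>x\<bar> powr (1 - \<delta>)) 0"
    using g_weight_continuous by (simp add: continuous_on_eq_continuous_at)
  then have "((\<lambda>x. g x * \<bar>x\<bar> powr (1 - \<delta>)) \<longlongrightarrow> 0) (at 0)" by (simp add: isCont_def)
  then have "((\<lambda>x. g x * \<bar>x\<bar> powr (1 - \<delta>)) \<longlongrightarrow> 0) (at_right 0)" by (rule tendsto_within_subset) auto
  then have "(f1 \<longlongrightarrow> 0) (at_right 0)"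
  proof (rule Lim_transform_eventually)
    show "\<forall>\<^sub>F x in at_right 0. g x * \<bar>x\<bar> powr (1 - \<delta>) = f1 x"
      using deriv_off_0 DERIV_imp_deriv[OF f_right]
      by (auto simp: eventually_at_right_field intro!: exI[of _ 1])
  qed
  ultimately show ?thesis by (rule tendsto_unique[OF trivial_limit_at_right_real])
qed

text \<open>The same limit from the left. The two one-sided derivatives must agree before
  \<open>deriv f 0\<close> has its usual meaning.\<close>

lemma left_derivative_0: "(f has_real_derivative 0) (at 0 within {..0})"
proof -
  have "C_k_on 2 {..0} f" using f by (simp add: D_L_def)
  then obtain D where D: "D 0 = f" "\<forall>i<2. \<forall>x\<in>{..0}. (D i has_real_derivative D (Suc i) x) (at x within {..0})"
    "\<forall>i\<le>2. continuous_on {..0} (D i)"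
    unfolding C_k_on_def by blast
  have d: "(f has_real_derivative D (Suc 0) x) (at x within {..0})" if "x \<le> 0" for x
    using D(1) D(2)[rule_format, of 0] that by auto
  have "(D (Suc 0) \<longlongrightarrow> D (Suc 0) 0) (at 0 within {..0})"
    using D(3) by (auto simp: continuous_on_def)
  then have "(D (Suc 0) \<longlongrightarrow> D (Suc 0) 0) (at_left 0)" by (rule tendsto_within_subset) auto
  moreover have "isCont (\<lambda>x. g x * \<bar>x\<bar> powr (1 - \<delta>)) 0"
    using g_weight_continuous by (simp add: continuous_on_eq_continuous_at)
  then have "((\<lambda>x. g x * \<bar>x\<bar> powr (1 - \<delta>)) \<longlongrightarrow> 0) (at 0)" by (simp add: isCont_def)
  then have "((\<lambda>x. g x * \<bar>x\<bar> powr (1 - \<delta>)) \<longlongrightarrow> 0) (at_left 0)" by (rule tendsto_within_subset) auto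
  then have "(D (Suc 0) \<longlongrightarrow> 0) (at_left 0)"
  proof (rule Lim_transform_eventually)
    have "deriv f x = D (Suc 0) x" if "x < 0" for x
      using d[of x] that at_within_interior[of x "{..0}"] by (intro DERIV_imp_deriv) (auto simp: interior_Iic[of 1])
    then show "\<forall>\<^sub>F x in at_left 0. g x * \<bar>x\<bar> powr (1 - \<delta>) = D (Suc 0) x"
      using deriv_off_0 by (auto simp: eventually_at_left_field intro!: exI[of _ "- 1"])
  qed
  ultimately have "D (Suc 0) 0 = 0" by (rule tendsto_unique[OF trivial_limit_at_left_real])
  then show ?thesis using d[of 0] by simp
qed

lemma deriv_0: "deriv f 0 = 0"
proof -
  have "(f has_real_derivative 0) (at 0 within {0..})" using right_derivatives f1_0 by auto
  then have "(f has_real_derivative 0) (at 0 within ({..0} \<union> {0..}))"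
    using left_derivative_0 unfolding has_field_derivative_iff
    by (subst at_within_union) (intro filterlim_sup)
  moreover have "{..0} \<union> {0..} = (UNIV :: real set)" by auto
  ultimately show ?thesis by (intro DERIV_imp_deriv) simp
qed

text \<open>At 0 both sides vanish, as 0 to a positive power is 0. Continuity of
  \<open>deriv f\<close> can then be read off.\<close>

lemma deriv_eq: "deriv f = (\<lambda>x. g x * \<bar>x\<bar> powr (1 - \<delta>))"
  using deriv_off_0 deriv_0 by (intro ext) (metis abs_zero mult_zero_right powr_zero_eq_one powr_0 \<delta>(2))

lemma cont_deriv: "continuous_on UNIV (deriv f)"
  unfolding deriv_eq by (rule g_weight_continuous)

lemma deriv_f1: "0 \<le> x \<Longrightarrow> deriv f x = f1 x"
  using DERIV_imp_deriv[OF f_right] deriv_0 f1_0 by (cases "x = 0") auto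

lemma H_eq:
  assumes x: "0 < x"
  shows "H x = f2 x - (1 - \<delta>) * f1 x / x"
proof -
  have "((\<lambda>y. f1 y * y powr (\<delta> - 1)) has_real_derivative
      f2 x * x powr (\<delta> - 1) + f1 x * ((\<delta> - 1) * x powr (\<delta> - 1 - 1))) (at x)"
    using x by (auto intro!: derivative_eq_intros f1_right)
  moreover have "f1 y * y powr (\<delta> - 1) = g y" if "y \<in> {0<..}" for y
    using extensions that DERIV_imp_deriv[OF f_right, of y] by (simp add: L_extensions_def)
  ultimately have "(g has_real_derivative
      f2 x * x powr (\<delta> - 1) + f1 x * ((\<delta> - 1) * x powr (\<delta> - 1 - 1))) (at x)"
    using x by (elim has_field_derivative_transform_within_open[of _ _ _ "{0<..}"]) auto
  then have "H x = (f2 x * x powr (\<delta> - 1) + f1 x * ((\<delta> - 1) * x powr (\<delta> - 1 - 1))) * x powr (1 - \<delta>)"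
    using extensions x by (simp add: L_extensions_def DERIV_imp_deriv)
  also have "\<dots> = f2 x * (x powr (\<delta> - 1) * x powr (1 - \<delta>)) + (\<delta> - 1) * f1 x * (x powr (\<delta> - 1 - 1) * x powr (1 - \<delta>))"
    by (simp add: algebra_simps)
  also have "x powr (\<delta> - 1) * x powr (1 - \<delta>) = 1" using x by (simp add: powr_add[symmetric])
  also have "x powr (\<delta> - 1 - 1) * x powr (1 - \<delta>) = 1 / x"
    using x by (simp add: powr_add[symmetric] powr_minus_divide)
  finally show ?thesis using x by (simp add: algebra_simps diff_divide_distrib)
qed

text \<open>As f'(0) = 0, this is the difference quotient of \<open>f1\<close> at 0.\<close>

lemma f1_quotient: "((\<lambda>x. f1 x / x) \<longlongrightarrow> f2 0) (at_right 0)"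
proof -
  have "(f1 has_real_derivative f2 0) (at 0 within {0..})" using right_derivatives by auto
  then have "((\<lambda>x. f1 x / x) \<longlongrightarrow> f2 0) (at 0 within {0..})" by (simp add: has_field_derivative_iff f1_0)
  then show ?thesis by (rule tendsto_within_subset) auto
qed

lemma f2_right_limit: "(f2 \<longlongrightarrow> f2 0) (at_right 0)"
proof -
  have "(f2 \<longlongrightarrow> f2 0) (at 0 within {0..})" using cont_f2 by (simp add: continuous_on_def)
  then show ?thesis by (rule tendsto_within_subset) auto
qed

text \<open>By continuity the formula for x > 0 extends to 0, where f'(x) / x becomes
  f''(0).\<close>

lemma H_0: "H 0 = \<delta> * f2 0"
proof -
  have "isCont H 0" using cont_H by (simp add: continuous_on_eq_continuous_at)
  then have "(H \<longlongrightarrow> H 0) (at 0)" by (simp add: isCont_def)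
  then have "(H \<longlongrightarrow> H 0) (at_right 0)" by (rule tendsto_within_subset) auto
  moreover have "((\<lambda>x. f2 x - (1 - \<delta>) * (f1 x / x)) \<longlongrightarrow> f2 0 - (1 - \<delta>) * f2 0) (at_right 0)"
    by (intro tendsto_intros f1_quotient f2_right_limit)
  then have "(H \<longlongrightarrow> f2 0 - (1 - \<delta>) * f2 0) (at_right 0)"
    by (rule Lim_transform_eventually) (auto simp: eventually_at_right_field H_eq intro!: exI[of _ 1])
  ultimately have "H 0 = f2 0 - (1 - \<delta>) * f2 0" by (rule tendsto_unique[OF trivial_limit_at_right_real])
  then show ?thesis by (simp add: algebra_simps)
qed

lemma L_op_H: "L_op \<delta> f x = H x / 2"
  by (rule L_op_eq[OF extensions])

definition q where "q s = f (sqrt s)"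
text \<open>\<open>q1\<close> and \<open>q2\<close> are the derivatives of \<open>q\<close> for s >
  0. At 0, \<open>q1\<close> takes the limit of f'(x) / (2 x), while \<open>q2 0\<close> is 0 by
  division by zero; the latter is harmless since \<open>q2\<close> enters with the factor s.\<close>

definition q1 where "q1 s = (if s = 0 then f2 0 / 2 else f1 (sqrt s) / (2 * sqrt s))"
definition q2 where "q2 s = f2 (sqrt s) / (4 * s) - f1 (sqrt s) / (4 * s * sqrt s)"

lemma sqrt_at_right: "filterlim sqrt (at_right 0) (at_right 0)"
proof -
  have "(sqrt \<longlongrightarrow> sqrt 0) (at_right 0)" by (rule tendsto_real_sqrt[OF tendsto_ident_at])
  then show ?thesis by (auto simp: filterlim_at eventually_at_right_field intro!: exI[of _ 1])
qed

text \<open>The critical limit is s * q2 s = (f''(x) - f'(x) / x) / 4 with x = sqrt s, whose two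
  terms both tend to f''(0).\<close>

lemma singular: "singular_C2 q q1 q2"
proof
  show "(q has_real_derivative q1 s) (at s)" if s: "0 < s" for s
    unfolding q_def[abs_def]
    by (rule DERIV_cong[OF DERIV_chain2[OF f_right DERIV_real_sqrt[OF s]]]) (use s in \<open>auto simp: q1_def field_simps\<close>)
  show "(q1 has_real_derivative q2 s) (at s)" if s: "0 < s" for s
  proof (rule has_field_derivative_transform_within_open[of _ _ _ "{0<..}"])
    have "((\<lambda>s. f1 (sqrt s) / (2 * sqrt s)) has_real_derivative
      (f2 (sqrt s) * (inverse (sqrt s) / 2) * (2 * sqrt s) - f1 (sqrt s) * (2 * (inverse (sqrt s) / 2))) / ((2 * sqrt s) * (2 * sqrt s))) (at s)"
      using s by (intro DERIV_divide DERIV_chain2[OF f1_right DERIV_real_sqrt] DERIV_cmult DERIV_real_sqrt) auto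
    moreover have "(f2 (sqrt s) * (inverse (sqrt s) / 2) * (2 * sqrt s) - f1 (sqrt s) * (2 * (inverse (sqrt s) / 2))) / ((2 * sqrt s) * (2 * sqrt s)) = q2 s"
      using s by (simp add: q2_def field_simps)
    ultimately show "((\<lambda>s. f1 (sqrt s) / (2 * sqrt s)) has_real_derivative q2 s) (at s)" by simp
  qed (use s in \<open>auto simp: q1_def\<close>)
  have cs: "continuous_on {0<..} (\<lambda>s. G (sqrt s))" if "continuous_on {0..} G" for G :: "real \<Rightarrow> real"
    by (rule continuous_on_compose2[OF that]) (auto intro!: continuous_intros)
  show "continuous_on {0<..} q2"
    unfolding q2_def[abs_def] by (intro continuous_intros cs cont_f1 cont_f2) auto
  have "isCont f 0" using f_continuous by (simp add: continuous_on_eq_continuous_at)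
  then have "(f \<longlongrightarrow> f 0) (at_right 0)" unfolding isCont_def by (rule tendsto_within_subset) auto
  from filterlim_compose[OF this sqrt_at_right] show "(q \<longlongrightarrow> q 0) (at_right 0)" by (simp add: q_def[abs_def])
  have quot: "((\<lambda>s. f1 (sqrt s) / sqrt s) \<longlongrightarrow> f2 0) (at_right 0)"
    by (rule filterlim_compose[OF f1_quotient sqrt_at_right])
  have "((\<lambda>s. f1 (sqrt s) / sqrt s / 2) \<longlongrightarrow> f2 0 / 2) (at_right 0)" by (intro tendsto_intros quot) auto
  then have "(q1 \<longlongrightarrow> f2 0 / 2) (at_right 0)"
    by (rule Lim_transform_eventually) (auto simp: q1_def eventually_at_right_field intro!: exI[of _ 1])
  then show "(q1 \<longlongrightarrow> q1 0) (at_right 0)" by (simp add: q1_def)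
  have "((\<lambda>s. (f2 (sqrt s) - f1 (sqrt s) / sqrt s) / 4) \<longlongrightarrow> (f2 0 - f2 0) / 4) (at_right 0)"
    by (intro tendsto_intros quot filterlim_compose[OF f2_right_limit sqrt_at_right]) auto
  then have lim: "((\<lambda>s. (f2 (sqrt s) - f1 (sqrt s) / sqrt s) / 4) \<longlongrightarrow> 0) (at_right 0)" by simp
  show "((\<lambda>s. s * q2 s) \<longlongrightarrow> 0) (at_right 0)"
    by (rule Lim_transform_eventually[OF lim])
      (auto simp: q2_def eventually_at_right_field field_simps intro!: exI[of _ 1])
qed

lemma q1_deriv: "0 \<le> s \<Longrightarrow> q1 s * (2 * sqrt s) = deriv f (sqrt s)"
  by (auto simp: q1_def deriv_f1 f1_0)

text \<open>For s > 0 both sides equal (f''(x) - (1 - \<delta>) f'(x) / x) / 2 at x = sqrt s. At 0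
  the second-order term drops out and \<delta> f''(0) / 2 remains, in agreement with
  \<open>H_0\<close>.\<close>

lemma generator: "0 \<le> s \<Longrightarrow> \<delta> * q1 s + 2 * (s * q2 s) = L_op \<delta> f (sqrt s)"
proof (cases "s = 0")
  case True
  then show ?thesis by (simp add: q1_def q2_def L_op_H H_0)
next
  case False
  assume "0 \<le> s"
  then have s: "0 < s" "0 < sqrt s" using False by auto
  have "s * q2 s = (f2 (sqrt s) - f1 (sqrt s) / sqrt s) / 4"
    using s by (simp add: q2_def right_diff_distrib diff_divide_distrib)
  moreover have "q1 s = f1 (sqrt s) / sqrt s / 2" using s by (simp add: q1_def)
  ultimately show ?thesis by (simp add: L_op_H H_eq[OF s(2)] algebra_simps diff_divide_distrib add_divide_distrib)
qed

end

section \<open>The strong martingale problem\<close>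

lemma (in singular_C2) taylor_ext_uniform_limit:
  fixes h :: "'b \<Rightarrow> real"
  assumes h: "\<And>t. t \<in> A \<Longrightarrow> 0 \<le> h t"
  shows "uniform_limit A (\<lambda>n t. taylor_ext (1 / 2 ^ n) F F1 F2 (h t)) (\<lambda>t. F (h t)) sequentially"
    "uniform_limit A (\<lambda>n t. taylor_ext' (1 / 2 ^ n) F1 F2 (h t)) (\<lambda>t. F1 (h t)) sequentially"
    "uniform_limit A (\<lambda>n t. h t * taylor_ext'' (1 / 2 ^ n) F2 (h t)) (\<lambda>t. h t * F2 (h t)) sequentially"
proof -
  have *: "\<forall>\<^sub>F n in sequentially. \<forall>t\<in>A. \<bar>taylor_ext (1 / 2 ^ n) F F1 F2 (h t) - F (h t)\<bar> < r \<and>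
    \<bar>taylor_ext' (1 / 2 ^ n) F1 F2 (h t) - F1 (h t)\<bar> < r \<and>
    \<bar>h t * taylor_ext'' (1 / 2 ^ n) F2 (h t) - h t * F2 (h t)\<bar> < r" if "0 < r" for r
    using taylor_ext_limit[OF that] by eventually_elim (use h in blast)
  show "uniform_limit A (\<lambda>n t. taylor_ext (1 / 2 ^ n) F F1 F2 (h t)) (\<lambda>t. F (h t)) sequentially"
    "uniform_limit A (\<lambda>n t. taylor_ext' (1 / 2 ^ n) F1 F2 (h t)) (\<lambda>t. F1 (h t)) sequentially"
    "uniform_limit A (\<lambda>n t. h t * taylor_ext'' (1 / 2 ^ n) F2 (h t)) (\<lambda>t. h t * F2 (h t)) sequentially"
    by (rule uniform_limitI, erule eventually_mono[OF *], simp add: dist_real_def)+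
qed

text \<open>Simple integrals start at 0. Applied to the integrated equation, this recovers the
  initial value of \<open>S\<close>.\<close>

lemma (in bm_setting) ito_approx_0:
  assumes "ito_approx H Y"
  shows "AE \<omega> in completion M. Y 0 \<omega> = 0"
proof -
  obtain \<Phi> where \<Phi>: "\<And>n. is_simple_process F T (\<Phi> n)"
    "AE \<omega> in completion M. (\<lambda>n. l2_dist (simple_value (\<Phi> n)) H \<omega>) \<longlonglongrightarrow> 0 \<and>
       uniform_limit {0..T} (\<lambda>n t. simple_integral_W W (\<Phi> n) t \<omega>) (\<lambda>t. Y t \<omega>) sequentially"
    using assms unfolding ito_approx_def by blast
  have zero: "simple_integral_W W (\<Phi> n) 0 \<omega> = 0" for n \<omega>
  proof -
    obtain k p \<xi> where eq: "\<Phi> n = (k, p, \<xi>)" by (cases "\<Phi> n") auto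
    have "min (p i) 0 = 0" if "i \<le> k" for i
      using simple_points(2)[OF \<Phi>(1)[of n, unfolded eq] that] by simp
    then show ?thesis by (simp add: eq simple_integral_W_def)
  qed
  show ?thesis
    using \<Phi>(2)
  proof eventually_elim
    case (elim \<omega>)
    have "(\<lambda>n. simple_integral_W W (\<Phi> n) 0 \<omega>) \<longlonglongrightarrow> Y 0 \<omega>"
      by (rule tendsto_uniform_limitI[OF conjunct2[OF elim]]) (use T in simp)
    then show ?case using zero LIMSEQ_unique[OF _ tendsto_const] by simp
  qed
qed

context besq
begin

lemma AE_S_0: "AE \<omega> in completion M. S 0 \<omega> = s0"
  using ito_approx_0[OF has_ito_integral_imp_ito_approx[OF S_ito]] by simp

lemma adapted_compose:
  assumes "continuous_on UNIV g"
  shows "adapted F T (\<lambda>t \<omega>. g (S t \<omega>))"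
  unfolding adapted_def by (intro ballI comp_measurable[OF assms] S_measurable)

lemma path_compose:
  assumes "continuous_on UNIV g" "\<omega> \<in> space M"
  shows "continuous_on {0..T} (\<lambda>t. g (S t \<omega>))"
  by (rule continuous_on_compose2[OF assms(1) S_path[OF assms(2)]]) auto

lemma progressive_compose: "continuous_on UNIV g \<Longrightarrow> progressive F T (\<lambda>t \<omega>. g (S t \<omega>))"
  by (rule progressive_continuous) (auto simp: continuous_paths_def intro: adapted_compose path_compose)

text \<open>Progressive measurability at \<open>t\<close> is exactly what makes the integral up to
  \<open>t\<close> measurable for \<open>F t\<close>.\<close>

lemma adapted_integral:
  assumes "continuous_on UNIV g"
  shows "adapted F T (\<lambda>t \<omega>. LINT s:{0..t}|lborel. g (S s \<omega>))"
  unfolding adapted_def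
  by (intro ballI measurable_set_integral)
    (use progressive_compose[OF assms] in \<open>simp add: progressive_def\<close>)

lemma path_integral:
  fixes g :: "real \<Rightarrow> real"
  shows "continuous_on UNIV g \<Longrightarrow> \<omega> \<in> space M \<Longrightarrow> continuous_on {0..T} (\<lambda>t. LINT s:{0..t}|lborel. g (S s \<omega>))"
  by (rule continuous_set_integral) (rule path_compose)

lemma has_ito_integral_compose:
  assumes approx: "ito_approx (\<lambda>t \<omega>. h (S t \<omega>)) Y" and h: "continuous_on UNIV h"
    and Y: "adapted F T Y" "continuous_paths M T Y"
  shows "has_ito_integral M T W (\<lambda>t \<omega>. h (S t \<omega>)) Y"
proof (rule has_ito_integralI[OF approx progressive_compose[OF h] _ Y])
  have "(\<integral>\<^sup>+ s\<in>{0..T}. ennreal ((h (S s \<omega>))\<^sup>2) \<partial>lborel) < \<infinity>" if "\<omega> \<in> space M" for \<omega>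
  proof -
    have "set_integrable lborel {0..T} (\<lambda>s. (h (S s \<omega>))\<^sup>2)"
      by (intro borel_integrable_atLeastAtMost' continuous_intros path_compose h that)
    then show ?thesis by (simp add: nn_set_integral_eq_set_integral)
  qed
  then show "AE \<omega> in completion M. (\<integral>\<^sup>+ s\<in>{0..T}. ennreal ((h (S s \<omega>))\<^sup>2) \<partial>lborel) < \<infinity>"
    by (intro AE_I2) simp
qed

end

section \<open>The root of a squared Bessel process\<close>

locale besq_domain = besq M T W \<delta> s0 S + domain_function \<delta> f
  for M :: "'a measure" and T W \<delta> s0 S f +
  assumes s0: "0 \<le> s0"
begin

lemma cont_integrands:
  "continuous_on UNIV (\<lambda>x. f (sqrt x))" "continuous_on UNIV (\<lambda>x. deriv f (sqrt x))"
  "continuous_on UNIV (\<lambda>x. L_op \<delta> f (sqrt x))"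
proof -
  have c: "continuous_on UNIV (\<lambda>x. g (sqrt x))" if "continuous_on UNIV g" for g :: "real \<Rightarrow> real"
    by (rule continuous_on_compose2[OF that]) (auto intro!: continuous_intros)
  show "continuous_on UNIV (\<lambda>x. f (sqrt x))" "continuous_on UNIV (\<lambda>x. deriv f (sqrt x))"
    by (rule c[OF f_continuous] c[OF cont_deriv])+
  show "continuous_on UNIV (\<lambda>x. L_op \<delta> f (sqrt x))"
    unfolding L_op_H by (intro continuous_intros c cont_H) auto
qed

text \<open>A second use of \<open>ito_approx_closed\<close>, now along the smooth extensions
  \<open>G n\<close> of \<open>q\<close>; each of them is covered by
  \<open>ito_formula\<close>.\<close>

lemma bessel_ito_approx:
  "ito_approx (\<lambda>t \<omega>. deriv f (sqrt (S t \<omega>)))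
    (\<lambda>t \<omega>. f (sqrt (S t \<omega>)) - f (sqrt s0) - (LINT s:{0..t}|lborel. L_op \<delta> f (sqrt (S s \<omega>))))"
proof -
  obtain k p \<xi> where "besq_approx M T W \<delta> s0 S k p \<xi>" by (rule obtain_approx)
  then interpret besq_approx M T W \<delta> s0 S k p \<xi> .
  interpret sing: singular_C2 q q1 q2 by (rule singular)
  define G where "G n = taylor_ext (1 / 2 ^ n) q q1 q2" for n :: nat
  define G1 where "G1 n = taylor_ext' (1 / 2 ^ n) q1 q2" for n :: nat
  define G2 where "G2 n = taylor_ext'' (1 / 2 ^ n) q2" for n :: nat
  have dG: "(G n has_real_derivative G1 n s) (at s)" and dG1: "(G1 n has_real_derivative G2 n s) (at s)"
    and cG2: "continuous_on UNIV (G2 n)" for n s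
    unfolding G_def G1_def G2_def by (rule sing.taylor_ext_derivative, simp)+
  have cG: "continuous_on UNIV (G n)" and cG1: "continuous_on UNIV (G1 n)" for n
    by (rule DERIV_continuous_on[OF has_field_derivative_at_within[OF dG]]
        DERIV_continuous_on[OF has_field_derivative_at_within[OF dG1]])+
  \<comment> \<open>The drift of G(S) in Ito's formula: half of G'' times (2 sqrt |x|)^2 is 2 |x|
    G''. The absolute value remains until the sign of \<open>S\<close> is used.\<close>
  define a where "a n x = \<delta> * G1 n x + 2 * (\<bar>x\<bar> * G2 n x)" for n x
  have ca: "continuous_on UNIV (a n)" for n
    unfolding a_def[abs_def] by (intro continuous_intros cG1 cG2)
  have cH: "continuous_on UNIV (\<lambda>x. G1 n x * (2 * sqrt \<bar>x\<bar>))" for n by (intro continuous_intros cG1)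
  define Y where "Y n t \<omega> = G n (S t \<omega>) - G n s0 - (LINT s:{0..t}|lborel. a n (S s \<omega>))" for n t \<omega>
  have limitY_eq: "limitY 0 (G n) (G1 n) (G2 n) t \<omega> = Y n t \<omega>" if t: "t \<in> {0..T}" and \<omega>: "\<omega> \<in> space M" for n t \<omega>
  proof -
    have disc: "disc 0 s \<omega> = 1" for s by (simp add: disc_def)
    have int: "set_integrable lborel {0..t} (\<lambda>s. g (S s \<omega>))" if "continuous_on UNIV g" for g :: "real \<Rightarrow> real"
      by (rule set_integrable_subset[OF borel_integrable_atLeastAtMost'[OF path_compose[OF that \<omega>]]]) (use t in auto)
    have "(LINT s:{0..t}|lborel. \<delta> * G1 n (S s \<omega>)) + (LINT s:{0..t}|lborel. 2 * (\<bar>S s \<omega>\<bar> * G2 n (S s \<omega>)))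
      = (LINT s:{0..t}|lborel. a n (S s \<omega>))"
      unfolding a_def
      by (rule set_integral_add(2)[symmetric, OF int[of "\<lambda>x. \<delta> * G1 n x"] int[of "\<lambda>x. 2 * (\<bar>x\<bar> * G2 n x)"]])
        (intro continuous_intros cG1 cG2)+
    moreover have "G2 n (S s \<omega>) / 2 * (2 * sqrt \<bar>S s \<omega>\<bar>)\<^sup>2 = 2 * (\<bar>S s \<omega>\<bar> * G2 n (S s \<omega>))" for s
      by (simp add: power_mult_distrib)
    ultimately show ?thesis by (simp add: limitY_def disc Y_def)
  qed
  have approx: "ito_approx (\<lambda>t \<omega>. G1 n (S t \<omega>) * (2 * sqrt \<bar>S t \<omega>\<bar>)) (Y n)" for n
    by (rule ito_approx_AE_cong[OF ito_formula[OF dG dG1 cG2]]) (use limitY_eq in \<open>auto intro!: AE_I2\<close>)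
  show ?thesis
  proof (rule ito_approx_closed[OF approx])
    show "joint (\<lambda>t \<omega>. G1 n (S t \<omega>) * (2 * sqrt \<bar>S t \<omega>\<bar>))" for n
      by (rule progressive_joint[OF progressive_compose[OF cH]])
    show "joint (\<lambda>t \<omega>. deriv f (sqrt (S t \<omega>)))"
      by (rule progressive_joint[OF progressive_compose[OF cont_integrands(2)]])
    show "Y n t \<in> borel_measurable (completion M)" if t: "t \<in> {0..T}" for n t
      unfolding Y_def
      by (intro borel_measurable_diff borel_measurable_const adapted_completion[OF adapted_compose[OF cG] t]
          adapted_completion[OF adapted_integral[OF ca] t])
    show "AE \<omega> in completion M. continuous_on {0..T} (\<lambda>t. Y n t \<omega>)" for n
      unfolding Y_def by (intro AE_I2 continuous_intros path_compose cG path_integral ca) simp_all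
    show "AE \<omega> in completion M. (\<lambda>n. l2_dist (\<lambda>t \<omega>. G1 n (S t \<omega>) * (2 * sqrt \<bar>S t \<omega>\<bar>)) (\<lambda>t \<omega>. deriv f (sqrt (S t \<omega>))) \<omega>) \<longlonglongrightarrow> 0 \<and>
      uniform_limit {0..T} (\<lambda>n t. Y n t \<omega>)
        (\<lambda>t. f (sqrt (S t \<omega>)) - f (sqrt s0) - (LINT s:{0..t}|lborel. L_op \<delta> f (sqrt (S s \<omega>)))) sequentially"
      using nonneg[OF \<delta>(1) s0] AE_space
    proof eventually_elim
      case (elim \<omega>)
      \<comment> \<open>Non-negativity enters here: the convergence of the extensions is uniform on
        \<open>{0..}\<close> only, and |S| may now be replaced by \<open>S\<close>.\<close>
      then have S: "0 \<le> S t \<omega>" if "t \<in> {0..T}" for t using that by blast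
      have \<omega>: "\<omega> \<in> space M" using elim by simp
      note lim = sing.taylor_ext_uniform_limit[of "{0..T}" "\<lambda>t. S t \<omega>", OF S, folded G_def G1_def G2_def]
      have "continuous_on {0..T} (\<lambda>t. q1 (S t \<omega>))"
        by (rule uniform_limit_theorem[OF _ lim(2)]) (auto intro!: always_eventually path_compose[OF cG1 \<omega>])
      then have "uniform_limit {0..T} (\<lambda>n t. G1 n (S t \<omega>) * (2 * sqrt \<bar>S t \<omega>\<bar>)) (\<lambda>t. q1 (S t \<omega>) * (2 * sqrt \<bar>S t \<omega>\<bar>)) sequentially"
        by (intro uniform_lim_mult lim uniform_limit_const bounded_continuous_image continuous_intros S_path \<omega>)
      moreover have "q1 (S t \<omega>) * (2 * sqrt \<bar>S t \<omega>\<bar>) = deriv f (sqrt (S t \<omega>))" if "t \<in> {0..T}" for t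
        using q1_deriv[OF S[OF that]] S[OF that] by simp
      ultimately have "uniform_limit {0..T} (\<lambda>n t. G1 n (S t \<omega>) * (2 * sqrt \<bar>S t \<omega>\<bar>)) (\<lambda>t. deriv f (sqrt (S t \<omega>))) sequentially"
        by (subst (asm) uniform_limit_cong'[OF refl]) auto
      then have l2: "(\<lambda>n. l2_dist (\<lambda>t \<omega>. G1 n (S t \<omega>) * (2 * sqrt \<bar>S t \<omega>\<bar>)) (\<lambda>t \<omega>. deriv f (sqrt (S t \<omega>))) \<omega>) \<longlonglongrightarrow> 0"
        unfolding l2_dist_def by (rule uniform_limit_imp_l2[OF less_imp_le[OF T]])
      have "uniform_limit {0..T} (\<lambda>n t. \<delta> * G1 n (S t \<omega>) + 2 * (S t \<omega> * G2 n (S t \<omega>)))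
        (\<lambda>t. \<delta> * q1 (S t \<omega>) + 2 * (S t \<omega> * q2 (S t \<omega>))) sequentially"
        by (intro uniform_limit_add bounded_linear.uniform_limit[OF bounded_linear_mult_right] lim)
      then have lim_a: "uniform_limit {0..T} (\<lambda>n t. a n (S t \<omega>)) (\<lambda>t. L_op \<delta> f (sqrt (S t \<omega>))) sequentially"
        by (subst uniform_limit_cong'[where g = "\<lambda>n t. \<delta> * G1 n (S t \<omega>) + 2 * (S t \<omega> * G2 n (S t \<omega>))"
              and i = "\<lambda>t. \<delta> * q1 (S t \<omega>) + 2 * (S t \<omega> * q2 (S t \<omega>))"])
          (use S generator in \<open>auto simp: a_def\<close>)
      have "uniform_limit {0..T} (\<lambda>n t. Y n t \<omega>)
          (\<lambda>t. q (S t \<omega>) - q s0 - (LINT s:{0..t}|lborel. L_op \<delta> f (sqrt (S s \<omega>)))) sequentially"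
        unfolding Y_def
        by (intro uniform_limit_minus lim set_integral_uniform_limit less_imp_le[OF T] path_compose[OF _ \<omega>] ca
            cont_integrands lim_a sing.taylor_ext_uniform_limit(1)[of "{0..T}" "\<lambda>_. s0", OF s0, folded G_def])
      then show ?case using l2 by (simp add: q_def)
    qed
  qed
qed

text \<open>The versions with \<open>s0\<close> and with \<open>S 0\<close> differ on a null set, by
  \<open>AE_S_0\<close>; adaptedness and continuity are checked for each.\<close>

lemma bessel_has_ito_integral:
  shows "has_ito_integral M T W (\<lambda>t \<omega>. deriv f (sqrt (S t \<omega>)))
      (\<lambda>t \<omega>. f (sqrt (S t \<omega>)) - f (sqrt s0) - (LINT s:{0..t}|lborel. L_op \<delta> f (sqrt (S s \<omega>))))" (is ?A)
    and "has_ito_integral M T W (\<lambda>t \<omega>. deriv f (sqrt (S t \<omega>)))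
      (\<lambda>t \<omega>. f (sqrt (S t \<omega>)) - f (sqrt (S 0 \<omega>)) - (LINT s:{0..t}|lborel. L_op \<delta> f (sqrt (S s \<omega>))))" (is ?B)
proof -
  note a = adapted_compose[OF cont_integrands(1)] adapted_integral[OF cont_integrands(3)]
  note c = path_compose[OF cont_integrands(1)] path_integral[OF cont_integrands(3)]
  show ?A
    by (rule has_ito_integral_compose[OF bessel_ito_approx cont_integrands(2)])
      (use a c in \<open>auto simp: adapted_def continuous_paths_def intro!: borel_measurable_diff continuous_intros\<close>)
  have m0: "(\<lambda>\<omega>. f (sqrt (S 0 \<omega>))) \<in> borel_measurable (F t)" if "t \<in> {0..T}" for t
    by (rule canonical_filtration_measurable_mono[of _ M T W 0]) (use a(1) T that in \<open>auto simp: adapted_def\<close>)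
  show ?B
  proof (rule has_ito_integral_compose[OF ito_approx_AE_cong[OF bessel_ito_approx] cont_integrands(2)])
    show "AE \<omega> in completion M. \<forall>t\<in>{0..T}. deriv f (sqrt (S t \<omega>)) = deriv f (sqrt (S t \<omega>)) \<and>
      f (sqrt (S t \<omega>)) - f (sqrt s0) - (LINT s:{0..t}|lborel. L_op \<delta> f (sqrt (S s \<omega>))) =
      f (sqrt (S t \<omega>)) - f (sqrt (S 0 \<omega>)) - (LINT s:{0..t}|lborel. L_op \<delta> f (sqrt (S s \<omega>)))"
      using AE_S_0 by eventually_elim simp
  qed (use a c m0 in \<open>auto simp: adapted_def continuous_paths_def intro!: borel_measurable_diff continuous_intros\<close>)
qed

end

theorem proposition3p6:
  fixes M :: "'a measure" and W S :: "real \<Rightarrow> 'a \<Rightarrow> real" and T x0 \<delta> :: real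
  assumes "prob_space M" and "T > 0"
    and "brownian_motion M T W"
    and "x0 \<ge> 0" and "0 \<le> \<delta>" and "\<delta> < 1"
    and "squared_bessel_solution M T W \<delta> (x0\<^sup>2) S"
  defines "X \<equiv> \<lambda>t \<omega>. sqrt (S t \<omega>)"
  shows "nonneg_process M T S \<and>
    BES M T W \<delta> x0 X \<and>
    strong_martingale_problem M T W (D_L \<delta>) (L_op \<delta>) x0 X \<and>
    (\<forall>f \<in> D_L \<delta>. has_ito_integral M T W (\<lambda>t \<omega>. deriv f (X t \<omega>))
       (\<lambda>t \<omega>. f (X t \<omega>) - f (X 0 \<omega>) - (LINT s:{0..t}|lborel. L_op \<delta> f (X s \<omega>))))"
proof -
  interpret prob_space M by fact
  interpret besq M T W \<delta> "x0\<^sup>2" S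
    using assms by unfold_locales (auto simp: squared_bessel_solution_def)
  have domain: "besq_domain M T W \<delta> (x0\<^sup>2) S f" if "f \<in> D_L \<delta>" for f
    using assms that by unfold_locales auto
  have pos: "AE \<omega> in completion M. \<forall>t\<in>{0..T}. 0 \<le> S t \<omega>" using nonneg assms by simp
  then have S_nonneg: "nonneg_process M T S" by (simp add: nonneg_process_def)
  from pos have X_nonneg: "nonneg_process M T X" by (simp add: nonneg_process_def X_def)
  have sqrt: "continuous_on UNIV sqrt" "continuous_on UNIV (\<lambda>x. (sqrt x)\<^sup>2)" "continuous_on UNIV (\<lambda>x. 2 * sqrt \<bar>(sqrt x)\<^sup>2\<bar>)"
    by (auto intro!: continuous_intros)
  have X2: "adapted F T (\<lambda>t \<omega>. (X t \<omega>)\<^sup>2)" "continuous_paths M T (\<lambda>t \<omega>. (X t \<omega>)\<^sup>2)"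
    unfolding X_def continuous_paths_def by (auto intro: adapted_compose[OF sqrt(2)] path_compose[OF sqrt(2)])
  \<comment> \<open>\<open>sqrt\<close> is odd in HOL, so \<open>(sqrt x)\<^sup>2\<close> is
    \<open>\<bar>x\<bar>\<close>. The square of \<open>X\<close> therefore equals \<open>S\<close>
    where \<open>S\<close> is non-negative, that is almost surely, and the equation is transferred
    along this identity.\<close>
  have "has_ito_integral M T W (\<lambda>t \<omega>. 2 * sqrt \<bar>(X t \<omega>)\<^sup>2\<bar>) (\<lambda>t \<omega>. (X t \<omega>)\<^sup>2 - x0\<^sup>2 - \<delta> * t)"
    unfolding X_def
  proof (rule has_ito_integral_compose[OF ito_approx_AE_cong[OF has_ito_integral_imp_ito_approx[OF S_ito]] sqrt(3)])
    show "AE \<omega> in completion M. \<forall>t\<in>{0..T}. 2 * sqrt \<bar>S t \<omega>\<bar> = 2 * sqrt \<bar>(sqrt (S t \<omega>))\<^sup>2\<bar> \<and>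
      S t \<omega> - x0\<^sup>2 - \<delta> * t = (sqrt (S t \<omega>))\<^sup>2 - x0\<^sup>2 - \<delta> * t"
      using pos by eventually_elim simp
  qed (use X2 in \<open>auto simp: X_def adapted_def continuous_paths_def intro!: borel_measurable_diff continuous_intros S_path\<close>)
  then have "squared_bessel_solution M T W \<delta> (x0\<^sup>2) (\<lambda>t \<omega>. (X t \<omega>)\<^sup>2)"
    using X2 by (simp add: squared_bessel_solution_def)
  then have BES: "BES M T W \<delta> x0 X"
    using X_nonneg by (simp add: BES_def BESQ_def nonneg_process_def)
  have X: "adapted F T X" "continuous_paths M T X"
    unfolding X_def continuous_paths_def by (auto intro: adapted_compose[OF sqrt(1)] path_compose[OF sqrt(1)])
  have X_0: "AE \<omega> in completion M. X 0 \<omega> = x0"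
    using AE_S_0 by eventually_elim (use \<open>x0 \<ge> 0\<close> in \<open>simp add: X_def\<close>)
  have x0: "sqrt (x0\<^sup>2) = x0" using \<open>x0 \<ge> 0\<close> by simp
  have ito: "has_ito_integral M T W (\<lambda>t \<omega>. deriv f (X t \<omega>))
      (\<lambda>t \<omega>. f (X t \<omega>) - f x0 - (LINT s:{0..t}|lborel. L_op \<delta> f (X s \<omega>)))"
    "has_ito_integral M T W (\<lambda>t \<omega>. deriv f (X t \<omega>))
      (\<lambda>t \<omega>. f (X t \<omega>) - f (X 0 \<omega>) - (LINT s:{0..t}|lborel. L_op \<delta> f (X s \<omega>)))"
    if "f \<in> D_L \<delta>" for f
    unfolding X_def by (rule besq_domain.bessel_has_ito_integral[OF domain[OF that], unfolded x0])+
  have "strong_martingale_problem M T W (D_L \<delta>) (L_op \<delta>) x0 X"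
    unfolding strong_martingale_problem_def by (intro conjI ballI X X_0 ito(1))
  then show ?thesis by (intro conjI ballI S_nonneg BES ito(2))
qed

end
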